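(* Let $(\mathcal A,M,\rho,[\,,\,]_{\mathcal A},\mathcal F)$ be a partial Finsler pre-Lie algebroid, with $\mathcal F$ defined on a conic open set $\mathcal M\subset\mathcal A$. (1) There exists a unique linear connection $\nabla:\Xi(\mathbf T\mathcal M)\times\Xi(\tilde{\mathcal A})\to\Xi(\tilde{\mathcal A})$, $(\mathcal X,\tilde Y)\mapsto\nabla_{\mathcal X}\tilde Y$, such that: (a) (torsion free) $\nabla_{\mathcal X}(\pi_{\tilde{\mathcal A}}(\mathcal Y))-\nabla_{\mathcal Y}(\pi_{\tilde{\mathcal A}}(\mathcal X))=\pi_{\tilde{\mathcal A}}([\mathcal X,\mathcal Y]_{\mathcal P})$ for all sections $\mathcal X,\mathcal Y$ of $\mathbf T\mathcal M$; (b) (almost $g_{\mathcal F}$-compatibility) $\hat\rho(\mathcal X)(g_{\mathcal F}(\tilde Y,\tilde Z))=g_{\mathcal F}(\nabla_{\mathcal X}\tilde Y,\tilde Z)+g_{\mathcal F}(\tilde Y,\nabla_{\mathcal X}\tilde Z)+2\,\mathbb A_{\mathcal F}(\theta(\mathcal X),\tilde Y,\tilde Z)$ for all sections $\mathcal X$ of $\mathbf T\mathcal M$ and $\tilde Y,\tilde Z$ of $\tilde{\mathcal A}$. (2) For a (local) section $Y$ of $\mathcal A$ let $\tilde Y$ be the section of $\tilde{\mathcal A}$ with $\tilde\pi\circ\tilde Y=Y\circ\pi$. For any section $U$ of $\mathcal M$ over an open set $O\subset M$ and any sections $X,Y$ of $\mathcal A$ over $O$, $$\tilde\pi\big(\nabla_{\mathcal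 X}\tilde Y(x,U(x))\big)=\nabla^U_XY(x)\qquad(x\in O),$$ where $\mathcal X$ is any section of $\mathbf T\mathcal M$ projectable on $X$.
   Context: Pre-Lie algebroid: rank $k$ vector bundle $\tau:\mathcal A\to M$ over a connected paracompact manifold, anchor $\rho:\mathcal A\to TM$ (bundle morphism), antisymmetric $\mathbb R$-bilinear bracket on sections with $[X,fY]_{\mathcal A}=f[X,Y]_{\mathcal A}+df(\rho X)Y$ and $\rho[X,Y]_{\mathcal A}=[\rho X,\rho Y]$ (Jacobi not required). $\Xi(\cdot)$ denotes sections. $\mathcal M\subset\mathcal A$ is open, contained in the complement of the zero section, stable under multiplication by positive scalars in the fibers, and $\pi=\tau|_{\mathcal M}:\mathcal M\to M$ is a fibered manifold. A partial Finsler metric is a smooth $\mathcal F:\mathcal M\to[0,\infty)$ with $\mathcal F(\lambda u)=\lambda\mathcal F(u)$ for $\lambda>0$ and, for each $u\in\mathcal M_x$, $g_u(v,w)=\frac12\frac{\partial^2\mathcal F^2}{\partial s\partial t}(u+sv+tw)|_{s=t=0}$ positive definite on $\mathcal A_x$. The Cartan tensor is $\mathbb A_u(v_1,v_2,v_3)=\frac14\frac{\partial^3\mathcal F^2}{\partial s_1\partial s_2\partial s_3}(u+\sum s_iv_i)|_{s=0}$. Pull-back bundle: $\tilde{\mathcal A}=\pi^*\mathcal A\to\mathcal M$ with $\tilde\pi:\tilde{\mathcal A}\to\mathcal A$; $g_u$, $\mathbb A_u$ define tensors $g_{\mathcal F}$, $\mathbb A_{\mathcal F}$ on $\tilde{\mathcal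 A}$. Prolongation: $\mathbf T\mathcal M\to\mathcal M$ has fiber $\{(b,v)\in\mathcal A_{\pi(m)}\times T_m\mathcal M:\rho(b)=T\pi(v)\}$, anchor $\hat\rho(m,b,v)=v$, $\pi_{\tilde{\mathcal A}}(m,b,v)=(m,b)$, vertical bundle $\mathbf V\mathcal M=\ker\pi_{\tilde{\mathcal A}}$. A section of $\mathbf T\mathcal M$ is projectable on a section $X$ of $\mathcal A$ if its $\mathcal A$-component at $m$ is $X(\pi(m))$. In local coordinates $(x^i,y^\alpha)$ given by a frame $(e_\alpha)$ with $\rho(e_\alpha)=\rho^i_\alpha\partial_{x^i}$, $[e_\alpha,e_\beta]_{\mathcal A}=C^\gamma_{\alpha\beta}e_\gamma$: $\mathcal X_\alpha=(e_\alpha,\rho_\alpha^i\partial_{x^i})$, $\mathcal V_\alpha=(0,\partial_{y^\alpha})$ is a basis; $[\mathcal X_\alpha,\mathcal X_\beta]_{\mathcal P}=C_{\alpha\beta}^\gamma\mathcal X_\gamma$, $[\mathcal X_\alpha,\mathcal V_\beta]_{\mathcal P}=[\mathcal V_\alpha,\mathcal V_\beta]_{\mathcal P}=0$ (extended by Leibniz with anchor $\hat\rho$); $J\mathcal X_\alpha=\mathcal V_\alpha$, $J\mathcal V_\alpha=0$. With $L=\frac12\mathcal F^2$, $g_{\alpha\beta}=\partial^2L/\partial y^\alpha\partial y^\beta$, the Finsler spray is $S_{\mathcal F}=y^\alpha\mathcal X_\alpha+\mathcal S^\beta\mathcal V_\beta$ with $g_{\alpha\beta}\mathcal S^\beta+\frac{\partial^2L}{\partial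 x^i\partial y^\alpha}\rho^i_\delta y^\delta+\frac{\partial L}{\partial y^\gamma}C_{\alpha\delta}^\gamma y^\delta-\rho_\alpha^i\frac{\partial L}{\partial x^i}=0$; the Finsler connection is the endomorphism $\mathcal N_{\mathcal F}(\mathcal X)=J[S_{\mathcal F},\mathcal X]_{\mathcal P}-[S_{\mathcal F},J\mathcal X]_{\mathcal P}$ of $\mathbf T\mathcal M$, which satisfies $\mathcal N_{\mathcal F}^2=\mathrm{Id}$, $\ker(\mathrm{Id}+\mathcal N_{\mathcal F})=\mathbf V\mathcal M$; its vertical projector is $\mathbf v_{\mathcal F}=\frac12(\mathrm{Id}-\mathcal N_{\mathcal F})$. $\theta:\mathbf T\mathcal M\to\tilde{\mathcal A}$ is $\mathbf v_{\mathcal F}$ followed by the canonical isomorphism $\mathbf V\mathcal M\cong\tilde{\mathcal A}$ ($\mathcal V_\alpha\mapsto\tilde e_\alpha$). A linear connection $\nabla:\Xi(\mathbf T\mathcal M)\times\Xi(\tilde{\mathcal A})\to\Xi(\tilde{\mathcal A})$ is biadditive with $\nabla_{f\mathcal X}\tilde Y=f\nabla_{\mathcal X}\tilde Y$, $\nabla_{\mathcal X}(f\tilde Y)=\hat\rho(\mathcal X)(f)\tilde Y+f\nabla_{\mathcal X}\tilde Y$ for $f\in C^\infty(\mathcal M)$. Sectional connection: for a section $U$ of $\mathcal M$ over $O$, $\nabla^U$ is the unique $\mathcal A$-linear connection on $\mathcal A|_O$ (i.e. $\nabla_{fX}Y=f\nabla_XY$, $\nabla_X(fY)=\rho(X)(f)Y+f\nabla_XY$)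 with $\nabla_XY-\nabla_YX=[X,Y]_{\mathcal A}$ and $\rho(X)(g_U(Y,Z))=g_U(\nabla_XY,Z)+g_U(Y,\nabla_XZ)+2\mathbb A_U(\nabla_XU,Y,Z)$. *)

theory Defs
  imports "HOL-Analysis.Analysis"
begin

section \<open>Smooth maps between open subsets of normed spaces\<close>

text \<open>Intended for open \<open>S\<close> and finite-dimensional domain, where differentiability of all iterated
  directional derivatives is the usual notion of a smooth map.\<close>

primrec Ck_on ::
  "nat \<Rightarrow> ('v::real_normed_vector \<Rightarrow> 'w::real_normed_vector) \<Rightarrow> 'v set \<Rightarrow> bool" where
  "Ck_on 0 f S \<longleftrightarrow> continuous_on S f"
| "Ck_on (Suc k) f S \<longleftrightarrow> (\<forall>x\<in>S. f differentiable (at x)) \<and>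
     (\<forall>v. Ck_on k (\<lambda>x. frechet_derivative f (at x) v) S)"

definition Cinf_on :: "('v::real_normed_vector \<Rightarrow> 'w::real_normed_vector) \<Rightarrow> 'v set \<Rightarrow> bool" where
  "Cinf_on f S \<longleftrightarrow> (\<forall>k. Ck_on k f S)"


section \<open>Manifolds, smooth maps and tangent vectors\<close>

text \<open>The underlying set of a manifold is a whole type. A chart is a pair of its domain and its
  coordinate map; the values of the coordinate map outside the domain are irrelevant.\<close>

type_synonym ('p, 'v) chart = "'p set \<times> ('p \<Rightarrow> 'v)"

definition chart_inv :: "('p, 'v) chart \<Rightarrow> 'v \<Rightarrow> 'p" where
  "chart_inv c = inv_into (fst c) (snd c)"

definition smooth_atlas ::
  "('p::topological_space, 'v::real_normed_vector) chart set \<Rightarrow> bool" where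
  "smooth_atlas At \<longleftrightarrow>
     (\<Union>c\<in>At. fst c) = UNIV \<and>
     (\<forall>c\<in>At. open (fst c) \<and> open (snd c ` fst c) \<and>
        homeomorphism (fst c) (snd c ` fst c) (snd c) (chart_inv c)) \<and>
     (\<forall>c\<in>At. \<forall>d\<in>At. Cinf_on (snd d \<circ> chart_inv c) (snd c ` (fst c \<inter> fst d)))"

definition paracompact_space :: "'p::topological_space itself \<Rightarrow> bool" where
  "paracompact_space _ \<longleftrightarrow>
     (\<forall>\<C>::'p set set. (\<forall>U\<in>\<C>. open U) \<and> \<Union>\<C> = UNIV \<longrightarrow>
        (\<exists>\<D>. (\<forall>V\<in>\<D>. open V \<and> (\<exists>U\<in>\<C>. V \<subseteq> U)) \<and> \<Union>\<D> = UNIV \<and>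
           (\<forall>x. \<exists>N. open N \<and> x \<in> N \<and> finite {V \<in> \<D>. V \<inter> N \<noteq> {}})))"

definition smooth_map ::
  "('p::topological_space, 'v::real_normed_vector) chart set \<Rightarrow>
   ('q::topological_space, 'w::real_normed_vector) chart set \<Rightarrow> 'p set \<Rightarrow> ('p \<Rightarrow> 'q) \<Rightarrow> bool" where
  "smooth_map At Bt W f \<longleftrightarrow> continuous_on W f \<and>
     (\<forall>c\<in>At. \<forall>d\<in>Bt. Cinf_on (snd d \<circ> f \<circ> chart_inv c) (snd c ` (fst c \<inter> W \<inter> f -` fst d)))"

definition smooth_fun ::
  "('p::topological_space, 'v::real_normed_vector) chart set \<Rightarrow> 'p set \<Rightarrow>
   ('p \<Rightarrow> 'w::real_normed_vector) \<Rightarrow> bool" where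
  "smooth_fun At W f \<longleftrightarrow> smooth_map At {(UNIV, id)} W f"

text \<open>A tangent vector at \<open>p\<close> is the family of its coordinate representatives with respect to the
  charts of the atlas around \<open>p\<close>, related by the differentials of the transition maps. It is set
  to 0 at all other arguments, so that the vector space operations are pointwise.\<close>

definition tangent_space ::
  "('p, 'v::real_normed_vector) chart set \<Rightarrow> 'p \<Rightarrow> (('p, 'v) chart \<Rightarrow> 'v) set" where
  "tangent_space At p = {v.
     (\<forall>c. \<not> (c \<in> At \<and> p \<in> fst c) \<longrightarrow> v c = 0) \<and>
     (\<forall>c\<in>At. \<forall>d\<in>At. p \<in> fst c \<and> p \<in> fst d \<longrightarrow>
        v d = frechet_derivative (snd d \<circ> chart_inv c) (at (snd c p)) (v c))}"

text \<open>The tangent vector at \<open>p\<close> with representative \<open>\<xi>\<close> in the chart \<open>c\<close>, i.e. \<open>\<xi>\<^sup>i \<partial>/\<partial>x\<^sup>i\<close>.\<close>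

definition coord_vector ::
  "('p, 'v::real_normed_vector) chart set \<Rightarrow> ('p, 'v) chart \<Rightarrow> 'p \<Rightarrow> 'v \<Rightarrow> ('p, 'v) chart \<Rightarrow> 'v" where
  "coord_vector At c p \<xi> = (\<lambda>d. if d \<in> At \<and> p \<in> fst d
     then frechet_derivative (snd d \<circ> chart_inv c) (at (snd c p)) \<xi> else 0)"

text \<open>The derivative \<open>df(v)\<close> of a function along a tangent vector \<open>v\<close> at \<open>p\<close>; the value does not
  depend on the chart around \<open>p\<close>.\<close>

definition deriv_along ::
  "('p, 'v::real_normed_vector) chart set \<Rightarrow> 'p \<Rightarrow> (('p, 'v) chart \<Rightarrow> 'v) \<Rightarrow>
   ('p \<Rightarrow> 'w::real_normed_vector) \<Rightarrow> 'w" where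
  "deriv_along At p v f =
     (let c = (SOME c. c \<in> At \<and> p \<in> fst c)
      in frechet_derivative (f \<circ> chart_inv c) (at (snd c p)) (v c))"

definition tangent_map ::
  "('p, 'v::real_normed_vector) chart set \<Rightarrow> ('q, 'w::real_normed_vector) chart set \<Rightarrow>
   ('p \<Rightarrow> 'q) \<Rightarrow> 'p \<Rightarrow> (('p, 'v) chart \<Rightarrow> 'v) \<Rightarrow> ('q, 'w) chart \<Rightarrow> 'w" where
  "tangent_map At Bt f p v = (\<lambda>d. if d \<in> Bt \<and> f p \<in> fst d
     then deriv_along At p v (snd d \<circ> f) else 0)"

text \<open>Surjective submersion from the open set \<open>W\<close> onto the whole target manifold.\<close>

definition fibered_manifold ::
  "('p::topological_space, 'v::real_normed_vector) chart set \<Rightarrow>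
   ('q::topological_space, 'w::real_normed_vector) chart set \<Rightarrow> 'p set \<Rightarrow> ('p \<Rightarrow> 'q) \<Rightarrow> bool" where
  "fibered_manifold At Bt W f \<longleftrightarrow> smooth_map At Bt W f \<and> f ` W = UNIV \<and>
     (\<forall>p\<in>W. tangent_map At Bt f p ` tangent_space At p = tangent_space Bt (f p))"


section \<open>Sections, brackets and connections\<close>

text \<open>Sections over \<open>W\<close> are functions assigning to each point of \<open>W\<close> an element of the fibre, and
  \<open>undefined\<close> outside \<open>W\<close>. The following notions only depend on the operations of the fibres.\<close>

definition section_add :: "('b \<Rightarrow> 'b \<Rightarrow> 'b) \<Rightarrow> 'p set \<Rightarrow> ('p \<Rightarrow> 'b) \<Rightarrow> ('p \<Rightarrow> 'b) \<Rightarrow> 'p \<Rightarrow> 'b" where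
  "section_add add W X Y = (\<lambda>p\<in>W. add (X p) (Y p))"

definition section_scale ::
  "(real \<Rightarrow> 'b \<Rightarrow> 'b) \<Rightarrow> 'p set \<Rightarrow> ('p \<Rightarrow> real) \<Rightarrow> ('p \<Rightarrow> 'b) \<Rightarrow> 'p \<Rightarrow> 'b" where
  "section_scale sc W f X = (\<lambda>p\<in>W. sc (f p) (X p))"

text \<open>\<open>S\<close> is the module of sections over \<open>W\<close>, \<open>C\<close> the ring of smooth functions on \<open>W\<close>, and
  \<open>act X f\<close> the derivative of \<open>f\<close> along the anchor of \<open>X\<close>.\<close>

definition leibniz_bracket ::
  "('p \<Rightarrow> 'b) set \<Rightarrow> ('b \<Rightarrow> 'b \<Rightarrow> 'b) \<Rightarrow> (real \<Rightarrow> 'b \<Rightarrow> 'b) \<Rightarrow> 'p set \<Rightarrow> ('p \<Rightarrow> real) set \<Rightarrow>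
   (('p \<Rightarrow> 'b) \<Rightarrow> ('p \<Rightarrow> real) \<Rightarrow> 'p \<Rightarrow> real) \<Rightarrow> (('p \<Rightarrow> 'b) \<Rightarrow> ('p \<Rightarrow> 'b) \<Rightarrow> 'p \<Rightarrow> 'b) \<Rightarrow> bool" where
  "leibniz_bracket S add sc W C act B \<longleftrightarrow> (\<forall>X\<in>S. \<forall>Y\<in>S.
     B X Y \<in> S \<and>
     B X Y = section_scale sc W (\<lambda>_. -1) (B Y X) \<and>
     (\<forall>Z\<in>S. B (section_add add W X Z) Y = section_add add W (B X Y) (B Z Y) \<and>
            B X (section_add add W Y Z) = section_add add W (B X Y) (B X Z)) \<and>
     (\<forall>r. B (section_scale sc W (\<lambda>_. r) X) Y = section_scale sc W (\<lambda>_. r) (B X Y) \<and>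
          B X (section_scale sc W (\<lambda>_. r) Y) = section_scale sc W (\<lambda>_. r) (B X Y)) \<and>
     (\<forall>f\<in>C. B X (section_scale sc W f Y) =
        section_add add W (section_scale sc W f (B X Y)) (section_scale sc W (act X f) Y)))"

text \<open>Covariant differentiation of sections in \<open>S2\<close> along sections in \<open>S1\<close>.\<close>

definition connection ::
  "('p \<Rightarrow> 'b) set \<Rightarrow> ('b \<Rightarrow> 'b \<Rightarrow> 'b) \<Rightarrow> (real \<Rightarrow> 'b \<Rightarrow> 'b) \<Rightarrow>
   ('p \<Rightarrow> 'c) set \<Rightarrow> ('c \<Rightarrow> 'c \<Rightarrow> 'c) \<Rightarrow> (real \<Rightarrow> 'c \<Rightarrow> 'c) \<Rightarrow> 'p set \<Rightarrow> ('p \<Rightarrow> real) set \<Rightarrow>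
   (('p \<Rightarrow> 'b) \<Rightarrow> ('p \<Rightarrow> real) \<Rightarrow> 'p \<Rightarrow> real) \<Rightarrow> (('p \<Rightarrow> 'b) \<Rightarrow> ('p \<Rightarrow> 'c) \<Rightarrow> 'p \<Rightarrow> 'c) \<Rightarrow> bool" where
  "connection S1 add1 sc1 S2 add2 sc2 W C act D \<longleftrightarrow> D \<in> S1 \<rightarrow>\<^sub>E S2 \<rightarrow>\<^sub>E S2 \<and>
     (\<forall>X\<in>S1. \<forall>Y\<in>S2.
        (\<forall>X'\<in>S1. D (section_add add1 W X X') Y = section_add add2 W (D X Y) (D X' Y)) \<and>
        (\<forall>Y'\<in>S2. D X (section_add add2 W Y Y') = section_add add2 W (D X Y) (D X Y')) \<and>
        (\<forall>f\<in>C. D (section_scale sc1 W f X) Y = section_scale sc2 W f (D X Y) \<and>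
           D X (section_scale sc2 W f Y) =
             section_add add2 W (section_scale sc2 W (act X f) Y) (section_scale sc2 W f (D X Y))))"

text \<open>Brackets and connections act on global sections but are local operators. The induced
  operation on sections \<open>X\<close>, \<open>Y\<close> defined near \<open>p\<close> is obtained from global sections with the same
  germs at \<open>p\<close>.\<close>

definition local_value ::
  "('p::topological_space \<Rightarrow> 'b) set \<Rightarrow> ('p \<Rightarrow> 'c) set \<Rightarrow> (('p \<Rightarrow> 'b) \<Rightarrow> ('p \<Rightarrow> 'c) \<Rightarrow> 'p \<Rightarrow> 'd) \<Rightarrow>
   ('p \<Rightarrow> 'b) \<Rightarrow> ('p \<Rightarrow> 'c) \<Rightarrow> 'p \<Rightarrow> 'd" where
  "local_value S1 S2 B X Y p = (THE w. \<exists>X'\<in>S1. \<exists>Y'\<in>S2.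
     (\<forall>\<^sub>F q in nhds p. X' q = X q \<and> Y' q = Y q) \<and> w = B X' Y' p)"


section \<open>Partial Finsler pre-Lie algebroids\<close>

text \<open>The base manifold has underlying type \<open>'m\<close> and is modelled on \<open>'e\<close>; the total space of the
  bundle has underlying type \<open>'a\<close> and the typical fibre is \<open>'f\<close>. An element \<open>(c, \<psi>)\<close> of
  \<open>bundle_atlas\<close> is a chart \<open>c\<close> of the base together with the fibre coordinates \<open>\<psi>\<close> of a local
  trivialisation over the domain of \<open>c\<close>; this is the data of local coordinates \<open>(x\<^sup>i, y\<^sup>\<alpha>)\<close>,
  equivalently of a local frame over a chart. Requiring the frame domain to be a chart domain is
  no restriction because the atlas of the base is arbitrary.\<close>

record ('m, 'e, 'a, 'f) finsler_algebroid =
  base_atlas :: "('m, 'e) chart set"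
  bproj :: "'a \<Rightarrow> 'm"
  fadd :: "'a \<Rightarrow> 'a \<Rightarrow> 'a"
  fscale :: "real \<Rightarrow> 'a \<Rightarrow> 'a"
  bundle_atlas :: "(('m, 'e) chart \<times> ('a \<Rightarrow> 'f)) set"
  anchor :: "'a \<Rightarrow> (('m, 'e) chart \<Rightarrow> 'e)"
  bracket :: "('m \<Rightarrow> 'a) \<Rightarrow> ('m \<Rightarrow> 'a) \<Rightarrow> 'm \<Rightarrow> 'a"
  conic_dom :: "'a set"
  finsler :: "'a \<Rightarrow> real"

type_synonym ('m, 'e, 'a, 'f) bundle_chart = "('m, 'e) chart \<times> ('a \<Rightarrow> 'f)"

definition total_chart ::
  "('m, 'e, 'a, 'f) finsler_algebroid \<Rightarrow> ('m, 'e, 'a, 'f) bundle_chart \<Rightarrow> ('a, 'e \<times> 'f) chart" where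
  "total_chart A b =
     (bproj A -` fst (fst b), \<lambda>u. (snd (fst b) (bproj A u), snd b u))"

definition total_atlas ::
  "('m, 'e, 'a, 'f) finsler_algebroid \<Rightarrow> ('a, 'e \<times> 'f) chart set" where
  "total_atlas A = total_chart A ` bundle_atlas A"

text \<open>The vector space axioms in the fibres follow from the existence, around each point, of fibre
  coordinates that are bijective and compatible with the operations.\<close>

definition vector_bundle ::
  "('m::topological_space, 'e::real_inner, 'a::topological_space, 'f::euclidean_space)
     finsler_algebroid \<Rightarrow> bool" where
  "vector_bundle A \<longleftrightarrow>
     smooth_atlas (base_atlas A) \<and>
     (\<forall>u w. bproj A u = bproj A w \<longrightarrow> bproj A (fadd A u w) = bproj A u) \<and>
     (\<forall>r u. bproj A (fscale A r u) = bproj A u) \<and>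
     (\<forall>(c, \<psi>)\<in>bundle_atlas A. c \<in> base_atlas A \<and>
        (\<forall>x\<in>fst c. bij_betw \<psi> {u. bproj A u = x} UNIV \<and>
           (\<forall>u w r. bproj A u = x \<and> bproj A w = x \<longrightarrow>
              \<psi> (fadd A u w) = \<psi> u + \<psi> w \<and> \<psi> (fscale A r u) = r *\<^sub>R \<psi> u))) \<and>
     (\<forall>x. \<exists>(c, \<psi>)\<in>bundle_atlas A. x \<in> fst c) \<and>
     smooth_atlas (total_atlas A)"

definition zero_vec :: "('m, 'e, 'a, 'f) finsler_algebroid \<Rightarrow> 'm \<Rightarrow> 'a" where
  "zero_vec A x = (THE z. bproj A z = x \<and> (\<forall>u. bproj A u = x \<longrightarrow> fadd A z u = u))"

definition sections ::
  "('m::topological_space, 'e::real_inner, 'a::topological_space, 'f::euclidean_space)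
     finsler_algebroid \<Rightarrow> 'm set \<Rightarrow> ('m \<Rightarrow> 'a) set" where
  "sections A V = {X \<in> extensional V. (\<forall>x\<in>V. bproj A (X x) = x) \<and>
     smooth_map (base_atlas A) (total_atlas A) V X}"

text \<open>\<open>\<rho>(X)(f)\<close> for a section \<open>X\<close> and a function \<open>f\<close> on the base.\<close>

definition anchor_act ::
  "('m, 'e::real_inner, 'a, 'f) finsler_algebroid \<Rightarrow> ('m \<Rightarrow> 'a) \<Rightarrow> ('m \<Rightarrow> real) \<Rightarrow> 'm \<Rightarrow> real" where
  "anchor_act A X f = (\<lambda>x. deriv_along (base_atlas A) x (anchor A (X x)) f)"

definition anchor_morphism ::
  "('m::topological_space, 'e::real_inner, 'a::topological_space, 'f::euclidean_space)
     finsler_algebroid \<Rightarrow> bool" where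
  "anchor_morphism A \<longleftrightarrow>
     (\<forall>u. anchor A u \<in> tangent_space (base_atlas A) (bproj A u)) \<and>
     (\<forall>u w. bproj A u = bproj A w \<longrightarrow>
        anchor A (fadd A u w) = (\<lambda>c. anchor A u c + anchor A w c)) \<and>
     (\<forall>r u. anchor A (fscale A r u) = (\<lambda>c. r *\<^sub>R anchor A u c)) \<and>
     (\<forall>c\<in>base_atlas A. smooth_fun (total_atlas A) (bproj A -` fst c) (\<lambda>u. anchor A u c))"

text \<open>The identity of vector fields \<open>\<rho>[X,Y] = [\<rho>X,\<rho>Y]\<close> is expressed through their action on smooth
  functions.\<close>

definition pre_lie_algebroid ::
  "('m::topological_space, 'e::real_inner, 'a::topological_space, 'f::euclidean_space)
     finsler_algebroid \<Rightarrow> bool" where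
  "pre_lie_algebroid A \<longleftrightarrow> vector_bundle A \<and> anchor_morphism A \<and>
     leibniz_bracket (sections A UNIV) (fadd A) (fscale A) UNIV
       {f. smooth_fun (base_atlas A) UNIV f} (anchor_act A) (bracket A) \<and>
     (\<forall>X\<in>sections A UNIV. \<forall>Y\<in>sections A UNIV. \<forall>V f. open V \<and> smooth_fun (base_atlas A) V f \<longrightarrow>
        (\<forall>x\<in>V. anchor_act A (bracket A X Y) f x =
           anchor_act A X (anchor_act A Y f) x - anchor_act A Y (anchor_act A X f) x))"

definition fund_tensor :: "('m, 'e, 'a, 'f) finsler_algebroid \<Rightarrow> 'a \<Rightarrow> 'a \<Rightarrow> 'a \<Rightarrow> real" where
  "fund_tensor A u v w = 1/2 * deriv (\<lambda>s. deriv (\<lambda>t.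
     (finsler A (fadd A u (fadd A (fscale A s v) (fscale A t w))))\<^sup>2) 0) 0"

definition cartan_tensor ::
  "('m, 'e, 'a, 'f) finsler_algebroid \<Rightarrow> 'a \<Rightarrow> 'a \<Rightarrow> 'a \<Rightarrow> 'a \<Rightarrow> real" where
  "cartan_tensor A u v\<^sub>1 v\<^sub>2 v\<^sub>3 = 1/4 * deriv (\<lambda>s\<^sub>1. deriv (\<lambda>s\<^sub>2. deriv (\<lambda>s\<^sub>3.
     (finsler A (fadd A u (fadd A (fscale A s\<^sub>1 v\<^sub>1)
        (fadd A (fscale A s\<^sub>2 v\<^sub>2) (fscale A s\<^sub>3 v\<^sub>3)))))\<^sup>2) 0) 0) 0"

definition partial_finsler_metric ::
  "('m::topological_space, 'e::real_inner, 'a::topological_space, 'f::euclidean_space)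
     finsler_algebroid \<Rightarrow> bool" where
  "partial_finsler_metric A \<longleftrightarrow>
     open (conic_dom A) \<and>
     (\<forall>u\<in>conic_dom A. u \<noteq> zero_vec A (bproj A u)) \<and>
     (\<forall>u\<in>conic_dom A. \<forall>r>0. fscale A r u \<in> conic_dom A) \<and>
     fibered_manifold (total_atlas A) (base_atlas A) (conic_dom A) (bproj A) \<and>
     smooth_fun (total_atlas A) (conic_dom A) (finsler A) \<and>
     (\<forall>u\<in>conic_dom A. finsler A u \<ge> 0 \<and>
        (\<forall>r>0. finsler A (fscale A r u) = r * finsler A u) \<and>
        (\<forall>v. bproj A v = bproj A u \<and> v \<noteq> zero_vec A (bproj A u) \<longrightarrow> fund_tensor A u v v > 0))"

text \<open>The model space of the base is a finite-dimensional inner product space rather than an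
  instance of \<open>euclidean_space\<close> because the latter excludes dimension 0, hence Lie algebras.
  Hausdorffness is part of the sort of \<open>'m\<close>.\<close>

definition partial_finsler_pre_lie_algebroid ::
  "('m::t2_space, 'e::real_inner, 'a::topological_space, 'f::euclidean_space)
     finsler_algebroid \<Rightarrow> bool" where
  "partial_finsler_pre_lie_algebroid A \<longleftrightarrow>
     (\<exists>B::'e set. finite B \<and> span B = UNIV) \<and>
     connected (UNIV :: 'm set) \<and> paracompact_space TYPE('m) \<and>
     pre_lie_algebroid A \<and> partial_finsler_metric A"


section \<open>The pull-back bundle and the prolongation\<close>

text \<open>The fibre of the pull-back bundle at \<open>m\<close> is the fibre of the original bundle at \<open>bproj A m\<close>.
  A section assigns to \<open>m\<close> its fibre component, so that the canonical map \<open>(m, b) \<mapsto> b\<close> to the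
  original bundle needs no symbol.\<close>

definition pb_sections ::
  "('m::topological_space, 'e::real_inner, 'a::topological_space, 'f::euclidean_space)
     finsler_algebroid \<Rightarrow> 'a set \<Rightarrow> ('a \<Rightarrow> 'a) set" where
  "pb_sections A W = {Y \<in> extensional W. (\<forall>m\<in>W. bproj A (Y m) = bproj A m) \<and>
     smooth_map (total_atlas A) (total_atlas A) W Y}"

definition pb_lift ::
  "('m, 'e, 'a, 'f) finsler_algebroid \<Rightarrow> 'a set \<Rightarrow> ('m \<Rightarrow> 'a) \<Rightarrow> 'a \<Rightarrow> 'a" where
  "pb_lift A W Y = (\<lambda>m\<in>W. Y (bproj A m))"

text \<open>Since the conic domain is open in the total space, its tangent vectors are those of the total
  space.\<close>

type_synonym ('e, 'a, 'f) prol = "'a \<times> (('a, 'e \<times> 'f) chart \<Rightarrow> 'e \<times> 'f)"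

definition prol_fiber ::
  "('m, 'e::real_inner, 'a, 'f::euclidean_space) finsler_algebroid \<Rightarrow> 'a \<Rightarrow> ('e, 'a, 'f) prol set"
where
  "prol_fiber A m = {(b, v). bproj A b = bproj A m \<and> v \<in> tangent_space (total_atlas A) m \<and>
     anchor A b = tangent_map (total_atlas A) (base_atlas A) (bproj A) m v}"

definition prol_add ::
  "('m, 'e::real_inner, 'a, 'f::euclidean_space) finsler_algebroid \<Rightarrow>
   ('e, 'a, 'f) prol \<Rightarrow> ('e, 'a, 'f) prol \<Rightarrow> ('e, 'a, 'f) prol" where
  "prol_add A p q = (fadd A (fst p) (fst q), \<lambda>d. snd p d + snd q d)"

definition prol_scale ::
  "('m, 'e::real_inner, 'a, 'f::euclidean_space) finsler_algebroid \<Rightarrow>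
   real \<Rightarrow> ('e, 'a, 'f) prol \<Rightarrow> ('e, 'a, 'f) prol" where
  "prol_scale A r p = (fscale A r (fst p), \<lambda>d. r *\<^sub>R snd p d)"

definition prol_sections ::
  "('m::topological_space, 'e::real_inner, 'a::topological_space, 'f::euclidean_space)
     finsler_algebroid \<Rightarrow> 'a set \<Rightarrow> ('a \<Rightarrow> ('e, 'a, 'f) prol) set" where
  "prol_sections A W = {Z \<in> extensional W. (\<forall>m\<in>W. Z m \<in> prol_fiber A m) \<and>
     smooth_map (total_atlas A) (total_atlas A) W (fst \<circ> Z) \<and>
     (\<forall>d\<in>total_atlas A. smooth_fun (total_atlas A) (W \<inter> fst d) (\<lambda>m. snd (Z m) d))}"

text \<open>The map induced on sections by the projection of the prolongation to the pull-back bundle.\<close>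

definition prol_proj :: "'a set \<Rightarrow> ('a \<Rightarrow> ('e, 'a, 'f) prol) \<Rightarrow> 'a \<Rightarrow> 'a" where
  "prol_proj W Z = (\<lambda>m\<in>W. fst (Z m))"

definition projectable_on ::
  "('m, 'e, 'a, 'f) finsler_algebroid \<Rightarrow> 'a set \<Rightarrow> ('a \<Rightarrow> ('e, 'a, 'f) prol) \<Rightarrow> ('m \<Rightarrow> 'a) \<Rightarrow> bool"
where
  "projectable_on A W Z X \<longleftrightarrow> (\<forall>m\<in>W. fst (Z m) = X (bproj A m))"

text \<open>Action of a section of the prolongation on functions through its anchor.\<close>

definition prol_act ::
  "('m, 'e::real_inner, 'a, 'f::euclidean_space) finsler_algebroid \<Rightarrow>
   ('a \<Rightarrow> ('e, 'a, 'f) prol) \<Rightarrow> ('a \<Rightarrow> real) \<Rightarrow> 'a \<Rightarrow> real" where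
  "prol_act A Z f = (\<lambda>m. deriv_along (total_atlas A) m (snd (Z m)) f)"


section \<open>Local coordinate expressions\<close>

text \<open>The local section of the bundle with constant fibre coordinates \<open>w\<close>; for \<open>w\<close> in \<open>Basis\<close> these
  are the members \<open>e\<^sub>\<alpha>\<close> of the local frame.\<close>

definition frame ::
  "('m, 'e, 'a, 'f) finsler_algebroid \<Rightarrow> ('m, 'e, 'a, 'f) bundle_chart \<Rightarrow> 'f \<Rightarrow> 'm \<Rightarrow> 'a" where
  "frame A b w = (\<lambda>x\<in>fst (fst b). THE u. bproj A u = x \<and> snd b u = w)"

definition local_bracket ::
  "('m::topological_space, 'e::real_inner, 'a::topological_space, 'f::euclidean_space)
     finsler_algebroid \<Rightarrow> ('m \<Rightarrow> 'a) \<Rightarrow> ('m \<Rightarrow> 'a) \<Rightarrow> 'm \<Rightarrow> 'a" where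
  "local_bracket A = local_value (sections A UNIV) (sections A UNIV) (bracket A)"

text \<open>The vector \<open>(\<rho>\<^sup>i\<^sub>\<alpha>(x))\<^sub>i\<close>, and the vector \<open>(C\<^sup>\<gamma>\<^sub>\<alpha>\<^sub>\<beta>(x))\<^sub>\<gamma>\<close>.\<close>

definition anchor_coeff ::
  "('m, 'e, 'a, 'f) finsler_algebroid \<Rightarrow> ('m, 'e, 'a, 'f) bundle_chart \<Rightarrow> 'f \<Rightarrow> 'm \<Rightarrow> 'e" where
  "anchor_coeff A b \<alpha> x = anchor A (frame A b \<alpha> x) (fst b)"

definition bracket_coeff ::
  "('m::topological_space, 'e::real_inner, 'a::topological_space, 'f::euclidean_space)
     finsler_algebroid \<Rightarrow> ('m, 'e, 'a, 'f) bundle_chart \<Rightarrow> 'f \<Rightarrow> 'f \<Rightarrow> 'm \<Rightarrow> 'f" where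
  "bracket_coeff A b \<alpha> \<beta> x = snd b (local_bracket A (frame A b \<alpha>) (frame A b \<beta>) x)"

text \<open>For \<open>w\<close> in \<open>Basis\<close> these are \<open>\<X>\<^sub>\<alpha> = (e\<^sub>\<alpha>, \<rho>\<^sup>i\<^sub>\<alpha> \<partial>/\<partial>x\<^sup>i)\<close> and \<open>\<V>\<^sub>\<alpha> = (0, \<partial>/\<partial>y\<^sup>\<alpha>)\<close>; for general \<open>w\<close>
  they are the combinations \<open>w\<^sup>\<alpha> \<X>\<^sub>\<alpha>\<close> and \<open>w\<^sup>\<alpha> \<V>\<^sub>\<alpha>\<close>.\<close>

definition prol_hor ::
  "('m, 'e::real_inner, 'a, 'f::euclidean_space) finsler_algebroid \<Rightarrow>
   ('m, 'e, 'a, 'f) bundle_chart \<Rightarrow> 'f \<Rightarrow> 'a \<Rightarrow> ('e, 'a, 'f) prol" where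
  "prol_hor A b w m = (frame A b w (bproj A m),
     coord_vector (total_atlas A) (total_chart A b) m (anchor_coeff A b w (bproj A m), 0))"

definition prol_ver ::
  "('m, 'e::real_inner, 'a, 'f::euclidean_space) finsler_algebroid \<Rightarrow>
   ('m, 'e, 'a, 'f) bundle_chart \<Rightarrow> 'f \<Rightarrow> 'a \<Rightarrow> ('e, 'a, 'f) prol" where
  "prol_ver A b w m = (zero_vec A (bproj A m),
     coord_vector (total_atlas A) (total_chart A b) m (0, w))"

definition is_prol_bracket ::
  "('m::topological_space, 'e::real_inner, 'a::topological_space, 'f::euclidean_space)
     finsler_algebroid \<Rightarrow>
   (('a \<Rightarrow> ('e, 'a, 'f) prol) \<Rightarrow> ('a \<Rightarrow> ('e, 'a, 'f) prol) \<Rightarrow> 'a \<Rightarrow> ('e, 'a, 'f) prol) \<Rightarrow> bool" where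
  "is_prol_bracket A B \<longleftrightarrow>
     (let M = conic_dom A; S = prol_sections A M; Bloc = local_value S S B in
      B \<in> S \<rightarrow>\<^sub>E S \<rightarrow>\<^sub>E S \<and>
      leibniz_bracket S (prol_add A) (prol_scale A) M {f. smooth_fun (total_atlas A) M f}
        (prol_act A) B \<and>
      (\<forall>b\<in>bundle_atlas A. \<forall>m\<in>M. bproj A m \<in> fst (fst b) \<longrightarrow>
         (\<forall>\<alpha>\<in>Basis. \<forall>\<beta>\<in>Basis.
            Bloc (prol_hor A b \<alpha>) (prol_hor A b \<beta>) m =
              prol_hor A b (bracket_coeff A b \<alpha> \<beta> (bproj A m)) m \<and>
            Bloc (prol_hor A b \<alpha>) (prol_ver A b \<beta>) m = (zero_vec A (bproj A m), \<lambda>_. 0) \<and>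
            Bloc (prol_ver A b \<alpha>) (prol_ver A b \<beta>) m = (zero_vec A (bproj A m), \<lambda>_. 0))))"

definition prol_bracket ::
  "('m::topological_space, 'e::real_inner, 'a::topological_space, 'f::euclidean_space)
     finsler_algebroid \<Rightarrow>
   ('a \<Rightarrow> ('e, 'a, 'f) prol) \<Rightarrow> ('a \<Rightarrow> ('e, 'a, 'f) prol) \<Rightarrow> 'a \<Rightarrow> ('e, 'a, 'f) prol" where
  "prol_bracket A = (THE B. is_prol_bracket A B)"


section \<open>Finsler spray and Finsler connection\<close>

text \<open>In the spray equation \<open>L\<close> is the coordinate expression of \<open>F\<^sup>2/2\<close> in the bundle chart \<open>b\<close>, and
  the summation over the base index \<open>i\<close> is evaluation of a differential on the vector
  \<open>(\<rho>\<^sup>i\<^sub>\<delta>)\<^sub>i\<close>.\<close>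

definition spray_equation ::
  "('m::topological_space, 'e::real_inner, 'a::topological_space, 'f::euclidean_space)
     finsler_algebroid \<Rightarrow> ('m, 'e, 'a, 'f) bundle_chart \<Rightarrow> 'a \<Rightarrow> 'f \<Rightarrow> bool" where
  "spray_equation A b m s \<longleftrightarrow>
     (let x = bproj A m; y = snd b m; z = snd (total_chart A b) m;
          L = (\<lambda>q. 1/2 * (finsler A (chart_inv (total_chart A b) q))\<^sup>2);
          \<D> = (\<lambda>h p v. frechet_derivative h (at p) v :: real);
          \<rho> = (\<lambda>\<delta>. anchor_coeff A b \<delta> x);
          C = (\<lambda>\<gamma> \<alpha> \<delta>. bracket_coeff A b \<alpha> \<delta> x \<bullet> \<gamma>)
      in \<forall>\<alpha>\<in>Basis.
        (\<Sum>\<beta>\<in>Basis. \<D> (\<lambda>q. \<D> L q (0, \<beta>)) z (0, \<alpha>) * (s \<bullet> \<beta>))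
        + (\<Sum>\<delta>\<in>Basis. \<D> (\<lambda>q. \<D> L q (0, \<alpha>)) z (\<rho> \<delta>, 0) * (y \<bullet> \<delta>))
        + (\<Sum>\<gamma>\<in>Basis. \<Sum>\<delta>\<in>Basis. \<D> L z (0, \<gamma>) * C \<gamma> \<alpha> \<delta> * (y \<bullet> \<delta>))
        - \<D> L z (\<rho> \<alpha>, 0) = 0)"

definition is_finsler_spray ::
  "('m::topological_space, 'e::real_inner, 'a::topological_space, 'f::euclidean_space)
     finsler_algebroid \<Rightarrow> ('a \<Rightarrow> ('e, 'a, 'f) prol) \<Rightarrow> bool" where
  "is_finsler_spray A S \<longleftrightarrow> S \<in> prol_sections A (conic_dom A) \<and>
     (\<forall>b\<in>bundle_atlas A. \<forall>m\<in>conic_dom A. bproj A m \<in> fst (fst b) \<longrightarrow>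
        (\<exists>s. S m = prol_add A (prol_hor A b (snd b m) m) (prol_ver A b s m) \<and>
           spray_equation A b m s))"

definition finsler_spray ::
  "('m::topological_space, 'e::real_inner, 'a::topological_space, 'f::euclidean_space)
     finsler_algebroid \<Rightarrow> 'a \<Rightarrow> ('e, 'a, 'f) prol" where
  "finsler_spray A = (THE S. is_finsler_spray A S)"

text \<open>The velocity at \<open>t = 0\<close> of \<open>t \<mapsto> m + t b\<close>; with \<open>b = e\<^sub>\<alpha>\<close> this is \<open>\<partial>/\<partial>y\<^sup>\<alpha>\<close>. Thus \<open>prol_J\<close> is the
  endomorphism with \<open>J \<X>\<^sub>\<alpha> = \<V>\<^sub>\<alpha>\<close> and \<open>J \<V>\<^sub>\<alpha> = 0\<close>, and \<open>vertical_iso\<close> sends \<open>\<V>\<^sub>\<alpha>\<close> to \<open>e\<^sub>\<alpha>\<close>.\<close>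

definition vertical_lift ::
  "('m, 'e::real_inner, 'a, 'f::euclidean_space) finsler_algebroid \<Rightarrow>
   'a \<Rightarrow> 'a \<Rightarrow> ('a, 'e \<times> 'f) chart \<Rightarrow> 'e \<times> 'f" where
  "vertical_lift A m b = (\<lambda>d. if d \<in> total_atlas A \<and> m \<in> fst d
     then vector_derivative (\<lambda>t. snd d (fadd A m (fscale A t b))) (at 0) else 0)"

definition prol_J ::
  "('m, 'e::real_inner, 'a, 'f::euclidean_space) finsler_algebroid \<Rightarrow>
   ('a \<Rightarrow> ('e, 'a, 'f) prol) \<Rightarrow> 'a \<Rightarrow> ('e, 'a, 'f) prol" where
  "prol_J A Z = (\<lambda>m\<in>conic_dom A. (zero_vec A (bproj A m), vertical_lift A m (fst (Z m))))"

definition vertical_iso ::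
  "('m, 'e::real_inner, 'a, 'f::euclidean_space) finsler_algebroid \<Rightarrow>
   'a \<Rightarrow> ('e, 'a, 'f) prol \<Rightarrow> 'a" where
  "vertical_iso A m p = (THE b. bproj A b = bproj A m \<and> vertical_lift A m b = snd p)"

definition prol_diff ::
  "('m, 'e::real_inner, 'a, 'f::euclidean_space) finsler_algebroid \<Rightarrow>
   ('a \<Rightarrow> ('e, 'a, 'f) prol) \<Rightarrow> ('a \<Rightarrow> ('e, 'a, 'f) prol) \<Rightarrow> 'a \<Rightarrow> ('e, 'a, 'f) prol" where
  "prol_diff A Y Z = section_add (prol_add A) (conic_dom A) Y
     (section_scale (prol_scale A) (conic_dom A) (\<lambda>_. -1) Z)"

definition finsler_connection ::
  "('m::topological_space, 'e::real_inner, 'a::topological_space, 'f::euclidean_space)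
     finsler_algebroid \<Rightarrow> ('a \<Rightarrow> ('e, 'a, 'f) prol) \<Rightarrow> 'a \<Rightarrow> ('e, 'a, 'f) prol" where
  "finsler_connection A Z = prol_diff A
     (prol_J A (prol_bracket A (finsler_spray A) Z)) (prol_bracket A (finsler_spray A) (prol_J A Z))"

definition vertical_projector ::
  "('m::topological_space, 'e::real_inner, 'a::topological_space, 'f::euclidean_space)
     finsler_algebroid \<Rightarrow> ('a \<Rightarrow> ('e, 'a, 'f) prol) \<Rightarrow> 'a \<Rightarrow> ('e, 'a, 'f) prol" where
  "vertical_projector A Z = section_scale (prol_scale A) (conic_dom A) (\<lambda>_. 1/2)
     (prol_diff A Z (finsler_connection A Z))"

definition theta ::
  "('m::topological_space, 'e::real_inner, 'a::topological_space, 'f::euclidean_space)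
     finsler_algebroid \<Rightarrow> ('a \<Rightarrow> ('e, 'a, 'f) prol) \<Rightarrow> 'a \<Rightarrow> 'a" where
  "theta A Z = (\<lambda>m\<in>conic_dom A. vertical_iso A m (vertical_projector A Z m))"


section \<open>Linear connections on the pull-back bundle and sectional connections\<close>

definition linear_connection ::
  "('m::topological_space, 'e::real_inner, 'a::topological_space, 'f::euclidean_space)
     finsler_algebroid \<Rightarrow> (('a \<Rightarrow> ('e, 'a, 'f) prol) \<Rightarrow> ('a \<Rightarrow> 'a) \<Rightarrow> 'a \<Rightarrow> 'a) \<Rightarrow> bool" where
  "linear_connection A D \<longleftrightarrow>
     connection (prol_sections A (conic_dom A)) (prol_add A) (prol_scale A)
       (pb_sections A (conic_dom A)) (fadd A) (fscale A) (conic_dom A)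
       {f. smooth_fun (total_atlas A) (conic_dom A) f} (prol_act A) D"

definition torsion_free ::
  "('m::topological_space, 'e::real_inner, 'a::topological_space, 'f::euclidean_space)
     finsler_algebroid \<Rightarrow> (('a \<Rightarrow> ('e, 'a, 'f) prol) \<Rightarrow> ('a \<Rightarrow> 'a) \<Rightarrow> 'a \<Rightarrow> 'a) \<Rightarrow> bool" where
  "torsion_free A D \<longleftrightarrow>
     (let M = conic_dom A in \<forall>X\<in>prol_sections A M. \<forall>Y\<in>prol_sections A M. \<forall>m\<in>M.
        fadd A (D X (prol_proj M Y) m) (fscale A (-1) (D Y (prol_proj M X) m)) =
        prol_proj M (prol_bracket A X Y) m)"

definition almost_compatible ::
  "('m::topological_space, 'e::real_inner, 'a::topological_space, 'f::euclidean_space)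
     finsler_algebroid \<Rightarrow> (('a \<Rightarrow> ('e, 'a, 'f) prol) \<Rightarrow> ('a \<Rightarrow> 'a) \<Rightarrow> 'a \<Rightarrow> 'a) \<Rightarrow> bool" where
  "almost_compatible A D \<longleftrightarrow>
     (let M = conic_dom A in
      \<forall>X\<in>prol_sections A M. \<forall>Y\<in>pb_sections A M. \<forall>Z\<in>pb_sections A M. \<forall>m\<in>M.
        prol_act A X (\<lambda>u. fund_tensor A u (Y u) (Z u)) m =
          fund_tensor A m (D X Y m) (Z m) + fund_tensor A m (Y m) (D X Z m)
          + 2 * cartan_tensor A m (theta A X m) (Y m) (Z m))"

definition is_sectional_connection ::
  "('m::topological_space, 'e::real_inner, 'a::topological_space, 'f::euclidean_space)
     finsler_algebroid \<Rightarrow> 'm set \<Rightarrow> ('m \<Rightarrow> 'a) \<Rightarrow>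
   (('m \<Rightarrow> 'a) \<Rightarrow> ('m \<Rightarrow> 'a) \<Rightarrow> 'm \<Rightarrow> 'a) \<Rightarrow> bool" where
  "is_sectional_connection A V U D \<longleftrightarrow>
     (let S = sections A V in
      connection S (fadd A) (fscale A) S (fadd A) (fscale A) V
        {f. smooth_fun (base_atlas A) V f} (anchor_act A) D \<and>
      (\<forall>X\<in>S. \<forall>Y\<in>S. \<forall>x\<in>V.
         fadd A (D X Y x) (fscale A (-1) (D Y X x)) = local_bracket A X Y x) \<and>
      (\<forall>X\<in>S. \<forall>Y\<in>S. \<forall>Z\<in>S. \<forall>x\<in>V.
         anchor_act A X (\<lambda>p. fund_tensor A (U p) (Y p) (Z p)) x =
           fund_tensor A (U x) (D X Y x) (Z x) + fund_tensor A (U x) (Y x) (D X Z x)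
           + 2 * cartan_tensor A (U x) (D X U x) (Y x) (Z x)))"

definition sectional_connection ::
  "('m::topological_space, 'e::real_inner, 'a::topological_space, 'f::euclidean_space)
     finsler_algebroid \<Rightarrow> 'm set \<Rightarrow> ('m \<Rightarrow> 'a) \<Rightarrow> ('m \<Rightarrow> 'a) \<Rightarrow> ('m \<Rightarrow> 'a) \<Rightarrow> 'm \<Rightarrow> 'a" where
  "sectional_connection A V U = (THE D. is_sectional_connection A V U D)"

end

theory Submission
  imports Defs "HOL-Computational_Algebra.Polynomial"
begin

text \<open>In a bundle chart write \<open>\<theta>(\<X>\<^sub>\<alpha>) = \<theta>\<^sub>\<alpha>\<close>, \<open>\<theta>(\<V>\<^sub>\<alpha>) = e\<^sub>\<alpha>\<close>. Torsion-freeness applied to a vertical and a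
  projectable section forces \<open>\<nabla>\<close> to differentiate coordinates along vertical directions, where
  compatibility is the definition of the Cartan tensor. Along \<open>\<X>\<^sub>\<alpha>\<close> the two conditions are those of
  the Koszul formula for \<open>g\<close> with \<open>\<X>\<^sub>\<alpha>(g) - 2 \<AA>(\<theta>\<^sub>\<alpha>, \<cdot>, \<cdot>)\<close> in place of the derivative of \<open>g\<close>; it has a
  unique solution \<open>\<Gamma>\<close>. Differentiating the spray equation along the fibre gives
  \<open>\<Gamma>(e\<^sub>\<alpha>, y) = \<theta>\<^sub>\<alpha>\<close>. Hence along a section \<open>U\<close> the restriction of \<open>\<nabla>\<close> satisfies \<open>\<theta>(TU(\<rho> X)) = \<nabla>\<^sub>X U\<close>, so that
  the compatibility condition for \<open>\<nabla>\<close> turns into the one for \<open>\<nabla>\<^sup>U\<close>, whose solution is unique because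
  the Cartan tensor vanishes on \<open>U\<close>.\<close>

section \<open>Smooth maps between normed spaces\<close>

text \<open>The prolongation bracket, the spray and the sectional connection are definite
  descriptions, so each has to be exhibited in coordinates and shown to be the only object with its
  properties before the theorem can refer to it. Global operators act on sections over the whole
  domain while frames are local; cut-off functions mediate, and these require that the total space
  is Hausdorff. Independence of charts is a computation for the bracket and the spray, where
  inhomogeneous terms cancel, but for the connection it comes from pointwise uniqueness. Uniqueness
  meets an obstacle unknown from the Levi-Civita case: \<nabla> differentiates sections of the
  pull-back along sections of the prolongation, so the difference of two solutions is symmetric only
  through the projection, and pull-back sections must first be realised as projections. The Cartan
  correction in the Koszul formula has a meaning: it turns the derivative along the frame into the
  derivative along its horizontal part. The spray is itself horizontal, and this makes the formula
  yield \<theta> on the tautological section.\<close>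

abbreviation fderiv :: "('v::real_normed_vector \<Rightarrow> 'w::real_normed_vector) \<Rightarrow> 'v \<Rightarrow> 'v \<Rightarrow> 'w" where
  "fderiv f x \<equiv> frechet_derivative f (at x)"

lemma fderiv_eq: "(f has_derivative f') (at x) \<Longrightarrow> fderiv f x = f'"
  by (metis frechet_derivative_at)

lemma has_fderiv: "f differentiable (at x) \<Longrightarrow> (f has_derivative fderiv f x) (at x)"
  by (simp add: frechet_derivative_works)

lemma fderiv_cong_ev:
  assumes "\<forall>\<^sub>F y in nhds x. f y = g y"
  shows "fderiv f x = fderiv g x" "f differentiable (at x) \<longleftrightarrow> g differentiable (at x)"
proof -
  have *: "(f has_derivative D) (at x) \<longleftrightarrow> (g has_derivative D) (at x)" for D
    using has_derivative_transform_eventually[of f D x UNIV g] has_derivative_transform_eventually[of g D x UNIV f]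
      assms eventually_nhds_x_imp_x[OF assms]
    by (auto simp: eventually_nhds_conv_at eq_commute)
  then show "fderiv f x = fderiv g x" "f differentiable (at x) \<longleftrightarrow> g differentiable (at x)"
    by (simp_all add: frechet_derivative_def differentiable_def)
qed

lemma Ck_on_cong:
  assumes "open S" "\<And>x. x \<in> S \<Longrightarrow> f x = g x"
  shows "Ck_on k f S \<longleftrightarrow> Ck_on k g S"
  using assms(2)
proof (induction k arbitrary: f g)
  case 0
  then show ?case by (auto intro: continuous_on_cong)
next
  case (Suc k)
  have ev: "\<forall>\<^sub>F y in nhds x. f y = g y" if "x \<in> S" for x
    using that assms(1) Suc.prems by (auto simp: eventually_nhds)
  have "Ck_on k (\<lambda>x. fderiv f x v) S \<longleftrightarrow> Ck_on k (\<lambda>x. fderiv g x v) S" for v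
    by (rule Suc.IH) (simp add: fderiv_cong_ev[OF ev])
  then show ?case using fderiv_cong_ev[OF ev] by auto
qed

lemma Ck_on_subset: "Ck_on k f S \<Longrightarrow> T \<subseteq> S \<Longrightarrow> Ck_on k f T"
  by (induction k arbitrary: f) (auto intro: continuous_on_subset)

lemma Ck_on_mono: "Ck_on (Suc k) f S \<Longrightarrow> Ck_on k f S"
proof (induction k arbitrary: f)
  case 0
  then show ?case
    by (auto simp: continuous_at_imp_continuous_on differentiable_imp_continuous_within)
next
  case (Suc k)
  then show ?case by (metis Ck_on.simps(2))
qed

lemma Ck_on_local:
  assumes "\<And>x. x \<in> S \<Longrightarrow> \<exists>N. open N \<and> x \<in> N \<and> Ck_on k f N"
  shows "Ck_on k f S"
  using assms
proof (induction k arbitrary: f)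
  case 0
  then have "isCont f x" if "x \<in> S" for x
    using that by (metis Ck_on.simps(1) continuous_on_eq_continuous_at)
  then show ?case by (simp add: continuous_at_imp_continuous_on)
next
  case (Suc k)
  show ?case
    unfolding Ck_on.simps
  proof (intro conjI ballI allI)
    fix x assume "x \<in> S" then show "f differentiable at x" using Suc.prems by fastforce
  next
    fix v show "Ck_on k (\<lambda>x. fderiv f x v) S"
      by (rule Suc.IH) (use Suc.prems in fastforce)
  qed
qed

lemma Ck_on_bounded_linear:
  assumes "bounded_linear L"
  shows "Ck_on k f S \<Longrightarrow> open S \<Longrightarrow> Ck_on k (\<lambda>x. L (f x)) S"
proof (induction k arbitrary: f)
  case 0
  then show ?case by (auto intro: bounded_linear.continuous_on[OF assms])
next
  case (Suc k)
  have d: "((\<lambda>x. L (f x)) has_derivative (\<lambda>v. L (fderiv f x v))) (at x)" if "x \<in> S" for x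
    using Suc.prems that by (intro bounded_linear.has_derivative[OF assms] has_fderiv) auto
  have "Ck_on k (\<lambda>x. fderiv (\<lambda>x. L (f x)) x v) S" for v
  proof (subst Ck_on_cong[OF \<open>open S\<close>])
    show "Ck_on k (\<lambda>x. L (fderiv f x v)) S" using Suc by auto
    show "fderiv (\<lambda>x. L (f x)) x v = L (fderiv f x v)" if "x \<in> S" for x
      using fderiv_eq[OF d[OF that]] by simp
  qed
  then show ?case using d by (auto simp: differentiable_def)
qed

lemma Ck_on_const: "Ck_on k (\<lambda>_. c) S"
  by (induction k arbitrary: c) auto

lemma Ck_on_add: "Ck_on k f S \<Longrightarrow> Ck_on k g S \<Longrightarrow> open S \<Longrightarrow> Ck_on k (\<lambda>x. f x + g x) S"
proof (induction k arbitrary: f g)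
  case 0
  then show ?case by (auto intro: continuous_intros)
next
  case (Suc k)
  have d: "((\<lambda>x. f x + g x) has_derivative (\<lambda>v. fderiv f x v + fderiv g x v)) (at x)" if "x \<in> S" for x
    using Suc.prems that by (intro has_derivative_add has_fderiv) auto
  have "Ck_on k (\<lambda>x. fderiv (\<lambda>x. f x + g x) x v) S" for v
  proof (subst Ck_on_cong[OF \<open>open S\<close>])
    show "Ck_on k (\<lambda>x. fderiv f x v + fderiv g x v) S" using Suc by auto
    show "fderiv (\<lambda>x. f x + g x) x v = fderiv f x v + fderiv g x v" if "x \<in> S" for x
      using fderiv_eq[OF d[OF that]] by simp
  qed
  then show ?case using d by (auto simp: differentiable_def)
qed

lemma Ck_on_bilinear:
  assumes "bounded_bilinear h"
  shows "Ck_on k f S \<Longrightarrow> Ck_on k g S \<Longrightarrow> open S \<Longrightarrow> Ck_on k (\<lambda>x. h (f x) (g x)) S"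
proof (induction k arbitrary: f g)
  case 0
  then show ?case by (auto intro: bounded_bilinear.continuous_on[OF assms])
next
  case (Suc k)
  have d: "((\<lambda>x. h (f x) (g x)) has_derivative (\<lambda>v. h (f x) (fderiv g x v) + h (fderiv f x v) (g x))) (at x)"
    if "x \<in> S" for x
    using Suc.prems that by (intro bounded_bilinear.FDERIV[OF assms] has_fderiv) auto
  have "Ck_on k (\<lambda>x. fderiv (\<lambda>x. h (f x) (g x)) x v) S" for v
  proof (subst Ck_on_cong[OF \<open>open S\<close>])
    show "Ck_on k (\<lambda>x. h (f x) (fderiv g x v) + h (fderiv f x v) (g x)) S"
      using Suc Ck_on_mono[OF Suc.prems(1)] Ck_on_mono[OF Suc.prems(2)] by (auto intro!: Ck_on_add)
    show "fderiv (\<lambda>x. h (f x) (g x)) x v = h (f x) (fderiv g x v) + h (fderiv f x v) (g x)"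
      if "x \<in> S" for x
      using fderiv_eq[OF d[OF that]] by simp
  qed
  then show ?case using d by (auto simp: differentiable_def)
qed

lemma Ck_on_sum:
  assumes "\<And>i. i \<in> I \<Longrightarrow> Ck_on k (f i) S" "open S"
  shows "Ck_on k (\<lambda>x. \<Sum>i\<in>I. f i x) S"
  using assms by (induction I rule: infinite_finite_induct) (auto simp: Ck_on_const Ck_on_add)

text \<open>The model space of the base is only a \<open>real_inner\<close> type, so finite-dimensionality is carried
  by a finite family reproducing every vector.\<close>

definition reproducing :: "'v::real_inner set \<Rightarrow> bool" where
  "reproducing B \<longleftrightarrow> finite B \<and> (\<forall>x. (\<Sum>b\<in>B. (x \<bullet> b) *\<^sub>R b) = x)"

lemma reproducing_Basis: "reproducing (Basis :: 'f::euclidean_space set)"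
  by (simp add: reproducing_def euclidean_representation)

text \<open>Orthogonalise a finite spanning set, discard 0 and normalise. The reproducing identity
  is linear in \<open>x\<close>, so for an orthonormal set it only has to be checked on the set
  itself, where all terms but one vanish.\<close>

lemma reproducing_exists:
  assumes "finite (B :: 'v::real_inner set)" "span B = UNIV"
  shows "\<exists>B::'v set. reproducing B"
proof -
  obtain C :: "'v set" where C: "finite C" "span C = UNIV" "pairwise orthogonal C"
    using basis_orthogonal[OF assms(1)] unfolding assms(2) by metis
  define D where "D = (\<lambda>c. c /\<^sub>R norm c) ` (C - {0})"
  have fD: "finite D" using C by (simp add: D_def)
  have on: "d \<bullet> d = 1" if "d \<in> D" for d
    using that by (auto simp: D_def dot_square_norm power_mult_distrib power_inverse intro!: left_inverse)
  have orth: "d \<bullet> d' = 0" if "d \<in> D" "d' \<in> D" "d \<noteq> d'" for d d'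
    using that C(3) by (auto simp: D_def pairwise_def orthogonal_def) metis
  have "C \<subseteq> span D"
  proof
    fix c assume "c \<in> C"
    show "c \<in> span D"
    proof (cases "c = 0")
      case False
      then have "c /\<^sub>R norm c \<in> D" using \<open>c \<in> C\<close> by (auto simp: D_def)
      then have "norm c *\<^sub>R (c /\<^sub>R norm c) \<in> span D" by (intro span_scale span_base)
      then show ?thesis using False by simp
    qed (simp add: span_zero)
  qed
  then have sD: "span D = UNIV" using C(2) by (metis span_minimal subspace_span top.extremum_unique)
  have "(\<Sum>b\<in>D. (x \<bullet> b) *\<^sub>R b) = x" for x
  proof -
    have "x \<in> span D" using sD by simp
    then show ?thesis
    proof (induction rule: span_induct_alt)
      case base then show ?case by simp
    next
      case (step c d y)
      have "(\<Sum>b\<in>D. (d \<bullet> b) *\<^sub>R b) = d"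
      proof -
        have "(\<Sum>b\<in>D - {d}. (d \<bullet> b) *\<^sub>R b) = 0"
        proof (rule sum.neutral, rule ballI)
          fix b assume "b \<in> D - {d}"
          then have "d \<bullet> b = 0" using orth[of d b] step(1) by auto
          then show "(d \<bullet> b) *\<^sub>R b = 0" by simp
        qed
        then show ?thesis using fD step(1) on[of d] by (subst sum.remove[of _ d]) auto
      qed
      then show ?case using step
        by (simp add: inner_add_left scaleR_add_left sum.distrib flip: scaleR_scaleR scaleR_sum_right)
    qed
  qed
  then show ?thesis using fD by (auto simp: reproducing_def)
qed

lemma reproducing_Times:
  assumes "reproducing (B :: 'v::real_inner set)" "reproducing (C :: 'w::real_inner set)"
  shows "reproducing ((\<lambda>b. (b, 0)) ` B \<union> (\<lambda>c. (0, c)) ` C)"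
proof -
  have fin: "finite B" "finite C" using assms by (auto simp: reproducing_def)
  \<comment> \<open>The vector 0 is the only one that the two embedded families can share; without
    it the sum over the union splits.\<close>
  have B: "reproducing (B - {0})" "reproducing (C - {0})"
    using assms by (auto simp: reproducing_def sum_diff1)
  have "(\<Sum>b\<in>(\<lambda>b. (b, 0)) ` B \<union> (\<lambda>c. (0, c)) ` C. (x \<bullet> b) *\<^sub>R b) = x" for x :: "'v \<times> 'w"
  proof -
    have "(\<Sum>b\<in>(\<lambda>b. (b, 0)) ` B \<union> (\<lambda>c. (0, c)) ` C. (x \<bullet> b) *\<^sub>R b)
        = (\<Sum>b\<in>(\<lambda>b. (b, 0)) ` (B - {0}) \<union> (\<lambda>c. (0, c)) ` (C - {0}). (x \<bullet> b) *\<^sub>R b)"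
      using fin by (intro sum.mono_neutral_right) (auto simp: zero_prod_def)
    also have "\<dots> = (\<Sum>b\<in>(\<lambda>b. (b, 0)) ` (B - {0}). (x \<bullet> b) *\<^sub>R b) + (\<Sum>b\<in>(\<lambda>c. (0, c)) ` (C - {0}). (x \<bullet> b) *\<^sub>R b)"
      using fin by (intro sum.union_disjoint) auto
    also have "\<dots> = (\<Sum>b\<in>B-{0}. (x \<bullet> (b,0)) *\<^sub>R (b,0)) + (\<Sum>c\<in>C-{0}. (x \<bullet> (0,c)) *\<^sub>R (0,c))"
      by (simp add: sum.reindex inj_on_def)
    also have "\<dots> = (\<Sum>b\<in>B-{0}. (fst x \<bullet> b) *\<^sub>R b, \<Sum>c\<in>C-{0}. (snd x \<bullet> c) *\<^sub>R c)"
      by (cases x) (simp add: sum_prod)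
    also have "\<dots> = x" using B by (simp add: reproducing_def)
    finally show ?thesis .
  qed
  then show ?thesis using fin by (auto simp: reproducing_def)
qed

lemma linear_reproducing:
  assumes "reproducing B" "linear L"
  shows "L v = (\<Sum>b\<in>B. (v \<bullet> b) *\<^sub>R L b)"
proof -
  have "L v = L (\<Sum>b\<in>B. (v \<bullet> b) *\<^sub>R b)" using assms by (simp add: reproducing_def)
  then show ?thesis using assms(2) by (simp add: linear_sum linear_cmul)
qed

text \<open>The chain rule differentiates \<open>g\<close> in the direction
  \<open>fderiv f x v\<close>, which moves with \<open>x\<close>, whereas the induction hypothesis
  speaks about fixed directions. Expanding the moving direction in a reproducing family turns the
  derivative into a sum of products of functions covered by the hypothesis; this is where finite
  dimension of the intermediate space enters.\<close>

lemma Ck_on_compose: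
  assumes "reproducing (B :: 'w::real_inner set)"
  shows "Ck_on k (f :: 'v::real_normed_vector \<Rightarrow> 'w) S \<Longrightarrow> Ck_on k g T \<Longrightarrow> open S \<Longrightarrow> open T \<Longrightarrow> f ` S \<subseteq> T \<Longrightarrow>
    Ck_on k (\<lambda>x. g (f x)) S"
proof (induction k arbitrary: f g)
  case 0
  then show ?case by (auto intro: continuous_on_compose2)
next
  case (Suc k)
  have d: "((\<lambda>x. g (f x)) has_derivative (\<lambda>v. fderiv g (f x) (fderiv f x v))) (at x)" if "x \<in> S" for x
  proof -
    have 1: "(f has_derivative fderiv f x) (at x)" using Suc.prems that by (intro has_fderiv) auto
    have "f x \<in> T" using Suc.prems that by auto
    then have "(g has_derivative fderiv g (f x)) (at (f x))"
      using Suc.prems(2) by (intro has_fderiv) simp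
    from has_derivative_compose[OF 1 this] show ?thesis .
  qed
  have "Ck_on k (\<lambda>x. fderiv (\<lambda>x. g (f x)) x v) S" for v
  proof (subst Ck_on_cong[OF \<open>open S\<close>])
    show "Ck_on k (\<lambda>x. \<Sum>b\<in>B. (fderiv f x v \<bullet> b) *\<^sub>R fderiv g (f x) b) S"
    proof (intro Ck_on_sum Ck_on_bilinear[OF bounded_bilinear_scaleR] \<open>open S\<close>)
      fix b
      show "Ck_on k (\<lambda>x. fderiv f x v \<bullet> b) S"
        using Suc.prems by (intro Ck_on_bounded_linear[OF bounded_linear_inner_left]) auto
      have "Ck_on k (\<lambda>y. fderiv g y b) T" using Suc.prems by auto
      then show "Ck_on k (\<lambda>x. fderiv g (f x) b) S"
        using Suc.IH[OF Ck_on_mono[OF Suc.prems(1)]] Suc.prems(3-5) by blast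
    qed
    show "fderiv (\<lambda>x. g (f x)) x v = (\<Sum>b\<in>B. (fderiv f x v \<bullet> b) *\<^sub>R fderiv g (f x) b)" if "x \<in> S" for x
    proof -
      have "f x \<in> T" using Suc.prems that by auto
      then have "linear (fderiv g (f x))" using Suc.prems(2) by (intro linear_frechet_derivative) auto
      from linear_reproducing[OF assms this] show ?thesis unfolding fderiv_eq[OF d[OF that]] .
    qed
  qed
  then show ?case using d by (auto simp: differentiable_def)
qed

text \<open>Smoothness becomes a property of the germ at a point, so that it can be combined with
  eventual equalities and no domains have to be carried through later arguments.\<close>

definition Cinf_at :: "('v::real_normed_vector \<Rightarrow> 'w::real_normed_vector) \<Rightarrow> 'v \<Rightarrow> bool" where
  "Cinf_at f x \<longleftrightarrow> (\<exists>S. open S \<and> x \<in> S \<and> Cinf_on f S)"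

lemma Cinf_on_iff_at: "open S \<Longrightarrow> Cinf_on f S \<longleftrightarrow> (\<forall>x\<in>S. Cinf_at f x)"
proof
  assume "open S" "\<forall>x\<in>S. Cinf_at f x"
  then show "Cinf_on f S" unfolding Cinf_at_def Cinf_on_def by (intro allI Ck_on_local) metis
qed (auto simp: Cinf_at_def)

lemma Cinf_at_eventually: "Cinf_at f x \<Longrightarrow> \<forall>\<^sub>F y in nhds x. Cinf_at f y"
  unfolding Cinf_at_def eventually_nhds by blast

lemma Cinf_at_differentiable: "Cinf_at f x \<Longrightarrow> f differentiable (at x)"
  unfolding Cinf_at_def Cinf_on_def by (metis Ck_on.simps(2))

lemma Cinf_at_isCont: "Cinf_at f x \<Longrightarrow> isCont f x"
  by (simp add: Cinf_at_differentiable differentiable_imp_continuous_within)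

lemma Cinf_at_has_derivative: "Cinf_at f x \<Longrightarrow> (f has_derivative fderiv f x) (at x)"
  by (simp add: Cinf_at_differentiable has_fderiv)

lemma Cinf_at_linear: "Cinf_at f x \<Longrightarrow> linear (fderiv f x)"
  by (simp add: Cinf_at_differentiable linear_frechet_derivative)

lemma Cinf_at_fderiv: "Cinf_at f x \<Longrightarrow> Cinf_at (\<lambda>y. fderiv f y v) x"
  unfolding Cinf_at_def Cinf_on_def by (metis Ck_on.simps(2))

lemma Cinf_at_cong:
  assumes "\<forall>\<^sub>F y in nhds x. f y = g y"
  shows "Cinf_at f x \<longleftrightarrow> Cinf_at g x"
proof -
  have *: "Cinf_at g x" if 1: "Cinf_at f x" and 2: "\<forall>\<^sub>F y in nhds x. f y = g y" for f g :: "'a \<Rightarrow> 'b"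
  proof -
    obtain S where "open S" "x \<in> S" "Cinf_on f S" using 1 unfolding Cinf_at_def by auto
    moreover obtain T where "open T" "x \<in> T" "\<And>y. y \<in> T \<Longrightarrow> f y = g y"
      using 2 unfolding eventually_nhds by auto
    ultimately have "open (S \<inter> T)" "x \<in> S \<inter> T" "Cinf_on g (S \<inter> T)"
      using Ck_on_cong[of "S \<inter> T" f g] Ck_on_subset[of _ f S "S \<inter> T"] by (auto simp: Cinf_on_def)
    then show ?thesis unfolding Cinf_at_def by blast
  qed
  show ?thesis using *[of f g] *[of g f] assms by (auto simp: eq_commute)
qed

lemma Cinf_at_transform: "\<forall>\<^sub>F y in nhds x. f y = g y \<Longrightarrow> Cinf_at g x \<Longrightarrow> Cinf_at f x"
  by (simp only: Cinf_at_cong)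

lemma Cinf_at_const [simp, intro]: "Cinf_at (\<lambda>_. c) x"
  unfolding Cinf_at_def Cinf_on_def using Ck_on_const by (metis UNIV_I open_UNIV)

lemma Cinf_at_obtain2:
  assumes "Cinf_at f x" "Cinf_at g x"
  obtains S where "open S" "x \<in> S" "\<And>k. Ck_on k f S" "\<And>k. Ck_on k g S"
proof -
  obtain S T where "open S" "x \<in> S" "Cinf_on f S" "open T" "x \<in> T" "Cinf_on g T"
    using assms unfolding Cinf_at_def by blast
  then show ?thesis using that[of "S \<inter> T"]
    by (metis Cinf_on_def Ck_on_subset IntI inf_le1 inf_le2 open_Int)
qed

lemma Cinf_at_add [intro]: "Cinf_at f x \<Longrightarrow> Cinf_at g x \<Longrightarrow> Cinf_at (\<lambda>y. f y + g y) x"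
  by (erule (1) Cinf_at_obtain2) (unfold Cinf_at_def Cinf_on_def, metis Ck_on_add)

lemma Cinf_at_bilinear:
  "bounded_bilinear h \<Longrightarrow> Cinf_at f x \<Longrightarrow> Cinf_at g x \<Longrightarrow> Cinf_at (\<lambda>y. h (f y) (g y)) x"
  by (erule (1) Cinf_at_obtain2) (unfold Cinf_at_def Cinf_on_def, metis Ck_on_bilinear)

lemmas Cinf_at_scaleR [intro] = Cinf_at_bilinear[OF bounded_bilinear_scaleR]
lemmas Cinf_at_mult [intro] = Cinf_at_bilinear[OF bounded_bilinear_mult]
lemmas Cinf_at_inner [intro] = Cinf_at_bilinear[OF bounded_bilinear_inner]

lemma Cinf_at_bounded_linear:
  "bounded_linear L \<Longrightarrow> Cinf_at f x \<Longrightarrow> Cinf_at (\<lambda>y. L (f y)) x"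
  unfolding Cinf_at_def Cinf_on_def using Ck_on_bounded_linear by blast

lemma Cinf_at_minus [intro]: "Cinf_at f x \<Longrightarrow> Cinf_at (\<lambda>y. - f y) x"
  by (rule Cinf_at_bounded_linear[OF bounded_linear_minus[OF bounded_linear_ident]])

lemma Cinf_at_diff [intro]: "Cinf_at f x \<Longrightarrow> Cinf_at g x \<Longrightarrow> Cinf_at (\<lambda>y. f y - g y) x"
  using Cinf_at_add[of f x "\<lambda>y. - g y"] Cinf_at_minus by auto

lemma Cinf_at_sum [intro]:
  "(\<And>i. i \<in> I \<Longrightarrow> Cinf_at (f i) x) \<Longrightarrow> Cinf_at (\<lambda>y. \<Sum>i\<in>I. f i y) x"
  by (induction I rule: infinite_finite_induct) auto

lemma Cinf_at_Pair [intro]: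
  assumes "Cinf_at f x" "Cinf_at g x" shows "Cinf_at (\<lambda>y. (f y, g y)) x"
proof -
  have "bounded_linear (\<lambda>a. (a, 0))" "bounded_linear (\<lambda>a. (0, a))"
    by (auto intro!: bounded_linear_Pair bounded_linear_ident bounded_linear_zero)
  from Cinf_at_add[OF Cinf_at_bounded_linear[OF this(1) assms(1)] Cinf_at_bounded_linear[OF this(2) assms(2)]]
  show ?thesis by simp
qed

lemma Cinf_at_id [simp, intro]: "Cinf_at (\<lambda>y. y) x"
proof -
  have "Ck_on k (\<lambda>y. y) UNIV" for k by (cases k) (auto simp: Ck_on_const)
  then show ?thesis unfolding Cinf_at_def Cinf_on_def by blast
qed

lemma Cinf_at_compose:
  assumes "\<exists>B::'w set. reproducing B" "Cinf_at g (f x)" "Cinf_at (f :: 'v::real_normed_vector \<Rightarrow> 'w::real_inner) x"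
  shows "Cinf_at (\<lambda>y. g (f y)) x"
proof -
  obtain S T where *: "open S" "x \<in> S" "Cinf_on f S" "open T" "f x \<in> T" "Cinf_on g T"
    using assms unfolding Cinf_at_def by blast
  have "continuous_on S f" using *(3) by (auto simp: Cinf_on_def dest!: spec[of _ 0])
  then have "open (S \<inter> f -` T)"
    using continuous_on_open_vimage[OF *(1)] *(4) by (metis Int_commute)
  moreover have "Cinf_on (\<lambda>y. g (f y)) (S \<inter> f -` T)"
  proof -
    obtain B :: "'w set" where "reproducing B" using assms by blast
    moreover have "Ck_on k f (S \<inter> f -` T)" "Ck_on k g T" for k
      using * Ck_on_subset[of k f S] by (auto simp: Cinf_on_def)
    ultimately show ?thesis
      using Ck_on_compose[of B _ f "S \<inter> f -` T" g T] \<open>open (S \<inter> f -` T)\<close> *(4) unfolding Cinf_on_def by blast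
  qed
  ultimately show ?thesis using * unfolding Cinf_at_def by blast
qed

lemma Cinf_at_compose_real:
  "Cinf_at g (f x) \<Longrightarrow> Cinf_at (f :: 'v::real_normed_vector \<Rightarrow> 'f::euclidean_space) x \<Longrightarrow> Cinf_at (\<lambda>y. g (f y)) x"
  using Cinf_at_compose reproducing_Basis by blast

text \<open>As in the chain rule the direction varies with the point; the derivative is a finite sum
  of derivatives in fixed directions with smooth coefficients.\<close>

lemma Cinf_at_fderiv_field:
  assumes "\<exists>B::'v set. reproducing B" "Cinf_at (f :: 'v::real_inner \<Rightarrow> 'w::real_normed_vector) x" "Cinf_at u x"
  shows "Cinf_at (\<lambda>y. fderiv f y (u y)) x"
proof -
  obtain B :: "'v set" where B: "reproducing B" using assms by blast
  have "\<forall>\<^sub>F y in nhds x. fderiv f y (u y) = (\<Sum>b\<in>B. (u y \<bullet> b) *\<^sub>R fderiv f y b)"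
    using Cinf_at_eventually[OF assms(2)]
    by eventually_elim (rule linear_reproducing[OF B Cinf_at_linear])
  moreover have "Cinf_at (\<lambda>y. \<Sum>b\<in>B. (u y \<bullet> b) *\<^sub>R fderiv f y b) x"
    using assms by (intro Cinf_at_sum Cinf_at_scaleR Cinf_at_inner Cinf_at_fderiv) auto
  ultimately show ?thesis by (rule Cinf_at_transform)
qed

text \<open>The derivative of \<open>inverse\<close> is a polynomial in \<open>inverse\<close>
  itself, which closes the induction on the order of differentiability.\<close>

lemma Cinf_at_inverse: "x \<noteq> 0 \<Longrightarrow> Cinf_at inverse (x::real)"
proof -
  assume "x \<noteq> 0"
  have "Ck_on k inverse (- {0::real})" for k
  proof (induction k)
    case 0 then show ?case by (auto intro!: continuous_intros)
  next
    case (Suc k)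
    have d: "(inverse has_derivative (\<lambda>v. - (inverse y * v * inverse y))) (at y)" if "y \<in> - {0::real}" for y
      using that by (auto intro!: derivative_eq_intros)
    have "Ck_on k (\<lambda>y. fderiv inverse y v) (- {0::real})" for v
    proof (subst Ck_on_cong)
      show "Ck_on k (\<lambda>y. - v * (inverse y * inverse y)) (- {0::real})"
        by (intro Ck_on_bilinear[OF bounded_bilinear_mult] Suc Ck_on_const) auto
      show "fderiv inverse y v = - v * (inverse y * inverse y)" if "y \<in> - {0}" for y
        using fderiv_eq[OF d[OF that]] by simp
    qed auto
    then show ?case using d by (auto simp: differentiable_def)
  qed
  then show ?thesis using \<open>x \<noteq> 0\<close> unfolding Cinf_at_def Cinf_on_def
    by (intro exI[of _ "- {0}"]) auto
qed

lemma Cinf_at_divide [intro]: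
  fixes f g :: "'v::real_normed_vector \<Rightarrow> real"
  assumes "Cinf_at f x" "Cinf_at g x" "g x \<noteq> 0"
  shows "Cinf_at (\<lambda>y. f y / g y) x"
  using Cinf_at_mult[OF assms(1) Cinf_at_compose_real[OF Cinf_at_inverse[OF assms(3)] assms(2)]]
  by (simp add: divide_inverse)

section \<open>Bump functions\<close>

text \<open>Derivatives of functions of the shape \<open>p (1/t) e\<^bsup>-1/t\<^esup>\<close> with a polynomial \<open>p\<close> have the same shape.\<close>

definition flat_exp :: "real poly \<Rightarrow> real \<Rightarrow> real" where
  "flat_exp p t = (if t > 0 then poly p (1/t) * exp (- (1/t)) else 0)"

text \<open>For positive \<open>t\<close> the chain rule gives the factor \<open>1/t^2\<close>,
  which is \<open>monom 1 2\<close> at \<open>1/t\<close>, times \<open>p - p'\<close>. At 0 the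
  difference quotient tends to 0 because the exponential beats every polynomial in
  \<open>1/t\<close>.\<close>

lemma flat_exp_has_derivative:
  "(flat_exp p has_real_derivative flat_exp (monom 1 2 * (p - pderiv p)) t) (at t)"
proof -
  consider "t > 0" | "t < 0" | "t = 0" by linarith
  then show ?thesis
  proof cases
    case 1
    have "((\<lambda>t. poly p (1/t) * exp (- (1/t))) has_real_derivative flat_exp (monom 1 2 * (p - pderiv p)) t) (at t)"
      using 1 by (auto intro!: derivative_eq_intros simp: flat_exp_def poly_monom field_simps power2_eq_square)
    moreover have "\<forall>\<^sub>F s in nhds t. flat_exp p s = poly p (1/s) * exp (- (1/s))"
      using eventually_nhds_in_open[of "{0<..}" t] 1 by (auto simp: flat_exp_def elim: eventually_mono)
    ultimately show ?thesis
      using DERIV_cong_ev[OF refl _ refl, where x=t and f="flat_exp p" and g="\<lambda>t. poly p (1/t) * exp (- (1/t))"] by simp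
  next
    case 2
    have "\<forall>\<^sub>F s in nhds t. flat_exp p s = 0"
      using eventually_nhds_in_open[of "{..<0}" t] 2 by (auto simp: flat_exp_def elim: eventually_mono)
    then have "(flat_exp p has_real_derivative 0) (at t)"
      using DERIV_cong_ev[OF refl _ refl, where x=t and f="flat_exp p" and g="\<lambda>_. 0"] by auto
    then show ?thesis using 2 by (simp add: flat_exp_def)
  next
    case 3
    have lim: "((\<lambda>u. poly q u * exp (- u)) \<longlongrightarrow> 0) at_top" for q :: "real poly"
    proof -
      have "((\<lambda>u. \<Sum>i\<le>degree q. coeff q i * (u ^ i / exp u)) \<longlongrightarrow> (\<Sum>i\<le>degree q. coeff q i * 0)) at_top"
        by (intro tendsto_sum tendsto_mult tendsto_const tendsto_power_div_exp_0)
      then show ?thesis by (simp add: poly_altdef exp_minus sum_distrib_right divide_inverse mult.assoc)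
    qed
    \<comment> \<open>Division by \<open>h\<close> in the difference quotient multiplies the
      polynomial in \<open>1/h\<close> by its variable, hence \<open>pCons 0 p\<close>.\<close>
    have "((\<lambda>h. poly (pCons 0 p) (inverse h) * exp (- inverse h)) \<longlongrightarrow> 0) (at_right 0)"
      using filterlim_compose[OF lim filterlim_inverse_at_top_right] .
    moreover have "\<forall>\<^sub>F h in at_right 0. poly (pCons 0 p) (inverse h) * exp (- inverse h) = (flat_exp p (0 + h) - flat_exp p 0) / h"
      using eventually_at_right_less[of 0]
      by eventually_elim (auto simp: flat_exp_def divide_inverse)
    ultimately have r: "((\<lambda>h. (flat_exp p (0 + h) - flat_exp p 0) / h) \<longlongrightarrow> 0) (at_right 0)"
      by (rule Lim_transform_eventually)
    have "\<forall>\<^sub>F h::real in at_left 0. h < 0" by (simp add: eventually_at_filter)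
    then have "\<forall>\<^sub>F h in at_left 0. 0 = (flat_exp p (0 + h) - flat_exp p 0) / h"
      by eventually_elim (auto simp: flat_exp_def)
    then have "((\<lambda>h. (flat_exp p (0 + h) - flat_exp p 0) / h) \<longlongrightarrow> 0) (at_left 0)"
      by (rule Lim_transform_eventually[OF tendsto_const])
    with r show ?thesis
      using 3 by (simp add: DERIV_def filterlim_at_split flat_exp_def)
  qed
qed

lemma Cinf_at_flat_exp: "Cinf_at (flat_exp p) t"
proof -
  have "Ck_on k (flat_exp p) UNIV" for k
  proof (induction k arbitrary: p)
    case 0
    have "isCont (flat_exp p) t" for t using DERIV_isCont[OF flat_exp_has_derivative] .
    then show ?case by (simp add: continuous_at_imp_continuous_on)
  next
    case (Suc k)
    have d: "(flat_exp p has_derivative (\<lambda>v. flat_exp (monom 1 2 * (p - pderiv p)) t * v)) (at t)" for t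
      using flat_exp_has_derivative[of p t] by (simp add: has_field_derivative_def)
    have "Ck_on k (\<lambda>t. fderiv (flat_exp p) t v) UNIV" for v
      unfolding fderiv_eq[OF d] using Suc by (intro Ck_on_bilinear[OF bounded_bilinear_mult] Ck_on_const) auto
    then show ?case using d by (auto simp: differentiable_def)
  qed
  then show ?thesis unfolding Cinf_at_def Cinf_on_def by blast
qed

definition smooth_step :: "real \<Rightarrow> real" where
  "smooth_step t = flat_exp 1 t / (flat_exp 1 t + flat_exp 1 (1 - t))"

lemma smooth_step: "t \<le> 0 \<Longrightarrow> smooth_step t = 0" "t \<ge> 1 \<Longrightarrow> smooth_step t = 1"
  by (auto simp: smooth_step_def flat_exp_def)

lemma Cinf_at_smooth_step: "Cinf_at smooth_step t"
proof -
  \<comment> \<open>One of \<open>t\<close> and \<open>1 - t\<close> is positive, so the denominator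
    of \<open>smooth_step\<close> never vanishes.\<close>
  have "flat_exp 1 t \<ge> 0" "flat_exp 1 (1 - t) \<ge> 0" "flat_exp 1 t > 0 \<or> flat_exp 1 (1 - t) > 0"
    by (auto simp: flat_exp_def)
  then have "flat_exp 1 t + flat_exp 1 (1 - t) \<noteq> 0" by linarith
  then show ?thesis unfolding smooth_step_def
    by (intro Cinf_at_divide Cinf_at_add Cinf_at_flat_exp Cinf_at_compose_real[of "flat_exp 1" "\<lambda>t. 1 - t"] Cinf_at_diff) auto
qed

lemma bump_exists:
  fixes x :: "'v::real_inner"
  assumes "open S" "x \<in> S"
  obtains \<beta> :: "'v \<Rightarrow> real" and r where "r > 0" "cball x r \<subseteq> S" "\<And>y. Cinf_at \<beta> y"
    "\<forall>\<^sub>F y in nhds x. \<beta> y = 1" "\<And>y. y \<notin> cball x r \<Longrightarrow> \<beta> y = 0"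
proof -
  obtain r where r: "r > 0" "cball x r \<subseteq> S" using assms open_contains_cball by blast
  \<comment> \<open>The squared distance is smooth also at the centre. The argument of the step is
    at least 1 where the squared distance is at most half of \<open>r^2\<close>, in particular on
    the ball of radius \<open>r/2\<close>, and at most 0 from radius \<open>r\<close> on.\<close>
  define \<beta> where "\<beta> y = smooth_step (2 - 2 * ((y - x) \<bullet> (y - x)) / r\<^sup>2)" for y
  have "Cinf_at \<beta> y" for y
    unfolding \<beta>_def using r(1)
    by (intro Cinf_at_compose_real[OF Cinf_at_smooth_step] Cinf_at_diff Cinf_at_divide Cinf_at_mult Cinf_at_inner) auto
  moreover have "\<forall>\<^sub>F y in nhds x. \<beta> y = 1"
  proof (rule eventually_mono)
    show "\<forall>\<^sub>F y in nhds x. y \<in> ball x (r/2)" using r(1) by (intro eventually_nhds_in_open) auto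
    fix y assume "y \<in> ball x (r/2)"
    then have "norm (y - x) \<le> r/2" by (simp add: dist_norm norm_minus_commute)
    then have "(norm (y - x))\<^sup>2 \<le> (r/2)\<^sup>2" by (intro power_mono) auto
    then have "(norm (y - x))\<^sup>2 * 4 \<le> r\<^sup>2" by (simp add: power_divide)
    moreover have "0 \<le> (norm (y - x))\<^sup>2" by simp
    ultimately have "2 * (norm (y - x))\<^sup>2 \<le> r\<^sup>2" by linarith
    then have "2 * ((y - x) \<bullet> (y - x)) / r\<^sup>2 \<le> 1"
      using r(1) by (simp add: dot_square_norm divide_simps)
    then show "\<beta> y = 1" unfolding \<beta>_def by (intro smooth_step) auto
  qed
  moreover have "\<beta> y = 0" if "y \<notin> cball x r" for y
  proof -
    have "r \<le> norm (y - x)" using that by (simp add: dist_norm norm_minus_commute)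
    then have "r\<^sup>2 \<le> (norm (y - x))\<^sup>2" using r(1) by (intro power_mono) auto
    then have "2 * ((y - x) \<bullet> (y - x)) / r\<^sup>2 \<ge> 2"
      using r(1) by (simp add: dot_square_norm field_simps)
    then show "\<beta> y = 0" unfolding \<beta>_def by (intro smooth_step) auto
  qed
  ultimately show ?thesis using that r by blast
qed

text \<open>Points of a ball have bounded coefficients with respect to a reproducing family, so the
  ball is a closed subset of the image of a compact box of coefficients.\<close>

lemma reproducing_compact_cball:
  fixes x :: "'v::real_inner"
  assumes "reproducing (B :: 'v set)"
  shows "compact (cball x r)"
proof -
  have fB: "finite B" using assms by (simp add: reproducing_def)
  define K where "K = (\<Sum>b\<in>B. (norm x + \<bar>r\<bar>) * norm b)"
  \<comment> \<open>The image of the box is treated one generator at a time, a sum of two compact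
    sets being compact.\<close>
  define C where "C F = {y. \<exists>c. (\<forall>b\<in>F. c b \<in> {-K..K}) \<and> y = (\<Sum>b\<in>F. c b *\<^sub>R b)}" for F :: "'v set"
  have "compact (C F)" if "finite F" for F
    using that
  proof (induction F)
    case empty
    have "C {} = {0}" by (auto simp: C_def)
    then show ?case by simp
  next
    case (insert a F)
    have "compact ((\<lambda>t. t *\<^sub>R a) ` {-K..K})" by (intro compact_continuous_image continuous_intros) auto
    from compact_sums[OF this insert.IH]
    have "compact {x + y |x y. x \<in> (\<lambda>t. t *\<^sub>R a) ` {-K..K} \<and> y \<in> C F}" .
    also have "{x + y |x y. x \<in> (\<lambda>t. t *\<^sub>R a) ` {-K..K} \<and> y \<in> C F} = C (insert a F)" (is "?L = ?R")
    proof (intro equalityI subsetI)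
      fix z assume "z \<in> ?L"
      then obtain t c where tc: "t \<in> {-K..K}" "\<forall>b\<in>F. c b \<in> {-K..K}" "z = t *\<^sub>R a + (\<Sum>b\<in>F. c b *\<^sub>R b)"
        by (auto simp: C_def)
      have "(\<Sum>b\<in>F. (c(a := t)) b *\<^sub>R b) = (\<Sum>b\<in>F. c b *\<^sub>R b)"
        using insert by (intro sum.cong) auto
      then have "z = (\<Sum>b\<in>insert a F. (c(a := t)) b *\<^sub>R b)" using tc insert by simp
      then show "z \<in> ?R" using tc unfolding C_def by (intro CollectI exI[of _ "c(a := t)"]) auto
    next
      fix z assume "z \<in> ?R"
      then obtain c where c: "\<forall>b\<in>insert a F. c b \<in> {-K..K}" "z = (\<Sum>b\<in>insert a F. c b *\<^sub>R b)"
        unfolding C_def by blast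
      then have "z = c a *\<^sub>R a + (\<Sum>b\<in>F. c b *\<^sub>R b)" using insert by simp
      moreover have "(\<Sum>b\<in>F. c b *\<^sub>R b) \<in> C F" using c(1) by (auto simp: C_def)
      ultimately show "z \<in> ?L" using c(1) by blast
    qed
    finally show ?case .
  qed
  then have "compact (C B)" using fB .
  moreover have "cball x r \<subseteq> C B"
  proof
    fix y assume "y \<in> cball x r"
    then have "norm (y - x) \<le> r" by (simp add: dist_norm norm_minus_commute)
    then have "norm y \<le> norm x + \<bar>r\<bar>" using norm_triangle_sub[of y x] by linarith
    have "\<bar>y \<bullet> b\<bar> \<le> K" if "b \<in> B" for b
    proof -
      have "\<bar>y \<bullet> b\<bar> \<le> norm y * norm b" by (rule Cauchy_Schwarz_ineq2)
      also have "\<dots> \<le> (norm x + \<bar>r\<bar>) * norm b"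
        using \<open>norm y \<le> norm x + \<bar>r\<bar>\<close> by (intro mult_right_mono) auto
      also have "\<dots> \<le> K" unfolding K_def using fB that
        by (intro member_le_sum) (auto intro!: mult_nonneg_nonneg add_nonneg_nonneg)
      finally show ?thesis .
    qed
    then show "y \<in> C B" using assms unfolding C_def reproducing_def
      by (intro CollectI exI[of _ "\<lambda>b. y \<bullet> b"]) (auto simp: abs_le_iff minus_le_iff)
  qed
  ultimately show ?thesis using compact_Int_closed[of "C B" "cball x r"] by (simp add: Int_absorb1)
qed

section \<open>Symmetry of second derivatives\<close>

text \<open>The mean value theorem is applied first to the increment in direction \<open>w\<close>
  as a function of the \<open>v\<close>-parameter, then along \<open>w\<close> to the derivative in
  direction \<open>v\<close>.\<close>

lemma second_difference_mean_value:
  fixes f :: "'v::real_normed_vector \<Rightarrow> real"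
  assumes sm: "\<And>y. dist x y < \<epsilon> \<Longrightarrow> Cinf_at f y" and h: "h > 0" "h * (norm v + norm w) < \<epsilon>"
  shows "\<exists>p. dist x p \<le> h * (norm v + norm w) \<and>
    f (x + h *\<^sub>R v + h *\<^sub>R w) - f (x + h *\<^sub>R v) - f (x + h *\<^sub>R w) + f x
      = h * (h * fderiv (\<lambda>y. fderiv f y v) p w)"
proof -
  have near: "dist x (x + s *\<^sub>R v + t *\<^sub>R w) \<le> h * (norm v + norm w)"
    if "0 \<le> s" "s \<le> h" "0 \<le> t" "t \<le> h" for s t
  proof -
    have "dist x (x + s *\<^sub>R v + t *\<^sub>R w) = norm (s *\<^sub>R v + t *\<^sub>R w)"
      using norm_minus_commute[of x "x + (s *\<^sub>R v + t *\<^sub>R w)"] by (simp add: dist_norm add.assoc)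
    also have "\<dots> \<le> s * norm v + t * norm w" using norm_triangle_ineq[of "s *\<^sub>R v" "t *\<^sub>R w"] that by simp
    also have "\<dots> \<le> h * norm v + h * norm w" using that by (intro add_mono mult_right_mono) auto
    finally show ?thesis by (simp add: distrib_left)
  qed
  have smooth: "Cinf_at f (x + s *\<^sub>R v + t *\<^sub>R w)" if "0 \<le> s" "s \<le> h" "0 \<le> t" "t \<le> h" for s t
    using near[OF that] h(2) by (intro sm) linarith
  have "DERIV (\<lambda>s. f (x + s *\<^sub>R v + h *\<^sub>R w) - f (x + s *\<^sub>R v)) s :>
      fderiv f (x + s *\<^sub>R v + h *\<^sub>R w) v - fderiv f (x + s *\<^sub>R v) v" if s: "0 \<le> s" "s \<le> h" for s
  proof -
    have 1: "((\<lambda>s. f (x + s *\<^sub>R v + t *\<^sub>R w)) has_derivative (\<lambda>d. fderiv f (x + s *\<^sub>R v + t *\<^sub>R w) (d *\<^sub>R v))) (at s)"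
      if "0 \<le> t" "t \<le> h" for t
      by (rule has_derivative_compose[of "\<lambda>s. x + s *\<^sub>R v + t *\<^sub>R w" "\<lambda>d. d *\<^sub>R v", OF _ Cinf_at_has_derivative[OF smooth[OF s that]]])
        (auto intro!: derivative_eq_intros)
    have 2: "fderiv f (x + s *\<^sub>R v + t *\<^sub>R w) (d *\<^sub>R v) = fderiv f (x + s *\<^sub>R v + t *\<^sub>R w) v * d"
      if "0 \<le> t" "t \<le> h" for t d
      using Cinf_at_linear[OF smooth[OF s that]] by (simp add: linear_cmul)
    show ?thesis using has_derivative_diff[OF 1[of h] 1[of 0]] 2[of h] 2[of 0] h(1)
      by (simp add: has_field_derivative_def flip: left_diff_distrib)
  qed
  from MVT2[of 0 h, OF h(1) this] obtain a where a: "0 < a" "a < h"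
    "(f (x + h *\<^sub>R v + h *\<^sub>R w) - f (x + h *\<^sub>R v)) - (f (x + h *\<^sub>R w) - f x)
      = h * (fderiv f (x + a *\<^sub>R v + h *\<^sub>R w) v - fderiv f (x + a *\<^sub>R v) v)"
    by auto
  have "DERIV (\<lambda>t. fderiv f (x + a *\<^sub>R v + t *\<^sub>R w) v) t :>
      fderiv (\<lambda>y. fderiv f y v) (x + a *\<^sub>R v + t *\<^sub>R w) w" if t: "0 \<le> t" "t \<le> h" for t
  proof -
    have *: "Cinf_at (\<lambda>y. fderiv f y v) (x + a *\<^sub>R v + t *\<^sub>R w)"
      using a t by (intro Cinf_at_fderiv smooth) auto
    have "((\<lambda>t. fderiv f (x + a *\<^sub>R v + t *\<^sub>R w) v) has_derivative
        (\<lambda>d. fderiv (\<lambda>y. fderiv f y v) (x + a *\<^sub>R v + t *\<^sub>R w) (d *\<^sub>R w))) (at t)"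
      by (rule has_derivative_compose[of "\<lambda>t. x + a *\<^sub>R v + t *\<^sub>R w" "\<lambda>d. d *\<^sub>R w", OF _ Cinf_at_has_derivative[OF *]])
        (auto intro!: derivative_eq_intros)
    then show ?thesis using Cinf_at_linear[OF *] by (simp add: linear_cmul has_field_derivative_def mult.commute[of _ "fderiv _ _ _"])
  qed
  from MVT2[of 0 h, OF h(1) this] obtain b where b: "0 < b" "b < h"
    "fderiv f (x + a *\<^sub>R v + h *\<^sub>R w) v - fderiv f (x + a *\<^sub>R v) v
      = h * fderiv (\<lambda>y. fderiv f y v) (x + a *\<^sub>R v + b *\<^sub>R w) w"
    by auto
  show ?thesis using a b near[of a b]
    by (intro exI[of _ "x + a *\<^sub>R v + b *\<^sub>R w"]) (auto simp: algebra_simps)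
qed

text \<open>The second difference does not depend on the order of the two directions, so the two
  iterated derivatives take equal values at two points arbitrarily close to \<open>x\<close>;
  continuity then excludes different values at \<open>x\<close>.\<close>

lemma second_fderiv_symmetric_real:
  fixes f :: "'v::real_normed_vector \<Rightarrow> real"
  assumes "Cinf_at f x"
  shows "fderiv (\<lambda>y. fderiv f y v) x w = fderiv (\<lambda>y. fderiv f y w) x v"
proof (rule ccontr)
  let ?F = "\<lambda>y. fderiv (\<lambda>y. fderiv f y v) y w" and ?G = "\<lambda>y. fderiv (\<lambda>y. fderiv f y w) y v"
  define e where "e = \<bar>?F x - ?G x\<bar> / 2"
  assume "?F x \<noteq> ?G x"
  then have "e > 0" by (simp add: e_def)
  have "isCont ?F x" "isCont ?G x"
    using assms by (auto intro!: Cinf_at_isCont Cinf_at_fderiv)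
  then obtain d1 d2 where d: "d1 > 0" "d2 > 0" "\<And>y. dist y x < d1 \<Longrightarrow> dist (?F y) (?F x) < e"
      "\<And>y. dist y x < d2 \<Longrightarrow> dist (?G y) (?G x) < e"
    using \<open>e > 0\<close> unfolding continuous_at_eps_delta by metis
  obtain d3 where d3: "d3 > 0" "\<And>y. dist y x < d3 \<Longrightarrow> Cinf_at f y"
    using Cinf_at_eventually[OF assms] unfolding eventually_nhds_metric by blast
  define m where "m = min d1 (min d2 d3)"
  \<comment> \<open>The step is so small that the parallelogram spanned by \<open>h v\<close> and
    \<open>h w\<close> stays where \<open>f\<close> is smooth and both derivatives are within
    \<open>e\<close> of their values at \<open>x\<close>; the summand 1 covers the case that both
    directions are 0.\<close>
  define h where "h = m / (2 * (norm v + norm w + 1))"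
  have m: "m > 0" using d d3 by (simp add: m_def)
  have n: "norm v + norm w + 1 > 0" by (simp add: add_nonneg_pos)
  have h: "h > 0" using m n by (simp add: h_def)
  have "h * (norm v + norm w) \<le> h * (norm v + norm w + 1)" using h by (intro mult_left_mono) auto
  also have "\<dots> = m / 2" using n by (simp add: h_def field_simps)
  also have "\<dots> < m" using m by simp
  finally have hm: "h * (norm v + norm w) < m" .
  have sm: "Cinf_at f y" if "dist x y < m" for y using that d3 by (simp add: m_def dist_commute)
  obtain p where p: "dist x p \<le> h * (norm v + norm w)"
    "f (x + h *\<^sub>R v + h *\<^sub>R w) - f (x + h *\<^sub>R v) - f (x + h *\<^sub>R w) + f x = h * (h * ?F p)"
    using second_difference_mean_value[OF sm h hm] by blast
  obtain q where q: "dist x q \<le> h * (norm w + norm v)"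
    "f (x + h *\<^sub>R w + h *\<^sub>R v) - f (x + h *\<^sub>R w) - f (x + h *\<^sub>R v) + f x = h * (h * ?G q)"
    using second_difference_mean_value[OF sm h, where v=w and w=v] hm by (auto simp: add.commute)
  have "h * (h * ?F p) = h * (h * ?G q)"
    unfolding p(2)[symmetric] q(2)[symmetric] by (simp add: add.assoc add.commute[of "h *\<^sub>R w"])
  then have "?F p = ?G q" using h by simp
  moreover have "dist (?F p) (?F x) < e" "dist (?G q) (?G x) < e"
    using p(1) q(1) hm by (auto intro!: d simp: m_def dist_commute add.commute)
  ultimately have "\<bar>?F x - ?G x\<bar> < 2 * e" by (simp add: dist_real_def)
  then show False by (simp add: e_def)
qed

text \<open>Inner products with an arbitrary vector reduce the claim to real functions.\<close>

lemma second_fderiv_symmetric: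
  fixes f :: "'v::real_normed_vector \<Rightarrow> 'w::real_inner"
  assumes "Cinf_at f x"
  shows "fderiv (\<lambda>y. fderiv f y v) x w = fderiv (\<lambda>y. fderiv f y w) x v"
proof -
  have inner: "fderiv (\<lambda>y. g y \<bullet> c) z u = fderiv g z u \<bullet> c" if "Cinf_at g z"
    for g :: "'v \<Rightarrow> 'w" and c u z
    using fderiv_eq[OF bounded_linear.has_derivative[OF bounded_linear_inner_left[of c] Cinf_at_has_derivative[OF that]]]
    by simp
  have "fderiv (\<lambda>y. fderiv f y a) x b \<bullet> c = fderiv (\<lambda>y. fderiv (\<lambda>z. f z \<bullet> c) y a) x b" for a b c
  proof -
    have "fderiv (\<lambda>y. fderiv f y a) x b \<bullet> c = fderiv (\<lambda>y. fderiv f y a \<bullet> c) x b"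
      using inner Cinf_at_fderiv[OF assms] by metis
    also have "\<dots> = fderiv (\<lambda>y. fderiv (\<lambda>z. f z \<bullet> c) y a) x b"
    proof (rule fun_cong[OF fderiv_cong_ev(1)])
      show "\<forall>\<^sub>F y in nhds x. fderiv f y a \<bullet> c = fderiv (\<lambda>z. f z \<bullet> c) y a"
        using Cinf_at_eventually[OF assms] by eventually_elim (simp add: inner)
    qed
    finally show ?thesis .
  qed
  then have "fderiv (\<lambda>y. fderiv f y v) x w \<bullet> c = fderiv (\<lambda>y. fderiv f y w) x v \<bullet> c" for c
    using second_fderiv_symmetric_real[of "\<lambda>z. f z \<bullet> c" x v w] Cinf_at_inner[OF assms Cinf_at_const[of c]] by metis
  then show ?thesis using vector_eq_rdot by blast
qed

section \<open>Smooth dependence of solutions of positive definite systems\<close>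

text \<open>One Gram--Schmidt step per basis vector: the vector \<open>e\<close> below is \<open>G\<close>-orthogonal to the span
  treated so far, so that the solution is corrected by a multiple of \<open>e\<close>.\<close>

lemma smooth_linear_solution_on:
  fixes G :: "'z::real_normed_vector \<Rightarrow> 'f::euclidean_space \<Rightarrow> 'f \<Rightarrow> real"
  assumes S: "open S"
    and bil: "\<And>z. z \<in> S \<Longrightarrow> bilinear (G z)"
    and sym: "\<And>z u w. z \<in> S \<Longrightarrow> G z u w = G z w u"
    and pos: "\<And>z u. z \<in> S \<Longrightarrow> u \<noteq> 0 \<Longrightarrow> G z u u > 0"
    and sm: "\<And>z u w. z \<in> S \<Longrightarrow> Cinf_at (\<lambda>z. G z u w) z"
    and "F \<subseteq> Basis"
    and "\<And>z w. z \<in> S \<Longrightarrow> w \<in> F \<Longrightarrow> Cinf_at (\<lambda>z. r z w) z"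
  shows "\<exists>s. \<forall>z\<in>S. Cinf_at s z \<and> s z \<in> span F \<and> (\<forall>w\<in>F. G z (s z) w = r z w)"
proof -
  have smG: "Cinf_at (\<lambda>z. G z (s z) w) z" if "z \<in> S" "\<And>z. z \<in> S \<Longrightarrow> Cinf_at s z" for s w z
  proof -
    have "\<forall>\<^sub>F z in nhds z. z \<in> S" using S that by (rule_tac eventually_nhds_in_open)
    then have "\<forall>\<^sub>F z in nhds z. G z (s z) w = (\<Sum>b\<in>Basis. (s z \<bullet> b) *\<^sub>R G z b w)"
      by eventually_elim (rule linear_reproducing[OF reproducing_Basis], use bil in \<open>auto simp: bilinear_def\<close>)
    moreover have "Cinf_at (\<lambda>z. \<Sum>b\<in>Basis. (s z \<bullet> b) *\<^sub>R G z b w) z"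
      using that sm by (intro Cinf_at_sum Cinf_at_scaleR Cinf_at_inner) auto
    ultimately show ?thesis by (rule Cinf_at_transform)
  qed
  have "finite F" using assms(6) finite_Basis finite_subset by blast
  then show ?thesis using assms(6,7)
  proof (induction F arbitrary: r)
    case empty
    show ?case by (intro exI[of _ "\<lambda>_. 0"]) auto
  next
    case (insert a F)
    \<comment> \<open>\<open>p z\<close> is the \<open>G z\<close>-orthogonal projection of
      \<open>a\<close> onto \<open>span F\<close>: the induction hypothesis is used with
      \<open>G z a\<close> as right-hand side.\<close>
    have "\<exists>p. \<forall>z\<in>S. Cinf_at p z \<and> p z \<in> span F \<and> (\<forall>w\<in>F. G z (p z) w = G z a w)"
      using insert.IH[of "\<lambda>z w. G z a w"] insert.prems(1) sm by simp
    then obtain p where p: "\<And>z. z \<in> S \<Longrightarrow> Cinf_at p z" "\<And>z. z \<in> S \<Longrightarrow> p z \<in> span F"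
        "\<And>z w. z \<in> S \<Longrightarrow> w \<in> F \<Longrightarrow> G z (p z) w = G z a w"
      by metis
    have "\<exists>s. \<forall>z\<in>S. Cinf_at s z \<and> s z \<in> span F \<and> (\<forall>w\<in>F. G z (s z) w = r z w)"
      using insert.IH[of r] insert.prems by simp
    then obtain s0 where s0: "\<And>z. z \<in> S \<Longrightarrow> Cinf_at s0 z" "\<And>z. z \<in> S \<Longrightarrow> s0 z \<in> span F"
        "\<And>z w. z \<in> S \<Longrightarrow> w \<in> F \<Longrightarrow> G z (s0 z) w = r z w"
      by metis
    define e where "e z = a - p z" for z
    define c where "c z = (r z a - G z (s0 z) a) / G z (e z) a" for z
    have a: "a \<notin> span F"
    proof -
      have "independent (insert a F)" using independent_Basis insert.prems(1) independent_mono by blast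
      then show ?thesis using insert.hyps(2) by (simp add: independent_insert)
    qed
    have eF: "G z (e z) w = 0" if "z \<in> S" "w \<in> F" for z w
      using p(3)[OF that] bilinear_lsub[OF bil[OF that(1)]] by (simp add: e_def)
    have eSp: "G z (e z) w = 0" if "z \<in> S" "w \<in> span F" for z w
    proof -
      have "linear (G z (e z))" using bil[OF that(1)] by (simp add: bilinear_def)
      from linear_eq_0_on_span[OF this _ that(2)] eF[OF that(1)] show ?thesis by blast
    qed
    \<comment> \<open>\<open>p z\<close> lies in \<open>span F\<close>, to which \<open>e z\<close>
      is orthogonal, so \<open>G z (e z) a\<close> equals \<open>G z (e z) (e z)\<close>, and this
      is positive because \<open>a\<close> is not in \<open>span F\<close>. It is the denominator of
      the correction coefficient \<open>c z\<close>.\<close>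
    have nz: "G z (e z) a \<noteq> 0" if "z \<in> S" for z
    proof -
      have "e z \<noteq> 0" using p(2)[OF that] a by (auto simp: e_def)
      then have "G z (e z) (e z) > 0" using pos that by blast
      moreover have "G z (e z) (e z) = G z (e z) a - G z (e z) (p z)"
        using bilinear_rsub[OF bil[OF that]] by (simp add: e_def)
      ultimately show ?thesis using eSp[OF that p(2)[OF that]] by simp
    qed
    have sme: "Cinf_at e z" if "z \<in> S" for z unfolding e_def using p(1)[OF that] by (intro Cinf_at_diff) auto
    have smc: "Cinf_at c z" if "z \<in> S" for z
      unfolding c_def using insert.prems(2)[OF that] nz[OF that] sme s0(1) that
      by (intro Cinf_at_divide Cinf_at_diff smG) auto
    show ?case
    proof (intro exI[of _ "\<lambda>z. s0 z + c z *\<^sub>R e z"] ballI conjI)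
      fix z assume z: "z \<in> S"
      show "Cinf_at (\<lambda>z. s0 z + c z *\<^sub>R e z) z" using s0(1) smc sme z by (intro Cinf_at_add Cinf_at_scaleR) auto
      have "p z \<in> span (insert a F)" "s0 z \<in> span (insert a F)" "a \<in> span (insert a F)"
        using p(2)[OF z] s0(2)[OF z] span_mono[of F "insert a F"] by (auto intro: span_base)
      then show "s0 z + c z *\<^sub>R e z \<in> span (insert a F)"
        unfolding e_def by (intro span_add span_scale span_diff)
      fix w assume w: "w \<in> insert a F"
      have "G z (s0 z + c z *\<^sub>R e z) w = G z (s0 z) w + c z * G z (e z) w"
        using bil[OF z] by (simp add: bilinear_ladd bilinear_lmul)
      also have "\<dots> = r z w"
        using w eF[OF z] s0(3)[OF z] nz[OF z] by (cases "w = a") (auto simp: c_def)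
      finally show "G z (s0 z + c z *\<^sub>R e z) w = r z w" .
    qed
  qed
qed

lemma smooth_linear_solution:
  fixes G :: "'z::real_normed_vector \<Rightarrow> 'f::euclidean_space \<Rightarrow> 'f \<Rightarrow> real"
  assumes "open S" "\<And>z. z \<in> S \<Longrightarrow> bilinear (G z)"
    "\<And>z u w. z \<in> S \<Longrightarrow> G z u w = G z w u"
    "\<And>z u. z \<in> S \<Longrightarrow> u \<noteq> 0 \<Longrightarrow> G z u u > 0"
    "\<And>z u w. z \<in> S \<Longrightarrow> Cinf_at (\<lambda>z. G z u w) z"
    and r: "\<And>z w. z \<in> S \<Longrightarrow> w \<in> Basis \<Longrightarrow> Cinf_at (\<lambda>z. r z w) z" "\<And>z. z \<in> S \<Longrightarrow> linear (r z)"
  obtains s where "\<And>z. z \<in> S \<Longrightarrow> Cinf_at s z" "\<And>z w. z \<in> S \<Longrightarrow> G z (s z) w = r z w"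
proof -
  obtain s where s: "\<And>z. z \<in> S \<Longrightarrow> Cinf_at s z" "\<And>z w. z \<in> S \<Longrightarrow> w \<in> Basis \<Longrightarrow> G z (s z) w = r z w"
    using smooth_linear_solution_on[OF assms(1-5) order_refl, of r] r(1) by blast
  have "G z (s z) w = r z w" if "z \<in> S" for z w
    using linear_eq_stdbasis[of "G z (s z)" "r z"] s(2) that r(2) assms(2) by (auto simp: bilinear_def)
  then show ?thesis using that s(1) by blast
qed

section \<open>Calculus on manifolds\<close>

lemma chart_chart_inv:
  "z \<in> snd c ` fst c \<Longrightarrow> snd c (chart_inv c z) = z" "z \<in> snd c ` fst c \<Longrightarrow> chart_inv c z \<in> fst c"
  unfolding chart_inv_def by (auto intro: f_inv_into_f inv_into_into)

lemma continuous_on_open_nhds: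
  "open S \<Longrightarrow> continuous_on S f \<longleftrightarrow> (\<forall>x\<in>S. filterlim f (nhds (f x)) (nhds x))"
  unfolding continuous_on_def by (metis at_within_open tendsto_at_iff_tendsto_nhds)

section \<open>Smooth functions at a point of a manifold\<close>

definition smooth_at ::
  "('p, 'v::real_normed_vector) chart set \<Rightarrow> ('p \<Rightarrow> 'w::real_normed_vector) \<Rightarrow> 'p \<Rightarrow> bool" where
  "smooth_at At f p \<longleftrightarrow> (\<exists>c\<in>At. p \<in> fst c \<and> Cinf_at (\<lambda>z. f (chart_inv c z)) (snd c p))"

locale smooth_manifold =
  fixes At :: "('p::topological_space, 'v::real_inner) chart set"
  assumes atlas: "smooth_atlas At"
    and model: "\<exists>B::'v set. reproducing B"
begin

lemma chart_open: "c \<in> At \<Longrightarrow> open (fst c)" "c \<in> At \<Longrightarrow> open (snd c ` fst c)"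
  and chart_homeo: "c \<in> At \<Longrightarrow> homeomorphism (fst c) (snd c ` fst c) (snd c) (chart_inv c)"
  and ex_chart: "\<exists>c\<in>At. p \<in> fst c"
  using atlas unfolding smooth_atlas_def by auto

lemma chart_inv_chart: "c \<in> At \<Longrightarrow> p \<in> fst c \<Longrightarrow> chart_inv c (snd c p) = p"
  using chart_homeo by (simp add: homeomorphism_def)

text \<open>A chart is a homeomorphism between open sets, so it identifies the neighbourhood filter
  of a point with that of its coordinates. By this bridge germs on the manifold become germs in the
  model space.\<close>

lemma eventually_chart:
  assumes "c \<in> At" "p \<in> fst c"
  shows "(\<forall>\<^sub>F z in nhds (snd c p). P (chart_inv c z)) \<longleftrightarrow> (\<forall>\<^sub>F q in nhds p. P q)"
proof
  note h = chart_homeo[OF assms(1), unfolded homeomorphism_def]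
  have t: "filterlim (snd c) (nhds (snd c p)) (nhds p)" "filterlim (chart_inv c) (nhds p) (nhds (snd c p))"
    using h assms(2) continuous_on_open_nhds[OF chart_open(1)[OF assms(1)], of "snd c"]
      continuous_on_open_nhds[OF chart_open(2)[OF assms(1)], of "chart_inv c"] chart_inv_chart[OF assms]
    by auto
  {
    assume "\<forall>\<^sub>F z in nhds (snd c p). P (chart_inv c z)"
    then have "\<forall>\<^sub>F q in nhds p. P (chart_inv c (snd c q))" using t(1) by (auto simp: filterlim_iff)
    moreover have "\<forall>\<^sub>F q in nhds p. q \<in> fst c" using chart_open[OF assms(1)] assms(2) by (intro eventually_nhds_in_open)
    ultimately show "\<forall>\<^sub>F q in nhds p. P q"
      by eventually_elim (simp add: chart_inv_chart[OF assms(1)])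
  next
    assume "\<forall>\<^sub>F q in nhds p. P q"
    then show "\<forall>\<^sub>F z in nhds (snd c p). P (chart_inv c z)" using t(2) by (auto simp: filterlim_iff)
  }
qed

lemma eventually_in_chart: "c \<in> At \<Longrightarrow> p \<in> fst c \<Longrightarrow> \<forall>\<^sub>F q in nhds p. q \<in> fst c"
  using chart_open by (intro eventually_nhds_in_open)

lemma eventually_in_chart_image:
  "c \<in> At \<Longrightarrow> p \<in> fst c \<Longrightarrow> \<forall>\<^sub>F z in nhds (snd c p). z \<in> snd c ` fst c"
  using chart_open by (intro eventually_nhds_in_open) auto

lemma open_chart_image:
  assumes "c \<in> At" "open W" "W \<subseteq> fst c" shows "open (snd c ` W)"
proof -
  have "snd c ` W = snd c ` fst c \<inter> chart_inv c -` W"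
    using assms chart_inv_chart[OF assms(1)] chart_chart_inv by fastforce
  then show ?thesis
    using continuous_on_open_vimage[OF chart_open(2)[OF assms(1)]] chart_homeo[OF assms(1)] assms(2)
    by (metis homeomorphism_def Int_commute)
qed

lemma Cinf_at_transition:
  assumes "c \<in> At" "d \<in> At" "p \<in> fst c" "p \<in> fst d"
  shows "Cinf_at (\<lambda>z. snd d (chart_inv c z)) (snd c p)"
proof -
  have "Cinf_on (snd d \<circ> chart_inv c) (snd c ` (fst c \<inter> fst d))"
    using atlas assms unfolding smooth_atlas_def by blast
  moreover have "open (snd c ` (fst c \<inter> fst d))"
    using assms chart_open by (intro open_chart_image open_Int) blast+
  ultimately show ?thesis using assms unfolding Cinf_at_def comp_def by blast
qed

lemma transition_eventually:
  assumes "c \<in> At" "d \<in> At" "p \<in> fst c" "p \<in> fst d"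
  shows "\<forall>\<^sub>F z in nhds (snd c p). f (chart_inv c z) = f (chart_inv d (snd d (chart_inv c z)))"
proof -
  have "\<forall>\<^sub>F z in nhds (snd c p). chart_inv c z \<in> fst d"
    using eventually_in_chart[OF assms(2,4)] by (simp add: eventually_chart[OF assms(1,3), of "\<lambda>q. q \<in> fst d"])
  then show ?thesis by eventually_elim (simp add: chart_inv_chart[OF assms(2)])
qed

lemma smooth_at_chart:
  assumes "c \<in> At" "p \<in> fst c"
  shows "smooth_at At f p \<longleftrightarrow> Cinf_at (\<lambda>z. f (chart_inv c z)) (snd c p)"
proof
  assume "smooth_at At f p"
  then obtain d where d: "d \<in> At" "p \<in> fst d" "Cinf_at (\<lambda>z. f (chart_inv d z)) (snd d p)"
    by (auto simp: smooth_at_def)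
  have "Cinf_at (\<lambda>z. f (chart_inv d (snd d (chart_inv c z)))) (snd c p)"
    by (rule Cinf_at_compose[OF model, of "\<lambda>z. f (chart_inv d z)" "\<lambda>z. snd d (chart_inv c z)"])
      (simp_all add: d chart_inv_chart Cinf_at_transition assms)
  then show "Cinf_at (\<lambda>z. f (chart_inv c z)) (snd c p)"
    by (rule Cinf_at_transform[OF transition_eventually[OF assms(1) d(1) assms(2) d(2), where f = f]])
qed (use assms in \<open>auto simp: smooth_at_def\<close>)

lemma smooth_at_transform:
  assumes "\<forall>\<^sub>F q in nhds p. f q = g q" "smooth_at At g p" shows "smooth_at At f p"
proof -
  obtain c where c: "c \<in> At" "p \<in> fst c" using ex_chart by blast
  have "\<forall>\<^sub>F z in nhds (snd c p). f (chart_inv c z) = g (chart_inv c z)"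
    using assms(1) by (simp add: eventually_chart[OF c, of "\<lambda>q. f q = g q"])
  then show ?thesis using assms(2) unfolding smooth_at_chart[OF c] by (rule Cinf_at_transform)
qed

lemma smooth_at_eventually: assumes "smooth_at At f p" shows "\<forall>\<^sub>F q in nhds p. smooth_at At f q"
proof -
  obtain c where c: "c \<in> At" "p \<in> fst c" using ex_chart by blast
  have "\<forall>\<^sub>F z in nhds (snd c p). Cinf_at (\<lambda>z. f (chart_inv c z)) z"
    using assms Cinf_at_eventually unfolding smooth_at_chart[OF c] by blast
  with eventually_in_chart_image[OF c] have "\<forall>\<^sub>F z in nhds (snd c p). smooth_at At f (chart_inv c z)"
    by eventually_elim (simp add: smooth_at_chart[OF c(1)] chart_chart_inv)
  then show ?thesis by (simp add: eventually_chart[OF c, of "smooth_at At f"])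
qed

lemma smooth_at_lift2:
  assumes "\<And>F G z. Cinf_at F z \<Longrightarrow> Cinf_at G z \<Longrightarrow> Cinf_at (\<lambda>x::'v. h (F x) (G x)) z"
    "smooth_at At f p" "smooth_at At g p"
  shows "smooth_at At (\<lambda>q. h (f q) (g q)) p"
proof -
  obtain c where c: "c \<in> At" "p \<in> fst c" using ex_chart by blast
  show ?thesis unfolding smooth_at_chart[OF c]
    by (rule assms(1)) (use assms(2,3) in \<open>simp_all add: smooth_at_chart[OF c]\<close>)
qed

lemma smooth_at_const [simp, intro]: "smooth_at At (\<lambda>_. k) p"
  using ex_chart[of p] by (auto simp: smooth_at_def)

lemma smooth_at_add [intro]: "smooth_at At f p \<Longrightarrow> smooth_at At g p \<Longrightarrow> smooth_at At (\<lambda>q. f q + g q) p"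
  by (rule smooth_at_lift2[of "(+)"]) auto

lemma smooth_at_diff [intro]: "smooth_at At f p \<Longrightarrow> smooth_at At g p \<Longrightarrow> smooth_at At (\<lambda>q. f q - g q) p"
  by (rule smooth_at_lift2[of "(-)"]) auto

lemma smooth_at_scaleR [intro]: "smooth_at At f p \<Longrightarrow> smooth_at At g p \<Longrightarrow> smooth_at At (\<lambda>q. f q *\<^sub>R g q) p"
  by (rule smooth_at_lift2[of "(*\<^sub>R)"]) auto

lemma smooth_at_mult [intro]:
  "smooth_at At f p \<Longrightarrow> smooth_at At g p \<Longrightarrow> smooth_at At (\<lambda>q. f q * g q :: real) p"
  by (rule smooth_at_lift2[of "(*)"]) auto

lemma smooth_at_inner [intro]: "smooth_at At f p \<Longrightarrow> smooth_at At g p \<Longrightarrow> smooth_at At (\<lambda>q. f q \<bullet> g q) p"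
  by (rule smooth_at_lift2[of "(\<bullet>)"]) auto

lemma smooth_at_Pair [intro]: "smooth_at At f p \<Longrightarrow> smooth_at At g p \<Longrightarrow> smooth_at At (\<lambda>q. (f q, g q)) p"
  by (rule smooth_at_lift2[of Pair]) auto

lemma smooth_at_bounded_linear: "bounded_linear L \<Longrightarrow> smooth_at At f p \<Longrightarrow> smooth_at At (\<lambda>q. L (f q)) p"
  by (rule smooth_at_lift2[of "\<lambda>a _. L a" f p f]) (auto intro: Cinf_at_bounded_linear)

lemmas smooth_at_fst [intro] = smooth_at_bounded_linear[OF bounded_linear_fst]
lemmas smooth_at_snd [intro] = smooth_at_bounded_linear[OF bounded_linear_snd]

lemma smooth_at_sum [intro]:
  "(\<And>i. i \<in> I \<Longrightarrow> smooth_at At (f i) p) \<Longrightarrow> smooth_at At (\<lambda>q. \<Sum>i\<in>I. f i q) p"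
  by (induction I rule: infinite_finite_induct) auto

lemma smooth_at_compose:
  assumes "\<exists>B::'w set. reproducing B" "Cinf_at g (f p)" "smooth_at At (f :: 'p \<Rightarrow> 'w::real_inner) p"
  shows "smooth_at At (\<lambda>q. g (f q)) p"
proof -
  obtain c where c: "c \<in> At" "p \<in> fst c" using ex_chart by blast
  show ?thesis using assms Cinf_at_compose[OF assms(1), of g "\<lambda>z. f (chart_inv c z)"] chart_inv_chart[OF c]
    unfolding smooth_at_chart[OF c] by auto
qed

lemma smooth_at_chart_map: "d \<in> At \<Longrightarrow> p \<in> fst d \<Longrightarrow> smooth_at At (snd d) p"
  by (simp add: smooth_at_chart Cinf_at_transition)

lemma smooth_at_tendsto: assumes "smooth_at At f p" shows "(f \<longlongrightarrow> f p) (nhds p)"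
proof -
  obtain c where c: "c \<in> At" "p \<in> fst c" using ex_chart by blast
  have "isCont (\<lambda>z. f (chart_inv c z)) (snd c p)"
    using assms Cinf_at_isCont unfolding smooth_at_chart[OF c] by blast
  then have "((\<lambda>z. f (chart_inv c z)) \<longlongrightarrow> f p) (nhds (snd c p))"
    using chart_inv_chart[OF c] tendsto_at_iff_tendsto_nhds[of "\<lambda>z. f (chart_inv c z)" "snd c p"]
    by (simp add: isCont_def)
  then show ?thesis
    unfolding filterlim_iff using eventually_chart[OF c, of "\<lambda>q. P (f q)" for P] by simp
qed

lemma smooth_fun_iff: assumes "open W" shows "smooth_fun At W f \<longleftrightarrow> (\<forall>p\<in>W. smooth_at At f p)"
proof -
  have o: "open (snd c ` (fst c \<inter> W))" if "c \<in> At" for c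
    using assms that chart_open by (intro open_chart_image open_Int) blast+
  have eq: "(\<forall>c\<in>At. Cinf_on (\<lambda>z. f (chart_inv c z)) (snd c ` (fst c \<inter> W))) \<longleftrightarrow> (\<forall>p\<in>W. smooth_at At f p)"
  proof
    assume *: "\<forall>c\<in>At. Cinf_on (\<lambda>z. f (chart_inv c z)) (snd c ` (fst c \<inter> W))"
    show "\<forall>p\<in>W. smooth_at At f p"
    proof
      fix p assume "p \<in> W"
      obtain c where c: "c \<in> At" "p \<in> fst c" using ex_chart by blast
      then show "smooth_at At f p"
        using * o[OF c(1)] \<open>p \<in> W\<close> by (auto simp: smooth_at_chart Cinf_on_iff_at)
    qed
  next
    assume *: "\<forall>p\<in>W. smooth_at At f p"
    show "\<forall>c\<in>At. Cinf_on (\<lambda>z. f (chart_inv c z)) (snd c ` (fst c \<inter> W))"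
    proof
      fix c assume c: "c \<in> At"
      show "Cinf_on (\<lambda>z. f (chart_inv c z)) (snd c ` (fst c \<inter> W))"
        using * smooth_at_chart[OF c] by (auto simp: Cinf_on_iff_at[OF o[OF c]])
    qed
  qed
  have cont: "continuous_on W f" if "\<forall>p\<in>W. smooth_at At f p"
  proof -
    show ?thesis unfolding continuous_on_open_nhds[OF assms] using smooth_at_tendsto that by blast
  qed
  show ?thesis unfolding smooth_fun_def smooth_map_def using eq cont by (auto simp: comp_def)
qed

lemma smooth_map_iff:
  assumes "open W" "\<And>d. d \<in> Bt \<Longrightarrow> open (fst d)"
  shows "smooth_map At Bt W f \<longleftrightarrow>
    continuous_on W f \<and> (\<forall>p\<in>W. \<forall>d\<in>Bt. f p \<in> fst d \<longrightarrow> smooth_at At (\<lambda>q. snd d (f q)) p)"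
proof (cases "continuous_on W f")
  case True
  have o: "open (W \<inter> f -` fst d)" if "d \<in> Bt" for d
    using continuous_on_open_vimage[OF assms(1)] True assms(2)[OF that] by (metis Int_commute)
  have o2: "open (snd c ` (fst c \<inter> W \<inter> f -` fst d))" if "c \<in> At" "d \<in> Bt" for c d
    using o[OF that(2)] chart_open[OF that(1)] that by (intro open_chart_image) (auto simp: Int_assoc)
  have "Cinf_on (snd d \<circ> f \<circ> chart_inv c) (snd c ` (fst c \<inter> W \<inter> f -` fst d)) \<longleftrightarrow>
    (\<forall>p\<in>fst c \<inter> W \<inter> f -` fst d. smooth_at At (\<lambda>q. snd d (f q)) p)" if "c \<in> At" "d \<in> Bt" for c d
    using smooth_at_chart[OF that(1)] by (auto simp: Cinf_on_iff_at[OF o2[OF that]] comp_def)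
  then have "smooth_map At Bt W f \<longleftrightarrow>
      (\<forall>c\<in>At. \<forall>d\<in>Bt. \<forall>p\<in>fst c \<inter> W \<inter> f -` fst d. smooth_at At (\<lambda>q. snd d (f q)) p)"
    unfolding smooth_map_def using True by simp
  also have "\<dots> \<longleftrightarrow> (\<forall>p\<in>W. \<forall>d\<in>Bt. f p \<in> fst d \<longrightarrow> smooth_at At (\<lambda>q. snd d (f q)) p)"
    using ex_chart by blast
  finally show ?thesis using True by blast
qed (simp add: smooth_map_def)

subsection \<open>Tangent vectors\<close>

lemma tangent_transition:
  "v \<in> tangent_space At p \<Longrightarrow> c \<in> At \<Longrightarrow> d \<in> At \<Longrightarrow> p \<in> fst c \<Longrightarrow> p \<in> fst d \<Longrightarrow>
    v d = fderiv (\<lambda>z. snd d (chart_inv c z)) (snd c p) (v c)"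
  unfolding tangent_space_def comp_def mem_Collect_eq by blast

lemma fderiv_transition:
  assumes "c \<in> At" "d \<in> At" "p \<in> fst c" "p \<in> fst d" "smooth_at At f p"
  shows "fderiv (\<lambda>z. f (chart_inv c z)) (snd c p) v
    = fderiv (\<lambda>z. f (chart_inv d z)) (snd d p) (fderiv (\<lambda>z. snd d (chart_inv c z)) (snd c p) v)"
proof -
  have "((\<lambda>z. f (chart_inv d (snd d (chart_inv c z)))) has_derivative
      (\<lambda>v. fderiv (\<lambda>z. f (chart_inv d z)) (snd d p) (fderiv (\<lambda>z. snd d (chart_inv c z)) (snd c p) v))) (at (snd c p))"
  proof (rule has_derivative_compose[where g = "\<lambda>z. f (chart_inv d z)"])
    show "((\<lambda>z. snd d (chart_inv c z)) has_derivative fderiv (\<lambda>z. snd d (chart_inv c z)) (snd c p)) (at (snd c p))"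
      using assms by (intro Cinf_at_has_derivative Cinf_at_transition)
    show "((\<lambda>z. f (chart_inv d z)) has_derivative fderiv (\<lambda>z. f (chart_inv d z)) (snd d p)) (at (snd d (chart_inv c (snd c p))))"
      unfolding chart_inv_chart[OF assms(1,3)]
      using assms(5) by (intro Cinf_at_has_derivative) (simp add: smooth_at_chart[OF assms(2,4)])
  qed
  from fderiv_eq[OF this] show ?thesis
    unfolding fderiv_cong_ev(1)[OF transition_eventually[OF assms(1-4), of f]] by simp
qed

text \<open>\<open>deriv_along\<close> computes in a chart picked by choice. The transition law
  between the representatives of a tangent vector is exactly what the chain rule asks for, so any
  chart around the point gives the same value.\<close>

lemma deriv_along_chart:
  assumes "v \<in> tangent_space At p" "c \<in> At" "p \<in> fst c" "smooth_at At f p"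
  shows "deriv_along At p v f = fderiv (\<lambda>z. f (chart_inv c z)) (snd c p) (v c)"
proof -
  define e where "e = (SOME c. c \<in> At \<and> p \<in> fst c)"
  have "e \<in> At \<and> p \<in> fst e" unfolding e_def
    using ex_chart[of p] by (intro someI_ex[of "\<lambda>c. c \<in> At \<and> p \<in> fst c"]) blast
  then have e: "e \<in> At" "p \<in> fst e" by auto
  have "deriv_along At p v f = fderiv (\<lambda>z. f (chart_inv e z)) (snd e p) (v e)"
    by (simp add: deriv_along_def e_def comp_def Let_def)
  then show ?thesis
    using fderiv_transition[OF assms(2) e(1) assms(3) e(2) assms(4)]
      tangent_transition[OF assms(1,2) e(1) assms(3) e(2)] by simp
qed

lemma deriv_along_eventually:
  assumes "\<forall>\<^sub>F q in nhds p. f q = g q" shows "deriv_along At p v f = deriv_along At p v g"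
proof -
  define e where "e = (SOME c. c \<in> At \<and> p \<in> fst c)"
  have "e \<in> At \<and> p \<in> fst e" unfolding e_def
    using ex_chart[of p] by (intro someI_ex[of "\<lambda>c. c \<in> At \<and> p \<in> fst c"]) blast
  then have e: "e \<in> At" "p \<in> fst e" by auto
  have "\<forall>\<^sub>F z in nhds (snd e p). (f \<circ> chart_inv e) z = (g \<circ> chart_inv e) z"
    using assms by (simp add: eventually_chart[OF e, of "\<lambda>q. f q = g q"])
  then show ?thesis
    unfolding deriv_along_def e_def[symmetric] Let_def by (simp only: fderiv_cong_ev(1))
qed

lemma tangent_outside: "v \<in> tangent_space At p \<Longrightarrow> d \<notin> At \<or> p \<notin> fst d \<Longrightarrow> v d = 0"
  by (auto simp add: tangent_space_def simp del: split_paired_All)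

lemma tangent_ext:
  assumes "v \<in> tangent_space At p" "w \<in> tangent_space At p" "c \<in> At" "p \<in> fst c" "v c = w c"
  shows "v = w"
proof
  fix d
  show "v d = w d"
  proof (cases "d \<in> At \<and> p \<in> fst d")
    case True
    then show ?thesis
      using tangent_transition[OF assms(1,3) _ assms(4), of d] tangent_transition[OF assms(2,3) _ assms(4), of d] assms(5)
      by simp
  next
    case False
    then show ?thesis using tangent_outside[OF assms(1)] tangent_outside[OF assms(2)] by simp
  qed
qed

lemma deriv_along_chart_map:
  assumes "v \<in> tangent_space At p" "d \<in> At" "p \<in> fst d"
  shows "deriv_along At p v (snd d) = v d"
proof -
  obtain c where c: "c \<in> At" "p \<in> fst c" using ex_chart by blast
  show ?thesis
    using deriv_along_chart[OF assms(1) c smooth_at_chart_map[OF assms(2,3)]]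
      tangent_transition[OF assms(1) c(1) assms(2) c(2) assms(3)] by simp
qed

text \<open>Compatibility of two arbitrary charts follows from the compatibility of each with the
  reference chart \<open>c\<close>, by the chain rule for transition maps.\<close>

lemma tangent_spaceI:
  assumes "\<And>d. d \<notin> At \<or> p \<notin> fst d \<Longrightarrow> v d = 0" "c \<in> At" "p \<in> fst c"
    "\<And>d. d \<in> At \<Longrightarrow> p \<in> fst d \<Longrightarrow> v d = fderiv (\<lambda>z. snd d (chart_inv c z)) (snd c p) (v c)"
  shows "v \<in> tangent_space At p"
  unfolding tangent_space_def comp_def
proof (intro CollectI conjI allI ballI impI)
  fix d e assume *: "d \<in> At" "e \<in> At" "p \<in> fst d \<and> p \<in> fst e"
  have "v e = fderiv (\<lambda>z. snd e (chart_inv c z)) (snd c p) (v c)" using assms(4) * by simp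
  also have "\<dots> = fderiv (\<lambda>z. snd e (chart_inv d z)) (snd d p) (fderiv (\<lambda>z. snd d (chart_inv c z)) (snd c p) (v c))"
    using * assms(2,3) by (intro fderiv_transition smooth_at_chart_map) auto
  also have "fderiv (\<lambda>z. snd d (chart_inv c z)) (snd c p) (v c) = v d" using assms(4)[of d] * by simp
  finally show "v e = fderiv (\<lambda>z. snd e (chart_inv d z)) (snd d p) (v d)" .
qed (use assms(1) in auto)

lemma coord_vector_chart:
  assumes "c \<in> At" "p \<in> fst c" shows "coord_vector At c p \<xi> c = \<xi>"
proof -
  have "\<forall>\<^sub>F z in nhds (snd c p). (snd c \<circ> chart_inv c) z = z"
    using eventually_in_chart_image[OF assms] by eventually_elim (simp add: chart_chart_inv)
  from fderiv_cong_ev(1)[OF this] have "fderiv (snd c \<circ> chart_inv c) (snd c p) = (\<lambda>z. z)"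
    unfolding comp_def by simp
  then show ?thesis using assms by (simp add: coord_vector_def)
qed

lemma coord_vector_tangent:
  assumes "c \<in> At" "p \<in> fst c" shows "coord_vector At c p \<xi> \<in> tangent_space At p"
  using coord_vector_chart[OF assms] assms
  by (intro tangent_spaceI[OF _ assms]) (auto simp: coord_vector_def comp_def)

lemma tangent_add:
  assumes "v \<in> tangent_space At p" "w \<in> tangent_space At p"
  shows "(\<lambda>d. v d + w d) \<in> tangent_space At p"
proof -
  obtain c where c: "c \<in> At" "p \<in> fst c" using ex_chart by blast
  show ?thesis
  proof (rule tangent_spaceI[OF _ c])
    fix d assume d: "d \<in> At" "p \<in> fst d"
    show "v d + w d = fderiv (\<lambda>z. snd d (chart_inv c z)) (snd c p) (v c + w c)"
      using tangent_transition[OF assms(1) c(1) d(1) c(2) d(2)] tangent_transition[OF assms(2) c(1) d(1) c(2) d(2)]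
        linear_add[OF Cinf_at_linear[OF Cinf_at_transition[OF c(1) d(1) c(2) d(2)]]] by simp
  qed (simp add: assms[THEN tangent_outside])
qed

lemma tangent_scale:
  assumes "v \<in> tangent_space At p"
  shows "(\<lambda>d. r *\<^sub>R v d) \<in> tangent_space At p"
proof -
  obtain c where c: "c \<in> At" "p \<in> fst c" using ex_chart by blast
  show ?thesis
  proof (rule tangent_spaceI[OF _ c])
    fix d assume d: "d \<in> At" "p \<in> fst d"
    show "r *\<^sub>R v d = fderiv (\<lambda>z. snd d (chart_inv c z)) (snd c p) (r *\<^sub>R v c)"
      using tangent_transition[OF assms c(1) d(1) c(2) d(2)]
        linear_cmul[OF Cinf_at_linear[OF Cinf_at_transition[OF c(1) d(1) c(2) d(2)]]] by simp
  qed (simp add: assms[THEN tangent_outside])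
qed

lemma tangent_zero: "(\<lambda>_. 0) \<in> tangent_space At p"
proof -
  obtain c where c: "c \<in> At" "p \<in> fst c" using ex_chart by blast
  have "coord_vector At c p 0 \<in> tangent_space At p" by (rule coord_vector_tangent[OF c])
  then show ?thesis using tangent_scale[of _ p 0] by force
qed

lemma deriv_along_add_vector:
  assumes "v \<in> tangent_space At p" "w \<in> tangent_space At p" "smooth_at At f p"
  shows "deriv_along At p (\<lambda>d. v d + w d) f = deriv_along At p v f + deriv_along At p w f"
proof -
  obtain c where c: "c \<in> At" "p \<in> fst c" using ex_chart by blast
  show ?thesis
    using linear_add[OF Cinf_at_linear[OF assms(3)[unfolded smooth_at_chart[OF c]]]]
      deriv_along_chart[OF _ c assms(3)] assms(1,2) tangent_add[OF assms(1,2)] by simp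
qed

lemma deriv_along_scale_vector:
  assumes "v \<in> tangent_space At p" "smooth_at At f p"
  shows "deriv_along At p (\<lambda>d. r *\<^sub>R v d) f = r *\<^sub>R deriv_along At p v f"
proof -
  obtain c where c: "c \<in> At" "p \<in> fst c" using ex_chart by blast
  show ?thesis
    using linear_cmul[OF Cinf_at_linear[OF assms(2)[unfolded smooth_at_chart[OF c]]]]
      deriv_along_chart[OF _ c assms(2)] assms(1) tangent_scale[OF assms(1)] by simp
qed

lemma deriv_along_const [simp]: "deriv_along At p v (\<lambda>_. k) = 0"
  by (simp add: deriv_along_def comp_def Let_def)

lemma deriv_along_compose:
  assumes "v \<in> tangent_space At p" "smooth_at At f p" "(g has_derivative g') (at (f p))"
    "smooth_at At (\<lambda>q. g (f q)) p"
  shows "deriv_along At p v (\<lambda>q. g (f q)) = g' (deriv_along At p v f)"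
proof -
  obtain c where c: "c \<in> At" "p \<in> fst c" using ex_chart by blast
  have "((\<lambda>z. g (f (chart_inv c z))) has_derivative (\<lambda>v. g' (fderiv (\<lambda>z. f (chart_inv c z)) (snd c p) v))) (at (snd c p))"
  proof (rule has_derivative_compose[of "\<lambda>z. f (chart_inv c z)" _ _ _ g g'])
    show "((\<lambda>z. f (chart_inv c z)) has_derivative fderiv (\<lambda>z. f (chart_inv c z)) (snd c p)) (at (snd c p))"
      using assms(2) by (intro Cinf_at_has_derivative) (simp add: smooth_at_chart[OF c])
    show "(g has_derivative g') (at (f (chart_inv c (snd c p))))"
      using assms(3) by (simp add: chart_inv_chart[OF c])
  qed
  from fderiv_eq[OF this] show ?thesis using assms c by (simp add: deriv_along_chart[OF _ c])
qed

lemma deriv_along_bounded_linear: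
  assumes "v \<in> tangent_space At p" "smooth_at At f p" "bounded_linear L"
  shows "deriv_along At p v (\<lambda>q. L (f q)) = L (deriv_along At p v f)"
  by (rule deriv_along_compose[of v p f L L, OF assms(1,2) bounded_linear_imp_has_derivative[OF assms(3)]
      smooth_at_bounded_linear[OF assms(3,2)]])

lemma deriv_along_bilinear:
  assumes "bounded_bilinear h" "v \<in> tangent_space At p" "smooth_at At f p" "smooth_at At g p"
  shows "deriv_along At p v (\<lambda>q. h (f q) (g q)) = h (f p) (deriv_along At p v g) + h (deriv_along At p v f) (g p)"
proof -
  obtain c where c: "c \<in> At" "p \<in> fst c" using ex_chart by blast
  have s: "smooth_at At (\<lambda>q. h (f q) (g q)) p"
    by (rule smooth_at_lift2[of h, OF _ assms(3,4)]) (rule Cinf_at_bilinear[OF assms(1)])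
  have "((\<lambda>z. h (f (chart_inv c z)) (g (chart_inv c z))) has_derivative
      (\<lambda>v. h (f (chart_inv c (snd c p))) (fderiv (\<lambda>z. g (chart_inv c z)) (snd c p) v)
        + h (fderiv (\<lambda>z. f (chart_inv c z)) (snd c p) v) (g (chart_inv c (snd c p))))) (at (snd c p))"
    using assms(3,4) by (intro bounded_bilinear.FDERIV[OF assms(1)])
      (auto intro!: Cinf_at_has_derivative simp: smooth_at_chart[OF c])
  from fderiv_eq[OF this] show ?thesis using assms c s chart_inv_chart[OF c]
    by (simp add: deriv_along_chart[OF _ c])
qed

lemmas deriv_along_scaleR = deriv_along_bilinear[OF bounded_bilinear_scaleR]

lemma deriv_along_add:
  assumes "v \<in> tangent_space At p" "smooth_at At f p" "smooth_at At g p"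
  shows "deriv_along At p v (\<lambda>q. f q + g q) = deriv_along At p v f + deriv_along At p v g"
proof -
  obtain c where c: "c \<in> At" "p \<in> fst c" using ex_chart by blast
  have s: "smooth_at At (\<lambda>q. f q + g q) p" using assms by auto
  have "((\<lambda>z. f (chart_inv c z) + g (chart_inv c z)) has_derivative
      (\<lambda>v. fderiv (\<lambda>z. f (chart_inv c z)) (snd c p) v + fderiv (\<lambda>z. g (chart_inv c z)) (snd c p) v)) (at (snd c p))"
    using assms(2,3) by (intro has_derivative_add)
      (auto intro!: Cinf_at_has_derivative simp: smooth_at_chart[OF c])
  from fderiv_eq[OF this] show ?thesis using assms c s by (simp add: deriv_along_chart[OF _ c])
qed

lemma deriv_along_minus:
  assumes "v \<in> tangent_space At p" "smooth_at At f p"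
  shows "deriv_along At p v (\<lambda>q. - f q) = - deriv_along At p v f"
  by (rule deriv_along_bounded_linear[OF assms bounded_linear_minus[OF bounded_linear_ident]])

lemma deriv_along_diff:
  assumes "v \<in> tangent_space At p" "smooth_at At f p" "smooth_at At g p"
  shows "deriv_along At p v (\<lambda>q. f q - g q) = deriv_along At p v f - deriv_along At p v g"
  using deriv_along_add[OF assms(1,2), of "\<lambda>q. - g q"] deriv_along_minus[OF assms(1,3)]
    smooth_at_bounded_linear[OF bounded_linear_minus[OF bounded_linear_ident] assms(3)] by simp

lemma deriv_along_sum:
  assumes "v \<in> tangent_space At p" "finite I" "\<And>i. i \<in> I \<Longrightarrow> smooth_at At (f i) p"
  shows "deriv_along At p v (\<lambda>q. \<Sum>i\<in>I. f i q) = (\<Sum>i\<in>I. deriv_along At p v (f i))"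
  using assms(2,3) by (induction I) (auto simp: deriv_along_add[OF assms(1)] smooth_at_sum)

lemma deriv_along_Pair:
  assumes "v \<in> tangent_space At p" "smooth_at At f p" "smooth_at At g p"
  shows "deriv_along At p v (\<lambda>q. (f q, g q)) = (deriv_along At p v f, deriv_along At p v g)"
  using deriv_along_bounded_linear[OF assms(1) smooth_at_Pair[OF assms(2,3)] bounded_linear_fst]
    deriv_along_bounded_linear[OF assms(1) smooth_at_Pair[OF assms(2,3)] bounded_linear_snd]
  by (simp add: prod_eq_iff)

section \<open>Smooth vector fields and their Lie bracket\<close>

definition smooth_field_at :: "('p \<Rightarrow> ('p, 'v) chart \<Rightarrow> 'v) \<Rightarrow> 'p \<Rightarrow> bool" where
  "smooth_field_at V p \<longleftrightarrow> (\<forall>\<^sub>F q in nhds p. V q \<in> tangent_space At q) \<and>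
     (\<forall>c\<in>At. p \<in> fst c \<longrightarrow> smooth_at At (\<lambda>q. V q c) p)"

lemma smooth_field_tangent: "smooth_field_at V p \<Longrightarrow> V p \<in> tangent_space At p"
  unfolding smooth_field_at_def using eventually_nhds_x_imp_x by blast

lemma deriv_along_field_eventually:
  assumes "smooth_field_at V p" "smooth_at At f p" "c \<in> At" "p \<in> fst c"
  shows "\<forall>\<^sub>F q in nhds p. deriv_along At q (V q) f = fderiv (\<lambda>z. f (chart_inv c z)) (snd c q) (V q c)"
proof -
  have "\<forall>\<^sub>F q in nhds p. V q \<in> tangent_space At q" using assms(1) by (simp add: smooth_field_at_def)
  with smooth_at_eventually[OF assms(2)] eventually_in_chart[OF assms(3,4)] show ?thesis
    by eventually_elim (simp add: deriv_along_chart assms(3))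
qed

lemma deriv_along_field_chart:
  assumes "smooth_field_at V p" "smooth_at At f p" "c \<in> At" "p \<in> fst c"
  shows "\<forall>\<^sub>F z in nhds (snd c p). deriv_along At (chart_inv c z) (V (chart_inv c z)) f
    = fderiv (\<lambda>z. f (chart_inv c z)) z (V (chart_inv c z) c)"
proof -
  have "\<forall>\<^sub>F z in nhds (snd c p). deriv_along At (chart_inv c z) (V (chart_inv c z)) f
    = fderiv (\<lambda>z. f (chart_inv c z)) (snd c (chart_inv c z)) (V (chart_inv c z) c)"
    using deriv_along_field_eventually[OF assms]
    by (simp add: eventually_chart[OF assms(3,4),
      of "\<lambda>q. deriv_along At q (V q) f = fderiv (\<lambda>z. f (chart_inv c z)) (snd c q) (V q c)"])
  then show ?thesis using eventually_in_chart_image[OF assms(3,4)]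
    by eventually_elim (simp add: chart_chart_inv)
qed

lemma smooth_at_deriv_along:
  assumes "smooth_field_at V p" "smooth_at At f p"
  shows "smooth_at At (\<lambda>q. deriv_along At q (V q) f) p"
proof -
  obtain c where c: "c \<in> At" "p \<in> fst c" using ex_chart by blast
  show ?thesis
    unfolding smooth_at_chart[OF c]
  proof (rule Cinf_at_transform[OF deriv_along_field_chart[OF assms c]])
    show "Cinf_at (\<lambda>z. fderiv (\<lambda>z. f (chart_inv c z)) z (V (chart_inv c z) c)) (snd c p)"
      using assms c by (intro Cinf_at_fderiv_field[OF model])
        (auto simp: smooth_field_at_def smooth_at_chart[OF c])
  qed
qed

text \<open>Product rule for a derivative of a derivative: the first summand freezes the field
  \<open>W\<close> and is a second derivative of \<open>f\<close>, the second one differentiates the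
  components of \<open>W\<close>. Expanding in a reproducing family separates the two dependencies.
  Second derivatives of \<open>f\<close> occur in the first summand only, and there they will cancel
  in commutators.\<close>

lemma deriv_along_twice:
  assumes "v \<in> tangent_space At p" "smooth_field_at W p" "smooth_at At f p" "c \<in> At" "p \<in> fst c"
  shows "deriv_along At p v (\<lambda>q. deriv_along At q (W q) f)
    = fderiv (\<lambda>z. fderiv (\<lambda>z. f (chart_inv c z)) z (W p c)) (snd c p) (v c)
      + fderiv (\<lambda>z. f (chart_inv c z)) (snd c p) (deriv_along At p v (\<lambda>q. W q c))"
proof -
  obtain B :: "'v set" where B: "reproducing B" using model by blast
  let ?F = "\<lambda>z. f (chart_inv c z)"
  let ?w = "\<lambda>z. W (chart_inv c z) c"
  let ?z = "snd c p"
  have F: "Cinf_at ?F ?z" using assms(3) by (simp add: smooth_at_chart[OF assms(4,5)])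
  have sW: "smooth_at At (\<lambda>q. W q c) p" using assms by (simp add: smooth_field_at_def)
  then have w: "Cinf_at ?w ?z" by (simp add: smooth_at_chart[OF assms(4,5)])
  have wp: "?w ?z = W p c" using chart_inv_chart[OF assms(4,5)] by simp
  have expand: "\<forall>\<^sub>F z in nhds ?z. fderiv ?F z (u z) = (\<Sum>b\<in>B. (u z \<bullet> b) *\<^sub>R fderiv ?F z b)" for u
    using Cinf_at_eventually[OF F] by eventually_elim (rule linear_reproducing[OF B Cinf_at_linear])
  have expand0: "fderiv ?F ?z u = (\<Sum>b\<in>B. (u \<bullet> b) *\<^sub>R fderiv ?F ?z b)" for u
    by (rule linear_reproducing[OF B Cinf_at_linear[OF F]])
  have d1: "((\<lambda>z. \<Sum>b\<in>B. (u z \<bullet> b) *\<^sub>R fderiv ?F z b) has_derivative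
      (\<lambda>h. \<Sum>b\<in>B. (u ?z \<bullet> b) *\<^sub>R fderiv (\<lambda>z. fderiv ?F z b) ?z h + (fderiv u ?z h \<bullet> b) *\<^sub>R fderiv ?F ?z b)) (at ?z)"
    if "Cinf_at u ?z" for u
    by (intro has_derivative_sum has_derivative_scaleR bounded_linear.has_derivative[OF bounded_linear_inner_left]
        Cinf_at_has_derivative Cinf_at_fderiv F that)
  have "fderiv (\<lambda>z. fderiv ?F z (?w z)) ?z (v c)
      = (\<Sum>b\<in>B. (W p c \<bullet> b) *\<^sub>R fderiv (\<lambda>z. fderiv ?F z b) ?z (v c)) + (\<Sum>b\<in>B. (fderiv ?w ?z (v c) \<bullet> b) *\<^sub>R fderiv ?F ?z b)"
    using fderiv_cong_ev(1)[OF expand[of ?w]] fderiv_eq[OF d1[OF w]] wp by (simp add: sum.distrib)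
  also have "(\<Sum>b\<in>B. (W p c \<bullet> b) *\<^sub>R fderiv (\<lambda>z. fderiv ?F z b) ?z (v c)) = fderiv (\<lambda>z. fderiv ?F z (W p c)) ?z (v c)"
    using fderiv_cong_ev(1)[OF expand[of "\<lambda>_. W p c"]] fderiv_eq[OF d1[of "\<lambda>_. W p c"]] by simp
  also have "(\<Sum>b\<in>B. (fderiv ?w ?z (v c) \<bullet> b) *\<^sub>R fderiv ?F ?z b) = fderiv ?F ?z (fderiv ?w ?z (v c))"
    by (simp add: expand0[of "fderiv ?w ?z (v c)"])
  also have "fderiv ?w ?z (v c) = deriv_along At p v (\<lambda>q. W q c)"
    by (simp add: deriv_along_chart[OF assms(1,4,5) sW])
  also have "fderiv (\<lambda>z. fderiv ?F z (?w z)) ?z (v c) = deriv_along At p v (\<lambda>q. deriv_along At q (W q) f)"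
    using deriv_along_chart[OF assms(1,4,5) smooth_at_deriv_along[OF assms(2,3)]]
      fderiv_cong_ev(1)[OF deriv_along_field_chart[OF assms(2,3,4,5)]] by simp
  finally show ?thesis .
qed

text \<open>The usual coordinate expression, written in every chart at once; that these
  representatives fit together to one tangent vector is a theorem,
  \<open>lie_bracket_tangent\<close>.\<close>

definition lie_bracket ::
  "('p \<Rightarrow> ('p, 'v) chart \<Rightarrow> 'v) \<Rightarrow> ('p \<Rightarrow> ('p, 'v) chart \<Rightarrow> 'v) \<Rightarrow> 'p \<Rightarrow> ('p, 'v) chart \<Rightarrow> 'v" where
  "lie_bracket V W p = (\<lambda>d. if d \<in> At \<and> p \<in> fst d
     then deriv_along At p (V p) (\<lambda>q. W q d) - deriv_along At p (W p) (\<lambda>q. V q d) else 0)"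

lemma commutator_chart:
  fixes f :: "'p \<Rightarrow> 'w::real_inner"
  assumes "smooth_field_at V p" "smooth_field_at W p" "smooth_at At f p" "c \<in> At" "p \<in> fst c"
  shows "deriv_along At p (V p) (\<lambda>q. deriv_along At q (W q) f) - deriv_along At p (W p) (\<lambda>q. deriv_along At q (V q) f)
    = fderiv (\<lambda>z. f (chart_inv c z)) (snd c p) (lie_bracket V W p c)"
proof -
  have F: "Cinf_at (\<lambda>z. f (chart_inv c z)) (snd c p)" using assms(3) by (simp add: smooth_at_chart[OF assms(4,5)])
  show ?thesis
    using deriv_along_twice[OF smooth_field_tangent[OF assms(1)] assms(2,3,4,5)]
      deriv_along_twice[OF smooth_field_tangent[OF assms(2)] assms(1,3,4,5)]
      second_fderiv_symmetric[OF F, of "W p c" "V p c"] linear_diff[OF Cinf_at_linear[OF F]] assms(4,5)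
    by (simp add: lie_bracket_def)
qed

text \<open>The coordinate map of a second chart \<open>d\<close> is a smooth function to which
  \<open>commutator_chart\<close> applies. Its derivatives along a field are the components of the
  field in \<open>d\<close>, so the commutator is the bracket computed in \<open>d\<close>.\<close>

lemma lie_bracket_tangent:
  assumes "smooth_field_at V p" "smooth_field_at W p"
  shows "lie_bracket V W p \<in> tangent_space At p"
proof -
  obtain c where c: "c \<in> At" "p \<in> fst c" using ex_chart by blast
  show ?thesis
  proof (rule tangent_spaceI[OF _ c])
    fix d assume d: "d \<in> At" "p \<in> fst d"
    have ev: "\<forall>\<^sub>F q in nhds p. deriv_along At q (U q) (snd d) = U q d" if "smooth_field_at U p" for U
    proof -
      have "\<forall>\<^sub>F q in nhds p. U q \<in> tangent_space At q" using that by (simp add: smooth_field_at_def)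
      with eventually_in_chart[OF d] show ?thesis
        by eventually_elim (simp add: deriv_along_chart_map d(1))
    qed
    show "lie_bracket V W p d = fderiv (\<lambda>z. snd d (chart_inv c z)) (snd c p) (lie_bracket V W p c)"
      using commutator_chart[OF assms smooth_at_chart_map[OF d] c] d
        deriv_along_eventually[OF ev[OF assms(1)]] deriv_along_eventually[OF ev[OF assms(2)]]
      by (simp add: lie_bracket_def[of V W p] del: )
  qed (auto simp: lie_bracket_def)
qed

lemma deriv_along_lie_bracket:
  fixes f :: "'p \<Rightarrow> 'w::real_inner"
  assumes "smooth_field_at V p" "smooth_field_at W p" "smooth_at At f p"
  shows "deriv_along At p (lie_bracket V W p) f
    = deriv_along At p (V p) (\<lambda>q. deriv_along At q (W q) f) - deriv_along At p (W p) (\<lambda>q. deriv_along At q (V q) f)"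
proof -
  obtain c where c: "c \<in> At" "p \<in> fst c" using ex_chart by blast
  show ?thesis using commutator_chart[OF assms c] deriv_along_chart[OF lie_bracket_tangent[OF assms(1,2)] c assms(3)]
    by simp
qed

lemma smooth_at_compose_map:
  assumes "\<exists>B::'w set. reproducing B" "Cinf_at (\<lambda>z. F (g z)) (f p)" "smooth_at At (f :: 'p \<Rightarrow> 'w::real_inner) p"
    "\<forall>\<^sub>F q in nhds p. h q = F (g (f q))"
  shows "smooth_at At h p"
  by (rule smooth_at_transform[OF assms(4) smooth_at_compose[OF assms(1), of "\<lambda>z. F (g z)"]]) (fact assms)+

lemma smooth_field_coord_vector:
  assumes "c \<in> At" "p \<in> fst c" "smooth_at At \<xi> p"
  shows "smooth_field_at (\<lambda>q. coord_vector At c q (\<xi> q)) p"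
  unfolding smooth_field_at_def
proof (intro conjI ballI impI)
  show "\<forall>\<^sub>F q in nhds p. coord_vector At c q (\<xi> q) \<in> tangent_space At q"
    using eventually_in_chart[OF assms(1,2)] by eventually_elim (rule coord_vector_tangent[OF assms(1)])
  fix d assume d: "d \<in> At" "p \<in> fst d"
  have "Cinf_at (\<lambda>z. fderiv (\<lambda>z. snd d (chart_inv c z)) z (\<xi> (chart_inv c z))) (snd c p)"
    using assms by (intro Cinf_at_fderiv_field[OF model] Cinf_at_transition d) (simp_all add: smooth_at_chart)
  moreover have "\<forall>\<^sub>F z in nhds (snd c p). fderiv (\<lambda>z. snd d (chart_inv c z)) z (\<xi> (chart_inv c z))
      = fderiv (\<lambda>z. snd d (chart_inv c z)) (snd c (chart_inv c z)) (\<xi> (chart_inv c z))"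
    using eventually_in_chart_image[OF assms(1,2)] by eventually_elim (simp add: chart_chart_inv)
  ultimately have "smooth_at At (\<lambda>q. fderiv (\<lambda>z. snd d (chart_inv c z)) (snd c q) (\<xi> q)) p"
    unfolding smooth_at_chart[OF assms(1,2)] by (simp add: Cinf_at_cong)
  moreover have "\<forall>\<^sub>F q in nhds p. coord_vector At c q (\<xi> q) d = fderiv (\<lambda>z. snd d (chart_inv c z)) (snd c q) (\<xi> q)"
    using eventually_in_chart[OF d] by eventually_elim (simp add: coord_vector_def d comp_def)
  ultimately show "smooth_at At (\<lambda>q. coord_vector At c q (\<xi> q) d) p"
    by (rule smooth_at_transform[rotated])
qed

lemma smooth_field_transform:
  assumes "\<forall>\<^sub>F q in nhds p. V q = W q" "smooth_field_at W p" shows "smooth_field_at V p"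
  unfolding smooth_field_at_def
proof (intro conjI ballI impI)
  have "\<forall>\<^sub>F q in nhds p. W q \<in> tangent_space At q" using assms(2) by (simp add: smooth_field_at_def)
  with assms(1) show "\<forall>\<^sub>F q in nhds p. V q \<in> tangent_space At q" by eventually_elim simp
  fix c assume "c \<in> At" "p \<in> fst c"
  then have "smooth_at At (\<lambda>q. W q c) p" using assms(2) by (simp add: smooth_field_at_def)
  moreover have "\<forall>\<^sub>F q in nhds p. V q c = W q c" using assms(1) by eventually_elim simp
  ultimately show "smooth_at At (\<lambda>q. V q c) p" by (rule smooth_at_transform[rotated])
qed

lemma tangent_coord_vector:
  "v \<in> tangent_space At p \<Longrightarrow> c \<in> At \<Longrightarrow> p \<in> fst c \<Longrightarrow> coord_vector At c p (v c) = v"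
  by (rule tangent_ext[OF coord_vector_tangent _ _ _ coord_vector_chart])

text \<open>A tangent field is the coordinate field of its components in any one chart, and
  transition maps are smooth.\<close>

lemma smooth_fieldI:
  assumes "\<forall>\<^sub>F q in nhds p. V q \<in> tangent_space At q" "c \<in> At" "p \<in> fst c" "smooth_at At (\<lambda>q. V q c) p"
  shows "smooth_field_at V p"
proof (rule smooth_field_transform)
  show "\<forall>\<^sub>F q in nhds p. V q = coord_vector At c q (V q c)"
    using assms(1) eventually_in_chart[OF assms(2,3)] by eventually_elim (simp add: tangent_coord_vector assms(2))
qed (rule smooth_field_coord_vector[OF assms(2-4)])

end

text \<open>Separation is required of the topology and not through a type class, because for the
  total space of the bundle it has to be derived from the base and the charts.\<close>

locale hausdorff_manifold = smooth_manifold +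
  assumes hausdorff: "Hausdorff_space (euclidean :: 'a topology)"
begin

lemma smooth_bump:
  assumes "open S" "p \<in> S"
  obtains \<beta> :: "'a \<Rightarrow> real" and K where "\<And>q. smooth_at At \<beta> q" "\<forall>\<^sub>F q in nhds p. \<beta> q = 1"
    "closed K" "K \<subseteq> S" "\<And>q. q \<notin> K \<Longrightarrow> \<beta> q = 0"
proof -
  obtain c where c: "c \<in> At" "p \<in> fst c" using ex_chart by blast
  have o: "open (snd c ` (fst c \<inter> S))" using assms chart_open[OF c(1)] by (intro open_chart_image c(1)) auto
  have m: "snd c p \<in> snd c ` (fst c \<inter> S)" using assms c by auto
  obtain b :: "'b \<Rightarrow> real" and r where b: "r > 0" "cball (snd c p) r \<subseteq> snd c ` (fst c \<inter> S)" "\<And>y. Cinf_at b y"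
    "\<forall>\<^sub>F y in nhds (snd c p). b y = 1" "\<And>y. y \<notin> cball (snd c p) r \<Longrightarrow> b y = 0"
    by (rule bump_exists[OF o m]) (rule that)
  define K where "K = chart_inv c ` cball (snd c p) r"
  define \<beta> where "\<beta> q = (if q \<in> fst c then b (snd c q) else 0)" for q
  have "compact (cball (snd c p) r)" using model reproducing_compact_cball by blast
  moreover have "continuous_on (cball (snd c p) r) (chart_inv c)"
    using chart_homeo[OF c(1)] b(2) by (auto simp: homeomorphism_def intro: continuous_on_subset)
  ultimately have "compact K" unfolding K_def by (rule compact_continuous_image[rotated])
  \<comment> \<open>The compact image of the ball is closed because the space is Hausdorff. Hence
    the complement of \<open>K\<close> is open, and the cut-off function, being zero there, is
    smooth at points outside the chart as well.\<close>
  then have K: "closed K" using compactin_imp_closedin[OF hausdorff, of K] by simp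
  have "x \<in> fst c \<inter> S" if "x \<in> K" for x
    using that b(2) chart_inv_chart[OF c(1)] by (auto simp: K_def dest!: subsetD)
  then have KS: "K \<subseteq> S" "K \<subseteq> fst c" by auto
  have off: "\<beta> q = 0" if "q \<notin> K" for q
  proof (cases "q \<in> fst c")
    case True
    then have "snd c q \<notin> cball (snd c p) r"
      using that chart_inv_chart[OF c(1) True] unfolding K_def by (metis imageI)
    then show ?thesis by (simp add: \<beta>_def b(5) del: mem_cball)
  qed (simp add: \<beta>_def)
  have "smooth_at At \<beta> q" for q
  proof (cases "q \<in> fst c")
    case True
    have "smooth_at At (\<lambda>q. b (snd c q)) q"
      by (rule smooth_at_compose[OF model b(3) smooth_at_chart_map[OF c(1) True]])
    moreover have "\<forall>\<^sub>F x in nhds q. \<beta> x = b (snd c x)"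
      using eventually_in_chart[OF c(1) True] by eventually_elim (simp add: \<beta>_def)
    ultimately show ?thesis by (rule smooth_at_transform[rotated])
  next
    case False
    then have "\<forall>\<^sub>F x in nhds q. x \<in> - K" using K KS by (intro eventually_nhds_in_open) auto
    then have "\<forall>\<^sub>F x in nhds q. \<beta> x = 0" by eventually_elim (simp add: off)
    then show ?thesis by (rule smooth_at_transform) simp
  qed
  moreover have "\<forall>\<^sub>F q in nhds p. \<beta> q = 1"
  proof -
    have "\<forall>\<^sub>F z in nhds (snd c p). \<beta> (chart_inv c z) = 1"
      using b(4) eventually_in_chart_image[OF c]
      by eventually_elim (simp add: \<beta>_def chart_chart_inv)
    then show ?thesis by (simp add: eventually_chart[OF c, of "\<lambda>q. \<beta> q = 1"])
  qed
  ultimately show ?thesis using that K KS(1) off by blast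
qed

lemma smooth_at_extend_zero:
  assumes "open S" "closed K" "K \<subseteq> S" "\<And>q. q \<notin> K \<Longrightarrow> \<beta> q = 0" "smooth_at At \<beta> p"
    "p \<in> S \<Longrightarrow> smooth_at At f p"
  shows "smooth_at At (\<lambda>q. if q \<in> S then \<beta> q *\<^sub>R f q else 0) p"
proof (cases "p \<in> S")
  case True
  then have "\<forall>\<^sub>F x in nhds p. x \<in> S" using assms(1) by (intro eventually_nhds_in_open)
  then have "\<forall>\<^sub>F x in nhds p. (if x \<in> S then \<beta> x *\<^sub>R f x else 0) = \<beta> x *\<^sub>R f x" by eventually_elim simp
  then show ?thesis by (rule smooth_at_transform) (use True assms(5,6) in auto)
next
  case False
  then have "\<forall>\<^sub>F x in nhds p. x \<in> - K" using assms(2,3) by (intro eventually_nhds_in_open) auto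
  then have "\<forall>\<^sub>F x in nhds p. (if x \<in> S then \<beta> x *\<^sub>R f x else 0) = 0" by eventually_elim (simp add: assms(4))
  then show ?thesis by (rule smooth_at_transform) simp
qed

end

section \<open>Local coordinates of a partial Finsler pre-Lie algebroid\<close>

lemma continuous_on_open_inter:
  "continuous_on S f \<Longrightarrow> open S \<Longrightarrow> open U \<Longrightarrow> open (S \<inter> f -` U)"
  using continuous_on_open_vimage by (metis Int_commute)

locale partial_finsler =
  fixes A :: "('m::t2_space, 'e::real_inner, 'a::topological_space, 'f::euclidean_space)
                finsler_algebroid"
  assumes pf: "partial_finsler_pre_lie_algebroid A"
begin

abbreviation "\<pi> \<equiv> bproj A"
abbreviation "Bs \<equiv> base_atlas A"
abbreviation "Ts \<equiv> total_atlas A"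
abbreviation "\<BB> \<equiv> bundle_atlas A"
abbreviation "tc \<equiv> total_chart A"
abbreviation "CM \<equiv> conic_dom A"
abbreviation dom :: "('m, 'e, 'a, 'f) bundle_chart \<Rightarrow> 'm set" where "dom b \<equiv> fst (fst b)"

lemma model_base: "\<exists>B::'e set. reproducing B"
  using pf reproducing_exists unfolding partial_finsler_pre_lie_algebroid_def by blast

lemma model_total: "\<exists>B::('e \<times> 'f) set. reproducing B"
  using model_base reproducing_Times reproducing_Basis by blast

lemma vb: "vector_bundle A" and am: "anchor_morphism A" and pfm: "partial_finsler_metric A"
  and lb: "leibniz_bracket (sections A UNIV) (fadd A) (fscale A) UNIV
       {f. smooth_fun (base_atlas A) UNIV f} (anchor_act A) (bracket A)"
  using pf unfolding partial_finsler_pre_lie_algebroid_def pre_lie_algebroid_def by - (elim conjE, assumption)+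

sublocale base: hausdorff_manifold Bs
proof
  show "smooth_atlas Bs" using vb by (simp add: vector_bundle_def)
  show "\<exists>B::'e set. reproducing B" by (rule model_base)
  show "Hausdorff_space (euclidean :: 'm topology)"
    unfolding Hausdorff_space_def using hausdorff by (auto simp: disjnt_def)
qed

sublocale tot: smooth_manifold Ts
  using vb model_total by unfold_locales (simp_all add: vector_bundle_def)

lemma ex_bundle_chart: "\<exists>b\<in>\<BB>. x \<in> dom b"
proof -
  have "\<forall>x. \<exists>(c, \<psi>)\<in>\<BB>. x \<in> fst c" using vb unfolding vector_bundle_def by (elim conjE)
  then obtain p where "p \<in> \<BB>" "case p of (c, \<psi>) \<Rightarrow> x \<in> fst c" by blast
  then show ?thesis by (intro bexI[of _ p]) (auto split: prod.splits)
qed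

lemma pi_add [simp]: "\<pi> u = x \<Longrightarrow> \<pi> w = x \<Longrightarrow> \<pi> (fadd A u w) = x"
  and pi_scale [simp]: "\<pi> (fscale A r u) = \<pi> u"
  using vb unfolding vector_bundle_def by auto

lemma bundle_chart:
  assumes "b \<in> \<BB>"
  shows "fst b \<in> Bs"
    and "\<And>x. x \<in> dom b \<Longrightarrow> bij_betw (snd b) {u. \<pi> u = x} UNIV"
    and "\<And>u w. \<pi> u \<in> dom b \<Longrightarrow> \<pi> w = \<pi> u \<Longrightarrow> snd b (fadd A u w) = snd b u + snd b w"
    and "\<And>u r. \<pi> u \<in> dom b \<Longrightarrow> snd b (fscale A r u) = r *\<^sub>R snd b u"
    and "tc b \<in> Ts"
proof -
  have *: "\<forall>(c, \<psi>)\<in>\<BB>. c \<in> Bs \<and> (\<forall>x\<in>fst c. bij_betw \<psi> {u. \<pi> u = x} UNIV \<and>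
           (\<forall>u w r. \<pi> u = x \<and> \<pi> w = x \<longrightarrow>
              \<psi> (fadd A u w) = \<psi> u + \<psi> w \<and> \<psi> (fscale A r u) = r *\<^sub>R \<psi> u))"
    using vb unfolding vector_bundle_def by (elim conjE)
  obtain c \<psi> where b: "b = (c, \<psi>)" by (cases b)
  show "fst b \<in> Bs"
    and "\<And>x. x \<in> dom b \<Longrightarrow> bij_betw (snd b) {u. \<pi> u = x} UNIV"
    and "\<And>u w. \<pi> u \<in> dom b \<Longrightarrow> \<pi> w = \<pi> u \<Longrightarrow> snd b (fadd A u w) = snd b u + snd b w"
    and "\<And>u r. \<pi> u \<in> dom b \<Longrightarrow> snd b (fscale A r u) = r *\<^sub>R snd b u"
    using bspec[OF * assms] unfolding b by auto
  show "tc b \<in> Ts" using assms by (simp add: total_atlas_def)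
qed

lemma fst_tc [simp]: "u \<in> fst (tc b) \<longleftrightarrow> \<pi> u \<in> dom b"
  and snd_tc: "snd (tc b) u = (snd (fst b) (\<pi> u), snd b u)"
  by (simp_all add: total_chart_def)

lemma fibre_eqI: "b \<in> \<BB> \<Longrightarrow> \<pi> u \<in> dom b \<Longrightarrow> \<pi> w = \<pi> u \<Longrightarrow> snd b u = snd b w \<Longrightarrow> u = w"
  using bundle_chart(2)[of b "\<pi> u"] by (auto simp: bij_betw_def inj_on_def)

lemma frame:
  assumes "b \<in> \<BB>" "x \<in> dom b"
  shows pi_frame: "\<pi> (frame A b w x) = x" and psi_frame: "snd b (frame A b w x) = w"
proof -
  have "w \<in> snd b ` {u. \<pi> u = x}"
    using bundle_chart(2)[OF assms] by (simp add: bij_betw_def)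
  then obtain u where u: "\<pi> u = x" "snd b u = w" by auto
  then have "frame A b w x = u" unfolding frame_def using assms fibre_eqI[OF assms(1)] by (auto intro!: the_equality)
  then show "\<pi> (frame A b w x) = x" "snd b (frame A b w x) = w" using u by auto
qed

lemma frame_psi: "b \<in> \<BB> \<Longrightarrow> \<pi> u \<in> dom b \<Longrightarrow> frame A b (snd b u) (\<pi> u) = u"
  by (rule fibre_eqI[of b]) (simp_all add: pi_frame psi_frame)

lemma chart_inv_tc: "b \<in> \<BB> \<Longrightarrow> x \<in> dom b \<Longrightarrow> chart_inv (tc b) (snd (fst b) x, w) = frame A b w x"
  using tot.chart_inv_chart[of "tc b" "frame A b w x"] by (simp add: bundle_chart snd_tc pi_frame psi_frame)

lemma zero_vec_eq: assumes "b \<in> \<BB>" "x \<in> dom b" shows "zero_vec A x = frame A b 0 x"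
  unfolding zero_vec_def
proof (rule the_equality)
  show "\<pi> (frame A b 0 x) = x \<and> (\<forall>u. \<pi> u = x \<longrightarrow> fadd A (frame A b 0 x) u = u)"
    using assms by (auto simp: pi_frame psi_frame bundle_chart intro!: fibre_eqI[of b])
  fix z assume z: "\<pi> z = x \<and> (\<forall>u. \<pi> u = x \<longrightarrow> fadd A z u = u)"
  then have "snd b (fadd A z z) = snd b z" by simp
  moreover have "snd b (fadd A z z) = snd b z + snd b z" using bundle_chart(3)[OF assms(1), of z z] z assms(2) by simp
  ultimately have "snd b z = 0" by simp
  then show "z = frame A b 0 x" using z assms by (intro fibre_eqI[of b]) (auto simp: pi_frame psi_frame)
qed

lemma pi_zero [simp]: "\<pi> (zero_vec A x) = x"
  using ex_bundle_chart[of x] zero_vec_eq pi_frame by metis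

lemma psi_zero: "b \<in> \<BB> \<Longrightarrow> x \<in> dom b \<Longrightarrow> snd b (zero_vec A x) = 0"
  by (simp add: zero_vec_eq psi_frame)

lemma open_dom: "b \<in> \<BB> \<Longrightarrow> open (dom b)"
  using base.chart_open bundle_chart by blast

text \<open>Continuity of the projection is read off the total charts: they are homeomorphisms whose
  first component is the base chart composed with the projection.\<close>

lemma pi_continuous: assumes "open O'" shows "open (\<pi> -` O')"
proof -
  have "\<exists>T. open T \<and> u \<in> T \<and> T \<subseteq> \<pi> -` O'" if u: "\<pi> u \<in> O'" for u
  proof -
    obtain b where b: "b \<in> \<BB>" "\<pi> u \<in> dom b" using ex_bundle_chart by blast
    let ?U = "(snd (fst b) ` (dom b \<inter> O')) \<times> (UNIV :: 'f set)"
    have "open ?U" using assms open_dom[OF b(1)] bundle_chart(1)[OF b(1)]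
      by (intro open_Times base.open_chart_image) auto
    then have "open (fst (tc b) \<inter> snd (tc b) -` ?U)"
      using tot.chart_homeo[OF bundle_chart(5)[OF b(1)]] tot.chart_open[OF bundle_chart(5)[OF b(1)]]
      by (intro continuous_on_open_inter) (auto simp: homeomorphism_def)
    moreover have "w \<in> \<pi> -` O'" if w: "w \<in> fst (tc b) \<inter> snd (tc b) -` ?U" for w
    proof -
      obtain y where "y \<in> dom b \<inter> O'" "snd (fst b) (\<pi> w) = snd (fst b) y" using w by (auto simp: snd_tc)
      then have "\<pi> w = y"
        using w base.chart_inv_chart[OF bundle_chart(1)[OF b(1)]] by (metis IntD1 fst_tc)
      then show ?thesis using \<open>y \<in> dom b \<inter> O'\<close> by simp
    qed
    ultimately show ?thesis using b u by (intro exI[of _ "fst (tc b) \<inter> snd (tc b) -` ?U"]) (auto simp: snd_tc)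
  qed
  then show ?thesis by (subst open_subopen) auto
qed

lemma filterlim_pi: "filterlim \<pi> (nhds (\<pi> u)) (nhds u)"
  unfolding filterlim_iff eventually_nhds
proof (intro allI impI)
  fix P assume "\<exists>S. open S \<and> \<pi> u \<in> S \<and> (\<forall>x\<in>S. P x)"
  then obtain S where "open S" "\<pi> u \<in> S" "\<forall>x\<in>S. P x" by blast
  then show "\<exists>S. open S \<and> u \<in> S \<and> (\<forall>x\<in>S. P (\<pi> x))"
    by (intro exI[of _ "\<pi> -` S"]) (auto simp: pi_continuous)
qed

lemma eventually_pi: "\<forall>\<^sub>F x in nhds (\<pi> u). P x \<Longrightarrow> \<forall>\<^sub>F w in nhds u. P (\<pi> w)"
  using filterlim_pi[of u] by (auto simp: filterlim_iff)

text \<open>Points of different fibres are separated by preimages of open sets of the base, points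
  of one fibre by their fibre coordinates in a trivialisation around it.\<close>

lemma total_hausdorff: "Hausdorff_space (euclidean :: 'a topology)"
  unfolding Hausdorff_space_def
proof (intro allI impI)
  fix u w :: 'a assume "u \<in> topspace euclidean \<and> w \<in> topspace euclidean \<and> u \<noteq> w"
  then have "u \<noteq> w" by simp
  have "\<exists>U V. open U \<and> open V \<and> u \<in> U \<and> w \<in> V \<and> U \<inter> V = {}"
  proof (cases "\<pi> u = \<pi> w")
    case True
    obtain b where b: "b \<in> \<BB>" "\<pi> u \<in> dom b" using ex_bundle_chart by blast
    have "snd b u \<noteq> snd b w" using True \<open>u \<noteq> w\<close> fibre_eqI[of b u w] b by metis
    then obtain U V where UV: "open U" "open V" "snd b u \<in> U" "snd b w \<in> V" "U \<inter> V = {}"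
      using hausdorff[of "snd b u" "snd b w"] by metis
    have "open (fst (tc b) \<inter> snd (tc b) -` (UNIV \<times> W))" if "open W" for W
      using tot.chart_homeo[OF bundle_chart(5)[OF b(1)]] tot.chart_open[OF bundle_chart(5)[OF b(1)]] that
      by (intro continuous_on_open_inter open_Times) (auto simp: homeomorphism_def)
    note this[OF UV(1)] this[OF UV(2)]
    moreover have "(fst (tc b) \<inter> snd (tc b) -` (UNIV \<times> U)) \<inter> (fst (tc b) \<inter> snd (tc b) -` (UNIV \<times> V)) = {}"
      using UV(5) by (auto simp: snd_tc)
    moreover have "u \<in> fst (tc b) \<inter> snd (tc b) -` (UNIV \<times> U)" "w \<in> fst (tc b) \<inter> snd (tc b) -` (UNIV \<times> V)"
      using b True UV by (auto simp: snd_tc)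
    ultimately show ?thesis by blast
  next
    case False
    then obtain U V where UV: "open U" "open V" "\<pi> u \<in> U" "\<pi> w \<in> V" "U \<inter> V = {}"
      using hausdorff[of "\<pi> u" "\<pi> w"] by metis
    then show ?thesis using pi_continuous by (intro exI[of _ "\<pi> -` U"] exI[of _ "\<pi> -` V"]) auto
  qed
  then show "\<exists>U V. openin euclidean U \<and> openin euclidean V \<and> u \<in> U \<and> w \<in> V \<and> disjnt U V"
    by (auto simp: disjnt_def)
qed

sublocale tot: hausdorff_manifold Ts
  by unfold_locales (rule total_hausdorff)

lemma open_CM: "open CM"
  using pfm by (simp add: partial_finsler_metric_def)

lemma eventually_dom: "b \<in> \<BB> \<Longrightarrow> x \<in> dom b \<Longrightarrow> \<forall>\<^sub>F y in nhds x. y \<in> dom b"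
  using open_dom by (intro eventually_nhds_in_open)

lemma eventually_pi_dom: "b \<in> \<BB> \<Longrightarrow> \<pi> u \<in> dom b \<Longrightarrow> \<forall>\<^sub>F w in nhds u. \<pi> w \<in> dom b"
  by (rule eventually_pi[OF eventually_dom])

lemma smooth_psi: "b \<in> \<BB> \<Longrightarrow> \<pi> u \<in> dom b \<Longrightarrow> smooth_at Ts (snd b) u"
  using tot.smooth_at_snd[OF tot.smooth_at_chart_map[of "tc b" u]] by (simp add: bundle_chart snd_tc)

lemma smooth_base_coords: "b \<in> \<BB> \<Longrightarrow> \<pi> u \<in> dom b \<Longrightarrow> smooth_at Ts (\<lambda>u. snd (fst b) (\<pi> u)) u"
  using tot.smooth_at_fst[OF tot.smooth_at_chart_map[of "tc b" u]] by (simp add: bundle_chart snd_tc)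

lemma smooth_lift:
  assumes "smooth_at Bs f (\<pi> u)" shows "smooth_at Ts (\<lambda>w. f (\<pi> w)) u"
proof -
  obtain b where b: "b \<in> \<BB>" "\<pi> u \<in> dom b" using ex_bundle_chart by blast
  show ?thesis
  proof (rule tot.smooth_at_compose_map[OF model_base _ smooth_base_coords[OF b]])
    show "Cinf_at (\<lambda>z. f (chart_inv (fst b) z)) (snd (fst b) (\<pi> u))"
      using assms by (simp add: base.smooth_at_chart[OF bundle_chart(1)[OF b(1)] b(2)])
    show "\<forall>\<^sub>F w in nhds u. f (\<pi> w) = f (chart_inv (fst b) (snd (fst b) (\<pi> w)))"
      using eventually_pi_dom[OF b] by eventually_elim (simp add: base.chart_inv_chart bundle_chart b)
  qed
qed

lemma tangent_map_tc:
  assumes "v \<in> tangent_space Ts u" "b \<in> \<BB>" "\<pi> u \<in> dom b"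
  shows "tangent_map Ts Bs \<pi> u v (fst b) = fst (v (tc b))"
  using tot.deriv_along_bounded_linear[OF assms(1) tot.smooth_at_chart_map[of "tc b" u] bounded_linear_fst]
    tot.deriv_along_chart_map[OF assms(1), of "tc b"] assms bundle_chart[OF assms(2)]
  by (simp add: tangent_map_def snd_tc comp_def)

lemma deriv_along_lift_chart:
  assumes "v \<in> tangent_space Ts u" "b \<in> \<BB>" "\<pi> u \<in> dom b" "smooth_at Bs f (\<pi> u)"
  shows "deriv_along Ts u v (\<lambda>w. f (\<pi> w)) = fderiv (\<lambda>z. f (chart_inv (fst b) z)) (snd (fst b) (\<pi> u)) (fst (v (tc b)))"
proof -
  note c = bundle_chart(1)[OF assms(2)]
  have "Cinf_at (\<lambda>z. f (chart_inv (fst b) z)) (snd (fst b) (\<pi> u))"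
    using assms(4) by (simp add: base.smooth_at_chart[OF c assms(3)])
  note d = Cinf_at_has_derivative[OF this]
  have ev: "\<forall>\<^sub>F w in nhds u. f (\<pi> w) = f (chart_inv (fst b) (snd (fst b) (\<pi> w)))"
    using eventually_pi_dom[OF assms(2,3)] by eventually_elim (simp add: base.chart_inv_chart[OF c])
  have s: "smooth_at Ts (\<lambda>w. f (chart_inv (fst b) (snd (fst b) (\<pi> w)))) u"
  proof (rule tot.smooth_at_transform)
    show "\<forall>\<^sub>F w in nhds u. f (chart_inv (fst b) (snd (fst b) (\<pi> w))) = f (\<pi> w)"
      using ev by eventually_elim simp
  qed (rule smooth_lift[OF assms(4)])
  have "deriv_along Ts u v (\<lambda>w. f (\<pi> w)) = deriv_along Ts u v (\<lambda>w. f (chart_inv (fst b) (snd (fst b) (\<pi> w))))"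
    by (rule tot.deriv_along_eventually[OF ev])
  also have "\<dots> = fderiv (\<lambda>z. f (chart_inv (fst b) z)) (snd (fst b) (\<pi> u)) (deriv_along Ts u v (\<lambda>w. snd (fst b) (\<pi> w)))"
    by (rule tot.deriv_along_compose[OF assms(1) smooth_base_coords[OF assms(2,3)] d s])
  also have "deriv_along Ts u v (\<lambda>w. snd (fst b) (\<pi> w)) = fst (v (tc b))"
    using tangent_map_tc[OF assms(1-3)] assms(3) c by (simp add: tangent_map_def comp_def)
  finally show ?thesis .
qed

lemma tangent_map_tangent:
  assumes "v \<in> tangent_space Ts u" shows "tangent_map Ts Bs \<pi> u v \<in> tangent_space Bs (\<pi> u)"
proof -
  obtain b where b: "b \<in> \<BB>" "\<pi> u \<in> dom b" using ex_bundle_chart by blast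
  show ?thesis
  proof (rule base.tangent_spaceI[OF _ bundle_chart(1)[OF b(1)] b(2)])
    fix d assume d: "d \<in> Bs" "\<pi> u \<in> fst d"
    have "tangent_map Ts Bs \<pi> u v d = deriv_along Ts u v (\<lambda>w. snd d (\<pi> w))"
      using d by (simp add: tangent_map_def comp_def)
    also have "\<dots> = fderiv (\<lambda>z. snd d (chart_inv (fst b) z)) (snd (fst b) (\<pi> u)) (fst (v (tc b)))"
      by (rule deriv_along_lift_chart[OF assms b base.smooth_at_chart_map[OF d]])
    finally show "tangent_map Ts Bs \<pi> u v d = fderiv (\<lambda>z. snd d (chart_inv (fst b) z)) (snd (fst b) (\<pi> u)) (tangent_map Ts Bs \<pi> u v (fst b))"
      by (simp add: tangent_map_tc[OF assms b])
  qed (auto simp: tangent_map_def)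
qed

lemma deriv_along_lift:
  assumes "v \<in> tangent_space Ts u" "smooth_at Bs f (\<pi> u)"
  shows "deriv_along Ts u v (\<lambda>w. f (\<pi> w)) = deriv_along Bs (\<pi> u) (tangent_map Ts Bs \<pi> u v) f"
proof -
  obtain b where b: "b \<in> \<BB>" "\<pi> u \<in> dom b" using ex_bundle_chart by blast
  show ?thesis
    using deriv_along_lift_chart[OF assms(1) b assms(2)]
      base.deriv_along_chart[OF tangent_map_tangent[OF assms(1)] bundle_chart(1)[OF b(1)] b(2) assms(2)]
      tangent_map_tc[OF assms(1) b] by simp
qed

end

section \<open>Modules of sections described by local coordinates\<close>

text \<open>Sections of the bundle, of its pull-back and of the prolongation are treated uniformly: \<open>\<kappa> i p\<close>
  are the coordinates of the fibre at \<open>p\<close> in the local trivialisation \<open>i\<close>, \<open>pt i p\<close> is its inverse.\<close>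

locale coord_module = N: hausdorff_manifold At
  for At :: "('p::topological_space, 'v::real_inner) chart set" +
  fixes W :: "'p set" and fib :: "'p \<Rightarrow> 'b set" and add :: "'b \<Rightarrow> 'b \<Rightarrow> 'b" and sc :: "real \<Rightarrow> 'b \<Rightarrow> 'b"
    and zero :: "'p \<Rightarrow> 'b" and I :: "'i set" and U :: "'i \<Rightarrow> 'p set"
    and \<kappa> :: "'i \<Rightarrow> 'p \<Rightarrow> 'b \<Rightarrow> 'w::real_inner" and pt :: "'i \<Rightarrow> 'p \<Rightarrow> 'w \<Rightarrow> 'b"
    and anc :: "'p \<Rightarrow> 'b \<Rightarrow> ('p, 'v) chart \<Rightarrow> 'v"
  assumes open_W: "open W" and open_U: "i \<in> I \<Longrightarrow> open (U i)" and cover: "\<exists>i\<in>I. p \<in> U i"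
    and pt_fib: "i \<in> I \<Longrightarrow> p \<in> U i \<Longrightarrow> pt i p w \<in> fib p"
    and \<kappa>_pt: "i \<in> I \<Longrightarrow> p \<in> U i \<Longrightarrow> \<kappa> i p (pt i p w) = w"
    and pt_\<kappa>: "i \<in> I \<Longrightarrow> p \<in> U i \<Longrightarrow> b \<in> fib p \<Longrightarrow> pt i p (\<kappa> i p b) = b"
    and add_fib: "b \<in> fib p \<Longrightarrow> b' \<in> fib p \<Longrightarrow> add b b' \<in> fib p"
    and sc_fib: "b \<in> fib p \<Longrightarrow> sc r b \<in> fib p"
    and zero_fib: "zero p \<in> fib p"
    and \<kappa>_add: "i \<in> I \<Longrightarrow> p \<in> U i \<Longrightarrow> b \<in> fib p \<Longrightarrow> b' \<in> fib p \<Longrightarrow> \<kappa> i p (add b b') = \<kappa> i p b + \<kappa> i p b'"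
    and \<kappa>_sc: "i \<in> I \<Longrightarrow> p \<in> U i \<Longrightarrow> b \<in> fib p \<Longrightarrow> \<kappa> i p (sc r b) = r *\<^sub>R \<kappa> i p b"
    and \<kappa>_zero: "i \<in> I \<Longrightarrow> p \<in> U i \<Longrightarrow> \<kappa> i p (zero p) = 0"
    and transition: "i \<in> I \<Longrightarrow> j \<in> I \<Longrightarrow> p \<in> U i \<Longrightarrow> p \<in> U j \<Longrightarrow> smooth_at At k p \<Longrightarrow>
      smooth_at At (\<lambda>q. \<kappa> j q (pt i q (k q))) p"
    and anc_tangent: "b \<in> fib p \<Longrightarrow> anc p b \<in> tangent_space At p"
    and anc_add: "b \<in> fib p \<Longrightarrow> b' \<in> fib p \<Longrightarrow> anc p (add b b') = (\<lambda>d. anc p b d + anc p b' d)"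
    and anc_sc: "b \<in> fib p \<Longrightarrow> anc p (sc r b) = (\<lambda>d. r *\<^sub>R anc p b d)"
begin

text \<open>A condition on the germ at \<open>p\<close>, so that frames and lifts over small open
  sets count as sections at each point of their domain without being extended first.\<close>

definition lsec :: "('p \<Rightarrow> 'b) \<Rightarrow> 'p \<Rightarrow> bool" where
  "lsec X p \<longleftrightarrow> (\<forall>\<^sub>F q in nhds p. X q \<in> fib q) \<and> (\<forall>i\<in>I. p \<in> U i \<longrightarrow> smooth_at At (\<lambda>q. \<kappa> i q (X q)) p)"

definition sect :: "'p set \<Rightarrow> ('p \<Rightarrow> 'b) set" where
  "sect V = {X \<in> extensional V. \<forall>p\<in>V. lsec X p}"

definition act :: "('p \<Rightarrow> 'b) \<Rightarrow> ('p \<Rightarrow> real) \<Rightarrow> 'p \<Rightarrow> real" where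
  "act X f = (\<lambda>p. deriv_along At p (anc p (X p)) f)"

lemma eventually_U: "i \<in> I \<Longrightarrow> p \<in> U i \<Longrightarrow> \<forall>\<^sub>F q in nhds p. q \<in> U i"
  using open_U by (intro eventually_nhds_in_open)

lemma eventually_W: "p \<in> W \<Longrightarrow> \<forall>\<^sub>F q in nhds p. q \<in> W"
  using open_W by (intro eventually_nhds_in_open)

lemma \<kappa>_inj: "i \<in> I \<Longrightarrow> p \<in> U i \<Longrightarrow> b \<in> fib p \<Longrightarrow> b' \<in> fib p \<Longrightarrow> \<kappa> i p b = \<kappa> i p b' \<Longrightarrow> b = b'"
  using pt_\<kappa> by metis

lemma lsec_fib: "lsec X p \<Longrightarrow> X p \<in> fib p"
  unfolding lsec_def using eventually_nhds_x_imp_x by blast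

lemma lsec_smooth: "lsec X p \<Longrightarrow> i \<in> I \<Longrightarrow> p \<in> U i \<Longrightarrow> smooth_at At (\<lambda>q. \<kappa> i q (X q)) p"
  unfolding lsec_def by blast

lemma sect_lsec: "X \<in> sect V \<Longrightarrow> p \<in> V \<Longrightarrow> lsec X p"
  and sect_ext: "X \<in> sect V \<Longrightarrow> X \<in> extensional V"
  unfolding sect_def by blast+

lemma sect_fib: "X \<in> sect V \<Longrightarrow> p \<in> V \<Longrightarrow> X p \<in> fib p"
  using sect_lsec lsec_fib by blast

text \<open>One trivialisation suffices, since changes of trivialisation preserve smooth
  coordinates.\<close>

lemma lsecI:
  assumes "\<forall>\<^sub>F q in nhds p. X q \<in> fib q" "i \<in> I" "p \<in> U i" "smooth_at At (\<lambda>q. \<kappa> i q (X q)) p"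
  shows "lsec X p"
  unfolding lsec_def
proof (intro conjI ballI impI assms(1))
  fix j assume j: "j \<in> I" "p \<in> U j"
  have "\<forall>\<^sub>F q in nhds p. \<kappa> j q (X q) = \<kappa> j q (pt i q (\<kappa> i q (X q)))"
    using assms(1) eventually_U[OF assms(2,3)] by eventually_elim (simp add: pt_\<kappa> assms(2))
  then show "smooth_at At (\<lambda>q. \<kappa> j q (X q)) p"
    by (rule N.smooth_at_transform[OF _ transition[OF assms(2) j(1) assms(3) j(2) assms(4)]])
qed

lemma lsec_transform:
  assumes "\<forall>\<^sub>F q in nhds p. X q = Y q" "lsec Y p" shows "lsec X p"
proof -
  obtain i where i: "i \<in> I" "p \<in> U i" using cover by blast
  show ?thesis
  proof (rule lsecI[OF _ i])
    have "\<forall>\<^sub>F q in nhds p. Y q \<in> fib q" using assms(2) by (simp add: lsec_def)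
    with assms(1) show "\<forall>\<^sub>F q in nhds p. X q \<in> fib q" by eventually_elim simp
    have "\<forall>\<^sub>F q in nhds p. \<kappa> i q (X q) = \<kappa> i q (Y q)" using assms(1) by eventually_elim simp
    then show "smooth_at At (\<lambda>q. \<kappa> i q (X q)) p" by (rule N.smooth_at_transform[OF _ lsec_smooth[OF assms(2) i]])
  qed
qed

lemma lsec_pt: "i \<in> I \<Longrightarrow> p \<in> U i \<Longrightarrow> smooth_at At k p \<Longrightarrow> lsec (\<lambda>q. pt i q (k q)) p"
proof (rule lsecI)
  assume *: "i \<in> I" "p \<in> U i" "smooth_at At k p"
  show "\<forall>\<^sub>F q in nhds p. pt i q (k q) \<in> fib q"
    using eventually_U[OF *(1,2)] by eventually_elim (simp add: pt_fib *)
  show "smooth_at At (\<lambda>q. \<kappa> i q (pt i q (k q))) p" by (rule transition) (fact *)+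
qed

lemma lsec_zero: "lsec zero p"
proof -
  obtain i where i: "i \<in> I" "p \<in> U i" using cover by blast
  have "\<forall>\<^sub>F q in nhds p. zero q = pt i q 0"
    using eventually_U[OF i]
  proof eventually_elim
    fix q assume "q \<in> U i"
    then show "zero q = pt i q 0" using i by (intro \<kappa>_inj[of i q]) (auto simp: zero_fib pt_fib \<kappa>_zero \<kappa>_pt)
  qed
  then show ?thesis by (rule lsec_transform) (simp add: lsec_pt i)
qed

lemma zero_eq: "i \<in> I \<Longrightarrow> p \<in> U i \<Longrightarrow> pt i p 0 = zero p"
  by (rule \<kappa>_inj[of i p]) (auto simp: zero_fib pt_fib \<kappa>_zero \<kappa>_pt)

lemma lsec_add: assumes "lsec X p" "lsec Y p" shows "lsec (\<lambda>q. add (X q) (Y q)) p"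
proof -
  obtain i where i: "i \<in> I" "p \<in> U i" using cover by blast
  have ev: "\<forall>\<^sub>F q in nhds p. X q \<in> fib q" "\<forall>\<^sub>F q in nhds p. Y q \<in> fib q" using assms by (simp_all add: lsec_def)
  show ?thesis
  proof (rule lsecI[OF _ i])
    show "\<forall>\<^sub>F q in nhds p. add (X q) (Y q) \<in> fib q" using ev by eventually_elim (rule add_fib)
    have "\<forall>\<^sub>F q in nhds p. \<kappa> i q (add (X q) (Y q)) = \<kappa> i q (X q) + \<kappa> i q (Y q)"
      using ev eventually_U[OF i] by eventually_elim (simp add: \<kappa>_add i)
    then show "smooth_at At (\<lambda>q. \<kappa> i q (add (X q) (Y q))) p"
      by (rule N.smooth_at_transform) (intro N.smooth_at_add lsec_smooth assms i)
  qed
qed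

lemma lsec_scale: assumes "lsec X p" "smooth_at At f p" shows "lsec (\<lambda>q. sc (f q) (X q)) p"
proof -
  obtain i where i: "i \<in> I" "p \<in> U i" using cover by blast
  have ev: "\<forall>\<^sub>F q in nhds p. X q \<in> fib q" using assms by (simp add: lsec_def)
  show ?thesis
  proof (rule lsecI[OF _ i])
    show "\<forall>\<^sub>F q in nhds p. sc (f q) (X q) \<in> fib q" using ev by eventually_elim (rule sc_fib)
    have "\<forall>\<^sub>F q in nhds p. \<kappa> i q (sc (f q) (X q)) = f q *\<^sub>R \<kappa> i q (X q)"
      using ev eventually_U[OF i] by eventually_elim (simp add: \<kappa>_sc i)
    then show "smooth_at At (\<lambda>q. \<kappa> i q (sc (f q) (X q))) p"
      by (rule N.smooth_at_transform) (intro N.smooth_at_scaleR lsec_smooth assms i)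
  qed
qed

lemma sectI:
  assumes "open V" "\<And>p. p \<in> V \<Longrightarrow> lsec (\<lambda>q. X q) p" shows "(\<lambda>p\<in>V. X p) \<in> sect V"
  unfolding sect_def
proof (intro CollectI conjI ballI)
  fix p assume p: "p \<in> V"
  have "\<forall>\<^sub>F q in nhds p. q \<in> V" using assms(1) p by (intro eventually_nhds_in_open)
  then have "\<forall>\<^sub>F q in nhds p. (\<lambda>p\<in>V. X p) q = X q" by eventually_elim simp
  then show "lsec (\<lambda>p\<in>V. X p) p" by (rule lsec_transform) (rule assms(2)[OF p])
qed auto

lemma sect_add: "open V \<Longrightarrow> X \<in> sect V \<Longrightarrow> Y \<in> sect V \<Longrightarrow> section_add add V X Y \<in> sect V"
  unfolding section_add_def by (intro sectI lsec_add sect_lsec)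

lemma sect_scale:
  "open V \<Longrightarrow> X \<in> sect V \<Longrightarrow> (\<And>p. p \<in> V \<Longrightarrow> smooth_at At f p) \<Longrightarrow> section_scale sc V f X \<in> sect V"
  unfolding section_scale_def by (intro sectI lsec_scale sect_lsec)

text \<open>The section with coordinates \<open>k\<close> over \<open>S\<close>, cut off by \<beta>
  and continued by zero. It is smooth as soon as \<beta> vanishes outside a closed subset of
  \<open>S\<close>.\<close>

definition ext :: "'i \<Rightarrow> 'p set \<Rightarrow> ('p \<Rightarrow> real) \<Rightarrow> ('p \<Rightarrow> 'w) \<Rightarrow> 'p \<Rightarrow> 'b" where
  "ext i S \<beta> k = (\<lambda>q\<in>W. if q \<in> S then pt i q (\<beta> q *\<^sub>R k q) else zero q)"

lemma ext_sect:
  assumes "i \<in> I" "open S" "S \<subseteq> W \<inter> U i" "closed K" "K \<subseteq> S" "\<And>q. q \<notin> K \<Longrightarrow> \<beta> q = 0"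
    "\<And>q. smooth_at At \<beta> q" "\<And>q. q \<in> S \<Longrightarrow> smooth_at At k q"
  shows "ext i S \<beta> k \<in> sect W"
  unfolding ext_def
proof (rule sectI[OF open_W])
  fix p assume p: "p \<in> W"
  show "lsec (\<lambda>q. if q \<in> S then pt i q (\<beta> q *\<^sub>R k q) else zero q) p"
  proof (cases "p \<in> S")
    case True
    have "\<forall>\<^sub>F q in nhds p. q \<in> S" using assms(2) True by (intro eventually_nhds_in_open)
    then have "\<forall>\<^sub>F q in nhds p. (if q \<in> S then pt i q (\<beta> q *\<^sub>R k q) else zero q) = pt i q (\<beta> q *\<^sub>R k q)"
      by eventually_elim simp
    then show ?thesis
      by (rule lsec_transform) (use True assms in \<open>auto intro!: lsec_pt\<close>)
  next
    case False
    then have "\<forall>\<^sub>F q in nhds p. q \<in> - K" using assms(4,5) by (intro eventually_nhds_in_open) auto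
    then have "\<forall>\<^sub>F q in nhds p. (if q \<in> S then pt i q (\<beta> q *\<^sub>R k q) else zero q) = zero q"
      by eventually_elim (use assms in \<open>auto simp: zero_eq\<close>)
    then show ?thesis by (rule lsec_transform) (rule lsec_zero)
  qed
qed

text \<open>Brackets and connections only accept sections over all of \<open>W\<close>. Cutting off
  with a function that is 1 near \<open>p\<close> produces such a section without changing the germ;
  this is what gives \<open>local_value\<close> a value on local frames.\<close>

lemma sect_extension:
  assumes "p \<in> W" "lsec X p"
  obtains X' where "X' \<in> sect W" "\<forall>\<^sub>F q in nhds p. X' q = X q"
proof -
  obtain i where i: "i \<in> I" "p \<in> U i" using cover by blast
  have "\<forall>\<^sub>F q in nhds p. q \<in> W \<and> q \<in> U i \<and> X q \<in> fib q \<and> smooth_at At (\<lambda>q. \<kappa> i q (X q)) q"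
    using eventually_W[OF assms(1)] eventually_U[OF i] assms(2) N.smooth_at_eventually[OF lsec_smooth[OF assms(2) i]]
    unfolding lsec_def by (intro eventually_conj) auto
  then obtain S where S: "open S" "p \<in> S" "\<forall>q\<in>S. q \<in> W \<and> q \<in> U i \<and> X q \<in> fib q \<and> smooth_at At (\<lambda>q. \<kappa> i q (X q)) q"
    unfolding eventually_nhds by blast
  obtain \<beta> :: "'p \<Rightarrow> real" and K where \<beta>: "\<And>q. smooth_at At \<beta> q" "\<forall>\<^sub>F q in nhds p. \<beta> q = 1"
    "closed K" "K \<subseteq> S" "\<And>q. q \<notin> K \<Longrightarrow> \<beta> q = 0" by (rule N.smooth_bump[OF S(1,2)]) (rule that)
  have "ext i S \<beta> (\<lambda>q. \<kappa> i q (X q)) \<in> sect W"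
    by (rule ext_sect[OF i(1) S(1) _ \<beta>(3,4,5,1)]) (use S in auto)
  moreover have "\<forall>\<^sub>F q in nhds p. q \<in> S" using S by (intro eventually_nhds_in_open)
  then have "\<forall>\<^sub>F q in nhds p. ext i S \<beta> (\<lambda>q. \<kappa> i q (X q)) q = X q"
    using \<beta>(2) by eventually_elim (use S i in \<open>auto simp: ext_def pt_\<kappa>\<close>)
  ultimately show ?thesis by (rule that)
qed

lemma sect_value:
  assumes "p \<in> W" "b \<in> fib p" obtains X where "X \<in> sect W" "X p = b"
proof -
  obtain i where i: "i \<in> I" "p \<in> U i" using cover by blast
  obtain X where "X \<in> sect W" "\<forall>\<^sub>F q in nhds p. X q = pt i q (\<kappa> i p b)"
    using sect_extension[OF assms(1) lsec_pt[OF i N.smooth_at_const]] by blast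
  then show ?thesis using that[of X] eventually_nhds_x_imp_x[of "\<lambda>q. X q = pt i q (\<kappa> i p b)" p]
    by (simp add: pt_\<kappa> i assms)
qed

text \<open>The classical argument that an operator linear over smooth functions only sees the value
  of its argument at \<open>p\<close>. Frames are local, so a multiple of the section by cut-off
  functions is expanded instead; \<open>T\<close> does not notice the multiple because the cut-off
  function is 1 at \<open>p\<close>.\<close>

lemma tensor_expansion:
  fixes T :: "('p \<Rightarrow> 'b) \<Rightarrow> 'u::real_vector"
  assumes R: "reproducing R" and p: "p \<in> W" and i: "i \<in> I" "p \<in> U i"
    and add: "\<And>X Y. X \<in> sect W \<Longrightarrow> Y \<in> sect W \<Longrightarrow> T (section_add add W X Y) = T X + T Y"
    and scale: "\<And>X f. X \<in> sect W \<Longrightarrow> (\<And>q. q \<in> W \<Longrightarrow> smooth_at At f q) \<Longrightarrow> T (section_scale sc W f X) = f p *\<^sub>R T X"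
  obtains E where "\<And>a. E a \<in> sect W" "\<And>a. \<forall>\<^sub>F q in nhds p. E a q = pt i q a"
    "\<And>X. X \<in> sect W \<Longrightarrow> T X = (\<Sum>a\<in>R. (\<kappa> i p (X p) \<bullet> a) *\<^sub>R T (E a))"
proof -
  define S where "S = W \<inter> U i"
  have S: "open S" "p \<in> S" "S \<subseteq> W \<inter> U i" using open_W open_U i p by (auto simp: S_def)
  obtain \<beta> :: "'p \<Rightarrow> real" and K where \<beta>: "\<And>q. smooth_at At \<beta> q" "\<forall>\<^sub>F q in nhds p. \<beta> q = 1"
    "closed K" "K \<subseteq> S" "\<And>q. q \<notin> K \<Longrightarrow> \<beta> q = 0" by (rule N.smooth_bump[OF S(1,2)]) (rule that)
  have \<beta>p: "\<beta> p = 1" using \<beta>(2) by (rule eventually_nhds_x_imp_x)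
  define E where "E a = ext i S \<beta> (\<lambda>_. a)" for a
  have sect: "ext i S \<beta> k \<in> sect W" if "\<And>q. q \<in> S \<Longrightarrow> smooth_at At k q" for k
    by (rule ext_sect[OF i(1) S(1,3) \<beta>(3,4,5,1)]) (use that in auto)
  have ES: "E a \<in> sect W" for a unfolding E_def by (rule sect) simp
  have Eev: "\<forall>\<^sub>F q in nhds p. E a q = pt i q a" for a
  proof -
    have "\<forall>\<^sub>F q in nhds p. q \<in> S" using S by (intro eventually_nhds_in_open)
    then show ?thesis using \<beta>(2) by eventually_elim (use S in \<open>auto simp: E_def ext_def\<close>)
  qed
  have sum: "T (ext i S \<beta> (\<lambda>q. \<Sum>a\<in>F. h a q *\<^sub>R a)) = (\<Sum>a\<in>F. h a p *\<^sub>R T (E a))"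
    if "finite F" "\<And>a q. smooth_at At (h a) q" for F h
    using that(1)
  proof (induction F)
    case empty
    have "ext i S \<beta> (\<lambda>q. 0) = section_scale sc W (\<lambda>_. 0) (ext i S \<beta> (\<lambda>q. 0))"
    proof
      fix q
      obtain j where j: "j \<in> I" "q \<in> U j" using cover by blast
      have "sc 0 (pt i q 0) = pt i q 0" if "q \<in> S"
        using that S i by (intro \<kappa>_inj[of i q]) (auto simp: \<kappa>_sc \<kappa>_pt pt_fib sc_fib)
      moreover have "sc 0 (zero q) = zero q"
        using j by (intro \<kappa>_inj[of j q]) (auto simp: \<kappa>_sc \<kappa>_zero zero_fib sc_fib)
      ultimately show "ext i S \<beta> (\<lambda>q. 0) q = section_scale sc W (\<lambda>_. 0) (ext i S \<beta> (\<lambda>q. 0)) q"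
        by (auto simp: ext_def section_scale_def)
    qed
    then have "T (ext i S \<beta> (\<lambda>q. 0)) = 0 *\<^sub>R T (ext i S \<beta> (\<lambda>q. 0))"
      using scale[OF sect, of "\<lambda>q. 0" "\<lambda>q. 0"] by simp
    then show ?case by simp
  next
    case (insert a F)
    have "ext i S \<beta> (\<lambda>q. \<Sum>a\<in>insert a F. h a q *\<^sub>R a)
      = section_add add W (section_scale sc W (h a) (E a)) (ext i S \<beta> (\<lambda>q. \<Sum>a\<in>F. h a q *\<^sub>R a))"
    proof
      fix q
      obtain j where j: "j \<in> I" "q \<in> U j" using cover by blast
      have "pt i q (\<beta> q *\<^sub>R (\<Sum>a\<in>insert a F. h a q *\<^sub>R a))
          = add (sc (h a q) (pt i q (\<beta> q *\<^sub>R a))) (pt i q (\<beta> q *\<^sub>R (\<Sum>a\<in>F. h a q *\<^sub>R a)))" if "q \<in> S"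
        using that S i insert(1,2)
        by (intro \<kappa>_inj[of i q]) (auto simp: \<kappa>_sc \<kappa>_add \<kappa>_pt pt_fib sc_fib add_fib scaleR_add_right)
      moreover have "add (sc (h a q) (zero q)) (zero q) = zero q"
        using j by (intro \<kappa>_inj[of j q]) (auto simp: \<kappa>_sc \<kappa>_add \<kappa>_zero zero_fib sc_fib add_fib)
      ultimately show "ext i S \<beta> (\<lambda>q. \<Sum>a\<in>insert a F. h a q *\<^sub>R a) q =
          section_add add W (section_scale sc W (h a) (E a)) (ext i S \<beta> (\<lambda>q. \<Sum>a\<in>F. h a q *\<^sub>R a)) q"
        by (auto simp: ext_def section_scale_def section_add_def E_def)
    qed
    moreover have "section_scale sc W (h a) (E a) \<in> sect W" using that(2) by (intro sect_scale open_W ES)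
    moreover have "ext i S \<beta> (\<lambda>q. \<Sum>a\<in>F. h a q *\<^sub>R a) \<in> sect W"
      by (intro sect N.smooth_at_sum N.smooth_at_scaleR that(2) N.smooth_at_const)
    ultimately show ?case using insert add scale[OF ES that(2), of a a] by simp
  qed
  have "T X = (\<Sum>a\<in>R. (\<kappa> i p (X p) \<bullet> a) *\<^sub>R T (E a))" if X: "X \<in> sect W" for X
  proof -
    \<comment> \<open>One factor \<beta> makes the coefficient functions global, a second one is
      contained in the sections \<open>E a\<close>; therefore \<open>X\<close> is multiplied by
      \<beta> twice below.\<close>
    define h where "h a q = (if q \<in> S then \<beta> q *\<^sub>R (\<kappa> i q (X q) \<bullet> a) else 0)" for a q
    have h: "smooth_at At (h a) q" for a q unfolding h_def
    proof (rule N.smooth_at_extend_zero[OF S(1) \<beta>(3,4,5,1)])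
      assume "q \<in> S"
      then show "smooth_at At (\<lambda>q. \<kappa> i q (X q) \<bullet> a) q"
        using S i by (intro N.smooth_at_inner N.smooth_at_const lsec_smooth sect_lsec[OF X]) auto
    qed
    have s1: "section_scale sc W \<beta> X \<in> sect W" using X \<beta>(1) by (intro sect_scale open_W)
    have "section_scale sc W \<beta> (section_scale sc W \<beta> X) = ext i S \<beta> (\<lambda>q. \<Sum>a\<in>R. h a q *\<^sub>R a)"
    proof
      fix q
      show "section_scale sc W \<beta> (section_scale sc W \<beta> X) q = ext i S \<beta> (\<lambda>q. \<Sum>a\<in>R. h a q *\<^sub>R a) q"
      proof (cases "q \<in> W")
        case True
        obtain j where j: "j \<in> I" "q \<in> U j" using cover by blast
        have Xq: "X q \<in> fib q" using X True sect_fib by blast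
        show ?thesis
        proof (cases "q \<in> S")
          case True
          have "(\<Sum>a\<in>R. h a q *\<^sub>R a) = (\<Sum>a\<in>R. \<beta> q *\<^sub>R ((\<kappa> i q (X q) \<bullet> a) *\<^sub>R a))"
            using True by (simp add: h_def)
          also have "\<dots> = \<beta> q *\<^sub>R \<kappa> i q (X q)"
            using R unfolding reproducing_def scaleR_sum_right[symmetric] by simp
          finally have "sc (\<beta> q) (sc (\<beta> q) (X q)) = pt i q (\<beta> q *\<^sub>R (\<Sum>a\<in>R. h a q *\<^sub>R a))"
            using True S i Xq by (intro \<kappa>_inj[of i q]) (auto simp: \<kappa>_sc \<kappa>_pt sc_fib pt_fib)
          then show ?thesis using True S by (auto simp: ext_def section_scale_def)
        next
          case False
          then have "\<beta> q = 0" using \<beta>(4,5) by blast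
          then have "sc (\<beta> q) (sc (\<beta> q) (X q)) = zero q"
            using j Xq by (intro \<kappa>_inj[of j q]) (auto simp: \<kappa>_sc \<kappa>_zero sc_fib zero_fib)
          then show ?thesis using False \<open>q \<in> W\<close> by (simp add: ext_def section_scale_def)
        qed
      qed (simp add: ext_def section_scale_def)
    qed
    then have "T X = T (ext i S \<beta> (\<lambda>q. \<Sum>a\<in>R. h a q *\<^sub>R a))"
      using scale[OF s1 \<beta>(1)] scale[OF X \<beta>(1)] \<beta>p by simp
    also have "\<dots> = (\<Sum>a\<in>R. h a p *\<^sub>R T (E a))" using sum[OF _ h] R by (simp add: reproducing_def)
    also have "\<dots> = (\<Sum>a\<in>R. (\<kappa> i p (X p) \<bullet> a) *\<^sub>R T (E a))" using S(2) \<beta>p by (simp add: h_def)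
    finally show ?thesis .
  qed
  then show ?thesis using that[OF ES Eev] by blast
qed

lemma smooth_fun_W: "smooth_fun At W f \<longleftrightarrow> (\<forall>p\<in>W. smooth_at At f p)"
  by (rule N.smooth_fun_iff[OF open_W])

lemma deriv_\<kappa>_cong:
  assumes "\<forall>\<^sub>F q in nhds p. X q = Y q"
  shows "deriv_along At p v (\<lambda>q. \<kappa> i q (X q)) = deriv_along At p v (\<lambda>q. \<kappa> i q (Y q))"
  by (rule N.deriv_along_eventually) (use assms in eventually_elim, simp)

section \<open>Leibniz brackets: locality and coordinate expression\<close>

context
  fixes B assumes B: "leibniz_bracket (sect W) add sc W {f. smooth_fun At W f} act B"
begin

lemma bracket_sect: "X \<in> sect W \<Longrightarrow> Y \<in> sect W \<Longrightarrow> B X Y \<in> sect W"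
  and bracket_anti: "X \<in> sect W \<Longrightarrow> Y \<in> sect W \<Longrightarrow> B X Y = section_scale sc W (\<lambda>_. -1) (B Y X)"
  and bracket_add: "X \<in> sect W \<Longrightarrow> Y \<in> sect W \<Longrightarrow> Z \<in> sect W \<Longrightarrow>
    B X (section_add add W Y Z) = section_add add W (B X Y) (B X Z)"
  and bracket_leibniz: "X \<in> sect W \<Longrightarrow> Y \<in> sect W \<Longrightarrow> (\<And>p. p \<in> W \<Longrightarrow> smooth_at At f p) \<Longrightarrow>
    B X (section_scale sc W f Y) = section_add add W (section_scale sc W f (B X Y)) (section_scale sc W (act X f) Y)"
proof -
  note * = B[unfolded leibniz_bracket_def, rule_format]
  show "X \<in> sect W \<Longrightarrow> Y \<in> sect W \<Longrightarrow> B X Y \<in> sect W" using * by blast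
  show "X \<in> sect W \<Longrightarrow> Y \<in> sect W \<Longrightarrow> B X Y = section_scale sc W (\<lambda>_. -1) (B Y X)" using * by blast
  show "X \<in> sect W \<Longrightarrow> Y \<in> sect W \<Longrightarrow> Z \<in> sect W \<Longrightarrow>
    B X (section_add add W Y Z) = section_add add W (B X Y) (B X Z)" using * by blast
  show "X \<in> sect W \<Longrightarrow> Y \<in> sect W \<Longrightarrow> (\<And>p. p \<in> W \<Longrightarrow> smooth_at At f p) \<Longrightarrow>
    B X (section_scale sc W f Y) = section_add add W (section_scale sc W f (B X Y)) (section_scale sc W (act X f) Y)"
    using * smooth_fun_W[of f] by blast
qed

text \<open>If \<beta> is supported where \<open>Y\<close> and \<open>Y'\<close> agree, both have
  the same product with \<beta>. The Leibniz rule at \<open>p\<close>, where \<beta> is 1, returns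
  the two brackets up to the same multiple of the common value at \<open>p\<close>.\<close>

lemma bracket_germ_right:
  assumes "X \<in> sect W" "Y \<in> sect W" "Y' \<in> sect W" "p \<in> W" "\<forall>\<^sub>F q in nhds p. Y q = Y' q"
  shows "B X Y p = B X Y' p"
proof -
  obtain i where i: "i \<in> I" "p \<in> U i" using cover by blast
  obtain S where S: "open S" "p \<in> S" "\<forall>q\<in>S. Y q = Y' q" using assms(5) unfolding eventually_nhds by blast
  obtain \<beta> :: "'p \<Rightarrow> real" and K where \<beta>: "\<And>q. smooth_at At \<beta> q" "\<forall>\<^sub>F q in nhds p. \<beta> q = 1"
    "closed K" "K \<subseteq> S" "\<And>q. q \<notin> K \<Longrightarrow> \<beta> q = 0" by (rule N.smooth_bump[OF S(1,2)]) (rule that)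
  have \<beta>p: "\<beta> p = 1" using \<beta>(2) by (rule eventually_nhds_x_imp_x)
  have "sc 0 b = zero q" if "b \<in> fib q" for b q
  proof -
    obtain j where "j \<in> I" "q \<in> U j" using cover by blast
    then show ?thesis using that by (intro \<kappa>_inj[of j q]) (auto simp: \<kappa>_sc \<kappa>_zero sc_fib zero_fib)
  qed
  then have "section_scale sc W \<beta> Y = section_scale sc W \<beta> Y'"
    using S(3) \<beta>(4,5) sect_fib[OF assms(2)] sect_fib[OF assms(3)]
    by (auto simp: section_scale_def fun_eq_iff) (metis subsetD)
  then have "B X (section_scale sc W \<beta> Y) p = B X (section_scale sc W \<beta> Y') p" by simp
  then have "\<kappa> i p (add (sc 1 (B X Y p)) (sc (act X \<beta> p) (Y p))) = \<kappa> i p (add (sc 1 (B X Y' p)) (sc (act X \<beta> p) (Y p)))"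
    using bracket_leibniz[OF assms(1,2) \<beta>(1)] bracket_leibniz[OF assms(1,3) \<beta>(1)] assms(4) \<beta>p S
    by (simp add: section_add_def section_scale_def)
  moreover have "B X Y p \<in> fib p" "B X Y' p \<in> fib p" "Y p \<in> fib p"
    using assms by (auto intro!: sect_fib bracket_sect)
  ultimately show ?thesis using i by (intro \<kappa>_inj[of i p]) (auto simp: \<kappa>_add \<kappa>_sc sc_fib)
qed

lemma bracket_germ:
  assumes "X \<in> sect W" "X' \<in> sect W" "Y \<in> sect W" "Y' \<in> sect W" "p \<in> W"
    "\<forall>\<^sub>F q in nhds p. X q = X' q" "\<forall>\<^sub>F q in nhds p. Y q = Y' q"
  shows "B X Y p = B X' Y' p"
proof -
  have "B X Y p = B X Y' p" by (rule bracket_germ_right[OF assms(1,3,4,5,7)])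
  also have "\<dots> = sc (-1) (B Y' X p)" using bracket_anti[OF assms(1,4)] assms(5) by (simp add: section_scale_def)
  also have "B Y' X p = B Y' X' p" by (rule bracket_germ_right[OF assms(4,1,2,5,6)])
  also have "sc (-1) (B Y' X' p) = B X' Y' p" using bracket_anti[OF assms(2,4)] assms(5) by (simp add: section_scale_def)
  finally show ?thesis .
qed

lemma local_value_bracket:
  assumes "X' \<in> sect W" "Y' \<in> sect W" "p \<in> W" "\<forall>\<^sub>F q in nhds p. X' q = X q" "\<forall>\<^sub>F q in nhds p. Y' q = Y q"
  shows "local_value (sect W) (sect W) B X Y p = B X' Y' p"
  unfolding local_value_def
proof (rule the_equality)
  show "\<exists>X''\<in>sect W. \<exists>Y''\<in>sect W. (\<forall>\<^sub>F q in nhds p. X'' q = X q \<and> Y'' q = Y q) \<and> B X' Y' p = B X'' Y'' p"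
    using assms eventually_conj by blast
  fix w assume "\<exists>X''\<in>sect W. \<exists>Y''\<in>sect W. (\<forall>\<^sub>F q in nhds p. X'' q = X q \<and> Y'' q = Y q) \<and> w = B X'' Y'' p"
  then obtain X'' Y'' where *: "X'' \<in> sect W" "Y'' \<in> sect W" "\<forall>\<^sub>F q in nhds p. X'' q = X q \<and> Y'' q = Y q" "w = B X'' Y'' p"
    by blast
  have "\<forall>\<^sub>F q in nhds p. X'' q = X' q" "\<forall>\<^sub>F q in nhds p. Y'' q = Y' q"
    using *(3) assms(4,5) by (eventually_elim, simp)+
  then show "w = B X' Y' p" using bracket_germ[OF *(1) assms(1) *(2) assms(2,3)] *(4) by simp
qed

text \<open>Subtracting the commutator of coordinate derivatives removes the derivative terms of the
  Leibniz rule, so the remainder \<open>T\<close> is bilinear over smooth functions and can be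
  expanded over frames. Frames have constant coordinates, hence \<open>T\<close> is the bracket
  itself on them.\<close>

lemma bracket_formula:
  assumes R: "reproducing R" and XY: "X \<in> sect W" "Y \<in> sect W" and p: "p \<in> W" and i: "i \<in> I" "p \<in> U i"
  shows "\<kappa> i p (B X Y p) = deriv_along At p (anc p (X p)) (\<lambda>q. \<kappa> i q (Y q))
      - deriv_along At p (anc p (Y p)) (\<lambda>q. \<kappa> i q (X q))
      + (\<Sum>a\<in>R. \<Sum>c\<in>R. ((\<kappa> i p (X p) \<bullet> a) * (\<kappa> i p (Y p) \<bullet> c)) *\<^sub>R
          \<kappa> i p (local_value (sect W) (sect W) B (\<lambda>q. pt i q a) (\<lambda>q. pt i q c) p))"
proof -
  define T where "T X Y = \<kappa> i p (B X Y p) - (deriv_along At p (anc p (X p)) (\<lambda>q. \<kappa> i q (Y q))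
      - deriv_along At p (anc p (Y p)) (\<lambda>q. \<kappa> i q (X q)))" for X Y
  note fb = sect_fib[OF _ p]
  have ev: "\<forall>\<^sub>F q in nhds p. q \<in> W \<and> q \<in> U i" using eventually_W[OF p] eventually_U[OF i] by eventually_elim simp
  note sm = lsec_smooth[OF sect_lsec[OF _ p] i]
  have add: "T X (section_add add W Y Z) = T X Y + T X Z" if "X \<in> sect W" "Y \<in> sect W" "Z \<in> sect W" for X Y Z
  proof -
    have "\<forall>\<^sub>F q in nhds p. \<kappa> i q (section_add add W Y Z q) = \<kappa> i q (Y q) + \<kappa> i q (Z q)"
      using ev by eventually_elim (use that i in \<open>auto simp: section_add_def \<kappa>_add sect_fib\<close>)
    then have "deriv_along At p (anc p (X p)) (\<lambda>q. \<kappa> i q (section_add add W Y Z q))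
      = deriv_along At p (anc p (X p)) (\<lambda>q. \<kappa> i q (Y q)) + deriv_along At p (anc p (X p)) (\<lambda>q. \<kappa> i q (Z q))"
      using N.deriv_along_add[OF anc_tangent[OF fb[OF that(1)]] sm[OF that(2)] sm[OF that(3)]]
        N.deriv_along_eventually by metis
    moreover have "deriv_along At p (anc p (section_add add W Y Z p)) (\<lambda>q. \<kappa> i q (X q))
      = deriv_along At p (anc p (Y p)) (\<lambda>q. \<kappa> i q (X q)) + deriv_along At p (anc p (Z p)) (\<lambda>q. \<kappa> i q (X q))"
      using p that fb N.deriv_along_add_vector[OF anc_tangent anc_tangent sm]
      by (simp add: section_add_def anc_add)
    moreover have "\<kappa> i p (B X (section_add add W Y Z) p) = \<kappa> i p (B X Y p) + \<kappa> i p (B X Z p)"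
      using that p i by (simp add: bracket_add[OF that]) (simp add: section_add_def \<kappa>_add fb bracket_sect)
    ultimately show ?thesis by (simp add: T_def)
  qed
  have scale: "T X (section_scale sc W f Y) = f p *\<^sub>R T X Y"
    if "X \<in> sect W" "Y \<in> sect W" "\<And>q. q \<in> W \<Longrightarrow> smooth_at At f q" for X Y f
  proof -
    have "\<forall>\<^sub>F q in nhds p. \<kappa> i q (section_scale sc W f Y q) = f q *\<^sub>R \<kappa> i q (Y q)"
      using ev by eventually_elim (use that i in \<open>auto simp: section_scale_def \<kappa>_sc sect_fib\<close>)
    then have "deriv_along At p (anc p (X p)) (\<lambda>q. \<kappa> i q (section_scale sc W f Y q))
      = f p *\<^sub>R deriv_along At p (anc p (X p)) (\<lambda>q. \<kappa> i q (Y q)) + act X f p *\<^sub>R \<kappa> i p (Y p)"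
      using N.deriv_along_scaleR[OF anc_tangent[OF fb[OF that(1)]] that(3)[OF p] sm[OF that(2)]]
        N.deriv_along_eventually unfolding act_def by metis
    moreover have "deriv_along At p (anc p (section_scale sc W f Y p)) (\<lambda>q. \<kappa> i q (X q))
      = f p *\<^sub>R deriv_along At p (anc p (Y p)) (\<lambda>q. \<kappa> i q (X q))"
      using p that fb N.deriv_along_scale_vector[OF anc_tangent sm]
      by (simp add: section_scale_def anc_sc)
    moreover have "\<kappa> i p (B X (section_scale sc W f Y) p) = f p *\<^sub>R \<kappa> i p (B X Y p) + act X f p *\<^sub>R \<kappa> i p (Y p)"
      using that p i by (simp add: bracket_leibniz[OF that])
        (simp add: section_add_def section_scale_def \<kappa>_add \<kappa>_sc fb bracket_sect sc_fib)
    ultimately show ?thesis by (simp add: T_def algebra_simps)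
  qed
  \<comment> \<open>The rules above concern the second argument; antisymmetry carries them over to
    the first.\<close>
  have anti: "T X Y = - T Y X" if "X \<in> sect W" "Y \<in> sect W" for X Y
    using bracket_anti[OF that] p i fb[OF bracket_sect[OF that(2,1)]]
    by (simp add: T_def section_scale_def \<kappa>_sc)
  have TE: "T X' Y' = \<kappa> i p (local_value (sect W) (sect W) B (\<lambda>q. pt i q a) (\<lambda>q. pt i q c) p)"
    if "X' \<in> sect W" "\<forall>\<^sub>F q in nhds p. X' q = pt i q a" "Y' \<in> sect W" "\<forall>\<^sub>F q in nhds p. Y' q = pt i q c" for X' Y' a c
  proof -
    have "deriv_along At p v (\<lambda>q. \<kappa> i q (Z q)) = 0" if "\<forall>\<^sub>F q in nhds p. Z q = pt i q e" for v Z e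
    proof -
      have "\<forall>\<^sub>F q in nhds p. \<kappa> i q (Z q) = e" using that ev by eventually_elim (simp add: \<kappa>_pt i)
      then show ?thesis using N.deriv_along_eventually[where g = "\<lambda>_. e"] by simp
    qed
    then show ?thesis using that local_value_bracket[OF that(1,3) p that(2,4)] by (simp add: T_def)
  qed
  obtain E where E: "\<And>a. E a \<in> sect W" "\<And>a. \<forall>\<^sub>F q in nhds p. E a q = pt i q a"
    "\<And>Y. Y \<in> sect W \<Longrightarrow> T X Y = (\<Sum>a\<in>R. (\<kappa> i p (Y p) \<bullet> a) *\<^sub>R T X (E a))"
    using tensor_expansion[OF R p i, of "T X"] add[OF XY(1)] scale[OF XY(1)] by blast
  have "T X (E c) = (\<Sum>a\<in>R. (\<kappa> i p (X p) \<bullet> a) *\<^sub>R \<kappa> i p (local_value (sect W) (sect W) B (\<lambda>q. pt i q a) (\<lambda>q. pt i q c) p))" for c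
  proof -
    obtain E' where E': "\<And>a. E' a \<in> sect W" "\<And>a. \<forall>\<^sub>F q in nhds p. E' a q = pt i q a"
      "\<And>Y. Y \<in> sect W \<Longrightarrow> T (E c) Y = (\<Sum>a\<in>R. (\<kappa> i p (Y p) \<bullet> a) *\<^sub>R T (E c) (E' a))"
      using tensor_expansion[OF R p i, of "T (E c)"] add[OF E(1)] scale[OF E(1)] by blast
    have "T X (E c) = - T (E c) X" by (rule anti[OF XY(1) E(1)])
    also have "\<dots> = (\<Sum>a\<in>R. (\<kappa> i p (X p) \<bullet> a) *\<^sub>R T (E' a) (E c))"
      unfolding E'(3)[OF XY(1)] anti[OF E(1) E'(1)] by (simp add: sum_negf)
    finally show ?thesis using TE[OF E'(1,2) E(1,2)] by simp
  qed
  then have "T X Y = (\<Sum>c\<in>R. (\<kappa> i p (Y p) \<bullet> c) *\<^sub>R (\<Sum>a\<in>R. (\<kappa> i p (X p) \<bullet> a) *\<^sub>R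
      \<kappa> i p (local_value (sect W) (sect W) B (\<lambda>q. pt i q a) (\<lambda>q. pt i q c) p)))"
    unfolding E(3)[OF XY(2)] by simp
  also have "\<dots> = (\<Sum>c\<in>R. \<Sum>a\<in>R. ((\<kappa> i p (X p) \<bullet> a) * (\<kappa> i p (Y p) \<bullet> c)) *\<^sub>R
      \<kappa> i p (local_value (sect W) (sect W) B (\<lambda>q. pt i q a) (\<lambda>q. pt i q c) p))"
    by (simp add: scaleR_sum_right mult.commute)
  also have "\<dots> = (\<Sum>a\<in>R. \<Sum>c\<in>R. ((\<kappa> i p (X p) \<bullet> a) * (\<kappa> i p (Y p) \<bullet> c)) *\<^sub>R
      \<kappa> i p (local_value (sect W) (sect W) B (\<lambda>q. pt i q a) (\<lambda>q. pt i q c) p))"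
    by (rule sum.swap)
  finally show ?thesis unfolding T_def by (simp add: algebra_simps)
qed

end

end

section \<open>Sections of the bundle, its pull-back and its prolongation\<close>

context partial_finsler
begin

text \<open>In total coordinates the argument of \<open>F\<close> is the pair of the base
  coordinates of \<phi> and the fibre coordinates \<open>k\<close>. The source manifold is left open
  because both the base, with \<phi> the identity, and the total space, with \<phi> the projection,
  occur.\<close>

lemma smooth_frame_comp:
  assumes "smooth_manifold At" "b \<in> \<BB>" "\<phi> p \<in> dom b" "\<forall>\<^sub>F q in nhds p. \<phi> q \<in> dom b"
    "smooth_at At (\<lambda>q. snd (fst b) (\<phi> q)) p" "smooth_at At k p" "smooth_at Ts F (frame A b (k p) (\<phi> p))"
  shows "smooth_at At (\<lambda>q. F (frame A b (k q) (\<phi> q))) p"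
proof -
  interpret N: smooth_manifold At by fact
  show ?thesis
  proof (rule N.smooth_at_compose_map[OF model_total _ N.smooth_at_Pair[OF assms(5,6)]])
    show "Cinf_at (\<lambda>z. F (chart_inv (tc b) z)) (snd (fst b) (\<phi> p), k p)"
      using assms(7) tot.smooth_at_chart[of "tc b" "frame A b (k p) (\<phi> p)" F] assms(2,3)
      by (simp add: bundle_chart pi_frame psi_frame snd_tc)
    show "\<forall>\<^sub>F q in nhds p. F (frame A b (k q) (\<phi> q)) = F (chart_inv (tc b) (snd (fst b) (\<phi> q), k q))"
      using assms(4) by eventually_elim (simp add: chart_inv_tc assms(2))
  qed
qed

text \<open>The base coordinates of a section are smooth automatically, so only its fibre
  coordinates remain to be tested; continuity follows from smooth coordinates since total charts are
  homeomorphisms. The map \<phi> covers ordinary sections and sections of the pull-back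
  together.\<close>

lemma smooth_map_total_iff:
  assumes "smooth_manifold At" "open W" and lim: "\<And>p. p \<in> W \<Longrightarrow> filterlim \<phi> (nhds (\<phi> p)) (nhds p)"
    and crd: "\<And>p b. p \<in> W \<Longrightarrow> b \<in> \<BB> \<Longrightarrow> \<phi> p \<in> dom b \<Longrightarrow> smooth_at At (\<lambda>q. snd (fst b) (\<phi> q)) p"
    and fib: "\<And>p. p \<in> W \<Longrightarrow> \<pi> (X p) = \<phi> p"
  shows "smooth_map At Ts W X \<longleftrightarrow> (\<forall>p\<in>W. \<forall>b\<in>\<BB>. \<phi> p \<in> dom b \<longrightarrow> smooth_at At (\<lambda>q. snd b (X q)) p)"
proof -
  interpret N: smooth_manifold At by fact
  have evW: "\<forall>\<^sub>F q in nhds p. q \<in> W" if "p \<in> W" for p using assms(2) that by (intro eventually_nhds_in_open)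
  have tcp: "smooth_at At (\<lambda>q. snd (tc b) (X q)) p \<longleftrightarrow> smooth_at At (\<lambda>q. snd b (X q)) p"
    if "p \<in> W" "b \<in> \<BB>" "\<phi> p \<in> dom b" for p b
  proof
    assume "smooth_at At (\<lambda>q. snd (tc b) (X q)) p"
    from N.smooth_at_snd[OF this] show "smooth_at At (\<lambda>q. snd b (X q)) p" by (simp add: snd_tc)
  next
    assume "smooth_at At (\<lambda>q. snd b (X q)) p"
    then have "smooth_at At (\<lambda>q. (snd (fst b) (\<phi> q), snd b (X q))) p" by (intro N.smooth_at_Pair crd that)
    moreover have "\<forall>\<^sub>F q in nhds p. snd (tc b) (X q) = (snd (fst b) (\<phi> q), snd b (X q))"
      using evW[OF that(1)] by eventually_elim (simp add: snd_tc fib)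
    ultimately show "smooth_at At (\<lambda>q. snd (tc b) (X q)) p" by (rule N.smooth_at_transform[rotated])
  qed
  have iff: "smooth_map At Ts W X \<longleftrightarrow>
    continuous_on W X \<and> (\<forall>p\<in>W. \<forall>d\<in>Ts. X p \<in> fst d \<longrightarrow> smooth_at At (\<lambda>q. snd d (X q)) p)"
    by (rule N.smooth_map_iff[OF assms(2)]) (rule tot.chart_open)
  have "(\<forall>p\<in>W. \<forall>d\<in>Ts. X p \<in> fst d \<longrightarrow> smooth_at At (\<lambda>q. snd d (X q)) p) \<longleftrightarrow>
    (\<forall>p\<in>W. \<forall>b\<in>\<BB>. \<phi> p \<in> dom b \<longrightarrow> smooth_at At (\<lambda>q. snd (tc b) (X q)) p)"
    unfolding total_atlas_def by (simp add: fib)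
  also have "\<dots> \<longleftrightarrow> (\<forall>p\<in>W. \<forall>b\<in>\<BB>. \<phi> p \<in> dom b \<longrightarrow> smooth_at At (\<lambda>q. snd b (X q)) p)"
    using tcp by blast
  finally have eq: "(\<forall>p\<in>W. \<forall>d\<in>Ts. X p \<in> fst d \<longrightarrow> smooth_at At (\<lambda>q. snd d (X q)) p) \<longleftrightarrow>
    (\<forall>p\<in>W. \<forall>b\<in>\<BB>. \<phi> p \<in> dom b \<longrightarrow> smooth_at At (\<lambda>q. snd b (X q)) p)" .
  have "continuous_on W X" if sm: "\<forall>p\<in>W. \<forall>b\<in>\<BB>. \<phi> p \<in> dom b \<longrightarrow> smooth_at At (\<lambda>q. snd b (X q)) p"
    unfolding continuous_on_open_nhds[OF assms(2)] filterlim_iff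
  proof (intro ballI allI impI)
    fix p P assume p: "p \<in> W" and P: "\<forall>\<^sub>F u in nhds (X p). P u"
    obtain b where b: "b \<in> \<BB>" "\<phi> p \<in> dom b" using ex_bundle_chart by blast
    have Pz: "\<forall>\<^sub>F z in nhds (snd (tc b) (X p)). P (chart_inv (tc b) z)"
      using P tot.eventually_chart[of "tc b" "X p" P] b p by (simp add: bundle_chart fib)
    have fl: "((\<lambda>q. snd (tc b) (X q)) \<longlongrightarrow> snd (tc b) (X p)) (nhds p)"
      using sm p b tcp by (intro N.smooth_at_tendsto) blast
    have "\<forall>\<^sub>F q in nhds p. P (chart_inv (tc b) (snd (tc b) (X q)))"
      using fl[unfolded filterlim_iff, rule_format, of "\<lambda>z. P (chart_inv (tc b) z)"] Pz by blast
    moreover have "\<forall>\<^sub>F q in nhds p. \<phi> q \<in> dom b"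
      using lim[OF p, unfolded filterlim_iff, rule_format, of "\<lambda>y. y \<in> dom b"] eventually_dom[OF b] by blast
    ultimately show "\<forall>\<^sub>F q in nhds p. P (X q)" using evW[OF p]
      by eventually_elim (simp add: tot.chart_inv_chart bundle_chart b fib)
  qed
  then show ?thesis using iff eq by blast
qed

lemma anchor_tangent: "anchor A u \<in> tangent_space Bs (\<pi> u)"
  and anchor_add: "\<pi> u = \<pi> w \<Longrightarrow> anchor A (fadd A u w) = (\<lambda>c. anchor A u c + anchor A w c)"
  and anchor_scale: "anchor A (fscale A r u) = (\<lambda>c. r *\<^sub>R anchor A u c)"
  using am unfolding anchor_morphism_def by blast+

lemma smooth_anchor: assumes "c \<in> Bs" "\<pi> u \<in> fst c" shows "smooth_at Ts (\<lambda>u. anchor A u c) u"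
proof -
  have "smooth_fun Ts (\<pi> -` fst c) (\<lambda>u. anchor A u c)"
    using am assms(1) unfolding anchor_morphism_def by blast
  then show ?thesis
    using tot.smooth_fun_iff[OF pi_continuous[OF base.chart_open(1)[OF assms(1)]], of "\<lambda>u. anchor A u c"] assms(2)
    by simp
qed

lemma anchor_coeff_psi: "b \<in> \<BB> \<Longrightarrow> \<pi> u \<in> dom b \<Longrightarrow> anchor_coeff A b (snd b u) (\<pi> u) = anchor A u (fst b)"
  by (simp add: anchor_coeff_def frame_psi)

lemma frame_add: "b \<in> \<BB> \<Longrightarrow> x \<in> dom b \<Longrightarrow> frame A b (v + w) x = fadd A (frame A b v x) (frame A b w x)"
  and frame_scale: "b \<in> \<BB> \<Longrightarrow> x \<in> dom b \<Longrightarrow> frame A b (r *\<^sub>R v) x = fscale A r (frame A b v x)"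
  by (rule fibre_eqI[of b]; simp add: pi_frame psi_frame bundle_chart)+

lemma linear_anchor_coeff: "b \<in> \<BB> \<Longrightarrow> x \<in> dom b \<Longrightarrow> linear (\<lambda>a. anchor_coeff A b a x)"
  by (rule linearI) (simp_all add: anchor_coeff_def frame_add frame_scale anchor_add anchor_scale pi_frame)

lemma smooth_manifold_Bs: "smooth_manifold Bs" and smooth_manifold_Ts: "smooth_manifold Ts"
  by unfold_locales

lemma smooth_frame_comp_base:
  "b \<in> \<BB> \<Longrightarrow> x \<in> dom b \<Longrightarrow> smooth_at Bs k x \<Longrightarrow> smooth_at Ts F (frame A b (k x) x) \<Longrightarrow>
    smooth_at Bs (\<lambda>q. F (frame A b (k q) q)) x"
  by (rule smooth_frame_comp[OF smooth_manifold_Bs, of b "\<lambda>x. x"])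
    (simp_all add: eventually_dom base.smooth_at_chart_map bundle_chart)

lemma smooth_frame_comp_total:
  "b \<in> \<BB> \<Longrightarrow> \<pi> u \<in> dom b \<Longrightarrow> smooth_at Ts k u \<Longrightarrow> smooth_at Ts F (frame A b (k u) (\<pi> u)) \<Longrightarrow>
    smooth_at Ts (\<lambda>q. F (frame A b (k q) (\<pi> q))) u"
  by (rule smooth_frame_comp[OF smooth_manifold_Ts, of b \<pi>]) (simp_all add: eventually_pi_dom smooth_base_coords)

lemma smooth_anchor_coeff_base:
  "b \<in> \<BB> \<Longrightarrow> x \<in> dom b \<Longrightarrow> smooth_at Bs k x \<Longrightarrow> smooth_at Bs (\<lambda>q. anchor_coeff A b (k q) q) x"
  unfolding anchor_coeff_def
  by (rule smooth_frame_comp_base) (simp_all add: smooth_anchor bundle_chart pi_frame)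

lemma smooth_anchor_coeff_total:
  "b \<in> \<BB> \<Longrightarrow> \<pi> u \<in> dom b \<Longrightarrow> smooth_at Ts k u \<Longrightarrow> smooth_at Ts (\<lambda>q. anchor_coeff A b (k q) (\<pi> q)) u"
  unfolding anchor_coeff_def
  by (rule smooth_frame_comp_total) (simp_all add: smooth_anchor bundle_chart pi_frame)

sublocale bm: coord_module Bs UNIV "\<lambda>x. {u. \<pi> u = x}" "fadd A" "fscale A" "zero_vec A" \<BB> dom
  "\<lambda>b x u. snd b u" "\<lambda>b x w. frame A b w x" "\<lambda>x u. anchor A u"
proof
  show "smooth_at Bs (\<lambda>q. snd j (frame A i (k q) q)) p"
    if "i \<in> \<BB>" "j \<in> \<BB>" "p \<in> dom i" "p \<in> dom j" "smooth_at Bs k p" for i j p k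
    by (rule smooth_frame_comp_base) (use that in \<open>simp_all add: smooth_psi pi_frame\<close>)
  show "frame A i (snd i u) p = u" if "i \<in> \<BB>" "p \<in> dom i" "u \<in> {u. \<pi> u = p}" for i p u
    using that frame_psi[of i u] by simp
qed (use ex_bundle_chart anchor_tangent in \<open>auto simp: open_dom pi_frame psi_frame frame_psi bundle_chart psi_zero
    anchor_add anchor_scale\<close>)

text \<open>The pull-back bundle enters without an anchor of its own; the zero map fulfils the
  anchor conditions, and the locale then supplies cut-off and extension of its sections.\<close>

sublocale pm: coord_module Ts CM "\<lambda>m. {u. \<pi> u = \<pi> m}" "fadd A" "fscale A" "\<lambda>m. zero_vec A (\<pi> m)" \<BB>
  "\<lambda>b. \<pi> -` dom b" "\<lambda>b m u. snd b u" "\<lambda>b m w. frame A b w (\<pi> m)" "\<lambda>m u d. 0"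
proof
  show "smooth_at Ts (\<lambda>q. snd j (frame A i (k q) (\<pi> q))) p"
    if "i \<in> \<BB>" "j \<in> \<BB>" "p \<in> \<pi> -` dom i" "p \<in> \<pi> -` dom j" "smooth_at Ts k p" for i j p k
    by (rule smooth_frame_comp_total) (use that in \<open>simp_all add: smooth_psi pi_frame\<close>)
  show "frame A i (snd i u) (\<pi> p) = u" if "i \<in> \<BB>" "p \<in> \<pi> -` dom i" "u \<in> {u. \<pi> u = \<pi> p}" for i p u
    using that frame_psi[of i u] by simp
qed (use ex_bundle_chart in \<open>auto simp: open_dom pi_frame psi_frame bundle_chart psi_zero open_CM pi_continuous
    tot.tangent_zero\<close>)

text \<open>In a fibre of the prolongation the base component of the vector is \<rho> of the first
  component. Hence only its fibre component is recorded, and \<open>prol_pt\<close> restores the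
  rest from the anchor coefficients.\<close>

definition prol_coord :: "('m, 'e, 'a, 'f) bundle_chart \<Rightarrow> 'a \<Rightarrow> ('e, 'a, 'f) prol \<Rightarrow> 'f \<times> 'f" where
  "prol_coord b m p = (snd b (fst p), snd (snd p (tc b)))"

definition prol_pt :: "('m, 'e, 'a, 'f) bundle_chart \<Rightarrow> 'a \<Rightarrow> 'f \<times> 'f \<Rightarrow> ('e, 'a, 'f) prol" where
  "prol_pt b m w = (frame A b (fst w) (\<pi> m),
     coord_vector Ts (tc b) m (anchor_coeff A b (fst w) (\<pi> m), snd w))"

lemma prol_fiberD:
  assumes "p \<in> prol_fiber A m"
  shows "\<pi> (fst p) = \<pi> m" "snd p \<in> tangent_space Ts m" "anchor A (fst p) = tangent_map Ts Bs \<pi> m (snd p)"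
  using assms by (auto simp: prol_fiber_def)

text \<open>Both sides of the anchor condition are tangent vectors of the base, so agreement of
  their representatives in one chart is enough.\<close>

lemma prol_fiberI:
  assumes "\<pi> u = \<pi> m" "v \<in> tangent_space Ts m" "b \<in> \<BB>" "\<pi> m \<in> dom b" "anchor A u (fst b) = fst (v (tc b))"
  shows "(u, v) \<in> prol_fiber A m"
  using assms base.tangent_ext[of "anchor A u" "\<pi> m" "tangent_map Ts Bs \<pi> m v" "fst b"] anchor_tangent[of u]
  by (simp add: prol_fiber_def tangent_map_tangent bundle_chart tangent_map_tc)

lemma prol_vector_fst:
  assumes "p \<in> prol_fiber A m" "b \<in> \<BB>" "\<pi> m \<in> dom b"
  shows "fst (snd p (tc b)) = anchor_coeff A b (snd b (fst p)) (\<pi> m)"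
  using prol_fiberD[OF assms(1)] tangent_map_tc[OF prol_fiberD(2)[OF assms(1)] assms(2,3)]
    anchor_coeff_psi[OF assms(2), of "fst p"] assms(3) by simp

lemma prol_vector:
  "p \<in> prol_fiber A m \<Longrightarrow> b \<in> \<BB> \<Longrightarrow> \<pi> m \<in> dom b \<Longrightarrow>
    snd p (tc b) = (anchor_coeff A b (fst (prol_coord b m p)) (\<pi> m), snd (prol_coord b m p))"
  using prol_vector_fst by (simp add: prol_coord_def prod_eq_iff)

sublocale qm: coord_module Ts CM "prol_fiber A" "prol_add A" "prol_scale A" "\<lambda>m. (zero_vec A (\<pi> m), \<lambda>_. 0)" \<BB>
  "\<lambda>b. \<pi> -` dom b" prol_coord prol_pt "\<lambda>m p. snd p"
proof
  note simps = bundle_chart pi_frame psi_frame tot.coord_vector_chart tot.coord_vector_tangent prol_fiberD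
    prol_coord_def prol_pt_def prol_add_def prol_scale_def tot.tangent_add tot.tangent_scale
  show "open CM" by (rule open_CM)
  show "open (\<pi> -` dom i)" if "i \<in> \<BB>" for i using that by (simp add: pi_continuous open_dom)
  show "\<exists>i\<in>\<BB>. p \<in> \<pi> -` dom i" for p using ex_bundle_chart by simp
  show "prol_pt i p w \<in> prol_fiber A p" if "i \<in> \<BB>" "p \<in> \<pi> -` dom i" for i p w
    unfolding prol_pt_def by (rule prol_fiberI[OF _ _ that(1)])
      (use that tot.coord_vector_chart[of "tc i" p] in
        \<open>simp_all add: pi_frame tot.coord_vector_tangent bundle_chart(5) anchor_coeff_def\<close>)
  show "prol_coord i p (prol_pt i p w) = w" if "i \<in> \<BB>" "p \<in> \<pi> -` dom i" for i p w
    using that by (simp add: simps)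
  show "prol_pt i p (prol_coord i p b) = b" if "i \<in> \<BB>" "p \<in> \<pi> -` dom i" "b \<in> prol_fiber A p" for i p b
  proof -
    have "(anchor_coeff A i (snd i (fst b)) (\<pi> p), snd (snd b (tc i))) = snd b (tc i)"
      using prol_vector_fst[OF that(3,1)] that(2) by (simp add: prod_eq_iff)
    moreover have "coord_vector Ts (tc i) p (snd b (tc i)) = snd b"
      using tot.tangent_coord_vector[OF prol_fiberD(2)[OF that(3)], of "tc i"] that by (simp add: bundle_chart)
    moreover have "frame A i (snd i (fst b)) (\<pi> p) = fst b"
      using frame_psi[OF that(1), of "fst b"] prol_fiberD(1)[OF that(3)] that(2) by simp
    ultimately show ?thesis unfolding prol_pt_def prol_coord_def fst_conv snd_conv by (simp add: prod_eq_iff)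
  qed
  show "prol_add A b b' \<in> prol_fiber A p" if *: "b \<in> prol_fiber A p" "b' \<in> prol_fiber A p" for b p b'
  proof -
    obtain i where i: "i \<in> \<BB>" "\<pi> p \<in> dom i" using ex_bundle_chart by blast
    show ?thesis unfolding prol_add_def
      by (rule prol_fiberI[OF _ _ i]) (use * i tangent_map_tc[OF prol_fiberD(2)[OF *(1)] i]
        tangent_map_tc[OF prol_fiberD(2)[OF *(2)] i] in \<open>simp_all add: prol_fiberD tot.tangent_add anchor_add\<close>)
  qed
  show "prol_scale A r b \<in> prol_fiber A p" if *: "b \<in> prol_fiber A p" for b p r
  proof -
    obtain i where i: "i \<in> \<BB>" "\<pi> p \<in> dom i" using ex_bundle_chart by blast
    show ?thesis unfolding prol_scale_def
      by (rule prol_fiberI[OF _ _ i]) (use * i tangent_map_tc[OF prol_fiberD(2)[OF *(1)] i]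
        in \<open>simp_all add: prol_fiberD tot.tangent_scale anchor_scale\<close>)
  qed
  show "(zero_vec A (\<pi> p), \<lambda>_. 0) \<in> prol_fiber A p" for p
  proof -
    obtain i where i: "i \<in> \<BB>" "\<pi> p \<in> dom i" using ex_bundle_chart by blast
    show ?thesis
      by (rule prol_fiberI[OF _ _ i]) (use i linear_0[OF linear_anchor_coeff[OF i]]
        in \<open>simp_all add: tot.tangent_zero zero_vec_eq anchor_coeff_def pi_frame\<close>)
  qed
  show "prol_coord i p (prol_add A b b') = prol_coord i p b + prol_coord i p b'"
    if "i \<in> \<BB>" "p \<in> \<pi> -` dom i" "b \<in> prol_fiber A p" "b' \<in> prol_fiber A p" for i p b b'
    using that by (simp add: simps)
  show "prol_coord i p (prol_scale A r b) = r *\<^sub>R prol_coord i p b"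
    if "i \<in> \<BB>" "p \<in> \<pi> -` dom i" "b \<in> prol_fiber A p" for i p b r
    using that by (simp add: simps)
  show "prol_coord i p (zero_vec A (\<pi> p), \<lambda>_. 0) = 0" if "i \<in> \<BB>" "p \<in> \<pi> -` dom i" for i p
    using that by (simp add: prol_coord_def psi_zero zero_prod_def)
  show "smooth_at Ts (\<lambda>q. prol_coord j q (prol_pt i q (k q))) p"
    if "i \<in> \<BB>" "j \<in> \<BB>" "p \<in> \<pi> -` dom i" "p \<in> \<pi> -` dom j" "smooth_at Ts k p" for i j p k
  proof -
    have k: "smooth_at Ts (\<lambda>q. fst (k q)) p" "smooth_at Ts (\<lambda>q. snd (k q)) p" using that(5) by auto
    have "smooth_at Ts (\<lambda>q. (anchor_coeff A i (fst (k q)) (\<pi> q), snd (k q))) p"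
      using k that by (intro tot.smooth_at_Pair smooth_anchor_coeff_total) auto
    then have "tot.smooth_field_at (\<lambda>q. coord_vector Ts (tc i) q (anchor_coeff A i (fst (k q)) (\<pi> q), snd (k q))) p"
      using that by (intro tot.smooth_field_coord_vector) (auto simp: bundle_chart)
    then have "smooth_at Ts (\<lambda>q. coord_vector Ts (tc i) q (anchor_coeff A i (fst (k q)) (\<pi> q), snd (k q)) (tc j)) p"
      using that by (simp add: tot.smooth_field_at_def bundle_chart)
    moreover have "smooth_at Ts (\<lambda>q. snd j (frame A i (fst (k q)) (\<pi> q))) p"
      using that k by (intro smooth_frame_comp_total[of i]) (auto simp: smooth_psi pi_frame)
    ultimately show ?thesis by (simp add: prol_coord_def prol_pt_def tot.smooth_at_Pair tot.smooth_at_snd)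
  qed
  show "snd b \<in> tangent_space Ts p" if "b \<in> prol_fiber A p" for b p using that by (rule prol_fiberD)
qed (simp_all add: prol_add_def prol_scale_def)

lemma bm_lsec_iff: "bm.lsec X x \<longleftrightarrow> (\<forall>\<^sub>F q in nhds x. \<pi> (X q) = q) \<and> (\<forall>b\<in>\<BB>. x \<in> dom b \<longrightarrow> smooth_at Bs (\<lambda>q. snd b (X q)) x)"
  by (simp add: bm.lsec_def)

lemma pm_lsec_iff: "pm.lsec X m \<longleftrightarrow> (\<forall>\<^sub>F q in nhds m. \<pi> (X q) = \<pi> q) \<and> (\<forall>b\<in>\<BB>. \<pi> m \<in> dom b \<longrightarrow> smooth_at Ts (\<lambda>q. snd b (X q)) m)"
  by (simp add: pm.lsec_def)

lemma sections_eq: assumes "open V" shows "sections A V = bm.sect V"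
proof -
  have "(\<forall>x\<in>V. \<pi> (X x) = x) \<and> smooth_map Bs Ts V X \<longleftrightarrow> (\<forall>x\<in>V. bm.lsec X x)" for X
  proof -
    have 1: "smooth_map Bs Ts V X \<longleftrightarrow> (\<forall>p\<in>V. \<forall>b\<in>\<BB>. p \<in> dom b \<longrightarrow> smooth_at Bs (\<lambda>q. snd b (X q)) p)"
      if "\<forall>x\<in>V. \<pi> (X x) = x"
      by (rule smooth_map_total_iff[OF smooth_manifold_Bs assms, of "\<lambda>x. x"])
        (use that in \<open>auto simp: filterlim_ident base.smooth_at_chart_map bundle_chart\<close>)
    have 2: "\<forall>\<^sub>F q in nhds x. \<pi> (X q) = q" if "\<forall>x\<in>V. \<pi> (X x) = x" "x \<in> V" for x
      using eventually_nhds_in_open[OF assms that(2)] by eventually_elim (use that(1) in auto)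
    have 3: "\<pi> (X x) = x" if "bm.lsec X x" for x using bm.lsec_fib[OF that] by simp
    show ?thesis unfolding bm_lsec_iff[of X] using 1 2 3[unfolded bm_lsec_iff] by blast
  qed
  then show ?thesis unfolding sections_def bm.sect_def by blast
qed

lemma pb_sections_eq: assumes "open V" shows "pb_sections A V = pm.sect V"
proof -
  have "(\<forall>x\<in>V. \<pi> (X x) = \<pi> x) \<and> smooth_map Ts Ts V X \<longleftrightarrow> (\<forall>x\<in>V. pm.lsec X x)" for X
  proof -
    have 1: "smooth_map Ts Ts V X \<longleftrightarrow> (\<forall>p\<in>V. \<forall>b\<in>\<BB>. \<pi> p \<in> dom b \<longrightarrow> smooth_at Ts (\<lambda>q. snd b (X q)) p)"
      if "\<forall>x\<in>V. \<pi> (X x) = \<pi> x"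
      by (rule smooth_map_total_iff[OF smooth_manifold_Ts assms, of \<pi>])
        (use that in \<open>auto simp: filterlim_pi smooth_base_coords\<close>)
    have 2: "\<forall>\<^sub>F q in nhds x. \<pi> (X q) = \<pi> q" if "\<forall>x\<in>V. \<pi> (X x) = \<pi> x" "x \<in> V" for x
      using eventually_nhds_in_open[OF assms that(2)] by eventually_elim (use that(1) in auto)
    have 3: "\<pi> (X x) = \<pi> x" if "pm.lsec X x" for x using pm.lsec_fib[OF that] by simp
    show ?thesis unfolding pm_lsec_iff[of X] using 1 2 3[unfolded pm_lsec_iff] by blast
  qed
  then show ?thesis unfolding pb_sections_def pm.sect_def by blast
qed

text \<open>The component of the vector that \<open>prol_coord\<close> drops is a smooth function of
  the first component through the anchor coefficients; this makes smoothness in these coordinates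
  equivalent to smoothness of both constituents.\<close>

lemma qm_lsec_iff:
  "qm.lsec Z m \<longleftrightarrow> (\<forall>\<^sub>F q in nhds m. Z q \<in> prol_fiber A q) \<and> pm.lsec (\<lambda>q. fst (Z q)) m \<and> tot.smooth_field_at (\<lambda>q. snd (Z q)) m"
proof
  assume Z: "qm.lsec Z m"
  then have ev: "\<forall>\<^sub>F q in nhds m. Z q \<in> prol_fiber A q" by (simp add: qm.lsec_def)
  obtain b where b: "b \<in> \<BB>" "\<pi> m \<in> dom b" using ex_bundle_chart by blast
  have s: "smooth_at Ts (\<lambda>q. prol_coord b q (Z q)) m" using qm.lsec_smooth[OF Z b(1)] b(2) by simp
  have f: "smooth_at Ts (\<lambda>q. snd b (fst (Z q))) m" using tot.smooth_at_fst[OF s] by (simp add: prol_coord_def)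
  have g: "smooth_at Ts (\<lambda>q. snd (prol_coord b q (Z q))) m" using tot.smooth_at_snd[OF s] .
  have "pm.lsec (\<lambda>q. fst (Z q)) m"
    by (rule pm.lsecI[OF _ b(1)]) (use ev b f in \<open>auto elim!: eventually_mono simp: prol_fiberD\<close>)
  moreover have "tot.smooth_field_at (\<lambda>q. snd (Z q)) m"
  proof (rule tot.smooth_fieldI)
    show "\<forall>\<^sub>F q in nhds m. snd (Z q) \<in> tangent_space Ts q" using ev by eventually_elim (rule prol_fiberD)
    show "tc b \<in> Ts" "m \<in> fst (tc b)" using b by (simp_all add: bundle_chart)
    have "\<forall>\<^sub>F q in nhds m. snd (Z q) (tc b) = (anchor_coeff A b (snd b (fst (Z q))) (\<pi> q), snd (prol_coord b q (Z q)))"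
      using ev eventually_pi_dom[OF b] by eventually_elim (simp add: prol_vector b, simp add: prol_coord_def)
    then show "smooth_at Ts (\<lambda>q. snd (Z q) (tc b)) m"
      by (rule tot.smooth_at_transform) (intro tot.smooth_at_Pair smooth_anchor_coeff_total b f g)
  qed
  ultimately show "(\<forall>\<^sub>F q in nhds m. Z q \<in> prol_fiber A q) \<and> pm.lsec (\<lambda>q. fst (Z q)) m \<and> tot.smooth_field_at (\<lambda>q. snd (Z q)) m"
    using ev by blast
next
  assume *: "(\<forall>\<^sub>F q in nhds m. Z q \<in> prol_fiber A q) \<and> pm.lsec (\<lambda>q. fst (Z q)) m \<and> tot.smooth_field_at (\<lambda>q. snd (Z q)) m"
  obtain b where b: "b \<in> \<BB>" "\<pi> m \<in> dom b" using ex_bundle_chart by blast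
  show "qm.lsec Z m"
  proof (rule qm.lsecI[OF _ b(1)])
    have "smooth_at Ts (\<lambda>q. snd b (fst (Z q))) m" using * b by (simp add: pm_lsec_iff)
    moreover have "smooth_at Ts (\<lambda>q. snd (Z q) (tc b)) m"
      using * b by (simp add: tot.smooth_field_at_def bundle_chart)
    ultimately show "smooth_at Ts (\<lambda>q. prol_coord b q (Z q)) m" unfolding prol_coord_def by auto
  qed (use * b in auto)
qed

lemma prol_sections_eq: assumes "open V" shows "prol_sections A V = qm.sect V"
proof -
  have "(\<forall>m\<in>V. Z m \<in> prol_fiber A m) \<and> smooth_map Ts Ts V (fst \<circ> Z) \<and>
     (\<forall>d\<in>Ts. smooth_fun Ts (V \<inter> fst d) (\<lambda>m. snd (Z m) d)) \<longleftrightarrow> (\<forall>m\<in>V. qm.lsec Z m)" (is "?L \<longleftrightarrow> ?R") for Z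
  proof -
    have sm: "smooth_fun Ts (V \<inter> fst d) (\<lambda>m. snd (Z m) d) \<longleftrightarrow> (\<forall>m\<in>V \<inter> fst d. smooth_at Ts (\<lambda>m. snd (Z m) d) m)"
      if "d \<in> Ts" for d using assms tot.chart_open(1)[OF that] by (intro tot.smooth_fun_iff open_Int)
    have ev: "\<forall>\<^sub>F q in nhds m. Z q \<in> prol_fiber A q" if "\<forall>m\<in>V. Z m \<in> prol_fiber A m" "m \<in> V" for m
      using eventually_nhds_in_open[OF assms that(2)] by eventually_elim (use that(1) in auto)
    have mp: "smooth_map Ts Ts V (fst \<circ> Z) \<longleftrightarrow> (\<forall>m\<in>V. pm.lsec (\<lambda>q. fst (Z q)) m)" if "\<forall>m\<in>V. Z m \<in> prol_fiber A m"
    proof -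
      have 1: "smooth_map Ts Ts V (fst \<circ> Z) \<longleftrightarrow> (\<forall>p\<in>V. \<forall>b\<in>\<BB>. \<pi> p \<in> dom b \<longrightarrow> smooth_at Ts (\<lambda>q. snd b ((fst \<circ> Z) q)) p)"
        by (rule smooth_map_total_iff[OF smooth_manifold_Ts assms, of \<pi>])
          (use that in \<open>auto simp: filterlim_pi smooth_base_coords prol_fiberD\<close>)
      have 2: "\<forall>\<^sub>F q in nhds m. \<pi> (fst (Z q)) = \<pi> q" if "m \<in> V" for m
        using ev[OF \<open>\<forall>m\<in>V. Z m \<in> prol_fiber A m\<close> that] by eventually_elim (rule prol_fiberD)
      show ?thesis unfolding 1 pm_lsec_iff using 2 by (simp add: comp_def)
    qed
    have vf: "(\<forall>m\<in>V. tot.smooth_field_at (\<lambda>q. snd (Z q)) m) \<longleftrightarrow>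
      (\<forall>d\<in>Ts. smooth_fun Ts (V \<inter> fst d) (\<lambda>m. snd (Z m) d))" if "\<forall>m\<in>V. Z m \<in> prol_fiber A m"
    proof -
      have "\<forall>\<^sub>F q in nhds m. snd (Z q) \<in> tangent_space Ts q" if "m \<in> V" for m
        using ev[OF \<open>\<forall>m\<in>V. Z m \<in> prol_fiber A m\<close> that] by eventually_elim (rule prol_fiberD)
      then show ?thesis unfolding tot.smooth_field_at_def using sm by blast
    qed
    have R: "\<forall>m\<in>V. Z m \<in> prol_fiber A m" if ?R using that qm.lsec_fib by blast
    show ?thesis
    proof
      assume ?L
      then have L: "\<forall>m\<in>V. Z m \<in> prol_fiber A m" by blast
      show ?R using \<open>?L\<close> mp[OF L] vf[OF L] ev[OF L] unfolding qm_lsec_iff by blast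
    next
      assume ?R
      note L = R[OF this]
      show ?L using \<open>?R\<close> mp[OF L] vf[OF L] L unfolding qm_lsec_iff by blast
    qed
  qed
  then show ?thesis unfolding prol_sections_def qm.sect_def by blast
qed

lemma act_eq: "anchor_act A = bm.act" "prol_act A = qm.act"
  by (simp_all add: fun_eq_iff anchor_act_def bm.act_def prol_act_def qm.act_def)

end

section \<open>The bracket in local coordinates\<close>

lemma (in smooth_manifold) smooth_field_eventually:
  assumes "smooth_field_at V p" shows "\<forall>\<^sub>F q in nhds p. smooth_field_at V q"
proof -
  obtain c where c: "c \<in> At" "p \<in> fst c" using ex_chart by blast
  have "\<forall>\<^sub>F q in nhds p. \<forall>\<^sub>F q in nhds q. V q \<in> tangent_space At q"
    using assms by (simp add: smooth_field_at_def eventually_eventually)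
  moreover have "\<forall>\<^sub>F q in nhds p. smooth_at At (\<lambda>q. V q c) q"
    using assms c by (intro smooth_at_eventually) (simp add: smooth_field_at_def)
  ultimately show ?thesis using eventually_in_chart[OF c]
    by eventually_elim (rule smooth_fieldI[OF _ c(1)])
qed

lemma (in smooth_manifold) smooth_field_lie_bracket:
  assumes "smooth_field_at V p" "smooth_field_at W p"
  shows "smooth_field_at (lie_bracket V W) p"
proof -
  obtain c where c: "c \<in> At" "p \<in> fst c" using ex_chart by blast
  show ?thesis
  proof (rule smooth_fieldI[OF _ c])
    show "\<forall>\<^sub>F q in nhds p. lie_bracket V W q \<in> tangent_space At q"
      using smooth_field_eventually[OF assms(1)] smooth_field_eventually[OF assms(2)]
      by eventually_elim (rule lie_bracket_tangent)
    have s: "smooth_at At (\<lambda>q. V q c) p" "smooth_at At (\<lambda>q. W q c) p"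
      using assms c by (auto simp: smooth_field_at_def)
    have "\<forall>\<^sub>F q in nhds p. lie_bracket V W q c
        = deriv_along At q (V q) (\<lambda>q. W q c) - deriv_along At q (W q) (\<lambda>q. V q c)"
      using eventually_in_chart[OF c] by eventually_elim (simp add: lie_bracket_def c)
    then show "smooth_at At (\<lambda>q. lie_bracket V W q c) p"
      by (rule smooth_at_transform) (intro smooth_at_diff smooth_at_deriv_along assms s)
  qed
qed

context partial_finsler
begin

lemma leibniz_base: "leibniz_bracket (bm.sect UNIV) (fadd A) (fscale A) UNIV {f. smooth_fun Bs UNIV f} bm.act (bracket A)"
  using lb by (simp add: sections_eq act_eq)

abbreviation br :: "('m, 'e, 'a, 'f) bundle_chart \<Rightarrow> 'm \<Rightarrow> 'f \<Rightarrow> 'f \<Rightarrow> 'f" where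
  "br b x a c \<equiv> bracket_coeff A b a c x"

lemma local_bracket_germ:
  assumes "X' \<in> bm.sect UNIV" "Y' \<in> bm.sect UNIV" "\<forall>\<^sub>F q in nhds x. X' q = X q" "\<forall>\<^sub>F q in nhds x. Y' q = Y q"
  shows "local_bracket A X Y x = bracket A X' Y' x"
  unfolding local_bracket_def sections_eq[OF open_UNIV]
  by (rule bm.local_value_bracket[OF leibniz_base]) (use assms in auto)

lemma local_bracket_ext:
  assumes "bm.lsec X x" "bm.lsec Y x"
  obtains X' Y' where "X' \<in> bm.sect UNIV" "Y' \<in> bm.sect UNIV" "\<forall>\<^sub>F q in nhds x. X' q = X q" "\<forall>\<^sub>F q in nhds x. Y' q = Y q"
    "\<forall>\<^sub>F q in nhds x. local_bracket A X Y q = bracket A X' Y' q"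
proof -
  obtain X' where X': "X' \<in> bm.sect UNIV" "\<forall>\<^sub>F q in nhds x. X' q = X q" using bm.sect_extension[OF _ assms(1)] by blast
  obtain Y' where Y': "Y' \<in> bm.sect UNIV" "\<forall>\<^sub>F q in nhds x. Y' q = Y q" using bm.sect_extension[OF _ assms(2)] by blast
  have "\<forall>\<^sub>F q in nhds x. \<forall>\<^sub>F q in nhds q. X' q = X q" "\<forall>\<^sub>F q in nhds x. \<forall>\<^sub>F q in nhds q. Y' q = Y q"
    using X' Y' by (simp_all add: eventually_eventually)
  then have "\<forall>\<^sub>F q in nhds x. local_bracket A X Y q = bracket A X' Y' q"
    by eventually_elim (rule local_bracket_germ[OF X'(1) Y'(1)])
  then show ?thesis using that X' Y' by blast
qed

lemma lsec_local_bracket: assumes "bm.lsec X x" "bm.lsec Y x" shows "bm.lsec (local_bracket A X Y) x"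
proof -
  obtain X' Y' where *: "X' \<in> bm.sect UNIV" "Y' \<in> bm.sect UNIV"
    "\<forall>\<^sub>F q in nhds x. local_bracket A X Y q = bracket A X' Y' q"
    using local_bracket_ext[OF assms] by blast
  show ?thesis
    by (rule bm.lsec_transform[OF *(3)], rule bm.sect_lsec[OF bm.bracket_sect[OF leibniz_base *(1,2)]]) simp
qed

lemma local_bracket_formula_sum:
  assumes "bm.lsec X x" "bm.lsec Y x" and b: "b \<in> \<BB>" "x \<in> dom b"
  shows "snd b (local_bracket A X Y x) = deriv_along Bs x (anchor A (X x)) (\<lambda>q. snd b (Y q))
      - deriv_along Bs x (anchor A (Y x)) (\<lambda>q. snd b (X q))
      + (\<Sum>a\<in>Basis. \<Sum>c\<in>Basis. ((snd b (X x) \<bullet> a) * (snd b (Y x) \<bullet> c)) *\<^sub>R br b x a c)"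
proof -
  obtain X' Y' where *: "X' \<in> bm.sect UNIV" "Y' \<in> bm.sect UNIV" "\<forall>\<^sub>F q in nhds x. X' q = X q" "\<forall>\<^sub>F q in nhds x. Y' q = Y q"
    "\<forall>\<^sub>F q in nhds x. local_bracket A X Y q = bracket A X' Y' q"
    using local_bracket_ext[OF assms(1,2)] by blast
  have eq: "X' x = X x" "Y' x = Y x" "local_bracket A X Y x = bracket A X' Y' x"
    using *(3-5) by (auto dest: eventually_nhds_x_imp_x)
  have "deriv_along Bs x v (\<lambda>q. snd b (X' q)) = deriv_along Bs x v (\<lambda>q. snd b (X q))"
    "deriv_along Bs x v (\<lambda>q. snd b (Y' q)) = deriv_along Bs x v (\<lambda>q. snd b (Y q))" for v
    using bm.deriv_\<kappa>_cong[OF *(3)] bm.deriv_\<kappa>_cong[OF *(4)] by blast+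
  then show ?thesis
    using bm.bracket_formula[OF leibniz_base reproducing_Basis *(1,2) _ b] eq
    by (simp add: bracket_coeff_def local_bracket_def sections_eq)
qed

lemma lsec_frame: "b \<in> \<BB> \<Longrightarrow> x \<in> dom b \<Longrightarrow> bm.lsec (frame A b a) x"
  using bm.lsec_pt[of b x "\<lambda>_. a"] by simp

lemma deriv_psi_frame: "b \<in> \<BB> \<Longrightarrow> x \<in> dom b \<Longrightarrow> deriv_along Bs x v (\<lambda>q. snd b (frame A b a q)) = 0"
proof -
  assume b: "b \<in> \<BB>" "x \<in> dom b"
  have "\<forall>\<^sub>F q in nhds x. snd b (frame A b a q) = a"
    using eventually_dom[OF b] by eventually_elim (simp add: psi_frame b)
  then show ?thesis using base.deriv_along_eventually[where g = "\<lambda>_. a"] by simp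
qed

text \<open>Frames have constant coordinates, so the derivative terms of the bracket formula vanish.
  Thus \<open>br\<close>, defined through brackets of frames for arbitrary \<open>u\<close> and
  \<open>w\<close>, is the bilinear extension of the structure functions of the basis.\<close>

lemma br_expand:
  assumes b: "b \<in> \<BB>" "x \<in> dom b"
  shows "br b x u w = (\<Sum>a\<in>Basis. \<Sum>c\<in>Basis. ((u \<bullet> a) * (w \<bullet> c)) *\<^sub>R br b x a c)"
  using local_bracket_formula_sum[OF lsec_frame[OF b] lsec_frame[OF b] b, of u w] b
  by (simp add: bracket_coeff_def deriv_psi_frame psi_frame)

lemma bilinear_br: assumes b: "b \<in> \<BB>" "x \<in> dom b" shows "bilinear (br b x)"
  unfolding bilinear_def
proof (intro conjI allI linearI)
  show "br b x u (v + w) = br b x u v + br b x u w" for u v w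
    unfolding br_expand[OF b, of u "v + w"] br_expand[OF b, of u v] br_expand[OF b, of u w]
    by (simp add: algebra_simps sum.distrib)
  show "br b x (v + w) u = br b x v u + br b x w u" for u v w
    unfolding br_expand[OF b, of "v + w" u] br_expand[OF b, of v u] br_expand[OF b, of w u]
    by (simp add: algebra_simps sum.distrib)
  show "br b x u (r *\<^sub>R v) = r *\<^sub>R br b x u v" for u v r
    unfolding br_expand[OF b, of u "r *\<^sub>R v"] br_expand[OF b, of u v]
    by (simp add: scaleR_sum_right mult.left_commute)
  show "br b x (r *\<^sub>R v) u = r *\<^sub>R br b x v u" for u v r
    unfolding br_expand[OF b, of "r *\<^sub>R v" u] br_expand[OF b, of v u]
    by (simp add: scaleR_sum_right mult.assoc)
qed

lemma local_bracket_formula: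
  assumes "bm.lsec X x" "bm.lsec Y x" and b: "b \<in> \<BB>" "x \<in> dom b"
  shows "snd b (local_bracket A X Y x) = deriv_along Bs x (anchor A (X x)) (\<lambda>q. snd b (Y q))
      - deriv_along Bs x (anchor A (Y x)) (\<lambda>q. snd b (X q)) + br b x (snd b (X x)) (snd b (Y x))"
  unfolding br_expand[OF b, of "snd b (X x)"] by (rule local_bracket_formula_sum[OF assms])

lemma br_anti: assumes b: "b \<in> \<BB>" "x \<in> dom b" shows "br b x u w = - br b x w u"
proof -
  obtain X' Y' where *: "X' \<in> bm.sect UNIV" "Y' \<in> bm.sect UNIV" "\<forall>\<^sub>F q in nhds x. X' q = frame A b u q" "\<forall>\<^sub>F q in nhds x. Y' q = frame A b w q"
    using local_bracket_ext[OF lsec_frame[OF b] lsec_frame[OF b]] by blast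
  have "bracket A X' Y' x = fscale A (-1) (bracket A Y' X' x)"
    using bm.bracket_anti[OF leibniz_base *(1,2)] by (simp add: section_scale_def)
  moreover have "\<pi> (bracket A Y' X' x) = x"
    using bm.sect_fib[OF bm.bracket_sect[OF leibniz_base *(2,1)], of x] by simp
  ultimately show ?thesis
    unfolding bracket_coeff_def local_bracket_germ[OF *] local_bracket_germ[OF *(2,1,4,3)]
    using b by (simp add: bundle_chart)
qed

lemma smooth_br: assumes b: "b \<in> \<BB>" "x \<in> dom b" shows "smooth_at Bs (\<lambda>y. br b y u w) x"
  unfolding bracket_coeff_def
  by (rule bm.lsec_smooth[OF lsec_local_bracket[OF lsec_frame[OF b] lsec_frame[OF b]] b])

lemma smooth_br_total:
  assumes b: "b \<in> \<BB>" "\<pi> m \<in> dom b" and "smooth_at Ts k m" "smooth_at Ts l m"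
  shows "smooth_at Ts (\<lambda>q. br b (\<pi> q) (k q) (l q)) m"
proof -
  have "\<forall>\<^sub>F q in nhds m. br b (\<pi> q) (k q) (l q)
      = (\<Sum>a\<in>Basis. \<Sum>c\<in>Basis. ((k q \<bullet> a) * (l q \<bullet> c)) *\<^sub>R br b (\<pi> q) a c)"
    using eventually_pi_dom[OF b] by eventually_elim (rule br_expand[OF b(1)])
  then show ?thesis
    by (rule tot.smooth_at_transform) (intro tot.smooth_at_sum tot.smooth_at_scaleR tot.smooth_at_mult
      tot.smooth_at_inner assms(3,4) tot.smooth_at_const smooth_lift smooth_br b)
qed

text \<open>The structure functions are not tensorial: the frame of \<open>b\<close> has
  non-constant coordinates in \<open>b'\<close>, and the bracket formula in \<open>b'\<close>
  contributes their derivatives. These terms are what later cancels in chart changes of the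
  prolongation bracket and of the Euler-Lagrange form.\<close>

lemma br_transform:
  assumes b: "b \<in> \<BB>" "x \<in> dom b" and b': "b' \<in> \<BB>" "x \<in> dom b'"
  shows "snd b' (frame A b (br b x u w) x) =
    deriv_along Bs x (anchor A (frame A b u x)) (\<lambda>q. snd b' (frame A b w q))
    - deriv_along Bs x (anchor A (frame A b w x)) (\<lambda>q. snd b' (frame A b u q))
    + br b' x (snd b' (frame A b u x)) (snd b' (frame A b w x))"
proof -
  have "\<pi> (local_bracket A (frame A b u) (frame A b w) x) = x"
    using bm.lsec_fib[OF lsec_local_bracket[OF lsec_frame[OF b] lsec_frame[OF b]]] by simp
  then have "frame A b (br b x u w) x = local_bracket A (frame A b u) (frame A b w) x"
    unfolding bracket_coeff_def using frame_psi[OF b(1), of "local_bracket A (frame A b u) (frame A b w) x"] b(2) by simp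
  then show ?thesis using local_bracket_formula[OF lsec_frame[OF b] lsec_frame[OF b] b', of u w] by simp
qed

lemma smooth_field_anchor:
  assumes "bm.lsec X x" shows "base.smooth_field_at (\<lambda>q. anchor A (X q)) x"
  unfolding base.smooth_field_at_def
proof (intro conjI ballI impI)
  have ev: "\<forall>\<^sub>F q in nhds x. \<pi> (X q) = q" using assms by (simp add: bm_lsec_iff)
  then show "\<forall>\<^sub>F q in nhds x. anchor A (X q) \<in> tangent_space Bs q"
    by eventually_elim (metis anchor_tangent)
  fix c assume c: "c \<in> Bs" "x \<in> fst c"
  obtain b where b: "b \<in> \<BB>" "x \<in> dom b" using ex_bundle_chart by blast
  have "smooth_at Bs (\<lambda>q. anchor A (frame A b (snd b (X q)) q) c) x"
    by (rule smooth_frame_comp_base[OF b]) (use assms b c in \<open>simp_all add: bm_lsec_iff smooth_anchor pi_frame\<close>)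
  moreover have "\<forall>\<^sub>F q in nhds x. anchor A (X q) c = anchor A (frame A b (snd b (X q)) q) c"
    using ev eventually_dom[OF b]
  proof eventually_elim
    fix q assume "\<pi> (X q) = q" "q \<in> dom b"
    then show "anchor A (X q) c = anchor A (frame A b (snd b (X q)) q) c"
      using frame_psi[OF b(1), of "X q"] by simp
  qed
  ultimately show "smooth_at Bs (\<lambda>q. anchor A (X q) c) x" by (rule base.smooth_at_transform[rotated])
qed

text \<open>The morphism property of the anchor is given through its action on smooth functions;
  applied to the coordinate functions of a chart it identifies the components of both tangent
  vectors.\<close>

lemma anchor_local_bracket:
  assumes "bm.lsec X x" "bm.lsec Y x"
  shows "anchor A (local_bracket A X Y x) = base.lie_bracket (\<lambda>q. anchor A (X q)) (\<lambda>q. anchor A (Y q)) x"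
proof -
  obtain X' Y' where *: "X' \<in> bm.sect UNIV" "Y' \<in> bm.sect UNIV" "\<forall>\<^sub>F q in nhds x. X' q = X q" "\<forall>\<^sub>F q in nhds x. Y' q = Y q"
    "\<forall>\<^sub>F q in nhds x. local_bracket A X Y q = bracket A X' Y' q"
    using local_bracket_ext[OF assms] by blast
  obtain c where c: "c \<in> Bs" "x \<in> fst c" using base.ex_chart by blast
  have l: "bm.lsec X' x" "bm.lsec Y' x" using * by (auto intro: bm.sect_lsec)
  note V = smooth_field_anchor[OF l(1)] and W = smooth_field_anchor[OF l(2)]
  have lie: "base.lie_bracket (\<lambda>q. anchor A (X' q)) (\<lambda>q. anchor A (Y' q)) x \<in> tangent_space Bs x"
    by (rule base.lie_bracket_tangent[OF V W])
  have pix: "\<pi> (bracket A X' Y' x) = x" using bm.sect_fib[OF bm.bracket_sect[OF leibniz_base *(1,2)], of x] by simp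
  then have an: "anchor A (bracket A X' Y' x) \<in> tangent_space Bs x" using anchor_tangent by metis
  have pre: "\<forall>X\<in>sections A UNIV. \<forall>Y\<in>sections A UNIV. \<forall>V f. open V \<and> smooth_fun Bs V f \<longrightarrow>
        (\<forall>x\<in>V. anchor_act A (bracket A X Y) f x =
           anchor_act A X (anchor_act A Y f) x - anchor_act A Y (anchor_act A X f) x)"
    using pf unfolding partial_finsler_pre_lie_algebroid_def pre_lie_algebroid_def by blast
  have "anchor A (bracket A X' Y' x) c \<bullet> e = base.lie_bracket (\<lambda>q. anchor A (X' q)) (\<lambda>q. anchor A (Y' q)) x c \<bullet> e" for e
  proof -
    have sf: "smooth_at Bs (\<lambda>q. snd c q \<bullet> e) q" if "q \<in> fst c" for q
      using that c by (intro base.smooth_at_inner base.smooth_at_chart_map base.smooth_at_const)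
    have "smooth_fun Bs (fst c) (\<lambda>q. snd c q \<bullet> e)"
      using base.smooth_fun_iff[OF base.chart_open(1)[OF c(1)]] sf by blast
    then have "anchor_act A (bracket A X' Y') (\<lambda>q. snd c q \<bullet> e) x =
        anchor_act A X' (anchor_act A Y' (\<lambda>q. snd c q \<bullet> e)) x - anchor_act A Y' (anchor_act A X' (\<lambda>q. snd c q \<bullet> e)) x"
      using pre *(1,2) base.chart_open(1)[OF c(1)] c(2) by (simp add: sections_eq)
    also have "\<dots> = deriv_along Bs x (base.lie_bracket (\<lambda>q. anchor A (X' q)) (\<lambda>q. anchor A (Y' q)) x) (\<lambda>q. snd c q \<bullet> e)"
      unfolding anchor_act_def using base.deriv_along_lie_bracket[OF V W sf[OF c(2)]] by simp
    also have "\<dots> = base.lie_bracket (\<lambda>q. anchor A (X' q)) (\<lambda>q. anchor A (Y' q)) x c \<bullet> e"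
      using base.deriv_along_bounded_linear[OF lie base.smooth_at_chart_map[OF c] bounded_linear_inner_left[of e]]
        base.deriv_along_chart_map[OF lie c] by simp
    finally show ?thesis
      using base.deriv_along_bounded_linear[OF an base.smooth_at_chart_map[OF c] bounded_linear_inner_left[of e]]
        base.deriv_along_chart_map[OF an c] unfolding anchor_act_def by simp
  qed
  then have "anchor A (bracket A X' Y' x) c = base.lie_bracket (\<lambda>q. anchor A (X' q)) (\<lambda>q. anchor A (Y' q)) x c"
    using vector_eq_rdot by blast
  then have "anchor A (bracket A X' Y' x) = base.lie_bracket (\<lambda>q. anchor A (X' q)) (\<lambda>q. anchor A (Y' q)) x"
    by (rule base.tangent_ext[OF an lie c])
  moreover have "base.lie_bracket (\<lambda>q. anchor A (X' q)) (\<lambda>q. anchor A (Y' q)) x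
    = base.lie_bracket (\<lambda>q. anchor A (X q)) (\<lambda>q. anchor A (Y q)) x"
  proof -
    have ev: "\<forall>\<^sub>F q in nhds x. anchor A (X' q) d = anchor A (X q) d" "\<forall>\<^sub>F q in nhds x. anchor A (Y' q) d = anchor A (Y q) d" for d
      using *(3,4) by (eventually_elim, simp)+
    have "X' x = X x" "Y' x = Y x" using *(3,4) by (auto dest: eventually_nhds_x_imp_x)
    then show ?thesis unfolding base.lie_bracket_def
      using base.deriv_along_eventually[OF ev(1)] base.deriv_along_eventually[OF ev(2)] by (simp add: fun_eq_iff)
  qed
  ultimately show ?thesis using eventually_nhds_x_imp_x[OF *(5)] by simp
qed

lemma anchor_br:
  assumes b: "b \<in> \<BB>" "x \<in> dom b"
  shows "anchor_coeff A b (br b x u w) x =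
    deriv_along Bs x (anchor A (frame A b u x)) (\<lambda>y. anchor_coeff A b w y)
    - deriv_along Bs x (anchor A (frame A b w x)) (\<lambda>y. anchor_coeff A b u y)"
proof -
  have "\<pi> (local_bracket A (frame A b u) (frame A b w) x) = x"
    using bm.lsec_fib[OF lsec_local_bracket[OF lsec_frame[OF b] lsec_frame[OF b]]] by simp
  then have "frame A b (br b x u w) x = local_bracket A (frame A b u) (frame A b w) x"
    unfolding bracket_coeff_def using frame_psi[OF b(1), of "local_bracket A (frame A b u) (frame A b w) x"] b(2) by simp
  then show ?thesis
    using anchor_local_bracket[OF lsec_frame[OF b] lsec_frame[OF b], of u w] b bundle_chart(1)[OF b(1)]
    by (simp add: anchor_coeff_def[abs_def] base.lie_bracket_def)
qed

text \<open>Product rule for a family of linear maps over the base, evaluated at a moving fibre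
  vector, proved by expanding that vector in the basis. The families in question are changes of
  frame and the anchor coefficients.\<close>

lemma deriv_along_linear_family:
  fixes H :: "'m \<Rightarrow> 'f \<Rightarrow> 'w::real_inner"
  assumes v: "v \<in> tangent_space Ts m" and k: "smooth_at Ts k m"
    and lin: "\<forall>\<^sub>F y in nhds (\<pi> m). linear (H y)" and sm: "\<And>a. smooth_at Bs (\<lambda>y. H y a) (\<pi> m)"
  shows "smooth_at Ts (\<lambda>q. H (\<pi> q) (k q)) m"
    and "deriv_along Ts m v (\<lambda>q. H (\<pi> q) (k q)) = H (\<pi> m) (deriv_along Ts m v k)
      + deriv_along Bs (\<pi> m) (tangent_map Ts Bs \<pi> m v) (\<lambda>y. H y (k m))"
proof -
  have l: "linear (H (\<pi> m))" using lin by (rule eventually_nhds_x_imp_x)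
  have ev: "\<forall>\<^sub>F q in nhds m. H (\<pi> q) (k q) = (\<Sum>a\<in>Basis. (k q \<bullet> a) *\<^sub>R H (\<pi> q) a)"
    using eventually_pi[OF lin] by eventually_elim (rule linear_reproducing[OF reproducing_Basis])
  have s: "smooth_at Ts (\<lambda>q. (k q \<bullet> a) *\<^sub>R H (\<pi> q) a) m" for a
    by (intro tot.smooth_at_scaleR tot.smooth_at_inner k tot.smooth_at_const smooth_lift sm)
  show "smooth_at Ts (\<lambda>q. H (\<pi> q) (k q)) m"
    by (rule tot.smooth_at_transform[OF ev]) (intro tot.smooth_at_sum s)
  have ki: "deriv_along Ts m v (\<lambda>q. k q \<bullet> a) = deriv_along Ts m v k \<bullet> a" for a
    by (rule tot.deriv_along_bounded_linear[OF v k bounded_linear_inner_left])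
  have "deriv_along Ts m v (\<lambda>q. H (\<pi> q) (k q)) = (\<Sum>a\<in>Basis. deriv_along Ts m v (\<lambda>q. (k q \<bullet> a) *\<^sub>R H (\<pi> q) a))"
    unfolding tot.deriv_along_eventually[OF ev] by (rule tot.deriv_along_sum[OF v _ s]) simp
  also have "\<dots> = (\<Sum>a\<in>Basis. (k m \<bullet> a) *\<^sub>R deriv_along Bs (\<pi> m) (tangent_map Ts Bs \<pi> m v) (\<lambda>y. H y a)
      + (deriv_along Ts m v k \<bullet> a) *\<^sub>R H (\<pi> m) a)"
    using k by (subst tot.deriv_along_scaleR[OF v])
      (auto simp: ki deriv_along_lift[OF v sm] intro!: smooth_lift sm)
  also have "\<dots> = H (\<pi> m) (deriv_along Ts m v k)
      + (\<Sum>a\<in>Basis. (k m \<bullet> a) *\<^sub>R deriv_along Bs (\<pi> m) (tangent_map Ts Bs \<pi> m v) (\<lambda>y. H y a))"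
    unfolding linear_reproducing[OF reproducing_Basis l, of "deriv_along Ts m v k"] by (simp add: sum.distrib)
  also have "(\<Sum>a\<in>Basis. (k m \<bullet> a) *\<^sub>R deriv_along Bs (\<pi> m) (tangent_map Ts Bs \<pi> m v) (\<lambda>y. H y a))
      = deriv_along Bs (\<pi> m) (tangent_map Ts Bs \<pi> m v) (\<lambda>y. H y (k m))"
  proof -
    note tv = tangent_map_tangent[OF v]
    have ev': "\<forall>\<^sub>F y in nhds (\<pi> m). H y (k m) = (\<Sum>a\<in>Basis. (k m \<bullet> a) *\<^sub>R H y a)"
      using lin by eventually_elim (rule linear_reproducing[OF reproducing_Basis])
    show ?thesis unfolding base.deriv_along_eventually[OF ev']
      by (subst base.deriv_along_sum[OF tv]) (auto simp: base.deriv_along_scaleR[OF tv _ sm] intro!: base.smooth_at_scaleR sm)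
  qed
  finally show "deriv_along Ts m v (\<lambda>q. H (\<pi> q) (k q)) = H (\<pi> m) (deriv_along Ts m v k)
      + deriv_along Bs (\<pi> m) (tangent_map Ts Bs \<pi> m v) (\<lambda>y. H y (k m))" .
qed

end

section \<open>The bracket of the prolongation\<close>

context partial_finsler
begin

definition fc :: "('m, 'e, 'a, 'f) bundle_chart \<Rightarrow> ('e, 'a, 'f) prol \<Rightarrow> 'f \<times> 'e \<times> 'f" where
  "fc b p = (snd b (fst p), snd p (tc b))"

lemma fc_inj:
  assumes "p \<in> prol_fiber A m" "p' \<in> prol_fiber A m" "b \<in> \<BB>" "\<pi> m \<in> dom b" "fc b p = fc b p'"
  shows "p = p'"
  using assms by (intro qm.\<kappa>_inj[of b m p p']) (auto simp: prol_coord_def fc_def)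

lemma fc_add: "p \<in> prol_fiber A m \<Longrightarrow> p' \<in> prol_fiber A m \<Longrightarrow> b \<in> \<BB> \<Longrightarrow> \<pi> m \<in> dom b \<Longrightarrow>
    fc b (prol_add A p p') = fc b p + fc b p'"
  by (simp add: fc_def prol_add_def bundle_chart prol_fiberD)

lemma fc_scale: "p \<in> prol_fiber A m \<Longrightarrow> b \<in> \<BB> \<Longrightarrow> \<pi> m \<in> dom b \<Longrightarrow> fc b (prol_scale A r p) = r *\<^sub>R fc b p"
  by (simp add: fc_def prol_scale_def bundle_chart prol_fiberD)

lemma smooth_psi_fst: "qm.lsec Z m \<Longrightarrow> b \<in> \<BB> \<Longrightarrow> \<pi> m \<in> dom b \<Longrightarrow> smooth_at Ts (\<lambda>q. snd b (fst (Z q))) m"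
  by (simp add: qm_lsec_iff pm_lsec_iff)

lemma smooth_prol_field: "qm.lsec Z m \<Longrightarrow> tot.smooth_field_at (\<lambda>q. snd (Z q)) m"
  by (simp add: qm_lsec_iff)

lemma smooth_snd_tc: "qm.lsec Z m \<Longrightarrow> b \<in> \<BB> \<Longrightarrow> \<pi> m \<in> dom b \<Longrightarrow> smooth_at Ts (\<lambda>q. snd (Z q) (tc b)) m"
  using smooth_prol_field[of Z m] by (simp add: tot.smooth_field_at_def bundle_chart)

lemma smooth_fc: "qm.lsec Z m \<Longrightarrow> b \<in> \<BB> \<Longrightarrow> \<pi> m \<in> dom b \<Longrightarrow> smooth_at Ts (\<lambda>q. fc b (Z q)) m"
  unfolding fc_def by (intro tot.smooth_at_Pair smooth_psi_fst smooth_snd_tc)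

text \<open>\<open>fc\<close> carries the base component of the vector, although the anchor determines it, because then
  the bracket is the commutator of derivatives up to the structure functions.\<close>

definition pbr :: "('m, 'e, 'a, 'f) bundle_chart \<Rightarrow> ('a \<Rightarrow> ('e, 'a, 'f) prol) \<Rightarrow> ('a \<Rightarrow> ('e, 'a, 'f) prol) \<Rightarrow> 'a \<Rightarrow>
    'f \<times> 'e \<times> 'f" where
  "pbr b Z Z' m = deriv_along Ts m (snd (Z m)) (\<lambda>q. fc b (Z' q)) - deriv_along Ts m (snd (Z' m)) (\<lambda>q. fc b (Z q))
    + (br b (\<pi> m) (snd b (fst (Z m))) (snd b (fst (Z' m))), 0)"

text \<open>The vector component is a Lie bracket of fields on the total space and thus free of
  charts; the first component is assembled in a chosen chart, and \<open>fc_PBv\<close> shows that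
  the choice is immaterial.\<close>

definition PBv :: "('a \<Rightarrow> ('e, 'a, 'f) prol) \<Rightarrow> ('a \<Rightarrow> ('e, 'a, 'f) prol) \<Rightarrow> 'a \<Rightarrow> ('e, 'a, 'f) prol" where
  "PBv Z Z' m = (let b = (SOME b. b \<in> \<BB> \<and> \<pi> m \<in> dom b) in
     (frame A b (fst (pbr b Z Z' m)) (\<pi> m), tot.lie_bracket (\<lambda>q. snd (Z q)) (\<lambda>q. snd (Z' q)) m))"

lemma lsec_vector: "qm.lsec Z m \<Longrightarrow> snd (Z m) \<in> tangent_space Ts m"
  using qm.lsec_fib prol_fiberD by blast

lemma lsec_tangent_map: "qm.lsec Z m \<Longrightarrow> tangent_map Ts Bs \<pi> m (snd (Z m)) = anchor A (fst (Z m))"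
  using qm.lsec_fib prol_fiberD by metis

lemma lsec_frame_fst:
  "qm.lsec Z m \<Longrightarrow> b \<in> \<BB> \<Longrightarrow> \<pi> m \<in> dom b \<Longrightarrow> frame A b (snd b (fst (Z m))) (\<pi> m) = fst (Z m)"
  using frame_psi[of b "fst (Z m)"] prol_fiberD(1)[OF qm.lsec_fib] by simp

lemma deriv_fc:
  assumes "v \<in> tangent_space Ts m" "qm.lsec Z m" "b \<in> \<BB>" "\<pi> m \<in> dom b"
  shows "deriv_along Ts m v (\<lambda>q. fc b (Z q))
    = (deriv_along Ts m v (\<lambda>q. snd b (fst (Z q))), deriv_along Ts m v (\<lambda>q. snd (Z q) (tc b)))"
  unfolding fc_def using assms by (intro tot.deriv_along_Pair smooth_psi_fst smooth_snd_tc)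

lemma pbr_components:
  assumes "qm.lsec Z m" "qm.lsec Z' m" "b \<in> \<BB>" "\<pi> m \<in> dom b"
  shows "fst (pbr b Z Z' m) = deriv_along Ts m (snd (Z m)) (\<lambda>q. snd b (fst (Z' q)))
      - deriv_along Ts m (snd (Z' m)) (\<lambda>q. snd b (fst (Z q))) + br b (\<pi> m) (snd b (fst (Z m))) (snd b (fst (Z' m)))"
    and "snd (pbr b Z Z' m) = tot.lie_bracket (\<lambda>q. snd (Z q)) (\<lambda>q. snd (Z' q)) m (tc b)"
  using assms by (simp_all add: pbr_def deriv_fc lsec_vector tot.lie_bracket_def bundle_chart)

lemma linear_frame_transition:
  "b \<in> \<BB> \<Longrightarrow> b' \<in> \<BB> \<Longrightarrow> x \<in> dom b \<Longrightarrow> x \<in> dom b' \<Longrightarrow> linear (\<lambda>w. snd b' (frame A b w x))"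
  by (rule linearI) (simp_all add: frame_add frame_scale bundle_chart pi_frame)

lemma eventually_linear_frame_transition:
  "b \<in> \<BB> \<Longrightarrow> b' \<in> \<BB> \<Longrightarrow> x \<in> dom b \<Longrightarrow> x \<in> dom b' \<Longrightarrow> \<forall>\<^sub>F y in nhds x. linear (\<lambda>w. snd b' (frame A b w y))"
  using eventually_conj[OF eventually_dom[of b x] eventually_dom[of b' x]]
  by (auto elim!: eventually_mono simp: linear_frame_transition)

lemma smooth_frame_transition:
  "b \<in> \<BB> \<Longrightarrow> b' \<in> \<BB> \<Longrightarrow> x \<in> dom b \<Longrightarrow> x \<in> dom b' \<Longrightarrow> smooth_at Bs (\<lambda>y. snd b' (frame A b w y)) x"
  by (rule smooth_frame_comp_base) (simp_all add: smooth_psi pi_frame)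

lemma deriv_transition:
  assumes v: "v \<in> tangent_space Ts m" and Z: "qm.lsec Z m"
    and b: "b \<in> \<BB>" "\<pi> m \<in> dom b" and b': "b' \<in> \<BB>" "\<pi> m \<in> dom b'"
  shows "deriv_along Ts m v (\<lambda>q. snd b' (fst (Z q))) =
    snd b' (frame A b (deriv_along Ts m v (\<lambda>q. snd b (fst (Z q)))) (\<pi> m))
    + deriv_along Bs (\<pi> m) (tangent_map Ts Bs \<pi> m v) (\<lambda>y. snd b' (frame A b (snd b (fst (Z m))) y))"
proof -
  have "\<forall>\<^sub>F q in nhds m. Z q \<in> prol_fiber A q" using Z by (simp add: qm.lsec_def)
  then have ev: "\<forall>\<^sub>F q in nhds m. snd b' (fst (Z q)) = snd b' (frame A b (snd b (fst (Z q))) (\<pi> q))"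
    using eventually_pi_dom[OF b]
  proof eventually_elim
    fix q assume "Z q \<in> prol_fiber A q" "\<pi> q \<in> dom b"
    then show "snd b' (fst (Z q)) = snd b' (frame A b (snd b (fst (Z q))) (\<pi> q))"
      using frame_psi[OF b(1), of "fst (Z q)"] prol_fiberD(1) by metis
  qed
  show ?thesis unfolding tot.deriv_along_eventually[OF ev]
    by (rule deriv_along_linear_family(2)[OF v smooth_psi_fst[OF Z b], of "\<lambda>y w. snd b' (frame A b w y)"])
      (intro eventually_linear_frame_transition smooth_frame_transition b b')+
qed

text \<open>Differentiating the change of frame along both vectors yields two inhomogeneous terms.
  Since the vectors project to the anchors of the first components, these are exactly the terms in
  \<open>br_transform\<close>.\<close>

lemma pbr_transition:
  assumes Z: "qm.lsec Z m" "qm.lsec Z' m" and b: "b \<in> \<BB>" "\<pi> m \<in> dom b" and b': "b' \<in> \<BB>" "\<pi> m \<in> dom b'"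
  shows "snd b' (frame A b (fst (pbr b Z Z' m)) (\<pi> m)) = fst (pbr b' Z Z' m)"
proof -
  interpret l: linear "\<lambda>w. snd b' (frame A b w (\<pi> m))" by (rule linear_frame_transition[OF b(1) b'(1) b(2) b'(2)])
  show ?thesis
    unfolding pbr_components(1)[OF Z b] pbr_components(1)[OF Z b']
      deriv_transition[OF lsec_vector[OF Z(1)] Z(2) b b'] deriv_transition[OF lsec_vector[OF Z(2)] Z(1) b b']
      lsec_tangent_map[OF Z(1)] lsec_tangent_map[OF Z(2)] l.add l.diff br_transform[OF b b'] lsec_frame_fst[OF Z(1) b]
      lsec_frame_fst[OF Z(2) b] by simp
qed

lemma fc_PBv:
  assumes Z: "qm.lsec Z m" "qm.lsec Z' m" and b: "b \<in> \<BB>" "\<pi> m \<in> dom b"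
  shows "fc b (PBv Z Z' m) = pbr b Z Z' m"
proof -
  define b0 where "b0 = (SOME b. b \<in> \<BB> \<and> \<pi> m \<in> dom b)"
  have "b0 \<in> \<BB> \<and> \<pi> m \<in> dom b0" unfolding b0_def
    using ex_bundle_chart[of "\<pi> m"] by (intro someI_ex[of "\<lambda>b. b \<in> \<BB> \<and> \<pi> m \<in> dom b"]) blast
  then have b0: "b0 \<in> \<BB>" "\<pi> m \<in> dom b0" by auto
  show ?thesis
    unfolding PBv_def Let_def b0_def[symmetric] fc_def fst_conv snd_conv pbr_transition[OF Z b0 b]
      pbr_components(2)[OF Z b, symmetric] by simp
qed

lemma deriv_anchor_component:
  assumes v: "v \<in> tangent_space Ts m" and Z: "qm.lsec Z m" and b: "b \<in> \<BB>" "\<pi> m \<in> dom b"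
  shows "fst (deriv_along Ts m v (\<lambda>q. snd (Z q) (tc b))) =
    anchor_coeff A b (deriv_along Ts m v (\<lambda>q. snd b (fst (Z q)))) (\<pi> m)
    + deriv_along Bs (\<pi> m) (tangent_map Ts Bs \<pi> m v) (\<lambda>y. anchor_coeff A b (snd b (fst (Z m))) y)"
proof -
  have "\<forall>\<^sub>F q in nhds m. Z q \<in> prol_fiber A q" using Z by (simp add: qm.lsec_def)
  then have ev: "\<forall>\<^sub>F q in nhds m. fst (snd (Z q) (tc b)) = anchor_coeff A b (snd b (fst (Z q))) (\<pi> q)"
    using eventually_pi_dom[OF b] by eventually_elim (simp add: prol_vector_fst b(1))
  have "fst (deriv_along Ts m v (\<lambda>q. snd (Z q) (tc b))) = deriv_along Ts m v (\<lambda>q. fst (snd (Z q) (tc b)))"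
    using tot.deriv_along_bounded_linear[OF v smooth_snd_tc[OF Z b] bounded_linear_fst] by simp
  also have "\<dots> = deriv_along Ts m v (\<lambda>q. anchor_coeff A b (snd b (fst (Z q))) (\<pi> q))"
    by (rule tot.deriv_along_eventually[OF ev])
  also have "\<dots> = anchor_coeff A b (deriv_along Ts m v (\<lambda>q. snd b (fst (Z q)))) (\<pi> m)
    + deriv_along Bs (\<pi> m) (tangent_map Ts Bs \<pi> m v) (\<lambda>y. anchor_coeff A b (snd b (fst (Z m))) y)"
  proof (rule deriv_along_linear_family(2)[OF v smooth_psi_fst[OF Z b], of "\<lambda>y w. anchor_coeff A b w y"])
    show "\<forall>\<^sub>F y in nhds (\<pi> m). linear (\<lambda>w. anchor_coeff A b w y)"
      using eventually_dom[OF b] by eventually_elim (rule linear_anchor_coeff[OF b(1)])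
    show "smooth_at Bs (\<lambda>y. anchor_coeff A b a y) (\<pi> m)" for a
      using smooth_anchor_coeff_base[OF b, of "\<lambda>_. a"] by simp
  qed
  finally show ?thesis .
qed

text \<open>That the bracket stays in the prolongation is the morphism property of the anchor in the
  form \<open>anchor_br\<close>; the derivatives of the components match by the product rule for the
  anchor coefficients.\<close>

lemma PBv_fiber:
  assumes Z: "qm.lsec Z m" "qm.lsec Z' m"
  shows "PBv Z Z' m \<in> prol_fiber A m"
proof -
  define b where "b = (SOME b. b \<in> \<BB> \<and> \<pi> m \<in> dom b)"
  have "b \<in> \<BB> \<and> \<pi> m \<in> dom b" unfolding b_def
    using ex_bundle_chart[of "\<pi> m"] by (intro someI_ex[of "\<lambda>b. b \<in> \<BB> \<and> \<pi> m \<in> dom b"]) blast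
  then have b: "b \<in> \<BB>" "\<pi> m \<in> dom b" by auto
  interpret l: linear "\<lambda>w. anchor_coeff A b w (\<pi> m)" by (rule linear_anchor_coeff[OF b])
  have "anchor_coeff A b (fst (pbr b Z Z' m)) (\<pi> m) = fst (snd (pbr b Z Z' m))"
    unfolding pbr_components(1)[OF Z b] l.add l.diff anchor_br[OF b] lsec_frame_fst[OF Z(1) b] lsec_frame_fst[OF Z(2) b]
    using deriv_anchor_component[OF lsec_vector[OF Z(1)] Z(2) b] deriv_anchor_component[OF lsec_vector[OF Z(2)] Z(1) b]
    by (simp add: pbr_def deriv_fc lsec_vector Z b lsec_tangent_map)
  then show ?thesis
    unfolding PBv_def Let_def b_def[symmetric]
    by (intro prol_fiberI[OF _ _ b] tot.lie_bracket_tangent smooth_prol_field Z)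
      (simp_all add: pi_frame b pbr_components(2)[OF Z b] anchor_coeff_def)
qed

lemma PBv_lsec:
  assumes Z: "\<forall>\<^sub>F q in nhds m. qm.lsec Z q" "\<forall>\<^sub>F q in nhds m. qm.lsec Z' q"
  shows "qm.lsec (PBv Z Z') m"
proof -
  note Zm = eventually_nhds_x_imp_x[OF Z(1)] eventually_nhds_x_imp_x[OF Z(2)]
  obtain b where b: "b \<in> \<BB>" "\<pi> m \<in> dom b" using ex_bundle_chart by blast
  have fib: "\<forall>\<^sub>F q in nhds m. PBv Z Z' q \<in> prol_fiber A q" using Z by eventually_elim (rule PBv_fiber)
  have "pm.lsec (\<lambda>q. fst (PBv Z Z' q)) m"
  proof (rule pm.lsecI[OF _ b(1)])
    show "\<forall>\<^sub>F q in nhds m. fst (PBv Z Z' q) \<in> {u. \<pi> u = \<pi> q}" using fib by eventually_elim (simp add: prol_fiberD)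
    have "\<forall>\<^sub>F q in nhds m. snd b (fst (PBv Z Z' q)) = deriv_along Ts q (snd (Z q)) (\<lambda>q. snd b (fst (Z' q)))
      - deriv_along Ts q (snd (Z' q)) (\<lambda>q. snd b (fst (Z q))) + br b (\<pi> q) (snd b (fst (Z q))) (snd b (fst (Z' q)))"
      using Z eventually_pi_dom[OF b]
    proof eventually_elim
      fix q assume q: "qm.lsec Z q" "qm.lsec Z' q" "\<pi> q \<in> dom b"
      show "snd b (fst (PBv Z Z' q)) = deriv_along Ts q (snd (Z q)) (\<lambda>q. snd b (fst (Z' q)))
      - deriv_along Ts q (snd (Z' q)) (\<lambda>q. snd b (fst (Z q))) + br b (\<pi> q) (snd b (fst (Z q))) (snd b (fst (Z' q)))"
        using fc_PBv[OF q(1,2) b(1) q(3)] pbr_components(1)[OF q(1,2) b(1) q(3)] unfolding fc_def by (metis fst_conv)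
    qed
    then show "smooth_at Ts (\<lambda>q. snd b (fst (PBv Z Z' q))) m"
      by (rule tot.smooth_at_transform)
        (intro tot.smooth_at_add tot.smooth_at_diff tot.smooth_at_deriv_along smooth_br_total smooth_prol_field
          smooth_psi_fst Zm b)
  qed (use b in simp)
  moreover have "(\<lambda>q. snd (PBv Z Z' q)) = tot.lie_bracket (\<lambda>q. snd (Z q)) (\<lambda>q. snd (Z' q))"
    by (simp add: PBv_def Let_def fun_eq_iff)
  then have "tot.smooth_field_at (\<lambda>q. snd (PBv Z Z' q)) m"
    using tot.smooth_field_lie_bracket[OF smooth_prol_field[OF Zm(1)] smooth_prol_field[OF Zm(2)]] by simp
  ultimately show ?thesis using fib by (simp add: qm_lsec_iff)
qed

lemma pbr_anti:
  assumes "b \<in> \<BB>" "\<pi> m \<in> dom b" shows "pbr b Z Z' m = - pbr b Z' Z m"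
  using br_anti[OF assms, of "snd b (fst (Z m))"] by (simp add: pbr_def)

lemma pbr_germ:
  assumes "\<forall>\<^sub>F q in nhds m. X q = X' q" "\<forall>\<^sub>F q in nhds m. Y q = Y' q"
  shows "pbr b X Y m = pbr b X' Y' m"
proof -
  have "deriv_along Ts m v (\<lambda>q. fc b (X q)) = deriv_along Ts m v (\<lambda>q. fc b (X' q))"
    "deriv_along Ts m v (\<lambda>q. fc b (Y q)) = deriv_along Ts m v (\<lambda>q. fc b (Y' q))" for v
    by (rule tot.deriv_along_eventually, use assms in eventually_elim, simp)+
  then show ?thesis using eventually_nhds_x_imp_x[OF assms(1)] eventually_nhds_x_imp_x[OF assms(2)]
    by (simp add: pbr_def)
qed

lemma pbr_add_right:
  assumes X: "qm.lsec X m" "qm.lsec Y m" "qm.lsec Z m" and b: "b \<in> \<BB>" "\<pi> m \<in> dom b"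
  shows "pbr b X (\<lambda>q. prol_add A (Y q) (Z q)) m = pbr b X Y m + pbr b X Z m"
proof -
  interpret l: linear "br b (\<pi> m) u" for u using bilinear_br[OF b] by (simp add: bilinear_def)
  have "\<forall>\<^sub>F q in nhds m. Y q \<in> prol_fiber A q" "\<forall>\<^sub>F q in nhds m. Z q \<in> prol_fiber A q"
    using X by (simp_all add: qm.lsec_def)
  then have "\<forall>\<^sub>F q in nhds m. fc b (prol_add A (Y q) (Z q)) = fc b (Y q) + fc b (Z q)"
    using eventually_pi_dom[OF b] by eventually_elim (rule fc_add[OF _ _ b(1)])
  from tot.deriv_along_eventually[OF this]
  have 1: "deriv_along Ts m v (\<lambda>q. fc b (prol_add A (Y q) (Z q))) =
      deriv_along Ts m v (\<lambda>q. fc b (Y q)) + deriv_along Ts m v (\<lambda>q. fc b (Z q))" if "v \<in> tangent_space Ts m" for v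
    using tot.deriv_along_add[OF that smooth_fc[OF X(2) b] smooth_fc[OF X(3) b]] by simp
  have 2: "deriv_along Ts m (snd (prol_add A (Y m) (Z m))) (\<lambda>q. fc b (X q)) =
      deriv_along Ts m (snd (Y m)) (\<lambda>q. fc b (X q)) + deriv_along Ts m (snd (Z m)) (\<lambda>q. fc b (X q))"
    using tot.deriv_along_add_vector[OF lsec_vector[OF X(2)] lsec_vector[OF X(3)] smooth_fc[OF X(1) b]]
    by (simp add: prol_add_def)
  have 3: "snd b (fst (prol_add A (Y m) (Z m))) = snd b (fst (Y m)) + snd b (fst (Z m))"
    using prol_fiberD(1)[OF qm.lsec_fib[OF X(2)]] prol_fiberD(1)[OF qm.lsec_fib[OF X(3)]] b
    by (simp add: prol_add_def bundle_chart)
  show ?thesis unfolding pbr_def 1[OF lsec_vector[OF X(1)]] 2 3 l.add by simp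
qed

lemma pbr_scale_right:
  assumes X: "qm.lsec X m" "qm.lsec Y m" and f: "smooth_at Ts f m" and b: "b \<in> \<BB>" "\<pi> m \<in> dom b"
  shows "pbr b X (\<lambda>q. prol_scale A (f q) (Y q)) m = f m *\<^sub>R pbr b X Y m + qm.act X f m *\<^sub>R fc b (Y m)"
proof -
  interpret l: linear "br b (\<pi> m) u" for u using bilinear_br[OF b] by (simp add: bilinear_def)
  have "\<forall>\<^sub>F q in nhds m. Y q \<in> prol_fiber A q" using X by (simp_all add: qm.lsec_def)
  then have "\<forall>\<^sub>F q in nhds m. fc b (prol_scale A (f q) (Y q)) = f q *\<^sub>R fc b (Y q)"
    using eventually_pi_dom[OF b] by eventually_elim (rule fc_scale[OF _ b(1)])
  from tot.deriv_along_eventually[OF this]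
  have 1: "deriv_along Ts m v (\<lambda>q. fc b (prol_scale A (f q) (Y q))) =
      f m *\<^sub>R deriv_along Ts m v (\<lambda>q. fc b (Y q)) + deriv_along Ts m v f *\<^sub>R fc b (Y m)" if "v \<in> tangent_space Ts m" for v
    using tot.deriv_along_scaleR[OF that f smooth_fc[OF X(2) b]] by simp
  have 2: "deriv_along Ts m (snd (prol_scale A (f m) (Y m))) (\<lambda>q. fc b (X q)) =
      f m *\<^sub>R deriv_along Ts m (snd (Y m)) (\<lambda>q. fc b (X q))"
    using tot.deriv_along_scale_vector[OF lsec_vector[OF X(2)] smooth_fc[OF X(1) b]]
    by (simp add: prol_scale_def)
  have 3: "snd b (fst (prol_scale A (f m) (Y m))) = f m *\<^sub>R snd b (fst (Y m))"
    using prol_fiberD(1)[OF qm.lsec_fib[OF X(2)]] b by (simp add: prol_scale_def bundle_chart)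
  show ?thesis unfolding pbr_def 1[OF lsec_vector[OF X(1)]] 2 3 l.scale qm.act_def by (simp add: algebra_simps)
qed

section \<open>The prolongation bracket on global sections\<close>

abbreviation "SS \<equiv> qm.sect CM"

definition PB :: "('a \<Rightarrow> ('e, 'a, 'f) prol) \<Rightarrow> ('a \<Rightarrow> ('e, 'a, 'f) prol) \<Rightarrow> 'a \<Rightarrow> ('e, 'a, 'f) prol" where
  "PB = (\<lambda>Z\<in>SS. \<lambda>Z'\<in>SS. \<lambda>m\<in>CM. PBv Z Z' m)"

lemma SS_lsec_eventually: "Z \<in> SS \<Longrightarrow> m \<in> CM \<Longrightarrow> \<forall>\<^sub>F q in nhds m. qm.lsec Z q"
  by (rule eventually_mono[OF qm.eventually_W]) (auto intro: qm.sect_lsec)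

lemma PB_sect: "Z \<in> SS \<Longrightarrow> Z' \<in> SS \<Longrightarrow> PB Z Z' \<in> SS"
  unfolding PB_def by (simp, intro qm.sectI open_CM PBv_lsec SS_lsec_eventually)

lemma fc_PB:
  "Z \<in> SS \<Longrightarrow> Z' \<in> SS \<Longrightarrow> m \<in> CM \<Longrightarrow> b \<in> \<BB> \<Longrightarrow> \<pi> m \<in> dom b \<Longrightarrow> fc b (PB Z Z' m) = pbr b Z Z' m"
  unfolding PB_def by (simp add: fc_PBv qm.sect_lsec)

lemma SS_eqI:
  assumes "X \<in> SS" "Y \<in> SS" "\<And>m b. m \<in> CM \<Longrightarrow> b \<in> \<BB> \<Longrightarrow> \<pi> m \<in> dom b \<Longrightarrow> fc b (X m) = fc b (Y m)"
  shows "X = Y"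
proof (rule extensionalityI[OF qm.sect_ext[OF assms(1)] qm.sect_ext[OF assms(2)]])
  fix m assume m: "m \<in> CM"
  obtain b where b: "b \<in> \<BB>" "\<pi> m \<in> dom b" using ex_bundle_chart by blast
  show "X m = Y m" using fc_inj[OF qm.sect_fib[OF assms(1) m] qm.sect_fib[OF assms(2) m] b assms(3)[OF m b]] .
qed

lemma eventually_section_add: "m \<in> CM \<Longrightarrow> \<forall>\<^sub>F q in nhds m. section_add (prol_add A) CM X Y q = prol_add A (X q) (Y q)"
  and eventually_section_scale: "m \<in> CM \<Longrightarrow> \<forall>\<^sub>F q in nhds m. section_scale (prol_scale A) CM f X q = prol_scale A (f q) (X q)"
  by (rule eventually_mono[OF qm.eventually_W]; simp add: section_add_def section_scale_def)+

lemma fc_section_add: "X \<in> SS \<Longrightarrow> Y \<in> SS \<Longrightarrow> m \<in> CM \<Longrightarrow> b \<in> \<BB> \<Longrightarrow> \<pi> m \<in> dom b \<Longrightarrow>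
    fc b (section_add (prol_add A) CM X Y m) = fc b (X m) + fc b (Y m)"
  by (simp add: section_add_def fc_add[OF qm.sect_fib qm.sect_fib])

lemma fc_section_scale: "X \<in> SS \<Longrightarrow> m \<in> CM \<Longrightarrow> b \<in> \<BB> \<Longrightarrow> \<pi> m \<in> dom b \<Longrightarrow>
    fc b (section_scale (prol_scale A) CM f X m) = f m *\<^sub>R fc b (X m)"
  by (simp add: section_scale_def fc_scale[OF qm.sect_fib])

lemma pbr_section_add_right:
  assumes "X \<in> SS" "Y \<in> SS" "Z \<in> SS" "m \<in> CM" "b \<in> \<BB>" "\<pi> m \<in> dom b"
  shows "pbr b X (section_add (prol_add A) CM Y Z) m = pbr b X Y m + pbr b X Z m"
  unfolding pbr_germ[OF eventually_mono[OF qm.eventually_W[OF assms(4)] refl] eventually_section_add[OF assms(4)]]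
  using assms by (intro pbr_add_right qm.sect_lsec)

lemma pbr_section_scale_right:
  assumes "X \<in> SS" "Y \<in> SS" "\<And>m. m \<in> CM \<Longrightarrow> smooth_at Ts f m" "m \<in> CM" "b \<in> \<BB>" "\<pi> m \<in> dom b"
  shows "pbr b X (section_scale (prol_scale A) CM f Y) m = f m *\<^sub>R pbr b X Y m + qm.act X f m *\<^sub>R fc b (Y m)"
  unfolding pbr_germ[OF eventually_mono[OF qm.eventually_W[OF assms(4)] refl] eventually_section_scale[OF assms(4)]]
  using assms by (intro pbr_scale_right qm.sect_lsec)

lemma smooth_act: "X \<in> SS \<Longrightarrow> (\<And>m. m \<in> CM \<Longrightarrow> smooth_at Ts f m) \<Longrightarrow> m \<in> CM \<Longrightarrow> smooth_at Ts (qm.act X f) m"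
  unfolding qm.act_def by (intro tot.smooth_at_deriv_along smooth_prol_field qm.sect_lsec)

text \<open>All identities are compared in the coordinates \<open>fc\<close>, where they become
  rules for derivatives; those for the first argument are reduced to the second by
  antisymmetry.\<close>

lemma leibniz_PB:
  "leibniz_bracket SS (prol_add A) (prol_scale A) CM {f. smooth_fun Ts CM f} qm.act PB"
  unfolding leibniz_bracket_def
proof (intro ballI conjI allI)
  fix X Y assume XY: "X \<in> SS" "Y \<in> SS"
  note [intro] = qm.sect_add[OF open_CM] qm.sect_scale[OF open_CM]
  show "PB X Y \<in> SS" by (rule PB_sect[OF XY])
  show "PB X Y = section_scale (prol_scale A) CM (\<lambda>_. - 1) (PB Y X)"
  proof (rule SS_eqI)
    show "fc b (PB X Y m) = fc b (section_scale (prol_scale A) CM (\<lambda>_. - 1) (PB Y X) m)"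
      if "m \<in> CM" "b \<in> \<BB>" "\<pi> m \<in> dom b" for m b
      using pbr_anti[OF that(2,3), of X Y] that XY by (simp add: fc_PB fc_section_scale PB_sect)
  qed (auto intro!: PB_sect XY)
  fix Z assume Z: "Z \<in> SS"
  show "PB X (section_add (prol_add A) CM Y Z) = section_add (prol_add A) CM (PB X Y) (PB X Z)"
  proof (rule SS_eqI)
    show "fc b (PB X (section_add (prol_add A) CM Y Z) m) = fc b (section_add (prol_add A) CM (PB X Y) (PB X Z) m)"
      if "m \<in> CM" "b \<in> \<BB>" "\<pi> m \<in> dom b" for m b
      using that XY Z by (simp add: fc_PB fc_section_add PB_sect pbr_section_add_right qm.sect_add[OF open_CM])
  qed (auto intro!: PB_sect XY Z)
  show "PB (section_add (prol_add A) CM X Z) Y = section_add (prol_add A) CM (PB X Y) (PB Z Y)"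
  proof (rule SS_eqI)
    show "fc b (PB (section_add (prol_add A) CM X Z) Y m) = fc b (section_add (prol_add A) CM (PB X Y) (PB Z Y) m)"
      if m: "m \<in> CM" and b: "b \<in> \<BB>" "\<pi> m \<in> dom b" for m b
      using m b XY Z pbr_anti[OF b, of _ Y]
      by (simp add: fc_PB fc_section_add PB_sect pbr_section_add_right qm.sect_add[OF open_CM])
  qed (auto intro!: PB_sect XY Z)
next
  fix X Y r assume XY: "X \<in> SS" "Y \<in> SS"
  note [intro] = qm.sect_scale[OF open_CM]
  have act0: "qm.act X (\<lambda>_. r) m = 0" for X m by (simp add: qm.act_def)
  have sc: "section_scale (prol_scale A) CM (\<lambda>_. r) X \<in> SS" if "X \<in> SS" for X using that by auto
  show "PB (section_scale (prol_scale A) CM (\<lambda>_. r) X) Y = section_scale (prol_scale A) CM (\<lambda>_. r) (PB X Y)"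
  proof (rule SS_eqI)
    show "fc b (PB (section_scale (prol_scale A) CM (\<lambda>_. r) X) Y m) = fc b (section_scale (prol_scale A) CM (\<lambda>_. r) (PB X Y) m)"
      if m: "m \<in> CM" and b: "b \<in> \<BB>" "\<pi> m \<in> dom b" for m b
      using m b XY pbr_anti[OF b, of _ Y]
      by (simp add: fc_PB fc_section_scale PB_sect pbr_section_scale_right sc act0)
  qed (auto intro!: PB_sect XY)
  show "PB X (section_scale (prol_scale A) CM (\<lambda>_. r) Y) = section_scale (prol_scale A) CM (\<lambda>_. r) (PB X Y)"
  proof (rule SS_eqI)
    show "fc b (PB X (section_scale (prol_scale A) CM (\<lambda>_. r) Y) m) = fc b (section_scale (prol_scale A) CM (\<lambda>_. r) (PB X Y) m)"
      if m: "m \<in> CM" and b: "b \<in> \<BB>" "\<pi> m \<in> dom b" for m b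
      using m b XY by (simp add: fc_PB fc_section_scale PB_sect pbr_section_scale_right sc act0)
  qed (auto intro!: PB_sect XY)
next
  fix X Y and f :: "'a \<Rightarrow> real" assume XY: "X \<in> SS" "Y \<in> SS" and "f \<in> {f. smooth_fun Ts CM f}"
  then have f: "\<And>m. m \<in> CM \<Longrightarrow> smooth_at Ts f m" by (simp add: tot.smooth_fun_iff open_CM)
  have sc: "section_scale (prol_scale A) CM f Y \<in> SS" if "Y \<in> SS" for Y using that f by (intro qm.sect_scale open_CM)
  have sc': "section_scale (prol_scale A) CM (qm.act X f) Y \<in> SS" using XY f by (intro qm.sect_scale open_CM smooth_act)
  show "PB X (section_scale (prol_scale A) CM f Y) = section_add (prol_add A) CM (section_scale (prol_scale A) CM f (PB X Y))
        (section_scale (prol_scale A) CM (qm.act X f) Y)"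
  proof (rule SS_eqI)
    show "fc b (PB X (section_scale (prol_scale A) CM f Y) m) =
        fc b (section_add (prol_add A) CM (section_scale (prol_scale A) CM f (PB X Y)) (section_scale (prol_scale A) CM (qm.act X f) Y) m)"
      if m: "m \<in> CM" and b: "b \<in> \<BB>" "\<pi> m \<in> dom b" for m b
      using m b XY by (simp add: fc_PB fc_section_scale fc_section_add PB_sect pbr_section_scale_right[OF _ _ f] sc sc')
  qed (auto intro!: PB_sect XY sc sc' qm.sect_add[OF open_CM])
qed

section \<open>Values of the bracket on frames and its uniqueness\<close>

lemma prol_hor_pt: "prol_hor A b a = (\<lambda>m. prol_pt b m (a, 0))"
  by (simp add: fun_eq_iff prol_hor_def prol_pt_def)

lemma prol_ver_pt: "b \<in> \<BB> \<Longrightarrow> \<pi> m \<in> dom b \<Longrightarrow> prol_ver A b a m = prol_pt b m (0, a)"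
  by (simp add: prol_ver_def prol_pt_def zero_vec_eq linear_0[OF linear_anchor_coeff])

lemma lsec_hor: "b \<in> \<BB> \<Longrightarrow> \<pi> m \<in> dom b \<Longrightarrow> qm.lsec (prol_hor A b a) m"
  unfolding prol_hor_pt by (rule qm.lsec_pt) simp_all

lemma eventually_ver: "b \<in> \<BB> \<Longrightarrow> \<pi> m \<in> dom b \<Longrightarrow> \<forall>\<^sub>F q in nhds m. prol_ver A b a q = prol_pt b q (0, a)"
  by (rule eventually_mono[OF eventually_pi_dom[of b m]]) (simp_all add: prol_ver_pt)

lemma lsec_ver: "b \<in> \<BB> \<Longrightarrow> \<pi> m \<in> dom b \<Longrightarrow> qm.lsec (prol_ver A b a) m"
  by (rule qm.lsec_transform[OF eventually_ver]) (auto intro: qm.lsec_pt)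

lemma fc_hor: "b \<in> \<BB> \<Longrightarrow> \<pi> m \<in> dom b \<Longrightarrow> fc b (prol_hor A b a m) = (a, anchor_coeff A b a (\<pi> m), 0)"
  and fc_ver: "b \<in> \<BB> \<Longrightarrow> \<pi> m \<in> dom b \<Longrightarrow> fc b (prol_ver A b a m) = (0, 0, a)"
  using tot.coord_vector_chart[of "tc b" m]
  by (simp_all add: fc_def prol_hor_def prol_ver_def psi_frame psi_zero bundle_chart)

lemma deriv_fc_hor:
  assumes b: "b \<in> \<BB>" "\<pi> m \<in> dom b" and v: "v \<in> tangent_space Ts m"
  shows "deriv_along Ts m v (\<lambda>q. fc b (prol_hor A b a q))
    = (0, deriv_along Bs (\<pi> m) (tangent_map Ts Bs \<pi> m v) (\<lambda>y. anchor_coeff A b a y), 0)"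
proof -
  have "\<forall>\<^sub>F q in nhds m. fc b (prol_hor A b a q) = (a, anchor_coeff A b a (\<pi> q), 0)"
    using eventually_pi_dom[OF b] by eventually_elim (simp add: fc_hor b)
  from tot.deriv_along_eventually[OF this]
  have "deriv_along Ts m v (\<lambda>q. fc b (prol_hor A b a q)) = deriv_along Ts m v (\<lambda>q. (a, anchor_coeff A b a (\<pi> q), 0))" .
  also have "\<dots> = (0, deriv_along Ts m v (\<lambda>q. anchor_coeff A b a (\<pi> q)), 0)"
    using smooth_anchor_coeff_total[OF b, of "\<lambda>_. a"]
    by (simp add: tot.deriv_along_Pair[OF v] tot.smooth_at_Pair)
  also have "deriv_along Ts m v (\<lambda>q. anchor_coeff A b a (\<pi> q)) = deriv_along Bs (\<pi> m) (tangent_map Ts Bs \<pi> m v) (\<lambda>y. anchor_coeff A b a y)"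
    using smooth_anchor_coeff_base[OF b, of "\<lambda>_. a"] by (intro deriv_along_lift v) simp
  finally show ?thesis .
qed

lemma deriv_fc_ver:
  assumes b: "b \<in> \<BB>" "\<pi> m \<in> dom b"
  shows "deriv_along Ts m v (\<lambda>q. fc b (prol_ver A b a q)) = 0"
proof -
  have "\<forall>\<^sub>F q in nhds m. fc b (prol_ver A b a q) = (0, 0, a)"
    using eventually_pi_dom[OF b] by eventually_elim (simp add: fc_ver b)
  from tot.deriv_along_eventually[OF this] show ?thesis by simp
qed

lemma fst_ver_hor: "fst (prol_ver A b a m) = zero_vec A (\<pi> m)" "fst (prol_hor A b a m) = frame A b a (\<pi> m)"
  by (simp_all add: prol_ver_def prol_hor_def)

lemma anchor_zero: "anchor A (zero_vec A x) = (\<lambda>_. 0)"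
proof -
  obtain b where b: "b \<in> \<BB>" "x \<in> dom b" using ex_bundle_chart by blast
  have "anchor A (zero_vec A x) = anchor A (fscale A 0 (zero_vec A x))"
    using b by (intro arg_cong[of _ _ "anchor A"] fibre_eqI[of b]) (simp_all add: bundle_chart psi_zero)
  then show ?thesis by (simp add: anchor_scale)
qed

lemma deriv_along_zero: "deriv_along Bs x (\<lambda>_. 0) f = 0" if "smooth_at Bs f x"
  using base.deriv_along_scale_vector[OF base.tangent_zero that, of 0] by simp

text \<open>The coordinates of the vertical frame are constant, those of the horizontal frame depend
  on the base point only. Vertical vectors therefore annihilate both, and between horizontal frames
  the derivatives of the anchor coefficients combine by \<open>anchor_br\<close>.\<close>

lemma pbr_frames:
  assumes b: "b \<in> \<BB>" "\<pi> m \<in> dom b"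
  shows "pbr b (prol_hor A b a) (prol_hor A b c) m = fc b (prol_hor A b (br b (\<pi> m) a c) m)"
    and "pbr b (prol_hor A b a) (prol_ver A b c) m = 0"
    and "pbr b (prol_ver A b a) (prol_ver A b c) m = 0"
proof -
  interpret l: linear "br b (\<pi> m) u" for u using bilinear_br[OF b] by (simp add: bilinear_def)
  note t = lsec_vector[OF lsec_hor[OF b]] lsec_vector[OF lsec_ver[OF b]]
  have s: "smooth_at Bs (\<lambda>y. anchor_coeff A b a y) (\<pi> m)" for a
    using smooth_anchor_coeff_base[OF b, of "\<lambda>_. a"] by simp
  show "pbr b (prol_hor A b a) (prol_hor A b c) m = fc b (prol_hor A b (br b (\<pi> m) a c) m)"
    by (simp add: pbr_def deriv_fc_hor[OF b t(1)] lsec_tangent_map[OF lsec_hor[OF b]] fc_hor b fst_ver_hor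
      anchor_br psi_frame)
  show "pbr b (prol_hor A b a) (prol_ver A b c) m = 0"
    by (simp add: pbr_def deriv_fc_hor[OF b t(2)] deriv_fc_ver[OF b] lsec_tangent_map[OF lsec_ver[OF b]] fst_ver_hor
      anchor_zero deriv_along_zero s psi_zero b l.zero flip: zero_prod_def)
  show "pbr b (prol_ver A b a) (prol_ver A b c) m = 0"
    by (simp add: pbr_def deriv_fc_ver[OF b] fst_ver_hor psi_zero b l.zero flip: zero_prod_def)
qed

lemma is_prol_bracket_iff:
  "is_prol_bracket A B \<longleftrightarrow> B \<in> SS \<rightarrow>\<^sub>E SS \<rightarrow>\<^sub>E SS \<and>
      leibniz_bracket SS (prol_add A) (prol_scale A) CM {f. smooth_fun Ts CM f} qm.act B \<and>
      (\<forall>b\<in>\<BB>. \<forall>m\<in>CM. \<pi> m \<in> dom b \<longrightarrow> (\<forall>\<alpha>\<in>Basis. \<forall>\<beta>\<in>Basis.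
            local_value SS SS B (prol_hor A b \<alpha>) (prol_hor A b \<beta>) m = prol_hor A b (br b (\<pi> m) \<alpha> \<beta>) m \<and>
            local_value SS SS B (prol_hor A b \<alpha>) (prol_ver A b \<beta>) m = (zero_vec A (\<pi> m), \<lambda>_. 0) \<and>
            local_value SS SS B (prol_ver A b \<alpha>) (prol_ver A b \<beta>) m = (zero_vec A (\<pi> m), \<lambda>_. 0)))"
  unfolding is_prol_bracket_def Let_def prol_sections_eq[OF open_CM] act_eq ..

lemma fc_zero: "b \<in> \<BB> \<Longrightarrow> \<pi> m \<in> dom b \<Longrightarrow> fc b (zero_vec A (\<pi> m), \<lambda>_. 0) = 0"
  by (simp add: fc_def psi_zero zero_prod_def)

lemma fc_local_value_PB:
  assumes "m \<in> CM" and b: "b \<in> \<BB>" "\<pi> m \<in> dom b" and "qm.lsec X m" "qm.lsec Y m"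
  shows "local_value SS SS PB X Y m \<in> prol_fiber A m" "fc b (local_value SS SS PB X Y m) = pbr b X Y m"
proof -
  obtain X' where X': "X' \<in> SS" "\<forall>\<^sub>F q in nhds m. X' q = X q" using qm.sect_extension[OF assms(1,4)] by blast
  obtain Y' where Y': "Y' \<in> SS" "\<forall>\<^sub>F q in nhds m. Y' q = Y q" using qm.sect_extension[OF assms(1,5)] by blast
  have eq: "local_value SS SS PB X Y m = PB X' Y' m"
    by (rule qm.local_value_bracket[OF leibniz_PB X'(1) Y'(1) assms(1) X'(2) Y'(2)])
  show "local_value SS SS PB X Y m \<in> prol_fiber A m"
    unfolding eq by (rule qm.sect_fib[OF PB_sect[OF X'(1) Y'(1)] assms(1)])
  show "fc b (local_value SS SS PB X Y m) = pbr b X Y m"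
    unfolding eq fc_PB[OF X'(1) Y'(1) assms(1) b] by (rule pbr_germ[OF X'(2) Y'(2)])
qed

lemma is_prol_bracket_PB: "is_prol_bracket A PB"
  unfolding is_prol_bracket_iff
proof (intro conjI ballI impI leibniz_PB)
  show "PB \<in> SS \<rightarrow>\<^sub>E SS \<rightarrow>\<^sub>E SS"
  proof (intro PiE_I)
    show "PB Z Z' \<in> SS" if "Z \<in> SS" "Z' \<in> SS" for Z Z' using PB_sect that by blast
  qed (auto simp: PB_def)
  fix b m \<alpha> \<beta> assume m: "m \<in> CM" and b: "b \<in> \<BB>" "\<pi> m \<in> dom b"
  have z: "(zero_vec A (\<pi> m), \<lambda>_. 0) \<in> prol_fiber A m" by (rule qm.zero_fib)
  show "local_value SS SS PB (prol_hor A b \<alpha>) (prol_hor A b \<beta>) m = prol_hor A b (br b (\<pi> m) \<alpha> \<beta>) m"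
    by (rule fc_inj[OF _ _ b]) (simp_all add: fc_local_value_PB[OF m b] b lsec_hor pbr_frames qm.lsec_fib)
  show "local_value SS SS PB (prol_hor A b \<alpha>) (prol_ver A b \<beta>) m = (zero_vec A (\<pi> m), \<lambda>_. 0)"
    by (rule fc_inj[OF _ _ b]) (simp_all add: fc_local_value_PB[OF m b] b lsec_hor lsec_ver pbr_frames z fc_zero)
  show "local_value SS SS PB (prol_ver A b \<alpha>) (prol_ver A b \<beta>) m = (zero_vec A (\<pi> m), \<lambda>_. 0)"
    by (rule fc_inj[OF _ _ b]) (simp_all add: fc_local_value_PB[OF m b] b lsec_hor lsec_ver pbr_frames z fc_zero)
qed

text \<open>By \<open>bracket_formula\<close> a Leibniz bracket is determined by its values on
  frames. These are prescribed for horizontal, mixed and vertical pairs; the mixed pairs in the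
  opposite order follow by antisymmetry.\<close>

lemma is_prol_bracket_unique:
  assumes B: "is_prol_bracket A B" and B': "is_prol_bracket A B'" shows "B = B'"
proof -
  have val: "local_value SS SS B (\<lambda>q. prol_pt b q a) (\<lambda>q. prol_pt b q c) m = local_value SS SS B' (\<lambda>q. prol_pt b q a) (\<lambda>q. prol_pt b q c) m"
    if m: "m \<in> CM" and b: "b \<in> \<BB>" "\<pi> m \<in> dom b"
      and ac: "a \<in> (\<lambda>b. (b, 0)) ` Basis \<union> (\<lambda>c. (0, c)) ` Basis" "c \<in> (\<lambda>b. (b, 0)) ` Basis \<union> (\<lambda>c. (0, c)) ` Basis" for m b a c
  proof -
    obtain X where X: "X \<in> SS" "\<forall>\<^sub>F q in nhds m. X q = prol_pt b q a"
      using qm.sect_extension[OF m qm.lsec_pt[of b m "\<lambda>_. a"]] b by auto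
    obtain Y where Y: "Y \<in> SS" "\<forall>\<^sub>F q in nhds m. Y q = prol_pt b q c"
      using qm.sect_extension[OF m qm.lsec_pt[of b m "\<lambda>_. c"]] b by auto
    have germ: "\<forall>\<^sub>F q in nhds m. X' q = prol_ver A b \<alpha> q" if "\<forall>\<^sub>F q in nhds m. X' q = prol_pt b q (0, \<alpha>)" for X' \<alpha>
      using that eventually_ver[OF b, of \<alpha>] by eventually_elim simp
    \<comment> \<open>The right-hand side does not mention \<open>B\<close>, so two brackets with
      the prescribed values agree on frames.\<close>
    have "B X Y m = (case (a, c) of ((\<alpha>, _), (\<beta>, _)) \<Rightarrow>
        if a \<in> (\<lambda>b. (b, 0)) ` Basis \<and> c \<in> (\<lambda>b. (b, 0)) ` Basis then prol_hor A b (br b (\<pi> m) \<alpha> \<beta>) m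
        else (zero_vec A (\<pi> m), \<lambda>_. 0))" if B: "is_prol_bracket A B" for B
    proof -
      note L = B[unfolded is_prol_bracket_iff, THEN conjunct2, THEN conjunct1]
      note V = B[unfolded is_prol_bracket_iff, THEN conjunct2, THEN conjunct2, rule_format, OF b(1) m b(2)]
      have lv: "local_value SS SS B P Q m = B P' Q' m" if "P' \<in> SS" "Q' \<in> SS"
        "\<forall>\<^sub>F q in nhds m. P' q = P q" "\<forall>\<^sub>F q in nhds m. Q' q = Q q" for P Q P' Q'
        by (rule qm.local_value_bracket[OF L that(1,2) m that(3,4)])
      \<comment> \<open>Basis vectors are nonzero, which keeps the two families of the combined
        basis apart in the conditional above.\<close>
      have nz: "(0, \<beta>) \<notin> (\<lambda>b. (b, 0)) ` (Basis :: 'f set)" if "\<beta> \<in> (Basis :: 'f set)" for \<beta> using that by auto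
      consider (hh) \<alpha> \<beta> where "a = (\<alpha>, 0)" "c = (\<beta>, 0)" "\<alpha> \<in> Basis" "\<beta> \<in> Basis"
        | (hv) \<alpha> \<beta> where "a = (\<alpha>, 0)" "c = (0, \<beta>)" "\<alpha> \<in> Basis" "\<beta> \<in> Basis"
        | (vh) \<alpha> \<beta> where "a = (0, \<alpha>)" "c = (\<beta>, 0)" "\<alpha> \<in> Basis" "\<beta> \<in> Basis"
        | (vv) \<alpha> \<beta> where "a = (0, \<alpha>)" "c = (0, \<beta>)" "\<alpha> \<in> Basis" "\<beta> \<in> Basis"
        using ac by auto
      then show ?thesis
      proof cases
        case hh
        then have "B X Y m = prol_hor A b (br b (\<pi> m) \<alpha> \<beta>) m"
          using V[of \<alpha> \<beta>] lv[OF X(1) Y(1), of "prol_hor A b \<alpha>" "prol_hor A b \<beta>"] X(2) Y(2) by (simp add: prol_hor_pt)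
        then show ?thesis using hh by auto
      next
        case hv
        then have "B X Y m = (zero_vec A (\<pi> m), \<lambda>_. 0)"
          using V[of \<alpha> \<beta>] lv[OF X(1) Y(1), of "prol_hor A b \<alpha>" "prol_ver A b \<beta>"] X(2) germ[of Y \<beta>] Y(2) by (simp add: prol_hor_pt)
        then show ?thesis using hv nz by simp
      next
        case vh
        then have "B Y X m = (zero_vec A (\<pi> m), \<lambda>_. 0)"
          using V[of \<beta> \<alpha>] lv[OF Y(1) X(1), of "prol_hor A b \<beta>" "prol_ver A b \<alpha>"] Y(2) germ[of X \<alpha>] X(2) by (simp add: prol_hor_pt)
        moreover have "prol_scale A (- 1) (zero_vec A (\<pi> m), \<lambda>_. 0) = (zero_vec A (\<pi> m), \<lambda>_. 0)"
          using fc_inj[OF qm.sc_fib[OF qm.zero_fib] qm.zero_fib b] fc_scale[OF qm.zero_fib b] by (simp add: fc_zero b)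
        ultimately have "B X Y m = (zero_vec A (\<pi> m), \<lambda>_. 0)"
          using qm.bracket_anti[OF L X(1) Y(1)] m by (simp add: section_scale_def)
        then show ?thesis using vh nz by simp
      next
        case vv
        then have "B X Y m = (zero_vec A (\<pi> m), \<lambda>_. 0)"
          using V[of \<alpha> \<beta>] lv[OF X(1) Y(1), of "prol_ver A b \<alpha>" "prol_ver A b \<beta>"] germ[of X \<alpha>] X(2) germ[of Y \<beta>] Y(2) by simp
        then show ?thesis using vv nz by simp
      qed
    qed
    from this[OF B] this[OF B'] have "B X Y m = B' X Y m" by simp
    moreover have "local_value SS SS B (\<lambda>q. prol_pt b q a) (\<lambda>q. prol_pt b q c) m = B X Y m"
      by (rule qm.local_value_bracket[OF _ X(1) Y(1) m X(2) Y(2)]) (use B in \<open>simp add: is_prol_bracket_iff\<close>)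
    moreover have "local_value SS SS B' (\<lambda>q. prol_pt b q a) (\<lambda>q. prol_pt b q c) m = B' X Y m"
      by (rule qm.local_value_bracket[OF _ X(1) Y(1) m X(2) Y(2)]) (use B' in \<open>simp add: is_prol_bracket_iff\<close>)
    ultimately show ?thesis by simp
  qed
  have LB: "leibniz_bracket SS (prol_add A) (prol_scale A) CM {f. smooth_fun Ts CM f} qm.act B"
    and LB': "leibniz_bracket SS (prol_add A) (prol_scale A) CM {f. smooth_fun Ts CM f} qm.act B'"
    and PE: "B \<in> SS \<rightarrow>\<^sub>E SS \<rightarrow>\<^sub>E SS" "B' \<in> SS \<rightarrow>\<^sub>E SS \<rightarrow>\<^sub>E SS"
    using B B' by (simp_all add: is_prol_bracket_iff)
  have R: "reproducing ((\<lambda>b. (b, 0)) ` (Basis :: 'f set) \<union> (\<lambda>c. (0, c)) ` (Basis :: 'f set))"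
    by (rule reproducing_Times[OF reproducing_Basis reproducing_Basis])
  have eq: "B X Y = B' X Y" if XY: "X \<in> SS" "Y \<in> SS" for X Y
  proof (rule extensionalityI[OF qm.sect_ext[OF qm.bracket_sect[OF LB XY]] qm.sect_ext[OF qm.bracket_sect[OF LB' XY]]])
    fix m assume m: "m \<in> CM"
    obtain b where b: "b \<in> \<BB>" "\<pi> m \<in> dom b" using ex_bundle_chart by blast
    have b': "m \<in> \<pi> -` dom b" using b by simp
    have "prol_coord b m (B X Y m) = prol_coord b m (B' X Y m)"
      unfolding qm.bracket_formula[OF LB R XY m b(1) b'] qm.bracket_formula[OF LB' R XY m b(1) b']
      by (intro arg_cong2[of _ _ _ _ "(+)"] sum.cong refl) (simp add: val[OF m b])
    then show "B X Y m = B' X Y m"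
      using qm.\<kappa>_inj[OF b(1) b' qm.sect_fib[OF qm.bracket_sect[OF LB XY] m] qm.sect_fib[OF qm.bracket_sect[OF LB' XY] m]] by blast
  qed
  show ?thesis
  proof (rule PiE_ext[OF PE])
    fix X assume X: "X \<in> SS"
    show "B X = B' X"
      by (rule PiE_ext[of _ SS "\<lambda>_. SS"]) (use PE X eq in \<open>auto dest: PiE_mem\<close>)
  qed
qed

lemma prol_bracket_eq: "prol_bracket A = PB"
  unfolding prol_bracket_def using is_prol_bracket_PB is_prol_bracket_unique by (intro the_equality)

end

section \<open>Vertical and horizontal derivatives and the Finsler metric\<close>

text \<open>The same product rule for linear maps that depend on all of the manifold, as the
  vertical Hessian of the energy does on the total space.\<close>

lemma (in smooth_manifold) deriv_along_linear_field:
  fixes H :: "'p \<Rightarrow> 'f::euclidean_space \<Rightarrow> 'w::real_normed_vector"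
  assumes v: "v \<in> tangent_space At m" and k: "smooth_at At k m"
    and lin: "\<forall>\<^sub>F q in nhds m. linear (H q)" and sm: "\<And>a. smooth_at At (\<lambda>q. H q a) m"
  shows "smooth_at At (\<lambda>q. H q (k q)) m"
    and "deriv_along At m v (\<lambda>q. H q (k q)) = H m (deriv_along At m v k) + deriv_along At m v (\<lambda>q. H q (k m))"
proof -
  have l: "linear (H m)" using lin by (rule eventually_nhds_x_imp_x)
  have ev: "\<forall>\<^sub>F q in nhds m. H q (l q) = (\<Sum>a\<in>Basis. (l q \<bullet> a) *\<^sub>R H q a)" for l
    using lin by eventually_elim (rule linear_reproducing[OF reproducing_Basis])
  have s: "smooth_at At (\<lambda>q. (l q \<bullet> a) *\<^sub>R H q a) m" if "smooth_at At l m" for a l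
    by (intro smooth_at_scaleR smooth_at_inner that smooth_at_const sm)
  show "smooth_at At (\<lambda>q. H q (k q)) m"
    by (rule smooth_at_transform[OF ev]) (intro smooth_at_sum s k)
  have ki: "deriv_along At m v (\<lambda>q. k q \<bullet> a) = deriv_along At m v k \<bullet> a" for a
    by (rule deriv_along_bounded_linear[OF v k bounded_linear_inner_left])
  have exp: "deriv_along At m v (\<lambda>q. H q (l q)) = (\<Sum>a\<in>Basis. deriv_along At m v (\<lambda>q. (l q \<bullet> a) *\<^sub>R H q a))"
    if "smooth_at At l m" for l
    unfolding deriv_along_eventually[OF ev] by (rule deriv_along_sum[OF v _ s[OF that]]) simp
  have "deriv_along At m v (\<lambda>q. H q (k q)) = (\<Sum>a\<in>Basis. (k m \<bullet> a) *\<^sub>R deriv_along At m v (\<lambda>q. H q a)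
      + (deriv_along At m v k \<bullet> a) *\<^sub>R H m a)"
    unfolding exp[OF k] using k by (subst deriv_along_scaleR[OF v]) (auto simp: ki intro!: sm)
  also have "\<dots> = H m (deriv_along At m v k) + (\<Sum>a\<in>Basis. (k m \<bullet> a) *\<^sub>R deriv_along At m v (\<lambda>q. H q a))"
    unfolding linear_reproducing[OF reproducing_Basis l, of "deriv_along At m v k"] by (simp add: sum.distrib)
  also have "(\<Sum>a\<in>Basis. (k m \<bullet> a) *\<^sub>R deriv_along At m v (\<lambda>q. H q a)) = deriv_along At m v (\<lambda>q. H q (k m))"
    using exp[OF smooth_at_const, of "k m"] by (simp add: deriv_along_scaleR[OF v _ sm])
  finally show "deriv_along At m v (\<lambda>q. H q (k q)) = H m (deriv_along At m v k) + deriv_along At m v (\<lambda>q. H q (k m))" .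
qed

context partial_finsler
begin

definition VV :: "('m, 'e, 'a, 'f) bundle_chart \<Rightarrow> 'f \<Rightarrow> ('a \<Rightarrow> 'w::real_normed_vector) \<Rightarrow> 'a \<Rightarrow> 'w" where
  "VV b w F m = deriv_along Ts m (snd (prol_ver A b w m)) F"

definition HH :: "('m, 'e, 'a, 'f) bundle_chart \<Rightarrow> 'f \<Rightarrow> ('a \<Rightarrow> 'w::real_normed_vector) \<Rightarrow> 'a \<Rightarrow> 'w" where
  "HH b w F m = deriv_along Ts m (snd (prol_hor A b w m)) F"

lemma ver_tangent: "b \<in> \<BB> \<Longrightarrow> \<pi> m \<in> dom b \<Longrightarrow> snd (prol_ver A b w m) \<in> tangent_space Ts m"
  and hor_tangent: "b \<in> \<BB> \<Longrightarrow> \<pi> m \<in> dom b \<Longrightarrow> snd (prol_hor A b w m) \<in> tangent_space Ts m"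
  by (simp_all add: lsec_vector lsec_ver lsec_hor)

lemma ver_tc: "b \<in> \<BB> \<Longrightarrow> \<pi> m \<in> dom b \<Longrightarrow> snd (prol_ver A b w m) (tc b) = (0, w)"
  and hor_tc: "b \<in> \<BB> \<Longrightarrow> \<pi> m \<in> dom b \<Longrightarrow> snd (prol_hor A b w m) (tc b) = (anchor_coeff A b w (\<pi> m), 0)"
  using fc_ver[of b m w] fc_hor[of b m w] by (simp_all add: fc_def)

lemma VV_chart: "b \<in> \<BB> \<Longrightarrow> \<pi> m \<in> dom b \<Longrightarrow> smooth_at Ts F m \<Longrightarrow>
    VV b w F m = fderiv (\<lambda>z. F (chart_inv (tc b) z)) (snd (tc b) m) (0, w)"
  and HH_chart: "b \<in> \<BB> \<Longrightarrow> \<pi> m \<in> dom b \<Longrightarrow> smooth_at Ts F m \<Longrightarrow>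
    HH b w F m = fderiv (\<lambda>z. F (chart_inv (tc b) z)) (snd (tc b) m) (anchor_coeff A b w (\<pi> m), 0)"
  unfolding VV_def HH_def
  by (simp_all add: tot.deriv_along_chart[of _ _ "tc b"] ver_tangent hor_tangent bundle_chart ver_tc hor_tc)

lemma deriv_along_split:
  assumes b: "b \<in> \<BB>" "\<pi> m \<in> dom b" and p: "p \<in> prol_fiber A m" and F: "smooth_at Ts F m"
  shows "deriv_along Ts m (snd p) F = HH b (snd b (fst p)) F m + VV b (snd (snd p (tc b))) F m"
proof -
  have "Cinf_at (\<lambda>z. F (chart_inv (tc b) z)) (snd (tc b) m)"
    using F b by (simp add: tot.smooth_at_chart[of "tc b"] bundle_chart)
  note l = linear_add[OF Cinf_at_linear[OF this], symmetric]
  have "snd p (tc b) = (anchor_coeff A b (snd b (fst p)) (\<pi> m), 0) + (0, snd (snd p (tc b)))"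
    using prol_vector_fst[OF p b] by (simp add: prod_eq_iff)
  then show ?thesis
    using tot.deriv_along_chart[OF prol_fiberD(2)[OF p], of "tc b" F] b F
    unfolding VV_chart[OF b F] HH_chart[OF b F] l by (simp add: bundle_chart)
qed

lemma linear_VV: assumes "b \<in> \<BB>" "\<pi> m \<in> dom b" "smooth_at Ts F m"
  shows "linear (\<lambda>w. VV b w F m)"
proof -
  have "Cinf_at (\<lambda>z. F (chart_inv (tc b) z)) (snd (tc b) m)"
    using assms by (simp add: tot.smooth_at_chart[of "tc b"] bundle_chart)
  then interpret l: linear "fderiv (\<lambda>z. F (chart_inv (tc b) z)) (snd (tc b) m)" by (rule Cinf_at_linear)
  show ?thesis unfolding VV_chart[OF assms] by (rule linearI) (simp_all flip: l.add l.scale)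
qed

lemma linear_HH: assumes "b \<in> \<BB>" "\<pi> m \<in> dom b" "smooth_at Ts F m"
  shows "linear (\<lambda>w. HH b w F m)"
proof -
  have "Cinf_at (\<lambda>z. F (chart_inv (tc b) z)) (snd (tc b) m)"
    using assms by (simp add: tot.smooth_at_chart[of "tc b"] bundle_chart)
  then interpret l: linear "fderiv (\<lambda>z. F (chart_inv (tc b) z)) (snd (tc b) m)" by (rule Cinf_at_linear)
  interpret a: linear "\<lambda>w. anchor_coeff A b w (\<pi> m)" by (rule linear_anchor_coeff[OF assms(1,2)])
  show ?thesis unfolding HH_chart[OF assms] by (rule linearI) (simp_all add: a.add a.scale flip: l.add l.scale)
qed

lemma smooth_VV: "b \<in> \<BB> \<Longrightarrow> \<pi> m \<in> dom b \<Longrightarrow> smooth_at Ts F m \<Longrightarrow> smooth_at Ts (\<lambda>q. VV b w F q) m"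
  and smooth_HH: "b \<in> \<BB> \<Longrightarrow> \<pi> m \<in> dom b \<Longrightarrow> smooth_at Ts F m \<Longrightarrow> smooth_at Ts (\<lambda>q. HH b w F q) m"
  unfolding VV_def HH_def
  by (intro tot.smooth_at_deriv_along smooth_prol_field lsec_ver lsec_hor; assumption)+

lemma VV_eventually: "\<forall>\<^sub>F q in nhds m. F q = G q \<Longrightarrow> VV b w F m = VV b w G m"
  and HH_eventually: "\<forall>\<^sub>F q in nhds m. F q = G q \<Longrightarrow> HH b w F m = HH b w G m"
  unfolding VV_def HH_def by (simp_all add: tot.deriv_along_eventually)

lemma deriv_psi: "v \<in> tangent_space Ts m \<Longrightarrow> b \<in> \<BB> \<Longrightarrow> \<pi> m \<in> dom b \<Longrightarrow> deriv_along Ts m v (snd b) = snd (v (tc b))"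
  using tot.deriv_along_bounded_linear[OF _ tot.smooth_at_chart_map[of "tc b" m] bounded_linear_snd, of v]
    tot.deriv_along_chart_map[of v m "tc b"] by (simp add: snd_tc bundle_chart)

lemma VV_psi: "b \<in> \<BB> \<Longrightarrow> \<pi> m \<in> dom b \<Longrightarrow> VV b w (snd b) m = w"
  unfolding VV_def by (simp add: deriv_psi ver_tangent ver_tc)

text \<open>The frame brackets with a vertical member vanish, so the underlying vector fields on the
  total space have zero Lie bracket and commute as derivations.\<close>

lemma VV_HH_commute:
  fixes F :: "'a \<Rightarrow> 'w::real_inner"
  assumes b: "b \<in> \<BB>" "\<pi> m \<in> dom b" and F: "smooth_at Ts F m"
  shows "VV b u (\<lambda>q. HH b w F q) m = HH b w (\<lambda>q. VV b u F q) m"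
    and VV_VV_commute: "VV b u (\<lambda>q. VV b w F q) m = VV b w (\<lambda>q. VV b u F q) m"
proof -
  have lie0: "tot.lie_bracket (\<lambda>q. snd (Z q)) (\<lambda>q. snd (Z' q)) m = (\<lambda>_. 0)"
    if Z: "qm.lsec Z m" "qm.lsec Z' m" "pbr b Z Z' m = 0" for Z Z'
    by (rule tot.tangent_ext[OF tot.lie_bracket_tangent[OF smooth_prol_field[OF Z(1)] smooth_prol_field[OF Z(2)]] tot.tangent_zero, of "tc b"])
      (use b Z pbr_components(2)[OF Z(1,2) b] in \<open>simp_all add: bundle_chart\<close>)
  have z: "deriv_along Ts m (\<lambda>_. 0) F = 0" using tot.deriv_along_scale_vector[OF tot.tangent_zero F, of 0] by simp
  show "VV b u (\<lambda>q. HH b w F q) m = HH b w (\<lambda>q. VV b u F q) m"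
    using tot.deriv_along_lie_bracket[OF smooth_prol_field[OF lsec_hor[OF b]] smooth_prol_field[OF lsec_ver[OF b]] F, of w u]
      lie0[OF lsec_hor[OF b] lsec_ver[OF b] pbr_frames(2)[OF b], of w u] z unfolding VV_def HH_def by simp
  show "VV b u (\<lambda>q. VV b w F q) m = VV b w (\<lambda>q. VV b u F q) m"
    using tot.deriv_along_lie_bracket[OF smooth_prol_field[OF lsec_ver[OF b]] smooth_prol_field[OF lsec_ver[OF b]] F, of w u]
      lie0[OF lsec_ver[OF b] lsec_ver[OF b] pbr_frames(3)[OF b], of w u] z unfolding VV_def HH_def by simp
qed

lemma fadd_fscale_chart:
  assumes "b \<in> \<BB>" "\<pi> m \<in> dom b" "\<pi> u = \<pi> m"
  shows "fadd A m (fscale A t u) = chart_inv (tc b) (snd (tc b) m + t *\<^sub>R (0, snd b u))"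
proof -
  have "fadd A m (fscale A t u) = frame A b (snd b m + t *\<^sub>R snd b u) (\<pi> m)"
    using assms by (intro fibre_eqI[of b]) (simp_all add: pi_frame psi_frame bundle_chart)
  then show ?thesis using chart_inv_tc[OF assms(1,2)] by (simp add: snd_tc)
qed

text \<open>The curve \<open>m + t u\<close> in a fibre is a straight line in total coordinates.
  This links the derivatives in the definitions of the fundamental and Cartan tensors with vertical
  vector fields.\<close>

lemma vertical_line_derivative:
  assumes b: "b \<in> \<BB>" "\<pi> m \<in> dom b" and u: "\<pi> u = \<pi> m" and F: "smooth_at Ts F m"
  shows "((\<lambda>t. F (fadd A m (fscale A t u))) has_vector_derivative VV b (snd b u) F m) (at 0)"
proof -
  let ?f = "\<lambda>z. F (chart_inv (tc b) z)" and ?z = "snd (tc b) m"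
  have f: "Cinf_at ?f ?z" using F b by (simp add: tot.smooth_at_chart[of "tc b"] bundle_chart)
  have d: "((\<lambda>t::real. ?z + t *\<^sub>R (0, snd b u)) has_derivative (\<lambda>t. t *\<^sub>R (0, snd b u))) (at 0)"
    by (auto intro!: derivative_eq_intros)
  have "((\<lambda>t. ?f (?z + t *\<^sub>R (0, snd b u))) has_derivative (\<lambda>t. fderiv ?f ?z (t *\<^sub>R (0, snd b u)))) (at 0)"
    by (rule has_derivative_compose[OF d]) (use Cinf_at_has_derivative[OF f] in \<open>simp flip: zero_prod_def\<close>)
  then show ?thesis
    unfolding has_vector_derivative_def VV_chart[OF b F] fadd_fscale_chart[OF b u] linear_cmul[OF Cinf_at_linear[OF f]] .
qed

lemma vertical_line_deriv:
  fixes F :: "'a \<Rightarrow> real"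
  assumes "b \<in> \<BB>" "\<pi> m \<in> dom b" "\<pi> u = \<pi> m" "smooth_at Ts F m"
  shows "deriv (\<lambda>t. F (fadd A m (fscale A t u))) 0 = VV b (snd b u) F m"
  using vertical_line_derivative[OF assms] by (intro DERIV_imp_deriv) (simp add: has_real_derivative_iff_has_vector_derivative)

lemma vertical_line_tendsto:
  assumes "\<pi> u = \<pi> m" "\<forall>\<^sub>F q in nhds m. P q"
  shows "\<forall>\<^sub>F t in nhds (0::real). P (fadd A m (fscale A t u))"
proof -
  obtain b where b: "b \<in> \<BB>" "\<pi> m \<in> dom b" using ex_bundle_chart by blast
  have "\<forall>\<^sub>F z in nhds (snd (tc b) m). P (chart_inv (tc b) z)"
    using assms(2) tot.eventually_chart[of "tc b" m P] b by (simp add: bundle_chart)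
  moreover have "((\<lambda>t::real. snd (tc b) m + t *\<^sub>R (0, snd b u)) \<longlongrightarrow> snd (tc b) m + 0 *\<^sub>R (0, snd b u)) (nhds 0)"
    by (intro tendsto_intros filterlim_ident)
  then have "filterlim (\<lambda>t::real. snd (tc b) m + t *\<^sub>R (0, snd b u)) (nhds (snd (tc b) m)) (nhds 0)"
    by (simp flip: zero_prod_def)
  ultimately have "\<forall>\<^sub>F t in nhds (0::real). P (chart_inv (tc b) (snd (tc b) m + t *\<^sub>R (0, snd b u)))"
    by (rule eventually_compose_filterlim)
  then show ?thesis unfolding fadd_fscale_chart[OF b assms(1)] .
qed

section \<open>The energy, its vertical Hessian and the Cartan tensor\<close>

definition L :: "'a \<Rightarrow> real" where "L m = 1/2 * (finsler A m)\<^sup>2"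

lemma smooth_L: "m \<in> CM \<Longrightarrow> smooth_at Ts L m"
proof -
  assume "m \<in> CM"
  then have "smooth_at Ts (finsler A) m"
    using pfm by (simp add: partial_finsler_metric_def tot.smooth_fun_iff[OF open_CM])
  then show ?thesis unfolding L_def power2_eq_square by (intro tot.smooth_at_mult tot.smooth_at_const)
qed

definition gm :: "('m, 'e, 'a, 'f) bundle_chart \<Rightarrow> 'a \<Rightarrow> 'f \<Rightarrow> 'f \<Rightarrow> real" where
  "gm b m u w = VV b u (\<lambda>q. VV b w L q) m"

lemma smooth_VL: "b \<in> \<BB> \<Longrightarrow> m \<in> CM \<Longrightarrow> \<pi> m \<in> dom b \<Longrightarrow> smooth_at Ts (\<lambda>q. VV b w L q) m"
  by (intro smooth_VV smooth_L)

lemma smooth_gm: "b \<in> \<BB> \<Longrightarrow> m \<in> CM \<Longrightarrow> \<pi> m \<in> dom b \<Longrightarrow> smooth_at Ts (\<lambda>q. gm b q u w) m"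
  unfolding gm_def by (intro smooth_VV smooth_L)

lemma gm_sym: "b \<in> \<BB> \<Longrightarrow> m \<in> CM \<Longrightarrow> \<pi> m \<in> dom b \<Longrightarrow> gm b m u w = gm b m w u"
  unfolding gm_def by (intro VV_VV_commute smooth_L)

lemma eventually_CM_dom: "b \<in> \<BB> \<Longrightarrow> m \<in> CM \<Longrightarrow> \<pi> m \<in> dom b \<Longrightarrow> \<forall>\<^sub>F q in nhds m. q \<in> CM \<and> \<pi> q \<in> dom b"
  using qm.eventually_W[of m] eventually_pi_dom[of b m] by (simp add: eventually_conj)

lemma bilinear_gm: assumes "b \<in> \<BB>" "m \<in> CM" "\<pi> m \<in> dom b" shows "bilinear (gm b m)"
proof -
  have l: "linear (\<lambda>u. gm b m u w)" for w unfolding gm_def by (rule linear_VV[OF assms(1,3) smooth_VL[OF assms]])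
  moreover have "linear (\<lambda>w. gm b m u w)" for u using l[of u] unfolding gm_sym[OF assms, of u] .
  ultimately show ?thesis by (simp add: bilinear_def)
qed

text \<open>The inner derivative has to be known at the points \<open>m + s v\<close> for small
  \<open>s\<close>, which stay in the open conic domain. Regrouping the sum makes the inner curve a
  line through such a point, and \<open>F^2 = 2 L\<close> cancels the factor 1/2.\<close>

lemma fund_tensor_eq:
  assumes b: "b \<in> \<BB>" "\<pi> m \<in> dom b" and m: "m \<in> CM" and v: "\<pi> v = \<pi> m" "\<pi> w = \<pi> m"
  shows "fund_tensor A m v w = gm b m (snd b v) (snd b w)"
proof -
  have assoc: "fadd A m (fadd A (fscale A s v) (fscale A t w)) = fadd A (fadd A m (fscale A s v)) (fscale A t w)" for s t
    using b v by (intro fibre_eqI[of b]) (simp_all add: bundle_chart)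
  have sq: "(finsler A u)\<^sup>2 = 2 * L u" for u by (simp add: L_def)
  have "\<forall>\<^sub>F s in nhds 0. fadd A m (fscale A s v) \<in> CM"
    by (rule vertical_line_tendsto[OF v(1) qm.eventually_W[OF m]])
  then have ev: "\<forall>\<^sub>F s in nhds 0. deriv (\<lambda>t. 2 * L (fadd A (fadd A m (fscale A s v)) (fscale A t w))) 0
      = 2 * VV b (snd b w) L (fadd A m (fscale A s v))"
  proof eventually_elim
    fix s assume s: "fadd A m (fscale A s v) \<in> CM"
    have "\<pi> (fadd A m (fscale A s v)) = \<pi> m" using v by simp
    then have "((\<lambda>t. L (fadd A (fadd A m (fscale A s v)) (fscale A t w))) has_real_derivative VV b (snd b w) L (fadd A m (fscale A s v))) (at 0)"
      using vertical_line_derivative[OF b(1) _ _ smooth_L[OF s], of w] b v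
      by (simp add: has_real_derivative_iff_has_vector_derivative)
    from DERIV_cmult[OF this, of 2] show "deriv (\<lambda>t. 2 * L (fadd A (fadd A m (fscale A s v)) (fscale A t w))) 0
      = 2 * VV b (snd b w) L (fadd A m (fscale A s v))" by (rule DERIV_imp_deriv)
  qed
  have "((\<lambda>s. VV b (snd b w) L (fadd A m (fscale A s v))) has_real_derivative gm b m (snd b v) (snd b w)) (at 0)"
    unfolding gm_def using vertical_line_derivative[OF b v(1) smooth_VL[OF b(1) m b(2)]]
    by (simp add: has_real_derivative_iff_has_vector_derivative)
  from DERIV_imp_deriv[OF DERIV_cmult[OF this, of 2]] show ?thesis
    unfolding fund_tensor_def assoc sq deriv_cong_ev[OF ev refl] by simp
qed

text \<open>The two inner derivatives are twice the fundamental tensor at a nearby point, so only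
  one further vertical derivative remains; the constants combine to 2 * 1/4 * 2 = 1.\<close>

lemma cartan_tensor_eq:
  assumes b: "b \<in> \<BB>" "\<pi> m \<in> dom b" and m: "m \<in> CM" and v: "\<pi> u = \<pi> m" "\<pi> v = \<pi> m" "\<pi> w = \<pi> m"
  shows "2 * cartan_tensor A m u v w = VV b (snd b u) (\<lambda>q. gm b q (snd b v) (snd b w)) m"
proof -
  have assoc: "fadd A m (fadd A (fscale A r u) (fadd A (fscale A s v) (fscale A t w)))
      = fadd A (fadd A m (fscale A r u)) (fadd A (fscale A s v) (fscale A t w))" for r s t
    using b v by (intro fibre_eqI[of b]) (simp_all add: bundle_chart)
  have "\<forall>\<^sub>F r in nhds 0. fadd A m (fscale A r u) \<in> CM"
    by (rule vertical_line_tendsto[OF v(1) qm.eventually_W[OF m]])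
  then have ev: "\<forall>\<^sub>F r in nhds 0. deriv (\<lambda>s. deriv (\<lambda>t. (finsler A (fadd A (fadd A m (fscale A r u)) (fadd A (fscale A s v) (fscale A t w))))\<^sup>2) 0) 0
      = 2 * gm b (fadd A m (fscale A r u)) (snd b v) (snd b w)"
  proof eventually_elim
    fix r assume r: "fadd A m (fscale A r u) \<in> CM"
    have "\<pi> (fadd A m (fscale A r u)) = \<pi> m" using v by simp
    then have "fund_tensor A (fadd A m (fscale A r u)) v w = gm b (fadd A m (fscale A r u)) (snd b v) (snd b w)"
      using b v by (intro fund_tensor_eq r) auto
    then show "deriv (\<lambda>s. deriv (\<lambda>t. (finsler A (fadd A (fadd A m (fscale A r u)) (fadd A (fscale A s v) (fscale A t w))))\<^sup>2) 0) 0
      = 2 * gm b (fadd A m (fscale A r u)) (snd b v) (snd b w)" by (simp add: fund_tensor_def)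
  qed
  have "((\<lambda>r. gm b (fadd A m (fscale A r u)) (snd b v) (snd b w)) has_real_derivative VV b (snd b u) (\<lambda>q. gm b q (snd b v) (snd b w)) m) (at 0)"
    using vertical_line_derivative[OF b v(1) smooth_gm[OF b(1) m b(2)]]
    by (simp add: has_real_derivative_iff_has_vector_derivative)
  from DERIV_imp_deriv[OF DERIV_cmult[OF this, of 2]] show ?thesis
    unfolding cartan_tensor_def assoc deriv_cong_ev[OF ev refl] by simp
qed

lemma gm_pos: assumes b: "b \<in> \<BB>" "\<pi> m \<in> dom b" and m: "m \<in> CM" and u: "u \<noteq> 0" shows "gm b m u u > 0"
proof -
  have "frame A b u (\<pi> m) \<noteq> zero_vec A (\<pi> m)" using u b psi_frame psi_zero by metis
  then have "fund_tensor A m (frame A b u (\<pi> m)) (frame A b u (\<pi> m)) > 0"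
    using pfm m b unfolding partial_finsler_metric_def by (simp add: pi_frame)
  then show ?thesis using b by (simp add: fund_tensor_eq[OF b m] pi_frame psi_frame)
qed

lemma gm_nondegenerate:
  assumes b: "b \<in> \<BB>" "\<pi> m \<in> dom b" and m: "m \<in> CM" and eq: "\<And>w. gm b m u w = gm b m v w" shows "u = v"
proof (rule ccontr)
  assume "u \<noteq> v"
  then have "gm b m (u - v) (u - v) > 0" using gm_pos[OF b m] by simp
  moreover have "gm b m (u - v) (u - v) = 0" using bilinear_lsub[OF bilinear_gm[OF b(1) m b(2)]] eq by simp
  ultimately show False by simp
qed

text \<open>Raising an index with g: the Gram-Schmidt construction is carried out in total
  coordinates, over the part of the conic domain in one trivialisation. It yields both the spray
  coefficients and the Christoffel symbols.\<close>

lemma smooth_solution: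
  assumes b: "b \<in> \<BB>" and r: "\<And>m w. m \<in> CM \<Longrightarrow> \<pi> m \<in> dom b \<Longrightarrow> smooth_at Ts (\<lambda>m. r m w) m"
    and lin: "\<And>m. m \<in> CM \<Longrightarrow> \<pi> m \<in> dom b \<Longrightarrow> linear (r m)"
  obtains s where "\<And>m. m \<in> CM \<Longrightarrow> \<pi> m \<in> dom b \<Longrightarrow> smooth_at Ts s m"
    "\<And>m w. m \<in> CM \<Longrightarrow> \<pi> m \<in> dom b \<Longrightarrow> gm b m (s m) w = r m w"
proof -
  define \<Omega> where "\<Omega> = CM \<inter> \<pi> -` dom b"
  let ?p = "chart_inv (tc b)"
  have tb: "tc b \<in> Ts" by (rule bundle_chart(5)[OF b])
  have o: "open (snd (tc b) ` \<Omega>)"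
    unfolding \<Omega>_def using open_CM pi_continuous[OF open_dom[OF b]] by (intro tot.open_chart_image tb open_Int) auto
  have p: "?p z \<in> CM" "\<pi> (?p z) \<in> dom b" "snd (tc b) (?p z) = z" if "z \<in> snd (tc b) ` \<Omega>" for z
    using that tot.chart_inv_chart[OF tb] by (auto simp: \<Omega>_def)
  have sm: "Cinf_at (\<lambda>z. F (?p z)) z" if "z \<in> snd (tc b) ` \<Omega>" "smooth_at Ts F (?p z)" for F :: "'a \<Rightarrow> real" and z
    using that p[OF that(1)] tot.smooth_at_chart[OF tb, of "?p z" F] by simp
  obtain s where s: "\<And>z. z \<in> snd (tc b) ` \<Omega> \<Longrightarrow> Cinf_at s z" "\<And>z w. z \<in> snd (tc b) ` \<Omega> \<Longrightarrow> gm b (?p z) (s z) w = r (?p z) w"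
  proof (rule smooth_linear_solution[OF o, of "\<lambda>z. gm b (?p z)" "\<lambda>z. r (?p z)"])
    fix z u w assume z: "z \<in> snd (tc b) ` \<Omega>"
    note pz = p[OF z]
    show "bilinear (gm b (?p z))" by (rule bilinear_gm[OF b pz(1,2)])
    show "gm b (?p z) u w = gm b (?p z) w u" by (rule gm_sym[OF b pz(1,2)])
    show "gm b (?p z) u u > 0" if "u \<noteq> 0" by (rule gm_pos[OF b pz(2,1) that])
    show "Cinf_at (\<lambda>z. gm b (?p z) u w) z" by (rule sm[OF z smooth_gm[OF b pz(1,2)]])
    show "Cinf_at (\<lambda>z. r (?p z) w) z" by (rule sm[OF z r[OF pz(1,2)]])
    show "linear (r (?p z))" by (rule lin[OF pz(1,2)])
  qed (rule that)
  show ?thesis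
  proof (rule that[of "\<lambda>m. s (snd (tc b) m)"])
    fix m w assume m: "m \<in> CM" "\<pi> m \<in> dom b"
    then have z: "snd (tc b) m \<in> snd (tc b) ` \<Omega>" by (simp add: \<Omega>_def)
    have pm: "?p (snd (tc b) m) = m" using tot.chart_inv_chart[OF tb] m by simp
    show "smooth_at Ts (\<lambda>m. s (snd (tc b) m)) m"
      using m by (intro tot.smooth_at_compose[OF model_total, of s "snd (tc b)"] s(1)[OF z] tot.smooth_at_chart_map tb) simp
    show "gm b m (s (snd (tc b) m)) w = r m w" using s(2)[OF z, of w] pm by simp
  qed
qed

subsection \<open>Euler's identities\<close>

lemma L_scale: "m \<in> CM \<Longrightarrow> r > 0 \<Longrightarrow> L (fscale A r m) = r\<^sup>2 * L m"
  using pfm unfolding partial_finsler_metric_def by (auto simp: L_def power_mult_distrib)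

text \<open>Moving from \<open>m\<close> in its own direction is scaling by \<open>1 + t\<close>;
  homogeneity of degree 2 is differentiated at \<open>t = 0\<close>.\<close>

lemma VL_psi: assumes b: "b \<in> \<BB>" "\<pi> m \<in> dom b" and m: "m \<in> CM" shows "VV b (snd b m) L m = 2 * L m"
proof -
  have "\<forall>\<^sub>F t in nhds (0::real). t \<in> {-1<..}" by (intro eventually_nhds_in_open) auto
  then have ev: "\<forall>\<^sub>F t in nhds (0::real). L (fadd A m (fscale A t m)) = (1 + t)\<^sup>2 * L m"
  proof eventually_elim
    fix t :: real assume t: "t \<in> {-1<..}"
    have "fadd A m (fscale A t m) = fscale A (1 + t) m"
      using b by (intro fibre_eqI[of b]) (simp_all add: bundle_chart algebra_simps)
    then show "L (fadd A m (fscale A t m)) = (1 + t)\<^sup>2 * L m" using L_scale[OF m, of "1 + t"] t by simp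
  qed
  have "((\<lambda>t. (1 + t)\<^sup>2 * L m) has_real_derivative 2 * L m) (at 0)" by (auto intro!: derivative_eq_intros)
  then show ?thesis
    using vertical_line_deriv[OF b refl smooth_L[OF m]] deriv_cong_ev[OF ev refl] DERIV_imp_deriv by metis
qed

lemma eventually_linear_VL:
  assumes "b \<in> \<BB>" "m \<in> CM" "\<pi> m \<in> dom b" shows "\<forall>\<^sub>F q in nhds m. linear (\<lambda>w. VV b w L q)"
  using eventually_CM_dom[OF assms] by eventually_elim (intro linear_VV smooth_L assms; simp)

text \<open>Euler's identity is differentiated along an arbitrary vector. The fibre coordinate
  \<open>snd b q\<close> inserted in the identity moves too, and its derivative, the fibre component
  of the vector, gives the first summand.\<close>

lemma deriv_VL_psi:
  assumes b: "b \<in> \<BB>" "\<pi> m \<in> dom b" and m: "m \<in> CM" and v: "v \<in> tangent_space Ts m"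
  shows "VV b (snd (v (tc b))) L m + deriv_along Ts m v (\<lambda>q. VV b (snd b m) L q) = 2 * deriv_along Ts m v L"
proof -
  have "\<forall>\<^sub>F q in nhds m. VV b (snd b q) L q = 2 * L q"
    using eventually_CM_dom[OF b(1) m b(2)] by eventually_elim (simp add: VL_psi b)
  from tot.deriv_along_eventually[OF this] have "deriv_along Ts m v (\<lambda>q. VV b (snd b q) L q) = 2 * deriv_along Ts m v L"
    using tot.deriv_along_bounded_linear[OF v smooth_L[OF m] bounded_linear_mult_right[of 2]] by simp
  then show ?thesis
    using tot.deriv_along_linear_field(2)[OF v smooth_psi[OF b] eventually_linear_VL[OF b(1) m b(2)] smooth_VL[OF b(1) m b(2)]]
    by (simp add: deriv_psi v b)
qed

text \<open>For a vertical vector the first summand of the differentiated Euler identity is one of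
  the two copies on its right-hand side.\<close>

lemma gm_psi: assumes b: "b \<in> \<BB>" "\<pi> m \<in> dom b" and m: "m \<in> CM" shows "gm b m w (snd b m) = VV b w L m"
  using deriv_VL_psi[OF b m ver_tangent[OF b, of w]] by (simp add: gm_def VV_def[of b w] ver_tc b)

lemma deriv_gm_psi:
  assumes b: "b \<in> \<BB>" "\<pi> m \<in> dom b" and m: "m \<in> CM" and v: "v \<in> tangent_space Ts m"
  shows "gm b m w (snd (v (tc b))) + deriv_along Ts m v (\<lambda>q. gm b q w (snd b m)) = deriv_along Ts m v (\<lambda>q. VV b w L q)"
proof -
  have "\<forall>\<^sub>F q in nhds m. gm b q w (snd b q) = VV b w L q"
    using eventually_CM_dom[OF b(1) m b(2)] by eventually_elim (simp add: gm_psi b)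
  note ev = tot.deriv_along_eventually[OF this]
  have "\<forall>\<^sub>F q in nhds m. linear (gm b q w)"
    using eventually_CM_dom[OF b(1) m b(2)] by eventually_elim (use bilinear_gm b in \<open>auto simp: bilinear_def\<close>)
  from tot.deriv_along_linear_field(2)[OF v smooth_psi[OF b] this smooth_gm[OF b(1) m b(2)]] show ?thesis
    using ev by (simp add: deriv_psi v b)
qed

text \<open>The fibre derivative of \<open>g(w, y) = V_w L\<close> in direction \<open>u\<close>
  produces \<open>g(w, u)\<close> on both sides; what is left says that the Cartan tensor
  annihilates \<open>y\<close>.\<close>

lemma V_gm_psi:
  assumes b: "b \<in> \<BB>" "\<pi> m \<in> dom b" and m: "m \<in> CM" shows "VV b u (\<lambda>q. gm b q w (snd b m)) m = 0"
  using deriv_gm_psi[OF b m ver_tangent[OF b, of u], of w] gm_sym[OF b(1) m b(2), of u w]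
  unfolding gm_def[of b m u w] by (simp add: VV_def[of b u] ver_tc b)

lemma V_gm_sym:
  assumes b: "b \<in> \<BB>" "\<pi> m \<in> dom b" and m: "m \<in> CM"
  shows "VV b u (\<lambda>q. gm b q v w) m = VV b v (\<lambda>q. gm b q u w) m"
    and "VV b u (\<lambda>q. gm b q v w) m = VV b u (\<lambda>q. gm b q w v) m"
proof -
  show "VV b u (\<lambda>q. gm b q v w) m = VV b v (\<lambda>q. gm b q u w) m"
    unfolding gm_def by (rule VV_VV_commute[OF b smooth_VL[OF b(1) m b(2)]])
  show "VV b u (\<lambda>q. gm b q v w) m = VV b u (\<lambda>q. gm b q w v) m"
    by (rule VV_eventually) (use eventually_CM_dom[OF b(1) m b(2)] in eventually_elim, use gm_sym b in auto)
qed

end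

section \<open>The Finsler spray and the vertical projection\<close>

context partial_finsler
begin

text \<open>\<open>vertical_lift\<close> is defined by curves in the fibre, without a
  trivialisation. Identifying it with the frame vectors shows that vertical derivatives depend on
  the fibre vector only.\<close>

lemma ver_vertical_lift:
  assumes b: "b \<in> \<BB>" "\<pi> m \<in> dom b" and u: "\<pi> u = \<pi> m"
  shows "snd (prol_ver A b (snd b u) m) = vertical_lift A m u"
proof
  fix d
  show "snd (prol_ver A b (snd b u) m) d = vertical_lift A m u d"
  proof (cases "d \<in> Ts \<and> m \<in> fst d")
    case True
    then have "vertical_lift A m u d = VV b (snd b u) (snd d) m"
      using vertical_line_derivative[OF b u, of "snd d"]
      by (auto simp: vertical_lift_def tot.smooth_at_chart_map intro: vector_derivative_at)
    also have "\<dots> = snd (prol_ver A b (snd b u) m) d"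
      unfolding VV_def using True by (simp add: tot.deriv_along_chart_map ver_tangent b)
    finally show ?thesis by simp
  next
    case False
    then show ?thesis using tot.tangent_outside[OF ver_tangent[OF b]] by (auto simp: vertical_lift_def)
  qed
qed

lemma VV_transition:
  assumes b: "b \<in> \<BB>" "\<pi> m \<in> dom b" and b': "b' \<in> \<BB>" "\<pi> m \<in> dom b'"
  shows "VV b w F m = VV b' (snd b' (frame A b w (\<pi> m))) F m"
  using ver_vertical_lift[OF b, of "frame A b w (\<pi> m)"] ver_vertical_lift[OF b', of "frame A b w (\<pi> m)"] b
  by (simp add: VV_def pi_frame psi_frame)

text \<open>The Euler--Lagrange form whose vanishing characterises the spray; \<open>v\<close> is a vector at \<open>m\<close>.\<close>

definition EL :: "('m, 'e, 'a, 'f) bundle_chart \<Rightarrow> 'a \<Rightarrow> (('a, 'e \<times> 'f) chart \<Rightarrow> 'e \<times> 'f) \<Rightarrow> 'f \<Rightarrow> real" where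
  "EL b m v w = deriv_along Ts m v (\<lambda>q. VV b w L q) + VV b (br b (\<pi> m) w (snd b m)) L m - HH b w L m"

text \<open>Three effects spoil the transformation law separately: the frame change is
  differentiated along the vector, the horizontal frame acquires a vertical part, and
  \<open>br_transform\<close> has two derivative terms. They cancel in the sum. The hypothesis
  \<open>fst p = m\<close> makes the vector project to \<rho>(m), so that the first effect meets its
  counterpart in the bracket.\<close>

lemma EL_transition:
  assumes b: "b \<in> \<BB>" "\<pi> m \<in> dom b" and b': "b' \<in> \<BB>" "\<pi> m \<in> dom b'" and m: "m \<in> CM"
    and p: "p \<in> prol_fiber A m" "fst p = m"
  shows "EL b m (snd p) w = EL b' m (snd p) (snd b' (frame A b w (\<pi> m)))"
proof -
  let ?G = "\<lambda>y w. snd b' (frame A b w y)" and ?x = "\<pi> m"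
  note v = prol_fiberD(2)[OF p(1)]
  note lG = eventually_linear_frame_transition[OF b(1) b'(1) b(2) b'(2)]
  note sG = smooth_frame_transition[OF b(1) b'(1) b(2) b'(2)]
  note lV = linear_VV[OF b' smooth_L[OF m]]
  have tv: "tangent_map Ts Bs \<pi> m (snd p) = anchor A m" using prol_fiberD(3)[OF p(1)] p(2) by simp
  have fm: "frame A b (snd b m) ?x = m" using frame_psi b by blast
  have "\<forall>\<^sub>F q in nhds m. VV b w L q = VV b' (?G (\<pi> q) w) L q"
    using eventually_pi_dom[OF b] eventually_pi_dom[OF b'] by eventually_elim (rule VV_transition[OF b(1) _ b'(1)])
  from tot.deriv_along_eventually[OF this]
  have 1: "deriv_along Ts m (snd p) (\<lambda>q. VV b w L q) = VV b' (deriv_along Bs ?x (anchor A m) (\<lambda>y. ?G y w)) L m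
      + deriv_along Ts m (snd p) (\<lambda>q. VV b' (?G ?x w) L q)"
    using tot.deriv_along_linear_field(2)[OF v smooth_lift[OF sG[of w]] eventually_linear_VL[OF b'(1) m b'(2)] smooth_VL[OF b'(1) m b'(2)]]
      deriv_along_lift[OF v sG[of w]] tv by simp
  have "\<forall>\<^sub>F q in nhds m. snd b' q = ?G (\<pi> q) (snd b q)"
    using eventually_pi_dom[OF b] by eventually_elim (simp add: frame_psi b)
  note ev = tot.deriv_along_eventually[OF this]
  interpret l: linear "?G ?x" by (rule linear_frame_transition[OF b(1) b'(1) b(2) b'(2)])
  have "snd (snd (prol_hor A b w m) (tc b')) = deriv_along Bs ?x (anchor A (frame A b w ?x)) (\<lambda>y. ?G y (snd b m))"
  proof -
    have "deriv_along Ts m (snd (prol_hor A b w m)) (snd b) = 0"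
      by (simp add: deriv_psi[OF hor_tangent[OF b] b] hor_tc b)
    then show ?thesis
      using deriv_along_linear_family(2)[OF hor_tangent[OF b, of w] smooth_psi[OF b] lG sG] ev[of "snd (prol_hor A b w m)"]
        deriv_psi[OF hor_tangent[OF b, of w] b'] l.zero lsec_tangent_map[OF lsec_hor[OF b], of w] fst_ver_hor(2)[of b w m]
      by simp
  qed
  then have 2: "HH b w L m = HH b' (?G ?x w) L m + VV b' (deriv_along Bs ?x (anchor A (frame A b w ?x)) (\<lambda>y. ?G y (snd b m))) L m"
    using deriv_along_split[OF b' qm.lsec_fib[OF lsec_hor[OF b]] smooth_L[OF m], of w]
    by (simp add: HH_def fst_ver_hor)
  have 3: "VV b (br b ?x w (snd b m)) L m = VV b' (?G ?x (br b ?x w (snd b m))) L m" by (rule VV_transition[OF b b'])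
  show ?thesis
    unfolding EL_def 1 2 3 br_transform[OF b b'] fm linear_add[OF lV] linear_diff[OF lV] by simp
qed

lemma linear_deriv_VL:
  assumes b: "b \<in> \<BB>" "\<pi> m \<in> dom b" and m: "m \<in> CM" and v: "v \<in> tangent_space Ts m"
  shows "linear (\<lambda>w. deriv_along Ts m v (\<lambda>q. VV b w L q))"
proof (rule linearI)
  note lin = eventually_linear_VL[OF b(1) m b(2)]
  note s = smooth_VL[OF b(1) m b(2)]
  fix u w r
  have "\<forall>\<^sub>F q in nhds m. VV b (u + w) L q = VV b u L q + VV b w L q"
    using lin by eventually_elim (rule linear_add)
  from tot.deriv_along_eventually[OF this]
  show "deriv_along Ts m v (\<lambda>q. VV b (u + w) L q) = deriv_along Ts m v (\<lambda>q. VV b u L q) + deriv_along Ts m v (\<lambda>q. VV b w L q)"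
    by (simp add: tot.deriv_along_add[OF v s s])
  have "\<forall>\<^sub>F q in nhds m. VV b (r *\<^sub>R u) L q = r *\<^sub>R VV b u L q"
    using lin by eventually_elim (rule linear_cmul)
  from tot.deriv_along_eventually[OF this]
  show "deriv_along Ts m v (\<lambda>q. VV b (r *\<^sub>R u) L q) = r *\<^sub>R deriv_along Ts m v (\<lambda>q. VV b u L q)"
    using tot.deriv_along_bounded_linear[OF v s bounded_linear_scaleR_right] by simp
qed

lemma linear_EL:
  assumes b: "b \<in> \<BB>" "\<pi> m \<in> dom b" and m: "m \<in> CM" and v: "v \<in> tangent_space Ts m"
  shows "linear (EL b m v)"
proof -
  have "linear (\<lambda>w. br b (\<pi> m) w (snd b m))" using bilinear_br[OF b] by (simp add: bilinear_def)
  from linear_compose[OF this linear_VV[OF b smooth_L[OF m]]]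
  have "linear (\<lambda>w. VV b (br b (\<pi> m) w (snd b m)) L m)" by (simp add: comp_def)
  then show ?thesis unfolding EL_def
    by (intro linear_compose_add linear_compose_sub linear_deriv_VL linear_HH b m v smooth_L)
qed

lemma spray_vector:
  assumes b: "b \<in> \<BB>" "\<pi> m \<in> dom b"
  shows "prol_add A (prol_hor A b (snd b m) m) (prol_ver A b s m) = prol_pt b m (snd b m, s)"
    and "prol_pt b m (snd b m, s) \<in> prol_fiber A m" and "fst (prol_pt b m (snd b m, s)) = m"
    and "snd (prol_pt b m (snd b m, s)) (tc b) = (anchor_coeff A b (snd b m) (\<pi> m), s)"
proof -
  show 1: "prol_pt b m (snd b m, s) \<in> prol_fiber A m" using qm.pt_fib b by simp
  show 3: "fst (prol_pt b m (snd b m, s)) = m" by (simp add: prol_pt_def frame_psi b)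
  show 2: "snd (prol_pt b m (snd b m, s)) (tc b) = (anchor_coeff A b (snd b m) (\<pi> m), s)"
    unfolding prol_pt_def fst_conv snd_conv
    by (rule tot.coord_vector_chart[OF bundle_chart(5)[OF b(1)]]) (simp add: b)
  show "prol_add A (prol_hor A b (snd b m) m) (prol_ver A b s m) = prol_pt b m (snd b m, s)"
  proof (rule fc_inj[OF _ 1 b])
    show "prol_add A (prol_hor A b (snd b m) m) (prol_ver A b s m) \<in> prol_fiber A m"
      by (intro qm.add_fib qm.lsec_fib lsec_hor lsec_ver b)
    show "fc b (prol_add A (prol_hor A b (snd b m) m) (prol_ver A b s m)) = fc b (prol_pt b m (snd b m, s))"
      unfolding fc_add[OF qm.lsec_fib[OF lsec_hor[OF b]] qm.lsec_fib[OF lsec_ver[OF b]] b] fc_hor[OF b] fc_ver[OF b]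
      by (simp add: fc_def 2 3)
  qed
qed

text \<open>The part of the Euler-Lagrange form without the fibre component \<open>s\<close> of the
  vector, moved to the other side; the spray equation becomes a linear system for \<open>s\<close>
  with matrix g.\<close>

definition spray_rhs :: "('m, 'e, 'a, 'f) bundle_chart \<Rightarrow> 'a \<Rightarrow> 'f \<Rightarrow> real" where
  "spray_rhs b m w = - (HH b (snd b m) (\<lambda>q. VV b w L q) m + VV b (br b (\<pi> m) w (snd b m)) L m - HH b w L m)"

lemma EL_spray:
  assumes b: "b \<in> \<BB>" "\<pi> m \<in> dom b" and m: "m \<in> CM"
  shows "EL b m (snd (prol_pt b m (snd b m, s))) w = gm b m s w - spray_rhs b m w"
proof -
  have "deriv_along Ts m (snd (prol_pt b m (snd b m, s))) (\<lambda>q. VV b w L q)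
      = HH b (snd b m) (\<lambda>q. VV b w L q) m + gm b m s w"
    using deriv_along_split[OF b spray_vector(2)[OF b] smooth_VL[OF b(1) m b(2)], of s w]
    by (simp add: spray_vector[OF b] gm_def)
  then show ?thesis by (simp add: EL_def spray_rhs_def)
qed

lemma linear_spray_rhs:
  assumes b: "b \<in> \<BB>" "\<pi> m \<in> dom b" and m: "m \<in> CM" shows "linear (spray_rhs b m)"
proof -
  have "spray_rhs b m = (\<lambda>w. gm b m 0 w - EL b m (snd (prol_pt b m (snd b m, 0))) w)"
    using EL_spray[OF b m, of 0] by (simp add: fun_eq_iff)
  moreover have "linear (gm b m 0)" using bilinear_gm[OF b(1) m b(2)] by (simp add: bilinear_def)
  ultimately show ?thesis
    using linear_compose_sub[OF _ linear_EL[OF b m prol_fiberD(2)[OF spray_vector(2)[OF b]]], of "gm b m 0"] by simp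
qed

lemma smooth_spray_rhs:
  assumes b: "b \<in> \<BB>" "\<pi> m \<in> dom b" and m: "m \<in> CM" shows "smooth_at Ts (\<lambda>q. spray_rhs b q w) m"
proof -
  have "\<forall>\<^sub>F q in nhds m. linear (\<lambda>a. HH b a (\<lambda>q. VV b w L q) q)"
    using eventually_CM_dom[OF b(1) m b(2)] by eventually_elim (intro linear_HH smooth_VL b; simp)
  then have 1: "smooth_at Ts (\<lambda>q. HH b (snd b q) (\<lambda>q. VV b w L q) q) m"
    by (rule tot.deriv_along_linear_field(1)[OF tot.tangent_zero smooth_psi[OF b], of "\<lambda>q a. HH b a (\<lambda>q. VV b w L q) q"])
      (intro smooth_HH smooth_VL b m)
  have 2: "smooth_at Ts (\<lambda>q. VV b (br b (\<pi> q) w (snd b q)) L q) m"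
    by (rule tot.deriv_along_linear_field(1)[OF tot.tangent_zero smooth_br_total[OF b tot.smooth_at_const smooth_psi[OF b]],
        of "\<lambda>q a. VV b a L q"]) (intro eventually_linear_VL smooth_VL b m)+
  show ?thesis unfolding spray_rhs_def
    using tot.smooth_at_diff[OF tot.smooth_at_const[of 0] tot.smooth_at_diff[OF tot.smooth_at_add[OF 1 2] smooth_HH[OF b smooth_L[OF m]]]]
    by simp
qed

text \<open>The coefficients \<open>\<S>\<^sup>\<beta>\<close> of the Finsler spray.\<close>

definition sb :: "('m, 'e, 'a, 'f) bundle_chart \<Rightarrow> 'a \<Rightarrow> 'f" where
  "sb b = (SOME s. \<forall>m\<in>CM. \<pi> m \<in> dom b \<longrightarrow> smooth_at Ts s m \<and> (\<forall>w. gm b m (s m) w = spray_rhs b m w))"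

lemma sb:
  assumes b: "b \<in> \<BB>" "\<pi> m \<in> dom b" and m: "m \<in> CM"
  shows smooth_sb: "smooth_at Ts (sb b) m" and gm_sb: "gm b m (sb b m) w = spray_rhs b m w"
proof -
  obtain s where "\<And>m. m \<in> CM \<Longrightarrow> \<pi> m \<in> dom b \<Longrightarrow> smooth_at Ts s m"
    "\<And>m w. m \<in> CM \<Longrightarrow> \<pi> m \<in> dom b \<Longrightarrow> gm b m (s m) w = spray_rhs b m w"
    using smooth_solution[OF b(1), of "spray_rhs b"] smooth_spray_rhs[OF b(1)] linear_spray_rhs[OF b(1)] by metis
  then have "\<exists>s. \<forall>m\<in>CM. \<pi> m \<in> dom b \<longrightarrow> smooth_at Ts s m \<and> (\<forall>w. gm b m (s m) w = spray_rhs b m w)" by blast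
  from someI_ex[OF this] show "smooth_at Ts (sb b) m" "gm b m (sb b m) w = spray_rhs b m w"
    using b m unfolding sb_def by blast+
qed

lemma sb_unique:
  assumes b: "b \<in> \<BB>" "\<pi> m \<in> dom b" and m: "m \<in> CM" and s: "\<And>w. gm b m s w = spray_rhs b m w"
  shows "s = sb b m"
  by (rule gm_nondegenerate[OF b m]) (simp add: s gm_sb[OF b m])

text \<open>The form \<open>EL\<close> of the candidate vanishes in the chart \<open>b\<close>,
  hence also in \<open>b'\<close> by its transformation law, and nondegeneracy of g allows only one
  such fibre component in \<open>b'\<close>.\<close>

lemma spray_transition:
  assumes b: "b \<in> \<BB>" "\<pi> m \<in> dom b" and b': "b' \<in> \<BB>" "\<pi> m \<in> dom b'" and m: "m \<in> CM"
  shows "prol_pt b m (snd b m, sb b m) = prol_pt b' m (snd b' m, sb b' m)"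
proof -
  let ?p = "prol_pt b m (snd b m, sb b m)"
  define s where "s = snd (prol_coord b' m ?p)"
  note p = spray_vector(2)[OF b, of "sb b m"] and fp = spray_vector(3)[OF b, of "sb b m"]
  have "prol_coord b' m ?p = (snd b' m, s)" by (simp add: s_def prol_coord_def fp)
  then have eq: "?p = prol_pt b' m (snd b' m, s)" using qm.pt_\<kappa>[OF b'(1) _ p] b'(2) by simp
  have "gm b' m s w = spray_rhs b' m w" for w
  proof -
    have "\<pi> (frame A b' w (\<pi> m)) = \<pi> m" using b' by (simp add: pi_frame)
    then have "snd b' (frame A b (snd b (frame A b' w (\<pi> m))) (\<pi> m)) = w"
      using frame_psi[OF b(1), of "frame A b' w (\<pi> m)"] b b' by (simp add: psi_frame)
    then have "EL b' m (snd ?p) w = EL b m (snd ?p) (snd b (frame A b' w (\<pi> m)))"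
      using EL_transition[OF b b' m p fp, of "snd b (frame A b' w (\<pi> m))"] by simp
    also have "\<dots> = 0" by (simp add: EL_spray[OF b m] gm_sb[OF b m])
    finally show ?thesis unfolding eq by (simp add: EL_spray[OF b' m])
  qed
  from sb_unique[OF b' m this] show ?thesis using eq by simp
qed

definition Sp :: "'a \<Rightarrow> ('e, 'a, 'f) prol" where
  "Sp = (\<lambda>m\<in>CM. let b = (SOME b. b \<in> \<BB> \<and> \<pi> m \<in> dom b) in prol_pt b m (snd b m, sb b m))"

lemma Sp_eq:
  assumes m: "m \<in> CM" and b: "b \<in> \<BB>" "\<pi> m \<in> dom b" shows "Sp m = prol_pt b m (snd b m, sb b m)"
proof -
  define b0 where "b0 = (SOME b. b \<in> \<BB> \<and> \<pi> m \<in> dom b)"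
  have "b0 \<in> \<BB> \<and> \<pi> m \<in> dom b0" unfolding b0_def
    using ex_bundle_chart[of "\<pi> m"] by (intro someI_ex[of "\<lambda>b. b \<in> \<BB> \<and> \<pi> m \<in> dom b"]) blast
  then have b0: "b0 \<in> \<BB>" "\<pi> m \<in> dom b0" by auto
  show ?thesis using m spray_transition[OF b0 b m] by (simp add: Sp_def Let_def flip: b0_def)
qed

lemma Sp_sect: "Sp \<in> SS"
  unfolding qm.sect_def
proof (intro CollectI conjI ballI)
  show "Sp \<in> extensional CM" by (simp add: Sp_def)
  fix m assume m: "m \<in> CM"
  obtain b where b: "b \<in> \<BB>" "\<pi> m \<in> dom b" using ex_bundle_chart by blast
  have "\<forall>\<^sub>F q in nhds m. Sp q = prol_pt b q (snd b q, sb b q)"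
    using eventually_CM_dom[OF b(1) m b(2)] by eventually_elim (simp add: Sp_eq b)
  then show "qm.lsec Sp m"
    by (rule qm.lsec_transform) (intro qm.lsec_pt tot.smooth_at_Pair smooth_psi smooth_sb b m, use b in simp)
qed

text \<open>The definition differentiates the coordinate expression of the energy twice, so its
  first derivatives have to be recognised as vertical derivatives on a whole neighbourhood. The sums
  over the basis are then expansions of linear maps.\<close>

lemma spray_equation_iff:
  assumes b: "b \<in> \<BB>" "\<pi> m \<in> dom b" and m: "m \<in> CM"
  shows "spray_equation A b m s \<longleftrightarrow> (\<forall>w\<in>Basis. gm b m s w = spray_rhs b m w)"
proof -
  let ?z = "snd (tc b) m" and ?L = "\<lambda>q. 1/2 * (finsler A (chart_inv (tc b) q))\<^sup>2"
  have tb: "tc b \<in> Ts" by (rule bundle_chart(5)[OF b(1)])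
  have Leq: "?L = (\<lambda>q. L (chart_inv (tc b) q))" by (simp add: L_def)
  have "\<forall>\<^sub>F z in nhds ?z. chart_inv (tc b) z \<in> CM \<and> \<pi> (chart_inv (tc b) z) \<in> dom b"
    using eventually_CM_dom[OF b(1) m b(2)] tot.eventually_chart[OF tb, of m "\<lambda>q. q \<in> CM \<and> \<pi> q \<in> dom b"] b by simp
  moreover have "\<forall>\<^sub>F z in nhds ?z. z \<in> snd (tc b) ` fst (tc b)" using tot.eventually_in_chart_image[OF tb] b by simp
  ultimately have ev: "\<forall>\<^sub>F z in nhds ?z. fderiv ?L z (0, w) = VV b w L (chart_inv (tc b) z)" for w
  proof eventually_elim
    fix z assume "chart_inv (tc b) z \<in> CM \<and> \<pi> (chart_inv (tc b) z) \<in> dom b" "z \<in> snd (tc b) ` fst (tc b)"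
    then show "fderiv ?L z (0, w) = VV b w L (chart_inv (tc b) z)"
      unfolding Leq by (simp add: VV_chart smooth_L b chart_chart_inv)
  qed
  have g: "fderiv (\<lambda>q. fderiv ?L q (0, \<beta>)) ?z (0, \<alpha>) = gm b m \<alpha> \<beta>" for \<alpha> \<beta>
    unfolding fderiv_cong_ev(1)[OF ev] gm_def by (simp add: VV_chart[OF b smooth_VL[OF b(1) m b(2)]])
  have h: "fderiv (\<lambda>q. fderiv ?L q (0, \<alpha>)) ?z (anchor_coeff A b \<delta> (\<pi> m), 0) = HH b \<delta> (\<lambda>q. VV b \<alpha> L q) m" for \<alpha> \<delta>
    unfolding fderiv_cong_ev(1)[OF ev] by (simp add: HH_chart[OF b smooth_VL[OF b(1) m b(2)]])
  have d: "fderiv ?L ?z (0, w) = VV b w L m" "fderiv ?L ?z (anchor_coeff A b w (\<pi> m), 0) = HH b w L m" for w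
    unfolding Leq by (simp_all add: VV_chart[OF b smooth_L[OF m]] HH_chart[OF b smooth_L[OF m]])
  have 1: "(\<Sum>\<beta>\<in>Basis. gm b m \<alpha> \<beta> * (s \<bullet> \<beta>)) = gm b m s \<alpha>" for \<alpha>
    using linear_reproducing[OF reproducing_Basis, of "gm b m \<alpha>" s] bilinear_gm[OF b(1) m b(2)] gm_sym[OF b(1) m b(2)]
    by (simp add: bilinear_def mult.commute)
  have 2: "(\<Sum>\<delta>\<in>Basis. HH b \<delta> (\<lambda>q. VV b \<alpha> L q) m * (snd b m \<bullet> \<delta>)) = HH b (snd b m) (\<lambda>q. VV b \<alpha> L q) m" for \<alpha>
    using linear_reproducing[OF reproducing_Basis linear_HH[OF b smooth_VL[OF b(1) m b(2)]], of "snd b m" \<alpha>]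
    by (simp add: mult.commute)
  have 3: "(\<Sum>\<gamma>\<in>Basis. \<Sum>\<delta>\<in>Basis. VV b \<gamma> L m * (br b (\<pi> m) \<alpha> \<delta> \<bullet> \<gamma>) * (snd b m \<bullet> \<delta>)) = VV b (br b (\<pi> m) \<alpha> (snd b m)) L m" for \<alpha>
  proof -
    have "linear (br b (\<pi> m) \<alpha>)" using bilinear_br[OF b] by (simp add: bilinear_def)
    from linear_reproducing[OF reproducing_Basis this, of "snd b m"]
    have "br b (\<pi> m) \<alpha> (snd b m) \<bullet> \<gamma> = (\<Sum>\<delta>\<in>Basis. (snd b m \<bullet> \<delta>) * (br b (\<pi> m) \<alpha> \<delta> \<bullet> \<gamma>))" for \<gamma>
      by (simp add: inner_sum_left)
    then show ?thesis
      using linear_reproducing[OF reproducing_Basis linear_VV[OF b smooth_L[OF m]], of "br b (\<pi> m) \<alpha> (snd b m)"]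
      by (simp add: sum_distrib_right sum_distrib_left mult_ac)
  qed
  show ?thesis
    unfolding spray_equation_def Let_def g h d 1 2 3 spray_rhs_def by (intro ball_cong refl) auto
qed

lemma spray_equation_sb:
  assumes b: "b \<in> \<BB>" "\<pi> m \<in> dom b" and m: "m \<in> CM"
  shows "spray_equation A b m s \<longleftrightarrow> s = sb b m"
proof
  assume "spray_equation A b m s"
  then have "\<forall>w\<in>Basis. gm b m s w = spray_rhs b m w" by (simp add: spray_equation_iff[OF assms])
  then have "gm b m s w = spray_rhs b m w" for w
    using linear_eq_stdbasis[of "gm b m s" "spray_rhs b m"] linear_spray_rhs[OF b m] bilinear_gm[OF b(1) m b(2)]
    by (auto simp: bilinear_def)
  then show "s = sb b m" by (rule sb_unique[OF assms])
qed (simp add: spray_equation_iff[OF assms] gm_sb[OF assms])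

lemma finsler_spray_eq: "finsler_spray A = Sp"
  unfolding finsler_spray_def
proof (rule the_equality)
  show "is_finsler_spray A Sp"
    unfolding is_finsler_spray_def prol_sections_eq[OF open_CM]
    using Sp_sect by (auto simp: Sp_eq spray_vector spray_equation_sb)
  fix S assume S: "is_finsler_spray A S"
  show "S = Sp"
  proof (rule extensionalityI)
    show "S \<in> extensional CM" using S by (simp add: is_finsler_spray_def prol_sections_def)
    show "Sp \<in> extensional CM" by (rule qm.sect_ext[OF Sp_sect])
    fix m assume m: "m \<in> CM"
    obtain b where b: "b \<in> \<BB>" "\<pi> m \<in> dom b" using ex_bundle_chart by blast
    then obtain s where "S m = prol_add A (prol_hor A b (snd b m) m) (prol_ver A b s m)" "spray_equation A b m s"
      using S m unfolding is_finsler_spray_def by blast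
    then show "S m = Sp m" using Sp_eq[OF m b] by (simp add: spray_vector spray_equation_sb b m)
  qed
qed

section \<open>The vertical endomorphism and the map theta\<close>

lemma prol_J_eq:
  assumes Z: "Z \<in> SS" and m: "m \<in> CM" and b: "b \<in> \<BB>" "\<pi> m \<in> dom b"
  shows "prol_J A Z m = prol_ver A b (snd b (fst (Z m))) m"
proof -
  have "\<pi> (fst (Z m)) = \<pi> m" using prol_fiberD(1)[OF qm.sect_fib[OF Z m]] .
  then show ?thesis using m ver_vertical_lift[OF b, of "fst (Z m)"] fst_ver_hor(1)[of b "snd b (fst (Z m))" m]
    by (simp add: prol_J_def prod_eq_iff)
qed

lemma prol_J_sect: assumes Z: "Z \<in> SS" shows "prol_J A Z \<in> SS"
  unfolding qm.sect_def
proof (intro CollectI conjI ballI)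
  show "prol_J A Z \<in> extensional CM" by (simp add: prol_J_def)
  fix m assume m: "m \<in> CM"
  obtain b where b: "b \<in> \<BB>" "\<pi> m \<in> dom b" using ex_bundle_chart by blast
  have "\<forall>\<^sub>F q in nhds m. prol_J A Z q = prol_pt b q (0, snd b (fst (Z q)))"
    using eventually_CM_dom[OF b(1) m b(2)] by eventually_elim (simp add: prol_J_eq[OF Z _ b(1)] prol_ver_pt b(1))
  then show "qm.lsec (prol_J A Z) m"
    by (rule qm.lsec_transform)
      (intro qm.lsec_pt tot.smooth_at_Pair tot.smooth_at_const smooth_psi_fst[OF qm.sect_lsec[OF Z m]] b, use b in simp)
qed

lemma prol_diff_sect: "X \<in> SS \<Longrightarrow> Y \<in> SS \<Longrightarrow> prol_diff A X Y \<in> SS"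
  unfolding prol_diff_def by (intro qm.sect_add qm.sect_scale open_CM) auto

lemma fc_prol_diff:
  "X \<in> SS \<Longrightarrow> Y \<in> SS \<Longrightarrow> m \<in> CM \<Longrightarrow> b \<in> \<BB> \<Longrightarrow> \<pi> m \<in> dom b \<Longrightarrow> fc b (prol_diff A X Y m) = fc b (X m) - fc b (Y m)"
  unfolding prol_diff_def by (simp add: fc_section_add fc_section_scale qm.sect_scale open_CM)

text \<open>The fibre coordinates of \<open>\<theta>(\<X>)\<close> for the combination \<open>\<X> = a\<^sup>\<alpha> \<X>\<^sub>\<alpha>\<close>.\<close>

definition thH :: "('m, 'e, 'a, 'f) bundle_chart \<Rightarrow> 'a \<Rightarrow> 'f \<Rightarrow> 'f" where
  "thH b m a = - (1/2) *\<^sub>R (br b (\<pi> m) (snd b m) a + VV b a (sb b) m)"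

text \<open>The derivative of the components of \<open>Z\<close> along the spray occurs in
  \<open>J[S, Z]\<close> and in \<open>[S, J Z]\<close> and cancels in the Finsler connection. What
  remains is algebraic in \<open>Z\<close> at \<open>m\<close>: a structure term and the fibre
  derivative of the spray coefficients, collected in \<open>thH\<close>.\<close>

lemma fc_vertical_projector:
  assumes Z: "Z \<in> SS" and m: "m \<in> CM" and b: "b \<in> \<BB>" "\<pi> m \<in> dom b"
  shows "vertical_projector A Z \<in> SS"
    and "fst (fc b (vertical_projector A Z m)) = 0"
    and "snd (snd (fc b (vertical_projector A Z m))) = snd (snd (Z m) (tc b)) + thH b m (snd b (fst (Z m)))"
proof -
  let ?X = "snd b (fst (Z m))" and ?w = "snd (snd (Z m) (tc b))"
  note l = qm.sect_lsec[OF Z m] qm.sect_lsec[OF Sp_sect m] qm.sect_lsec[OF prol_J_sect[OF Z] m]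
  have br0: "br b (\<pi> m) (snd b m) 0 = 0" using bilinear_rzero[OF bilinear_br[OF b]] .
  have evS: "\<forall>\<^sub>F q in nhds m. fc b (Sp q) = (snd b q, anchor_coeff A b (snd b q) (\<pi> q), sb b q)"
    using eventually_CM_dom[OF b(1) m b(2)]
    by eventually_elim (simp add: fc_def Sp_eq[OF _ b(1)] spray_vector b(1))
  have dS: "deriv_along Ts m v (\<lambda>q. fc b (Sp q)) = (deriv_along Ts m v (snd b),
      deriv_along Ts m v (\<lambda>q. anchor_coeff A b (snd b q) (\<pi> q)), deriv_along Ts m v (sb b))" if v: "v \<in> tangent_space Ts m" for v
  proof -
    have "deriv_along Ts m v (\<lambda>q. fc b (Sp q)) = deriv_along Ts m v (\<lambda>q. (snd b q, anchor_coeff A b (snd b q) (\<pi> q), sb b q))"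
      by (rule tot.deriv_along_eventually[OF evS])
    then show ?thesis
      by (simp add: tot.deriv_along_Pair[OF v] tot.smooth_at_Pair smooth_psi smooth_anchor_coeff_total smooth_sb b m)
  qed
  have Spm: "fst (Sp m) = m" by (simp add: Sp_eq[OF m b] spray_vector b)
  have evJ: "\<forall>\<^sub>F q in nhds m. fc b (prol_J A Z q) = (0, 0, snd b (fst (Z q)))"
    using eventually_CM_dom[OF b(1) m b(2)] by eventually_elim (simp add: prol_J_eq[OF Z _ b(1)] fc_ver b(1))
  have dJ: "deriv_along Ts m v (\<lambda>q. fc b (prol_J A Z q)) = (0, 0, deriv_along Ts m v (\<lambda>q. snd b (fst (Z q))))"
    if v: "v \<in> tangent_space Ts m" for v
  proof -
    have "deriv_along Ts m v (\<lambda>q. fc b (prol_J A Z q)) = deriv_along Ts m v (\<lambda>q. (0, 0, snd b (fst (Z q))))"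
      by (rule tot.deriv_along_eventually[OF evJ])
    then show ?thesis
      by (simp add: tot.deriv_along_Pair[OF v] tot.smooth_at_Pair smooth_psi_fst l b)
  qed
  have Jm: "snd (prol_J A Z m) = snd (prol_ver A b ?X m)" "snd b (fst (prol_J A Z m)) = 0"
    by (simp_all add: prol_J_eq[OF Z m b] fst_ver_hor psi_zero b)
  have pS: "fst (pbr b Sp Z m) = deriv_along Ts m (snd (Sp m)) (\<lambda>q. snd b (fst (Z q))) - ?w + br b (\<pi> m) (snd b m) ?X"
    by (simp add: pbr_def dS[OF lsec_vector[OF l(1)]] deriv_fc[OF lsec_vector[OF l(2)] l(1) b] Spm
      deriv_psi[OF lsec_vector[OF l(1)] b])
  have pJ: "pbr b Sp (prol_J A Z) m = (- ?X, - deriv_along Ts m (snd (prol_ver A b ?X m)) (\<lambda>q. anchor_coeff A b (snd b q) (\<pi> q)),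
      deriv_along Ts m (snd (Sp m)) (\<lambda>q. snd b (fst (Z q))) - VV b ?X (sb b) m)"
    by (simp add: pbr_def Jm dS[OF ver_tangent[OF b]] dJ[OF lsec_vector[OF l(2)]] Spm br0 VV_def
      deriv_psi[OF ver_tangent[OF b] b] ver_tc b)
  have S1: "prol_J A (PB Sp Z) \<in> SS" "PB Sp (prol_J A Z) \<in> SS" by (intro prol_J_sect PB_sect Sp_sect Z)+
  have c: "finsler_connection A Z \<in> SS" unfolding finsler_connection_def prol_bracket_eq finsler_spray_eq
    by (intro prol_diff_sect S1)
  show vp: "vertical_projector A Z \<in> SS" unfolding vertical_projector_def
    by (intro qm.sect_scale open_CM prol_diff_sect Z c) simp
  have J1: "fc b (prol_J A (PB Sp Z) m) = (0, 0, fst (pbr b Sp Z m))"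
  proof -
    have "snd b (fst (PB Sp Z m)) = fst (pbr b Sp Z m)"
      using fc_PB[OF Sp_sect Z m b] unfolding fc_def by (metis fst_conv)
    then show ?thesis by (simp add: prol_J_eq[OF PB_sect[OF Sp_sect Z] m b] fc_ver b)
  qed
  have e: "fc b (vertical_projector A Z m) = (1/2) *\<^sub>R (fc b (Z m) - (fc b (prol_J A (PB Sp Z) m) - pbr b Sp (prol_J A Z) m))"
    unfolding vertical_projector_def fc_section_scale[OF prol_diff_sect[OF Z c] m b] fc_prol_diff[OF Z c m b]
    unfolding finsler_connection_def prol_bracket_eq finsler_spray_eq fc_prol_diff[OF S1 m b] fc_PB[OF Sp_sect prol_J_sect[OF Z] m b] ..
  show "fst (fc b (vertical_projector A Z m)) = 0"
    unfolding e J1 pJ pS by (simp add: fc_def)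
  show "snd (snd (fc b (vertical_projector A Z m))) = ?w + thH b m ?X"
    unfolding e J1 pJ pS by (simp add: fc_def thH_def algebra_simps) (simp flip: scaleR_add_left)
qed

lemma theta_eq:
  assumes Z: "Z \<in> SS" and m: "m \<in> CM" and b: "b \<in> \<BB>" "\<pi> m \<in> dom b"
  shows "theta A Z m = frame A b (snd (snd (Z m) (tc b)) + thH b m (snd b (fst (Z m)))) (\<pi> m)"
proof -
  let ?p = "vertical_projector A Z m" and ?w = "snd (snd (Z m) (tc b)) + thH b m (snd b (fst (Z m)))"
  note vp = fc_vertical_projector[OF assms]
  have fib: "?p \<in> prol_fiber A m" by (rule qm.sect_fib[OF vp(1) m])
  have "?p = prol_ver A b ?w m"
  proof (rule qm.\<kappa>_inj[of b m])
    show "prol_coord b m ?p = prol_coord b m (prol_ver A b ?w m)"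
      using vp(2,3) fc_ver[OF b, of ?w] by (simp add: prol_coord_def fc_def)
  qed (use b fib qm.lsec_fib[OF lsec_ver[OF b]] in auto)
  then have "snd ?p = vertical_lift A m (frame A b ?w (\<pi> m))"
    using ver_vertical_lift[OF b, of "frame A b ?w (\<pi> m)"] b by (simp add: pi_frame psi_frame)
  \<comment> \<open>Injectivity of the vertical lift, required by the definite description in
    \<open>vertical_iso\<close>.\<close>
  moreover have "u = u'" if "\<pi> u = \<pi> m" "\<pi> u' = \<pi> m" "vertical_lift A m u = vertical_lift A m u'" for u u'
  proof -
    have "snd (prol_ver A b (snd b u) m) (tc b) = snd (prol_ver A b (snd b u') m) (tc b)"
      using that ver_vertical_lift[OF b] by simp
    then show ?thesis using that b by (intro fibre_eqI[of b]) (simp_all add: ver_tc)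
  qed
  ultimately have "vertical_iso A m ?p = frame A b ?w (\<pi> m)"
    unfolding vertical_iso_def using pi_frame[OF b] by (intro the_equality) auto
  then show ?thesis using m by (simp add: theta_def)
qed

end

section \<open>The connection on the pull-back bundle\<close>

lemma (in smooth_manifold) linear_deriv_field:
  fixes H :: "'p \<Rightarrow> 'f::euclidean_space \<Rightarrow> 'w::real_normed_vector"
  assumes v: "v \<in> tangent_space At m" and lin: "\<forall>\<^sub>F q in nhds m. linear (H q)"
    and sm: "\<And>a. smooth_at At (\<lambda>q. H q a) m"
  shows "linear (\<lambda>w. deriv_along At m v (\<lambda>q. H q w))"
proof (rule linearI)
  fix u w r
  have "\<forall>\<^sub>F q in nhds m. H q (u + w) = H q u + H q w" using lin by eventually_elim (rule linear_add)
  from deriv_along_eventually[OF this]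
  show "deriv_along At m v (\<lambda>q. H q (u + w)) = deriv_along At m v (\<lambda>q. H q u) + deriv_along At m v (\<lambda>q. H q w)"
    by (simp add: deriv_along_add[OF v sm sm])
  have "\<forall>\<^sub>F q in nhds m. H q (r *\<^sub>R u) = r *\<^sub>R H q u" using lin by eventually_elim (rule linear_cmul)
  from deriv_along_eventually[OF this]
  show "deriv_along At m v (\<lambda>q. H q (r *\<^sub>R u)) = r *\<^sub>R deriv_along At m v (\<lambda>q. H q u)"
    using deriv_along_bounded_linear[OF v sm bounded_linear_scaleR_right] by simp
qed

context partial_finsler
begin

text \<open>Twice the Cartan tensor in fibre coordinates, by \<open>cartan_tensor_eq\<close>; the
  factor is the one in the compatibility condition.\<close>

definition CC :: "('m, 'e, 'a, 'f) bundle_chart \<Rightarrow> 'a \<Rightarrow> 'f \<Rightarrow> 'f \<Rightarrow> 'f \<Rightarrow> real" where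
  "CC b m u v w = VV b u (\<lambda>q. gm b q v w) m"

text \<open>The vertical part of the frame combination with coefficients \<open>a\<close> has fibre
  coordinates \<open>thH b m a\<close>; with its action on g subtracted, this is the derivative of g
  along the horizontal part.\<close>

definition Pk :: "('m, 'e, 'a, 'f) bundle_chart \<Rightarrow> 'a \<Rightarrow> 'f \<Rightarrow> 'f \<Rightarrow> 'f \<Rightarrow> real" where
  "Pk b m a c e = HH b a (\<lambda>q. gm b q c e) m - CC b m (thH b m a) c e"

text \<open>The right-hand side of the Koszul formula for constant coordinate sections.\<close>

definition Kk :: "('m, 'e, 'a, 'f) bundle_chart \<Rightarrow> 'a \<Rightarrow> 'f \<Rightarrow> 'f \<Rightarrow> 'f \<Rightarrow> real" where
  "Kk b m a c e = 1/2 * (Pk b m a c e + Pk b m c e a - Pk b m e a c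
     + gm b m (br b (\<pi> m) a c) e - gm b m (br b (\<pi> m) c e) a + gm b m (br b (\<pi> m) e a) c)"

context
  fixes b m assumes b: "b \<in> \<BB>" "\<pi> m \<in> dom b" and m: "m \<in> CM"
begin

lemma gm_linear: "linear (\<lambda>u. gm b m u w)" "linear (gm b m u)"
  using bilinear_gm[OF b(1) m b(2)] by (simp_all add: bilinear_def)

lemma br_linear: "linear (\<lambda>u. br b (\<pi> m) u w)" "linear (br b (\<pi> m) u)"
  using bilinear_br[OF b] by (simp_all add: bilinear_def)

lemma eventually_gm_linear: "\<forall>\<^sub>F q in nhds m. linear (\<lambda>u. gm b q u w)" "\<forall>\<^sub>F q in nhds m. linear (gm b q u)"
  using eventually_CM_dom[OF b(1) m b(2)] bilinear_gm[OF b(1)] unfolding bilinear_def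
  by (auto elim: eventually_mono)

lemma linear_deriv_gm:
  assumes "v \<in> tangent_space Ts m"
  shows "linear (\<lambda>u. deriv_along Ts m v (\<lambda>q. gm b q u w))" "linear (\<lambda>w. deriv_along Ts m v (\<lambda>q. gm b q u w))"
  by (rule tot.linear_deriv_field[OF assms eventually_gm_linear(1) smooth_gm[OF b(1) m b(2)]])
    (rule tot.linear_deriv_field[OF assms eventually_gm_linear(2) smooth_gm[OF b(1) m b(2)]])

lemma linear_HH_gm: "linear (\<lambda>a. HH b a (\<lambda>q. gm b q c e) m)"
    "linear (\<lambda>c. HH b a (\<lambda>q. gm b q c e) m)" "linear (\<lambda>e. HH b a (\<lambda>q. gm b q c e) m)"
  using linear_HH[OF b smooth_gm[OF b(1) m b(2)]] linear_deriv_gm[OF hor_tangent[OF b]]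
  unfolding HH_def by blast+

lemma linear_CC: "linear (\<lambda>a. CC b m a c e)" "linear (\<lambda>c. CC b m a c e)" "linear (\<lambda>e. CC b m a c e)"
  using linear_VV[OF b smooth_gm[OF b(1) m b(2)]] linear_deriv_gm[OF ver_tangent[OF b]]
  unfolding CC_def VV_def by blast+

lemma linear_thH: "linear (thH b m)"
  unfolding thH_def by (intro linear_compose_scale_right linear_compose_add br_linear linear_VV b smooth_sb m)

lemma linear_Pk: "linear (\<lambda>a. Pk b m a c e)" "linear (\<lambda>c. Pk b m a c e)" "linear (\<lambda>e. Pk b m a c e)"
proof -
  have "linear (\<lambda>a. CC b m (thH b m a) c e)" using linear_compose[OF linear_thH linear_CC(1)] by (simp add: comp_def)
  then show "linear (\<lambda>a. Pk b m a c e)" "linear (\<lambda>c. Pk b m a c e)" "linear (\<lambda>e. Pk b m a c e)"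
    unfolding Pk_def by (intro linear_compose_sub linear_HH_gm linear_CC; assumption)+
qed

lemma linear_gm_br: "linear (\<lambda>u. gm b m (br b (\<pi> m) u w) e)" "linear (\<lambda>u. gm b m (br b (\<pi> m) w u) e)"
  using linear_compose[OF br_linear(1) gm_linear(1)] linear_compose[OF br_linear(2) gm_linear(1)]
  by (simp_all add: comp_def)

lemma linear_Kk: "linear (\<lambda>a. Kk b m a c e)" "linear (\<lambda>c. Kk b m a c e)" "linear (\<lambda>e. Kk b m a c e)"
  unfolding Kk_def real_scaleR_def[symmetric]
  by (intro linear_compose_scale_right linear_compose_add linear_compose_sub linear_Pk linear_gm_br gm_linear)+

lemma Pk_sym: "Pk b m a c e = Pk b m a e c"
proof -
  have "HH b a (\<lambda>q. gm b q c e) m = HH b a (\<lambda>q. gm b q e c) m"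
    by (rule HH_eventually) (use eventually_CM_dom[OF b(1) m b(2)] in eventually_elim, use gm_sym b in auto)
  then show ?thesis by (simp add: Pk_def CC_def V_gm_sym(2)[OF b m, of _ c])
qed

text \<open>Symmetry of \<open>Pk\<close> in its last two arguments cancels the derivative terms,
  and antisymmetry of \<open>br\<close> collects the structure terms.\<close>

lemma Kk_torsion: "Kk b m a c e - Kk b m c a e = gm b m (br b (\<pi> m) a c) e"
proof -
  have anti: "gm b m (br b (\<pi> m) u v) w = - gm b m (br b (\<pi> m) v u) w" for u v w
    using br_anti[OF b, of u v] linear_neg[OF gm_linear(1)] by metis
  show ?thesis
    unfolding Kk_def using Pk_sym[of a c e] Pk_sym[of c e a] Pk_sym[of e a c] anti[of c a e] anti[of c e a] anti[of e a c]
    by (simp add: field_simps)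
qed

lemma Kk_compatible: "Kk b m a c e + Kk b m a e c = Pk b m a c e"
proof -
  have anti: "gm b m (br b (\<pi> m) u v) w = - gm b m (br b (\<pi> m) v u) w" for u v w
    using br_anti[OF b, of u v] linear_neg[OF gm_linear(1)] by metis
  show ?thesis
    unfolding Kk_def using Pk_sym[of a c e] Pk_sym[of c e a] Pk_sym[of e a c] anti[of c a e] anti[of c e a] anti[of e a c]
    by (simp add: field_simps)
qed

lemma smooth_thH: "smooth_at Ts (\<lambda>q. thH b q a) m"
  unfolding thH_def
  by (intro tot.smooth_at_scaleR tot.smooth_at_const tot.smooth_at_add smooth_br_total smooth_psi smooth_VV smooth_sb b m)

lemma smooth_gm_field: "smooth_at Ts k m \<Longrightarrow> smooth_at Ts (\<lambda>q. gm b q (k q) e) m"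
  by (rule tot.deriv_along_linear_field(1)[OF tot.tangent_zero _ eventually_gm_linear(1)[of e] smooth_gm[OF b(1) m b(2)]])

end

lemma smooth_Kk: assumes b: "b \<in> \<BB>" "\<pi> m \<in> dom b" and m: "m \<in> CM"
  shows "smooth_at Ts (\<lambda>q. Kk b q a c e) m"
proof -
  have P: "smooth_at Ts (\<lambda>q. Pk b q a c e) m" for a c e
  proof -
    have "\<forall>\<^sub>F q in nhds m. linear (\<lambda>u. CC b q u c e)"
      using eventually_CM_dom[OF b(1) m b(2)] by eventually_elim (intro linear_CC b; simp)
    moreover have "smooth_at Ts (\<lambda>q. CC b q u c e) m" for u unfolding CC_def by (intro smooth_VV smooth_gm b m)
    ultimately have "smooth_at Ts (\<lambda>q. CC b q (thH b q a) c e) m"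
      by (rule tot.deriv_along_linear_field(1)[OF tot.tangent_zero smooth_thH[OF b m], of "\<lambda>q u. CC b q u c e"])
    then show ?thesis unfolding Pk_def by (intro tot.smooth_at_diff smooth_HH smooth_gm b m)
  qed
  show ?thesis unfolding Kk_def
    by (intro tot.smooth_at_mult tot.smooth_at_const tot.smooth_at_add tot.smooth_at_diff P smooth_gm_field b m
      smooth_br_total)
qed

text \<open>The Christoffel symbols \<open>\<Gamma>(a, c)\<close> of the connection along \<open>a\<^sup>\<alpha> \<X>\<^sub>\<alpha>\<close>; those along the \<open>\<V>\<^sub>\<alpha>\<close> vanish.\<close>

definition Gam :: "('m, 'e, 'a, 'f) bundle_chart \<Rightarrow> 'f \<Rightarrow> 'f \<Rightarrow> 'a \<Rightarrow> 'f" where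
  "Gam b a c = (SOME s. \<forall>m\<in>CM. \<pi> m \<in> dom b \<longrightarrow> smooth_at Ts s m \<and> (\<forall>e. gm b m (s m) e = Kk b m a c e))"

lemma Gam:
  assumes b: "b \<in> \<BB>" "\<pi> m \<in> dom b" and m: "m \<in> CM"
  shows smooth_Gam: "smooth_at Ts (Gam b a c) m" and gm_Gam: "gm b m (Gam b a c m) e = Kk b m a c e"
proof -
  obtain s where "\<And>m. m \<in> CM \<Longrightarrow> \<pi> m \<in> dom b \<Longrightarrow> smooth_at Ts s m"
    "\<And>m w. m \<in> CM \<Longrightarrow> \<pi> m \<in> dom b \<Longrightarrow> gm b m (s m) w = Kk b m a c w"
    using smooth_solution[OF b(1), of "\<lambda>m. Kk b m a c"] smooth_Kk[OF b(1)] linear_Kk(3)[OF b(1)] by metis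
  then have "\<exists>s. \<forall>m\<in>CM. \<pi> m \<in> dom b \<longrightarrow> smooth_at Ts s m \<and> (\<forall>e. gm b m (s m) e = Kk b m a c e)" by blast
  from someI_ex[OF this] show "smooth_at Ts (Gam b a c) m" "gm b m (Gam b a c m) e = Kk b m a c e"
    using b m unfolding Gam_def by blast+
qed

context
  fixes b m assumes b: "b \<in> \<BB>" "\<pi> m \<in> dom b" and m: "m \<in> CM"
begin

lemma bilinear_Gam: "bilinear (\<lambda>a c. Gam b a c m)"
  unfolding bilinear_def
proof (intro conjI allI linearI)
  note l = linear_add[OF gm_linear(1)[OF b m]] linear_cmul[OF gm_linear(1)[OF b m]]
  note k = linear_add[OF linear_Kk(1)[OF b m]] linear_cmul[OF linear_Kk(1)[OF b m]]
    linear_add[OF linear_Kk(2)[OF b m]] linear_cmul[OF linear_Kk(2)[OF b m]]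
  show "Gam b a (c + d) m = Gam b a c m + Gam b a d m" "Gam b (c + d) a m = Gam b c a m + Gam b d a m"
    "Gam b a (r *\<^sub>R c) m = r *\<^sub>R Gam b a c m" "Gam b (r *\<^sub>R c) a m = r *\<^sub>R Gam b c a m" for a c d r
    by (rule gm_nondegenerate[OF b m]; simp add: gm_Gam[OF b m] l k)+
qed

lemma Gam_torsion: "Gam b a c m - Gam b c a m = br b (\<pi> m) a c"
  by (rule gm_nondegenerate[OF b m])
    (simp add: linear_diff[OF gm_linear(1)[OF b m]] gm_Gam[OF b m] Kk_torsion[OF b m])

lemma Gam_compatible: "gm b m (Gam b a c m) e + gm b m c (Gam b a e m) = Pk b m a c e"
  using gm_sym[OF b(1) m b(2), of c] by (simp add: gm_Gam[OF b m] Kk_compatible[OF b m])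

end

lemma bilinear_expand:
  fixes f :: "'f \<Rightarrow> 'f \<Rightarrow> 'w::real_vector"
  assumes "bilinear f"
  shows "f u w = (\<Sum>a\<in>Basis. \<Sum>c\<in>Basis. ((u \<bullet> a) * (w \<bullet> c)) *\<^sub>R f a c)"
proof -
  have "f u w = (\<Sum>a\<in>Basis. (u \<bullet> a) *\<^sub>R f a w)"
    by (rule linear_reproducing[OF reproducing_Basis]) (use assms in \<open>simp add: bilinear_def\<close>)
  also have "\<dots> = (\<Sum>a\<in>Basis. (u \<bullet> a) *\<^sub>R (\<Sum>c\<in>Basis. (w \<bullet> c) *\<^sub>R f a c))"
    using linear_reproducing[OF reproducing_Basis, of "f a" w for a] assms by (simp add: bilinear_def)
  finally show ?thesis by (simp add: scaleR_sum_right)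
qed

lemma smooth_Gam_field:
  assumes b: "b \<in> \<BB>" "\<pi> m \<in> dom b" and m: "m \<in> CM" and "smooth_at Ts k m" "smooth_at Ts l m"
  shows "smooth_at Ts (\<lambda>q. Gam b (k q) (l q) q) m"
proof -
  have "\<forall>\<^sub>F q in nhds m. Gam b (k q) (l q) q = (\<Sum>a\<in>Basis. \<Sum>c\<in>Basis. ((k q \<bullet> a) * (l q \<bullet> c)) *\<^sub>R Gam b a c q)"
    using eventually_CM_dom[OF b(1) m b(2)] by eventually_elim (rule bilinear_expand, use bilinear_Gam b in auto)
  then show ?thesis
    by (rule tot.smooth_at_transform)
      (intro tot.smooth_at_sum tot.smooth_at_scaleR tot.smooth_at_mult tot.smooth_at_inner tot.smooth_at_const assms smooth_Gam)
qed

text \<open>The tautological section has covariant derivative \<open>\<theta>\<close>; this is the derivative of the spray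
  equation in the direction of the fibre.\<close>

lemma Gam_psi:
  assumes b: "b \<in> \<BB>" "\<pi> m \<in> dom b" and m: "m \<in> CM"
  shows "Gam b a (snd b m) m = thH b m a"
proof -
  let ?y = "snd b m" and ?x = "\<pi> m"
  note lV = linear_VV[OF b smooth_L[OF m]]
  note gl = gm_linear[OF b m]
  have vtan: "tangent_map Ts Bs \<pi> m (snd (prol_ver A b w m)) = (\<lambda>_. 0)" for w
    by (simp add: lsec_tangent_map[OF lsec_ver[OF b]] fst_ver_hor anchor_zero)
  have fib: "\<forall>\<^sub>F q in nhds m. q \<in> CM \<and> \<pi> q \<in> dom b" by (rule eventually_CM_dom[OF b(1) m b(2)])
  \<comment> \<open>The spray equation holds throughout the fibre inside the conic domain, so its
    derivative in direction \<open>a\<close> may be taken term by term. The anchor coefficients and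
    structure functions are constant along the fibre, whereas \<open>y\<close>, the spray
    coefficients and the derivatives of the energy all contribute.\<close>
  have V: "gm b m (VV b a (sb b) m) e = - CC b m a (sb b m) e - HH b a (\<lambda>q. VV b e L q) m
      - HH b ?y (\<lambda>q. gm b q a e) m - VV b (br b ?x e a) L m - gm b m a (br b ?x e ?y) + HH b e (\<lambda>q. VV b a L q) m" for a e
  proof -
    note v = ver_tangent[OF b, of a]
    note sVL = smooth_VL[OF b(1) m b(2)]
    have h_lin: "\<forall>\<^sub>F q in nhds m. linear (\<lambda>d. HH b d (\<lambda>q. VV b e L q) q)"
      using fib by eventually_elim (intro linear_HH smooth_VL b; simp)
    have 1: "smooth_at Ts (\<lambda>q. gm b q (sb b q) e) m" by (rule smooth_gm_field[OF b m smooth_sb[OF b m]])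
    have h1: "VV b a (\<lambda>q. gm b q (sb b q) e) m = gm b m (VV b a (sb b) m) e + CC b m a (sb b m) e"
      unfolding VV_def CC_def
      by (rule tot.deriv_along_linear_field(2)[OF v smooth_sb[OF b m] eventually_gm_linear(1)[OF b m] smooth_gm[OF b(1) m b(2)]])
    have 2: "smooth_at Ts (\<lambda>q. HH b (snd b q) (\<lambda>q. VV b e L q) q) m"
      by (rule tot.deriv_along_linear_field(1)[OF v smooth_psi[OF b] h_lin]) (intro smooth_HH sVL b)
    have "VV b a (\<lambda>q. HH b (snd b q) (\<lambda>q. VV b e L q) q) m = HH b (VV b a (snd b) m) (\<lambda>q. VV b e L q) m
        + VV b a (\<lambda>q. HH b ?y (\<lambda>q. VV b e L q) q) m"
      using tot.deriv_along_linear_field(2)[OF v smooth_psi[OF b] h_lin smooth_HH[OF b sVL]] unfolding VV_def by simp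
    then have h2: "VV b a (\<lambda>q. HH b (snd b q) (\<lambda>q. VV b e L q) q) m = HH b a (\<lambda>q. VV b e L q) m + HH b ?y (\<lambda>q. gm b q a e) m"
      by (simp add: VV_psi b VV_HH_commute[OF b sVL] gm_def)
    have k: "smooth_at Ts (\<lambda>q. br b (\<pi> q) e (snd b q)) m" by (intro smooth_br_total smooth_psi tot.smooth_at_const b)
    have "\<forall>\<^sub>F y in nhds ?x. linear (br b y e)"
      using eventually_dom[OF b] by eventually_elim (use bilinear_br[OF b(1)] in \<open>auto simp: bilinear_def\<close>)
    from deriv_along_linear_family(2)[OF v smooth_psi[OF b] this smooth_br[OF b]]
    have kV: "VV b a (\<lambda>q. br b (\<pi> q) e (snd b q)) m = br b ?x e a"
      using VV_psi[OF b, of a] by (simp add: VV_def vtan deriv_along_zero smooth_br b)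
    have 3: "smooth_at Ts (\<lambda>q. VV b (br b (\<pi> q) e (snd b q)) L q) m"
      by (rule tot.deriv_along_linear_field(1)[OF v k eventually_linear_VL[OF b(1) m b(2)] sVL])
    have "VV b a (\<lambda>q. VV b (br b (\<pi> q) e (snd b q)) L q) m = VV b (VV b a (\<lambda>q. br b (\<pi> q) e (snd b q)) m) L m
        + VV b a (\<lambda>q. VV b (br b ?x e ?y) L q) m"
      using tot.deriv_along_linear_field(2)[OF v k eventually_linear_VL[OF b(1) m b(2)] sVL] unfolding VV_def by simp
    then have h3: "VV b a (\<lambda>q. VV b (br b (\<pi> q) e (snd b q)) L q) m = VV b (br b ?x e a) L m + gm b m a (br b ?x e ?y)"
      by (simp add: kV gm_def)
    have 4: "smooth_at Ts (\<lambda>q. HH b e L q) m" by (intro smooth_HH b smooth_L m)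
    have h4: "VV b a (\<lambda>q. HH b e L q) m = HH b e (\<lambda>q. VV b a L q) m" by (rule VV_HH_commute[OF b smooth_L[OF m]])
    have "\<forall>\<^sub>F q in nhds m. gm b q (sb b q) e + HH b (snd b q) (\<lambda>q. VV b e L q) q
        + VV b (br b (\<pi> q) e (snd b q)) L q - HH b e L q = 0"
      using fib by eventually_elim (simp add: gm_sb b spray_rhs_def)
    from VV_eventually[OF this, of b a] have "VV b a (\<lambda>q. gm b q (sb b q) e + HH b (snd b q) (\<lambda>q. VV b e L q) q
        + VV b (br b (\<pi> q) e (snd b q)) L q - HH b e L q) m = 0" by (simp add: VV_def)
    also have "VV b a (\<lambda>q. gm b q (sb b q) e + HH b (snd b q) (\<lambda>q. VV b e L q) q
        + VV b (br b (\<pi> q) e (snd b q)) L q - HH b e L q) m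
      = VV b a (\<lambda>q. gm b q (sb b q) e) m + VV b a (\<lambda>q. HH b (snd b q) (\<lambda>q. VV b e L q) q) m
        + VV b a (\<lambda>q. VV b (br b (\<pi> q) e (snd b q)) L q) m - VV b a (\<lambda>q. HH b e L q) m"
      unfolding VV_def[of b a]
      by (simp add: tot.deriv_along_diff[OF v] tot.deriv_along_add[OF v] 1 2 3 4 tot.smooth_at_add)
    finally show ?thesis unfolding h1 h2 h3 h4 by simp
  qed
  \<comment> \<open>Horizontal frame vectors have no fibre component, so \<open>y\<close> counts as
    constant when Euler's identities are differentiated along them.\<close>
  have Hg: "HH b a (\<lambda>q. gm b q e ?y) m = HH b a (\<lambda>q. VV b e L q) m" for a e
    using deriv_gm_psi[OF b m hor_tangent[OF b, of a], of e] linear_0[OF gl(2)] by (simp add: HH_def hor_tc b)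
  have Hg': "HH b a (\<lambda>q. gm b q ?y e) m = HH b a (\<lambda>q. VV b e L q) m" for a e
    unfolding Hg[symmetric] by (rule HH_eventually) (use fib in eventually_elim, use gm_sym b in auto)
  have Cy: "CC b m u e ?y = 0" "CC b m u ?y e = 0" "CC b m ?y u e = 0" for u e
    using V_gm_psi[OF b m, of u e] V_gm_sym(2)[OF b m, of u e ?y] V_gm_sym(1)[OF b m, of ?y u e] by (simp_all add: CC_def)
  have Hy: "HH b e (\<lambda>q. VV b ?y L q) m = 2 * HH b e L m" for e
    using deriv_VL_psi[OF b m hor_tangent[OF b, of e]] linear_0[OF lV] by (simp add: HH_def hor_tc b)
  \<comment> \<open>The spray coefficients are homogeneous of degree 2. Here this comes from the
    differentiated spray equation with \<open>a = y\<close> together with Euler's identities,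
    instead of from scaling.\<close>
  have Vs: "VV b ?y (sb b) m = 2 *\<^sub>R sb b m"
  proof (rule gm_nondegenerate[OF b m])
    fix e
    show "gm b m (VV b ?y (sb b) m) e = gm b m (2 *\<^sub>R sb b m) e"
      unfolding V[of ?y e] linear_cmul[OF gl(1)] gm_sb[OF b m] spray_rhs_def
      using Cy(3)[of "sb b m" e] Hg'[of ?y e] Hy[of e] gm_psi[OF b m, of "br b ?x e ?y"] gm_sym[OF b(1) m b(2), of ?y "br b ?x e ?y"]
      by simp
  qed
  have br0: "br b ?x ?y ?y = 0" using br_anti[OF b, of ?y ?y] by (simp add: eq_neg_iff_add_eq_0 flip: scaleR_2)
  \<comment> \<open>Hence the spray has no vertical part: its frame combination with coefficients
    \<open>y\<close> contributes \<open>- sb b m\<close>, which its fibre component compensates. So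
    \<open>P2\<close> below is the derivative of g along the spray.\<close>
  have thy: "thH b m ?y = - sb b m" by (simp add: thH_def br0 Vs)
  have "Kk b m a ?y e = gm b m (thH b m a) e" for a e
  proof -
    have anti: "gm b m (br b ?x u v) w = - gm b m (br b ?x v u) w" for u v w
      using br_anti[OF b, of u v] linear_neg[OF gl(1)] by metis
    have P1: "Pk b m a ?y e = HH b a (\<lambda>q. VV b e L q) m" by (simp add: Pk_def Cy Hg')
    have P2: "Pk b m ?y e a = HH b ?y (\<lambda>q. gm b q a e) m + CC b m a (sb b m) e"
      using Pk_sym[OF b m, of ?y e a] linear_neg[OF linear_CC(1)[OF b m]] V_gm_sym(1)[OF b m, of "sb b m" a e]
      by (simp add: Pk_def[of b m ?y a e] thy) (simp add: CC_def)
    have P3: "Pk b m e a ?y = HH b e (\<lambda>q. VV b a L q) m" by (simp add: Pk_def Cy Hg)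
    have "gm b m (thH b m a) e = - (1/2) * (gm b m (br b ?x ?y a) e + gm b m (VV b a (sb b) m) e)"
      unfolding thH_def linear_cmul[OF gl(1)] linear_add[OF gl(1)] by simp
    then show ?thesis
      unfolding Kk_def P1 P2 P3 V[of a e]
      using anti[of ?y a e] anti[of ?y e a] gm_psi[OF b m, of "br b ?x e a"] gm_sym[OF b(1) m b(2), of a "br b ?x e ?y"]
      by (simp add: field_simps)
  qed
  then show ?thesis by (intro gm_nondegenerate[OF b m]) (simp add: gm_Gam[OF b m])
qed

section \<open>The connection in coordinates\<close>

abbreviation "PS \<equiv> pm.sect CM"

text \<open>The fibre coordinates of \<open>\<nabla>\<^bsub>X\<^esub> Y\<close> at \<open>m\<close>.\<close>

definition psiD :: "('m, 'e, 'a, 'f) bundle_chart \<Rightarrow> ('a \<Rightarrow> ('e, 'a, 'f) prol) \<Rightarrow> ('a \<Rightarrow> 'a) \<Rightarrow> 'a \<Rightarrow> 'f" where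
  "psiD b X Y m = deriv_along Ts m (snd (X m)) (\<lambda>q. snd b (Y q)) + Gam b (snd b (fst (X m))) (snd b (Y m)) m"

lemma smooth_psi_pm: "pm.lsec Y m \<Longrightarrow> b \<in> \<BB> \<Longrightarrow> \<pi> m \<in> dom b \<Longrightarrow> smooth_at Ts (\<lambda>q. snd b (Y q)) m"
  by (simp add: pm_lsec_iff)

lemma pm_sect_pi: "Y \<in> PS \<Longrightarrow> m \<in> CM \<Longrightarrow> \<pi> (Y m) = \<pi> m"
  using pm.sect_fib by blast

lemma prol_proj_sect: assumes "X \<in> SS" shows "prol_proj CM X \<in> PS"
  unfolding prol_proj_def
  by (rule pm.sectI[OF open_CM]) (use qm.sect_lsec[OF assms] qm_lsec_iff in blast)

lemma psi_prol_proj: "m \<in> CM \<Longrightarrow> deriv_along Ts m v (\<lambda>q. snd b (prol_proj CM X q)) = deriv_along Ts m v (\<lambda>q. snd b (fst (X q)))"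
  by (rule tot.deriv_along_eventually, rule eventually_mono[OF qm.eventually_W]) (simp_all add: prol_proj_def)

text \<open>The derivative terms are the same on both sides; the torsion of the Christoffel symbols
  supplies the structure functions in the bracket.\<close>

lemma psiD_torsion:
  assumes "X \<in> SS" "Y \<in> SS" and m: "m \<in> CM" and b: "b \<in> \<BB>" "\<pi> m \<in> dom b"
  shows "psiD b X (prol_proj CM Y) m - psiD b Y (prol_proj CM X) m = snd b (fst (PB X Y m))"
proof -
  have "snd b (fst (PB X Y m)) = fst (pbr b X Y m)"
    using fc_PB[OF assms(1,2) m b] unfolding fc_def by (metis fst_conv)
  then show ?thesis
    using Gam_torsion[OF b m, of "snd b (fst (X m))" "snd b (fst (Y m))"] m
    by (simp add: psiD_def psi_prol_proj pbr_components qm.sect_lsec[OF assms(1)] qm.sect_lsec[OF assms(2)] b)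
      (simp add: prol_proj_def algebra_simps)
qed

lemma deriv_gm_fields:
  assumes b: "b \<in> \<BB>" "\<pi> m \<in> dom b" and m: "m \<in> CM" and v: "v \<in> tangent_space Ts m"
    and k: "smooth_at Ts k m" and l: "smooth_at Ts l m"
  shows "deriv_along Ts m v (\<lambda>q. gm b q (k q) (l q)) = deriv_along Ts m v (\<lambda>q. gm b q (k m) (l m))
    + gm b m (deriv_along Ts m v k) (l m) + gm b m (k m) (deriv_along Ts m v l)"
proof -
  have "\<forall>\<^sub>F q in nhds m. linear (gm b q (k q))"
    using eventually_CM_dom[OF b(1) m b(2)] by eventually_elim (intro gm_linear b; simp)
  then have "deriv_along Ts m v (\<lambda>q. gm b q (k q) (l q)) = gm b m (k m) (deriv_along Ts m v l) + deriv_along Ts m v (\<lambda>q. gm b q (k q) (l m))"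
    by (rule tot.deriv_along_linear_field(2)[OF v l, of "\<lambda>q. gm b q (k q)"]) (intro smooth_gm_field b m k)
  also have "deriv_along Ts m v (\<lambda>q. gm b q (k q) (l m)) = gm b m (deriv_along Ts m v k) (l m) + deriv_along Ts m v (\<lambda>q. gm b q (k m) (l m))"
    by (rule tot.deriv_along_linear_field(2)[OF v k eventually_gm_linear(1)[OF b m] smooth_gm[OF b(1) m b(2)]])
  finally show ?thesis by simp
qed

text \<open>Split the vector into its frame components: the horizontal one differentiates g to
  \<open>Pk\<close> plus a Cartan term in \<open>thH\<close>, the vertical one adds a Cartan term in
  the fibre component, and both together have the fibre coordinates of \<theta> as argument. A
  single vector and arbitrary coefficient functions are allowed, so that the identity also applies
  to the image of a vector under the tangent map of a section.\<close>

lemma gm_compatible: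
  assumes b: "b \<in> \<BB>" "\<pi> m \<in> dom b" and m: "m \<in> CM" and p: "p \<in> prol_fiber A m"
    and k: "smooth_at Ts k m" and l: "smooth_at Ts l m"
  shows "deriv_along Ts m (snd p) (\<lambda>q. gm b q (k q) (l q)) =
    gm b m (deriv_along Ts m (snd p) k + Gam b (snd b (fst p)) (k m) m) (l m)
    + gm b m (k m) (deriv_along Ts m (snd p) l + Gam b (snd b (fst p)) (l m) m)
    + CC b m (snd (snd p (tc b)) + thH b m (snd b (fst p))) (k m) (l m)"
  unfolding deriv_gm_fields[OF b m prol_fiberD(2)[OF p] k l] deriv_along_split[OF b p smooth_gm[OF b(1) m b(2)]]
    linear_add[OF gm_linear(1)[OF b m]] linear_add[OF gm_linear(2)[OF b m]] linear_add[OF linear_CC(1)[OF b m]]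
  using Gam_compatible[OF b m, of "snd b (fst p)" "k m" "l m"] by (simp add: Pk_def CC_def)

lemma psiD_compatible:
  assumes X: "X \<in> SS" and Y: "Y \<in> PS" and Z: "Z \<in> PS" and m: "m \<in> CM" and b: "b \<in> \<BB>" "\<pi> m \<in> dom b"
  shows "qm.act X (\<lambda>u. fund_tensor A u (Y u) (Z u)) m = gm b m (psiD b X Y m) (snd b (Z m))
    + gm b m (snd b (Y m)) (psiD b X Z m) + 2 * cartan_tensor A m (theta A X m) (Y m) (Z m)"
proof -
  have "\<forall>\<^sub>F q in nhds m. fund_tensor A q (Y q) (Z q) = gm b q (snd b (Y q)) (snd b (Z q))"
    using eventually_CM_dom[OF b(1) m b(2)] by eventually_elim (simp add: fund_tensor_eq b pm_sect_pi Y Z)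
  from tot.deriv_along_eventually[OF this]
  have "qm.act X (\<lambda>u. fund_tensor A u (Y u) (Z u)) m = deriv_along Ts m (snd (X m)) (\<lambda>q. gm b q (snd b (Y q)) (snd b (Z q)))"
    by (simp add: qm.act_def)
  moreover have "2 * cartan_tensor A m (theta A X m) (Y m) (Z m)
      = CC b m (snd (snd (X m) (tc b)) + thH b m (snd b (fst (X m)))) (snd b (Y m)) (snd b (Z m))"
    using cartan_tensor_eq[OF b m, of "theta A X m" "Y m" "Z m"] b pm_sect_pi[OF Y m] pm_sect_pi[OF Z m]
    by (simp add: theta_eq[OF X m b] pi_frame psi_frame CC_def)
  ultimately show ?thesis
    using gm_compatible[OF b m qm.sect_fib[OF X m] smooth_psi_pm[OF pm.sect_lsec[OF Y m] b] smooth_psi_pm[OF pm.sect_lsec[OF Z m] b]]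
    by (simp add: psiD_def)
qed

text \<open>The properties of the connection that can be tested at one point, imposed on an operator
  with values in a single fibre. In this form two local expressions can be compared before a global
  connection exists.\<close>

definition conn_at :: "'a \<Rightarrow> (('a \<Rightarrow> ('e, 'a, 'f) prol) \<Rightarrow> ('a \<Rightarrow> 'a) \<Rightarrow> 'a) \<Rightarrow> bool" where
  "conn_at m D \<longleftrightarrow> (\<forall>X\<in>SS. \<forall>Y\<in>PS. \<pi> (D X Y) = \<pi> m \<and>
      (\<forall>f. (\<forall>m\<in>CM. smooth_at Ts f m) \<longrightarrow>
        D X (section_scale (fscale A) CM f Y) = fadd A (fscale A (qm.act X f m) (Y m)) (fscale A (f m) (D X Y)))) \<and>
    (\<forall>X\<in>SS. \<forall>Y\<in>SS. fadd A (D X (prol_proj CM Y)) (fscale A (-1) (D Y (prol_proj CM X))) = fst (PB X Y m)) \<and>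
    (\<forall>X\<in>SS. \<forall>Y\<in>PS. \<forall>Z\<in>PS. qm.act X (\<lambda>u. fund_tensor A u (Y u) (Z u)) m =
       fund_tensor A m (D X Y) (Z m) + fund_tensor A m (Y m) (D X Z) + 2 * cartan_tensor A m (theta A X m) (Y m) (Z m))"

text \<open>The difference \<open>T\<close> of two solutions is symmetric through the projection,
  and skew with respect to g because the Cartan terms involve only \<theta> and cancel. The
  Levi-Civita argument then forces \<open>T = 0\<close>, also along vertical sections, since the
  symmetry is available for every section of the prolongation.\<close>

lemma conn_at_unique:
  assumes D: "conn_at m D" "conn_at m D'" and m: "m \<in> CM" and X: "X \<in> SS" and Y: "Y \<in> PS"
  shows "D X Y = D' X Y"
proof -
  obtain b where b: "b \<in> \<BB>" "\<pi> m \<in> dom b" using ex_bundle_chart by blast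
  define T where "T X Y = snd b (D X Y) - snd b (D' X Y)" for X Y
  have pi: "\<pi> (D X Y) = \<pi> m" "\<pi> (D' X Y) = \<pi> m" if "X \<in> SS" "Y \<in> PS" for X Y
    using D that unfolding conn_at_def by blast+
  note gl = gm_linear[OF b m]
  have scale: "T X (section_scale (fscale A) CM f Y) = f m *\<^sub>R T X Y"
    if "X \<in> SS" "Y \<in> PS" "\<forall>m\<in>CM. smooth_at Ts f m" for X Y f
  proof -
    have "snd b (E X (section_scale (fscale A) CM f Y)) = qm.act X f m *\<^sub>R snd b (Y m) + f m *\<^sub>R snd b (E X Y)"
      if "conn_at m E" for E
    proof -
      have "E X (section_scale (fscale A) CM f Y) = fadd A (fscale A (qm.act X f m) (Y m)) (fscale A (f m) (E X Y))"
        "\<pi> (E X Y) = \<pi> m"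
        using that \<open>X \<in> SS\<close> \<open>Y \<in> PS\<close> \<open>\<forall>m\<in>CM. smooth_at Ts f m\<close> unfolding conn_at_def by blast+
      then show ?thesis using b pm_sect_pi[OF \<open>Y \<in> PS\<close> m] by (simp add: bundle_chart)
    qed
    from this[OF D(1)] this[OF D(2)] show ?thesis by (simp add: T_def scaleR_diff_right)
  qed
  have sym: "T X (prol_proj CM Y) = T Y (prol_proj CM X)" if XY: "X \<in> SS" "Y \<in> SS" for X Y
  proof -
    have "snd b (E X (prol_proj CM Y)) - snd b (E Y (prol_proj CM X)) = snd b (fst (PB X Y m))"
      if "conn_at m E" for E
    proof -
      have "fadd A (E X (prol_proj CM Y)) (fscale A (-1) (E Y (prol_proj CM X))) = fst (PB X Y m)"
        "\<pi> (E X (prol_proj CM Y)) = \<pi> m" "\<pi> (E Y (prol_proj CM X)) = \<pi> m"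
        using that XY prol_proj_sect unfolding conn_at_def by blast+
      then show ?thesis using b by (simp add: bundle_chart flip: \<open>_ = fst (PB X Y m)\<close>)
    qed
    from this[OF D(1)] this[OF D(2)] show ?thesis by (simp add: T_def algebra_simps)
  qed
  have skew: "gm b m (T X Y) (snd b (Z m)) = - gm b m (T X Z) (snd b (Y m))" if XYZ: "X \<in> SS" "Y \<in> PS" "Z \<in> PS" for X Y Z
  proof -
    have "qm.act X (\<lambda>u. fund_tensor A u (Y u) (Z u)) m = gm b m (snd b (E X Y)) (snd b (Z m))
       + gm b m (snd b (Y m)) (snd b (E X Z)) + 2 * cartan_tensor A m (theta A X m) (Y m) (Z m)"
      if "conn_at m E" for E
    proof -
      have "qm.act X (\<lambda>u. fund_tensor A u (Y u) (Z u)) m =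
         fund_tensor A m (E X Y) (Z m) + fund_tensor A m (Y m) (E X Z) + 2 * cartan_tensor A m (theta A X m) (Y m) (Z m)"
        "\<pi> (E X Y) = \<pi> m" "\<pi> (E X Z) = \<pi> m"
        using that XYZ unfolding conn_at_def by blast+
      then show ?thesis using XYZ m by (simp add: fund_tensor_eq[OF b m] pm_sect_pi)
    qed
    from this[OF D(1)] this[OF D(2)] show ?thesis
      using gm_sym[OF b(1) m b(2), of "snd b (Y m)"] linear_diff[OF gl(1)] by (simp add: T_def)
  qed
  obtain \<beta> :: "'a \<Rightarrow> real" and K where \<beta>: "\<And>q. smooth_at Ts \<beta> q" "\<forall>\<^sub>F q in nhds m. \<beta> q = 1"
    "closed K" "K \<subseteq> CM \<inter> \<pi> -` dom b" "\<And>q. q \<notin> K \<Longrightarrow> \<beta> q = 0"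
  proof (rule tot.smooth_bump)
    show "open (CM \<inter> \<pi> -` dom b)" "m \<in> CM \<inter> \<pi> -` dom b"
      using open_CM pi_continuous[OF open_dom[OF b(1)]] m b by auto
  qed (rule that)
  have \<beta>m: "\<beta> m = 1" using \<beta>(2) by (rule eventually_nhds_x_imp_x)
  \<comment> \<open>A section of the prolongation whose projection is \<beta> times
    \<open>Y\<close>: symmetry of \<open>T\<close> can only be used for projections, and by
    \<open>scale\<close> the factor \<beta> is harmless at \<open>m\<close>.\<close>
  define X2 where "X2 = qm.ext b (CM \<inter> \<pi> -` dom b) \<beta> (\<lambda>q. (snd b (Y q), 0))"
  have X2: "X2 \<in> SS" unfolding X2_def
  proof (rule qm.ext_sect[OF b(1) _ _ \<beta>(3,4,5,1)])
    show "open (CM \<inter> \<pi> -` dom b)" using open_CM pi_continuous[OF open_dom[OF b(1)]] by auto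
    show "smooth_at Ts (\<lambda>q. (snd b (Y q), 0)) q" if "q \<in> CM \<inter> \<pi> -` dom b" for q
      using that by (intro tot.smooth_at_Pair smooth_psi_pm pm.sect_lsec[OF Y] b) auto
  qed simp
  have proj: "prol_proj CM X2 = section_scale (fscale A) CM \<beta> Y"
  proof
    fix q
    obtain b' where b': "b' \<in> \<BB>" "\<pi> q \<in> dom b'" using ex_bundle_chart by blast
    have "frame A b (\<beta> q *\<^sub>R snd b (Y q)) (\<pi> q) = fscale A (\<beta> q) (Y q)" if "q \<in> CM" "\<pi> q \<in> dom b"
      using that pm_sect_pi[OF Y] frame_psi[OF b(1), of "Y q"] by (simp add: frame_scale b(1))
    moreover have "zero_vec A (\<pi> q) = fscale A (\<beta> q) (Y q)" if "q \<in> CM" "\<not> \<pi> q \<in> dom b"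
    proof -
      have "\<beta> q = 0" using that \<beta>(4,5) by blast
      then show ?thesis using that pm_sect_pi[OF Y that(1)] b' by (intro fibre_eqI[of b']) (simp_all add: bundle_chart psi_zero)
    qed
    ultimately show "prol_proj CM X2 q = section_scale (fscale A) CM \<beta> Y q"
      by (simp add: prol_proj_def section_scale_def X2_def qm.ext_def prol_pt_def)
  qed
  have TY: "T X Y = T X (prol_proj CM X2)" using scale[OF X Y, of \<beta>] \<beta>(1) \<beta>m by (simp add: proj)
  \<comment> \<open>The third section is chosen with projection \<open>T X Y\<close> at
    \<open>m\<close> in fibre coordinates, so that the expression \<open>t\<close> becomes the
    squared length of \<open>T X Y\<close>.\<close>
  obtain X3 where X3: "X3 \<in> SS" "X3 m = prol_pt b m (T X Y, 0)"
    using qm.sect_value[OF m, of "prol_pt b m (T X Y, 0)"] qm.pt_fib[OF b(1), of m] b(2) by auto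
  have p3: "snd b (prol_proj CM X3 m) = T X Y" using m X3(2) b by (simp add: prol_proj_def prol_pt_def psi_frame)
  note P = prol_proj_sect
  define t where "t i j k = gm b m (T i (prol_proj CM j)) (snd b (prol_proj CM k m))"
    for i j k :: "'a \<Rightarrow> ('e, 'a, 'f) prol"
  have ts: "t i j k = t j i k" if "i \<in> SS" "j \<in> SS" for i j k using sym[OF that] by (simp add: t_def)
  have tk: "t i j k = - t i k j" if "i \<in> SS" "j \<in> SS" "k \<in> SS" for i j k
    unfolding t_def by (rule skew[OF that(1) P[OF that(2)] P[OF that(3)]])
  \<comment> \<open>Symmetric in the first pair and skew in the last pair: six alternating exchanges
    return to the start with the opposite sign.\<close>
  have "t X X2 X3 = 0"
    using ts[OF X X2, of X3] tk[OF X2 X X3(1)] ts[OF X2 X3(1), of X] tk[OF X3(1) X2 X] ts[OF X3(1) X, of X2] tk[OF X X3(1) X2]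
    by linarith
  then have "gm b m (T X Y) (T X Y) = 0" by (simp add: t_def p3 TY[symmetric])
  then have "T X Y = 0" using gm_pos[OF b m, of "T X Y"] by (cases "T X Y = 0") auto
  then show ?thesis using pi[OF X Y] b by (intro fibre_eqI[of b]) (simp_all add: T_def)
qed

lemma psiD_scale:
  assumes X: "X \<in> SS" and Y: "Y \<in> PS" and m: "m \<in> CM" and b: "b \<in> \<BB>" "\<pi> m \<in> dom b" and f: "smooth_at Ts f m"
  shows "psiD b X (section_scale (fscale A) CM f Y) m = qm.act X f m *\<^sub>R snd b (Y m) + f m *\<^sub>R psiD b X Y m"
proof -
  have "\<forall>\<^sub>F q in nhds m. snd b (section_scale (fscale A) CM f Y q) = f q *\<^sub>R snd b (Y q)"
    using eventually_CM_dom[OF b(1) m b(2)] by eventually_elim (simp add: section_scale_def bundle_chart b pm_sect_pi Y)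
  from tot.deriv_along_eventually[OF this] eventually_nhds_x_imp_x[OF this]
  show ?thesis
    using tot.deriv_along_scaleR[OF lsec_vector[OF qm.sect_lsec[OF X m]] f smooth_psi_pm[OF pm.sect_lsec[OF Y m] b]]
      bilinear_rmul[OF bilinear_Gam[OF b m]]
    by (simp add: psiD_def qm.act_def algebra_simps)
qed

lemma psiD_add_right:
  assumes X: "X \<in> SS" and Y: "Y \<in> PS" "Y' \<in> PS" and m: "m \<in> CM" and b: "b \<in> \<BB>" "\<pi> m \<in> dom b"
  shows "psiD b X (section_add (fadd A) CM Y Y') m = psiD b X Y m + psiD b X Y' m"
proof -
  have "\<forall>\<^sub>F q in nhds m. snd b (section_add (fadd A) CM Y Y' q) = snd b (Y q) + snd b (Y' q)"
    using eventually_CM_dom[OF b(1) m b(2)] by eventually_elim (simp add: section_add_def bundle_chart b pm_sect_pi Y)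
  from tot.deriv_along_eventually[OF this] eventually_nhds_x_imp_x[OF this]
  show ?thesis
    using tot.deriv_along_add[OF lsec_vector[OF qm.sect_lsec[OF X m]] smooth_psi_pm[OF pm.sect_lsec[OF Y(1) m] b] smooth_psi_pm[OF pm.sect_lsec[OF Y(2) m] b]]
      bilinear_radd[OF bilinear_Gam[OF b m]]
    by (simp add: psiD_def algebra_simps)
qed

lemma psiD_add_left:
  assumes X: "X \<in> SS" "X' \<in> SS" and Y: "Y \<in> PS" and m: "m \<in> CM" and b: "b \<in> \<BB>" "\<pi> m \<in> dom b"
  shows "psiD b (section_add (prol_add A) CM X X') Y m = psiD b X Y m + psiD b X' Y m"
proof -
  have "snd b (fst (section_add (prol_add A) CM X X' m)) = snd b (fst (X m)) + snd b (fst (X' m))"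
    using m b prol_fiberD(1)[OF qm.sect_fib[OF X(1) m]] prol_fiberD(1)[OF qm.sect_fib[OF X(2) m]]
    by (simp add: section_add_def prol_add_def bundle_chart)
  moreover have "deriv_along Ts m (snd (section_add (prol_add A) CM X X' m)) (\<lambda>q. snd b (Y q))
      = deriv_along Ts m (snd (X m)) (\<lambda>q. snd b (Y q)) + deriv_along Ts m (snd (X' m)) (\<lambda>q. snd b (Y q))"
    using m tot.deriv_along_add_vector[OF lsec_vector[OF qm.sect_lsec[OF X(1) m]] lsec_vector[OF qm.sect_lsec[OF X(2) m]]
        smooth_psi_pm[OF pm.sect_lsec[OF Y m] b]]
    by (simp add: section_add_def prol_add_def)
  ultimately show ?thesis using bilinear_ladd[OF bilinear_Gam[OF b m]] by (simp add: psiD_def algebra_simps)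
qed

lemma psiD_scale_left:
  assumes X: "X \<in> SS" and Y: "Y \<in> PS" and m: "m \<in> CM" and b: "b \<in> \<BB>" "\<pi> m \<in> dom b"
  shows "psiD b (section_scale (prol_scale A) CM f X) Y m = f m *\<^sub>R psiD b X Y m"
proof -
  have "snd b (fst (section_scale (prol_scale A) CM f X m)) = f m *\<^sub>R snd b (fst (X m))"
    using m b prol_fiberD(1)[OF qm.sect_fib[OF X m]] by (simp add: section_scale_def prol_scale_def bundle_chart)
  moreover have "deriv_along Ts m (snd (section_scale (prol_scale A) CM f X m)) (\<lambda>q. snd b (Y q))
      = f m *\<^sub>R deriv_along Ts m (snd (X m)) (\<lambda>q. snd b (Y q))"
    using m tot.deriv_along_scale_vector[OF lsec_vector[OF qm.sect_lsec[OF X m]] smooth_psi_pm[OF pm.sect_lsec[OF Y m] b]]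
    by (simp add: section_scale_def prol_scale_def)
  ultimately show ?thesis using bilinear_lmul[OF bilinear_Gam[OF b m]] by (simp add: psiD_def algebra_simps)
qed

lemma conn_at_psiD:
  assumes m: "m \<in> CM" and b: "b \<in> \<BB>" "\<pi> m \<in> dom b"
  shows "conn_at m (\<lambda>X Y. frame A b (psiD b X Y m) (\<pi> m))"
  unfolding conn_at_def
proof (intro conjI ballI allI impI)
  fix X Y assume X: "X \<in> SS" and Y: "Y \<in> PS"
  show "\<pi> (frame A b (psiD b X Y m) (\<pi> m)) = \<pi> m" by (simp add: pi_frame b)
  fix f :: "'a \<Rightarrow> real" assume "\<forall>m\<in>CM. smooth_at Ts f m"
  then have f: "smooth_at Ts f m" using m by blast
  show "frame A b (psiD b X (section_scale (fscale A) CM f Y) m) (\<pi> m) =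
    fadd A (fscale A (qm.act X f m) (Y m)) (fscale A (f m) (frame A b (psiD b X Y m) (\<pi> m)))"
    unfolding psiD_scale[OF X Y m b f] using b pm_sect_pi[OF Y m]
    by (intro fibre_eqI[of b]) (simp_all add: pi_frame psi_frame bundle_chart)
next
  fix X Y assume X: "X \<in> SS" and Y: "Y \<in> SS"
  show "fadd A (frame A b (psiD b X (prol_proj CM Y) m) (\<pi> m)) (fscale A (-1) (frame A b (psiD b Y (prol_proj CM X) m) (\<pi> m))) = fst (PB X Y m)"
    using b prol_fiberD(1)[OF qm.sect_fib[OF PB_sect[OF X Y] m]] psiD_torsion[OF X Y m b]
    by (intro fibre_eqI[of b]) (simp_all add: pi_frame psi_frame bundle_chart)
next
  fix X Y Z assume X: "X \<in> SS" and Y: "Y \<in> PS" and Z: "Z \<in> PS"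
  show "qm.act X (\<lambda>u. fund_tensor A u (Y u) (Z u)) m =
       fund_tensor A m (frame A b (psiD b X Y m) (\<pi> m)) (Z m) + fund_tensor A m (Y m) (frame A b (psiD b X Z m) (\<pi> m))
       + 2 * cartan_tensor A m (theta A X m) (Y m) (Z m)"
    unfolding psiD_compatible[OF X Y Z m b]
    using b pm_sect_pi[OF Y m] pm_sect_pi[OF Z m] by (simp add: fund_tensor_eq[OF b m] pi_frame psi_frame)
qed

definition D0 :: "('a \<Rightarrow> ('e, 'a, 'f) prol) \<Rightarrow> ('a \<Rightarrow> 'a) \<Rightarrow> 'a \<Rightarrow> 'a" where
  "D0 = (\<lambda>X\<in>SS. \<lambda>Y\<in>PS. \<lambda>m\<in>CM. let b = (SOME b. b \<in> \<BB> \<and> \<pi> m \<in> dom b) in frame A b (psiD b X Y m) (\<pi> m))"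

text \<open>No transformation law of the Christoffel symbols is computed: the expressions in both
  charts fulfil \<open>conn_at m\<close>, and uniqueness makes them agree.\<close>

lemma D0_eq:
  assumes X: "X \<in> SS" and Y: "Y \<in> PS" and m: "m \<in> CM" and b: "b \<in> \<BB>" "\<pi> m \<in> dom b"
  shows "D0 X Y m = frame A b (psiD b X Y m) (\<pi> m)"
proof -
  define b0 where "b0 = (SOME b. b \<in> \<BB> \<and> \<pi> m \<in> dom b)"
  have "b0 \<in> \<BB> \<and> \<pi> m \<in> dom b0" unfolding b0_def
    using ex_bundle_chart[of "\<pi> m"] by (intro someI_ex[of "\<lambda>b. b \<in> \<BB> \<and> \<pi> m \<in> dom b"]) blast
  then have b0: "b0 \<in> \<BB>" "\<pi> m \<in> dom b0" by auto
  have "D0 X Y m = frame A b0 (psiD b0 X Y m) (\<pi> m)" using X Y m by (simp add: D0_def Let_def flip: b0_def)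
  also have "\<dots> = frame A b (psiD b X Y m) (\<pi> m)"
    by (rule conn_at_unique[OF conn_at_psiD[OF m b0] conn_at_psiD[OF m b] m X Y])
  finally show ?thesis .
qed

lemma psi_D0: "X \<in> SS \<Longrightarrow> Y \<in> PS \<Longrightarrow> m \<in> CM \<Longrightarrow> b \<in> \<BB> \<Longrightarrow> \<pi> m \<in> dom b \<Longrightarrow> snd b (D0 X Y m) = psiD b X Y m"
  by (simp add: D0_eq psi_frame)

lemma D0_sect: assumes X: "X \<in> SS" and Y: "Y \<in> PS" shows "D0 X Y \<in> PS"
  unfolding pm.sect_def
proof (intro CollectI conjI ballI)
  show "D0 X Y \<in> extensional CM" using X Y by (simp add: D0_def)
  fix m assume m: "m \<in> CM"
  obtain b where b: "b \<in> \<BB>" "\<pi> m \<in> dom b" using ex_bundle_chart by blast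
  have "\<forall>\<^sub>F q in nhds m. D0 X Y q = frame A b (psiD b X Y q) (\<pi> q)"
    using eventually_CM_dom[OF b(1) m b(2)] by eventually_elim (intro D0_eq X Y b; simp)
  then show "pm.lsec (D0 X Y) m"
  proof (rule pm.lsec_transform)
    have "smooth_at Ts (\<lambda>q. psiD b X Y q) m" unfolding psiD_def
      by (intro tot.smooth_at_add tot.smooth_at_deriv_along smooth_prol_field[OF qm.sect_lsec[OF X m]]
        smooth_psi_pm[OF pm.sect_lsec[OF Y m]] smooth_Gam_field smooth_psi_fst[OF qm.sect_lsec[OF X m]] b m)
    then show "pm.lsec (\<lambda>q. frame A b (psiD b X Y q) (\<pi> q)) m"
      using b by (intro pm.lsec_pt) auto
  qed
qed

lemma PS_eqI:
  assumes "X \<in> PS" "Y \<in> PS" "\<And>m b. m \<in> CM \<Longrightarrow> b \<in> \<BB> \<Longrightarrow> \<pi> m \<in> dom b \<Longrightarrow> snd b (X m) = snd b (Y m)"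
  shows "X = Y"
proof (rule extensionalityI[OF pm.sect_ext[OF assms(1)] pm.sect_ext[OF assms(2)]])
  fix m assume m: "m \<in> CM"
  obtain b where b: "b \<in> \<BB>" "\<pi> m \<in> dom b" using ex_bundle_chart by blast
  show "X m = Y m" using pm_sect_pi[OF assms(1) m] pm_sect_pi[OF assms(2) m] assms(3)[OF m b] b by (intro fibre_eqI[of b]) simp_all
qed

lemma linear_connection_iff:
  "linear_connection A D \<longleftrightarrow> connection SS (prol_add A) (prol_scale A) PS (fadd A) (fscale A) CM
     {f. \<forall>m\<in>CM. smooth_at Ts f m} qm.act D"
  by (simp add: linear_connection_def prol_sections_eq pb_sections_eq open_CM act_eq tot.smooth_fun_iff)

lemma psi_pb_add:
  "Y \<in> PS \<Longrightarrow> Y' \<in> PS \<Longrightarrow> m \<in> CM \<Longrightarrow> b \<in> \<BB> \<Longrightarrow> \<pi> m \<in> dom b \<Longrightarrow>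
    snd b (section_add (fadd A) CM Y Y' m) = snd b (Y m) + snd b (Y' m)"
  using pm_sect_pi by (simp add: section_add_def bundle_chart)

lemma psi_pb_scale:
  "Y \<in> PS \<Longrightarrow> m \<in> CM \<Longrightarrow> b \<in> \<BB> \<Longrightarrow> \<pi> m \<in> dom b \<Longrightarrow>
    snd b (section_scale (fscale A) CM f Y m) = f m *\<^sub>R snd b (Y m)"
  using pm_sect_pi by (simp add: section_scale_def bundle_chart)

lemma linear_connection_D0: "linear_connection A D0"
  unfolding linear_connection_iff connection_def
proof (intro conjI ballI)
  show "D0 \<in> SS \<rightarrow>\<^sub>E PS \<rightarrow>\<^sub>E PS"
  proof (intro PiE_I)
    show "D0 X Y \<in> PS" if "X \<in> SS" "Y \<in> PS" for X Y using D0_sect that by blast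
  qed (auto simp: D0_def)
  fix X Y assume XY: "X \<in> SS" "Y \<in> PS"
  note s = qm.sect_add[OF open_CM] pm.sect_add[OF open_CM] D0_sect
  fix X' assume X': "X' \<in> SS"
  show "D0 (section_add (prol_add A) CM X X') Y = section_add (fadd A) CM (D0 X Y) (D0 X' Y)"
    by (rule PS_eqI) (simp_all add: s XY X' psi_D0 psi_pb_add psiD_add_left)
next
  fix X Y Y' assume XY: "X \<in> SS" "Y \<in> PS" "Y' \<in> PS"
  show "D0 X (section_add (fadd A) CM Y Y') = section_add (fadd A) CM (D0 X Y) (D0 X Y')"
    by (rule PS_eqI) (simp_all add: pm.sect_add[OF open_CM] D0_sect XY psi_D0 psi_pb_add psiD_add_right)
next
  fix X Y and f :: "'a \<Rightarrow> real" assume XY: "X \<in> SS" "Y \<in> PS" and "f \<in> {f. \<forall>m\<in>CM. smooth_at Ts f m}"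
  then have f: "\<And>m. m \<in> CM \<Longrightarrow> smooth_at Ts f m" by blast
  have s: "section_scale (prol_scale A) CM f X \<in> SS" "section_scale (fscale A) CM f Z \<in> PS"
    "section_scale (fscale A) CM (qm.act X f) Z \<in> PS" if "Z \<in> PS" for Z
    using that XY f by (auto intro!: qm.sect_scale[OF open_CM] pm.sect_scale[OF open_CM] smooth_act)
  show "D0 (section_scale (prol_scale A) CM f X) Y = section_scale (fscale A) CM f (D0 X Y)"
    by (rule PS_eqI) (simp_all add: s[OF XY(2)] s[OF D0_sect[OF XY]] D0_sect XY psi_D0 psi_pb_scale psiD_scale_left)
  show "D0 X (section_scale (fscale A) CM f Y) =
      section_add (fadd A) CM (section_scale (fscale A) CM (qm.act X f) Y) (section_scale (fscale A) CM f (D0 X Y))"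
    by (rule PS_eqI) (simp_all add: s[OF XY(2)] s[OF D0_sect[OF XY]] D0_sect XY psi_D0 psi_pb_scale psi_pb_add psiD_scale f
      pm.sect_add[OF open_CM])
qed

text \<open>The Leibniz rule and the fibre in which the values lie are part of being a linear
  connection, so the pointwise conditions reduce to torsion and compatibility.\<close>

lemma conn_at_iff:
  assumes "linear_connection A D"
  shows "(\<forall>m\<in>CM. conn_at m (\<lambda>X Y. D X Y m)) \<longleftrightarrow> torsion_free A D \<and> almost_compatible A D"
proof -
  note D = assms[unfolded linear_connection_iff connection_def]
  have D_sect: "D X Y \<in> PS" if "X \<in> SS" "Y \<in> PS" for X Y
    by (rule PiE_mem[OF PiE_mem[OF conjunct1[OF D] that(1)] that(2)])
  have 1: "\<pi> (D X Y m) = \<pi> m \<and> (\<forall>f. (\<forall>m\<in>CM. smooth_at Ts f m) \<longrightarrow>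
        D X (section_scale (fscale A) CM f Y) m = fadd A (fscale A (qm.act X f m) (Y m)) (fscale A (f m) (D X Y m)))"
    if "X \<in> SS" "Y \<in> PS" "m \<in> CM" for X Y m
  proof (intro conjI allI impI)
    show "\<pi> (D X Y m) = \<pi> m" by (rule pm_sect_pi[OF D_sect[OF that(1,2)] that(3)])
    fix f :: "'a \<Rightarrow> real" assume "\<forall>m\<in>CM. smooth_at Ts f m"
    then have "D X (section_scale (fscale A) CM f Y) =
        section_add (fadd A) CM (section_scale (fscale A) CM (qm.act X f) Y) (section_scale (fscale A) CM f (D X Y))"
      using D that by blast
    then show "D X (section_scale (fscale A) CM f Y) m = fadd A (fscale A (qm.act X f m) (Y m)) (fscale A (f m) (D X Y m))"
      using that(3) by (simp add: section_add_def section_scale_def)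
  qed
  have 2: "torsion_free A D \<longleftrightarrow> (\<forall>m\<in>CM. \<forall>X\<in>SS. \<forall>Y\<in>SS.
      fadd A (D X (prol_proj CM Y) m) (fscale A (-1) (D Y (prol_proj CM X) m)) = fst (PB X Y m))"
    unfolding torsion_free_def Let_def prol_sections_eq[OF open_CM] prol_bracket_eq prol_proj_def[of CM "PB _ _"] by auto
  have 3: "almost_compatible A D \<longleftrightarrow> (\<forall>m\<in>CM. \<forall>X\<in>SS. \<forall>Y\<in>PS. \<forall>Z\<in>PS. qm.act X (\<lambda>u. fund_tensor A u (Y u) (Z u)) m =
       fund_tensor A m (D X Y m) (Z m) + fund_tensor A m (Y m) (D X Z m) + 2 * cartan_tensor A m (theta A X m) (Y m) (Z m))"
    unfolding almost_compatible_def Let_def prol_sections_eq[OF open_CM] pb_sections_eq[OF open_CM] act_eq by blast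
  show ?thesis unfolding conn_at_def 2 3 using 1 by blast
qed

lemma connection_exists: "linear_connection A D0 \<and> torsion_free A D0 \<and> almost_compatible A D0"
proof -
  have "conn_at m (\<lambda>X Y. D0 X Y m)" if m: "m \<in> CM" for m
  proof -
    obtain b where b: "b \<in> \<BB>" "\<pi> m \<in> dom b" using ex_bundle_chart by blast
    have e: "D0 X Y m = frame A b (psiD b X Y m) (\<pi> m)" if "X \<in> SS" "Y \<in> PS" for X Y
      by (rule D0_eq[OF that m b])
    have s: "section_scale (fscale A) CM f Y \<in> PS" if "Y \<in> PS" "\<forall>m\<in>CM. smooth_at Ts f m" for f Y
      using that by (intro pm.sect_scale open_CM) auto
    show ?thesis using conn_at_psiD[OF m b] unfolding conn_at_def by (simp add: e s prol_proj_sect)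
  qed
  then show ?thesis using conn_at_iff[OF linear_connection_D0] linear_connection_D0 by blast
qed

lemma connection_unique:
  assumes "linear_connection A D \<and> torsion_free A D \<and> almost_compatible A D" shows "D = D0"
proof -
  have P: "D \<in> SS \<rightarrow>\<^sub>E PS \<rightarrow>\<^sub>E PS" "D0 \<in> SS \<rightarrow>\<^sub>E PS \<rightarrow>\<^sub>E PS"
    using assms linear_connection_D0 unfolding linear_connection_iff connection_def by blast+
  have "D X Y = D0 X Y" if "X \<in> SS" "Y \<in> PS" for X Y
  proof (rule extensionalityI)
    show "D X Y \<in> extensional CM" "D0 X Y \<in> extensional CM"
      using PiE_mem[OF PiE_mem[OF P(1) that(1)] that(2)] PiE_mem[OF PiE_mem[OF P(2) that(1)] that(2)]
      by (auto intro: pm.sect_ext)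
    fix m assume m: "m \<in> CM"
    show "D X Y m = D0 X Y m"
      by (rule conn_at_unique[of m "\<lambda>X Y. D X Y m" "\<lambda>X Y. D0 X Y m", OF _ _ m that])
        (use m assms connection_exists conn_at_iff in blast)+
  qed
  note eq = this
  show ?thesis
  proof (rule PiE_ext[OF P])
    fix X assume X: "X \<in> SS"
    show "D X = D0 X"
      by (rule PiE_ext[of _ PS "\<lambda>_. PS"]) (use P X eq in \<open>auto dest: PiE_mem\<close>)
  qed
qed

subsection \<open>The sectional connections\<close>

text \<open>For \<open>m = U(x)\<close> these are the fibre coordinates of \<open>\<nabla>\<^sup>U\<^bsub>u\<^esub> Y\<close> at \<open>x\<close>.\<close>

definition psiL :: "('m, 'e, 'a, 'f) bundle_chart \<Rightarrow> 'a \<Rightarrow> ('m \<Rightarrow> 'a) \<Rightarrow> 'a \<Rightarrow> 'f" where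
  "psiL b u Y m = deriv_along Bs (\<pi> m) (anchor A u) (\<lambda>x. snd b (Y x)) + Gam b (snd b u) (snd b (Y (\<pi> m))) m"

lemma smooth_psi_bm: "bm.lsec Y x \<Longrightarrow> b \<in> \<BB> \<Longrightarrow> x \<in> dom b \<Longrightarrow> smooth_at Bs (\<lambda>q. snd b (Y q)) x"
  by (simp add: bm_lsec_iff)

lemma bm_lsec_pi: "bm.lsec Y x \<Longrightarrow> \<pi> (Y x) = x"
  using bm.lsec_fib by blast

lemma lsec_lift: "bm.lsec Y (\<pi> m) \<Longrightarrow> pm.lsec (\<lambda>q. Y (\<pi> q)) m"
  unfolding bm_lsec_iff pm_lsec_iff by (auto intro: eventually_pi smooth_lift)

lemma deriv_along_lift_prol:
  "p \<in> prol_fiber A m \<Longrightarrow> smooth_at Bs f (\<pi> m) \<Longrightarrow>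
    deriv_along Ts m (snd p) (\<lambda>w. f (\<pi> w)) = deriv_along Bs (\<pi> m) (anchor A (fst p)) f"
  by (simp add: deriv_along_lift prol_fiberD)

text \<open>Functions lifted from the base are differentiated by the projection of the vector, which
  is the anchor of its first component. Therefore only that component of \<open>Z\<close> enters,
  and all sections projectable on a given one yield the same value.\<close>

lemma psiD_lift:
  assumes Z: "Z m \<in> prol_fiber A m" and Y: "bm.lsec Y (\<pi> m)" "\<forall>\<^sub>F q in nhds m. Y' q = Y (\<pi> q)"
    and b: "b \<in> \<BB>" "\<pi> m \<in> dom b"
  shows "psiD b Z Y' m = psiL b (fst (Z m)) Y m"
proof -
  have "\<forall>\<^sub>F q in nhds m. snd b (Y' q) = snd b (Y (\<pi> q))" using Y(2) by eventually_elim simp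
  from tot.deriv_along_eventually[OF this] eventually_nhds_x_imp_x[OF this] show ?thesis
    by (simp add: psiD_def psiL_def deriv_along_lift_prol[OF Z smooth_psi_bm[OF Y(1) b]])
qed

lemma D0_lift:
  assumes m: "m \<in> CM" and Y: "bm.lsec Y (\<pi> m)" and u: "\<pi> u = \<pi> m"
  obtains Z Y' where "Z \<in> SS" "Y' \<in> PS" "fst (Z m) = u" "\<forall>\<^sub>F q in nhds m. Y' q = Y (\<pi> q)"
proof -
  obtain b where b: "b \<in> \<BB>" "\<pi> m \<in> dom b" using ex_bundle_chart by blast
  obtain Z where Z: "Z \<in> SS" "Z m = prol_pt b m (snd b u, 0)"
    using qm.sect_value[OF m, of "prol_pt b m (snd b u, 0)"] qm.pt_fib[OF b(1), of m] b(2) by auto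
  obtain Y' where "Y' \<in> PS" "\<forall>\<^sub>F q in nhds m. Y' q = Y (\<pi> q)"
    using pm.sect_extension[OF m lsec_lift[OF Y]] by blast
  moreover have "fst (Z m) = u" using Z(2) frame_psi[OF b(1), of u] b u by (simp add: prol_pt_def)
  ultimately show thesis using Z(1) by (rule_tac that)
qed

text \<open>Independence of the chart is inherited from \<open>D0\<close>, applied to a section of
  the prolongation with first component \<open>u\<close> at \<open>m\<close> and to an extension of
  the lift of \<open>Y\<close>.\<close>

lemma psiL_chart:
  assumes m: "m \<in> CM" and Y: "bm.lsec Y (\<pi> m)" and u: "\<pi> u = \<pi> m"
    and b: "b \<in> \<BB>" "\<pi> m \<in> dom b" and b': "b' \<in> \<BB>" "\<pi> m \<in> dom b'"
  shows "frame A b (psiL b u Y m) (\<pi> m) = frame A b' (psiL b' u Y m) (\<pi> m)"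
proof -
  obtain Z Y' where Z: "Z \<in> SS" "Y' \<in> PS" "fst (Z m) = u" "\<forall>\<^sub>F q in nhds m. Y' q = Y (\<pi> q)"
    using D0_lift[OF m Y u] .
  have "D0 Z Y' m = frame A c (psiL c u Y m) (\<pi> m)" if c: "c \<in> \<BB>" "\<pi> m \<in> dom c" for c
    using D0_eq[OF Z(1,2) m c] psiD_lift[where Z=Z and Y=Y and m=m and Y'=Y', OF qm.sect_fib[OF Z(1) m] Y Z(4) c] Z(3) by simp
  from this[OF b] this[OF b'] show ?thesis by simp
qed

text \<open>All extensions of the two germs give the same value because \<open>psiL\<close> depends
  only on the first component of \<open>Z m\<close> and on the germ of \<open>Y\<close>; so the
  definite description is met.\<close>

lemma local_value_D0:
  assumes m: "m \<in> CM" and Z: "qm.lsec Z m" and Y: "bm.lsec Y (\<pi> m)" "\<forall>\<^sub>F q in nhds m. Y1 q = Y (\<pi> q)"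
    and b: "b \<in> \<BB>" "\<pi> m \<in> dom b"
  shows "local_value SS PS D0 Z Y1 m = frame A b (psiL b (fst (Z m)) Y m) (\<pi> m)"
proof -
  obtain Z' where Z': "Z' \<in> SS" "\<forall>\<^sub>F q in nhds m. Z' q = Z q" using qm.sect_extension[OF m Z] by blast
  obtain Y' where Y': "Y' \<in> PS" "\<forall>\<^sub>F q in nhds m. Y' q = Y (\<pi> q)"
    using pm.sect_extension[OF m lsec_lift[OF Y(1)]] by blast
  have ev: "\<forall>\<^sub>F q in nhds m. Z' q = Z q \<and> Y' q = Y1 q"
    using Z'(2) Y'(2) Y(2) by eventually_elim simp
  have *: "D0 X W m = frame A b (psiL b (fst (Z m)) Y m) (\<pi> m)"
    if XW: "X \<in> SS" "W \<in> PS" and e: "\<forall>\<^sub>F q in nhds m. X q = Z q \<and> W q = Y1 q" for X W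
  proof -
    have W: "\<forall>\<^sub>F q in nhds m. W q = Y (\<pi> q)" using e Y(2) by eventually_elim simp
    have "X m = Z m" using eventually_nhds_x_imp_x[OF e] by blast
    with D0_eq[OF XW m b] psiD_lift[where Z=X and Y=Y and m=m and Y'=W, OF qm.sect_fib[OF XW(1) m] Y(1) W b] show ?thesis by simp
  qed
  show ?thesis unfolding local_value_def
  proof (rule the_equality)
    show "\<exists>X'\<in>SS. \<exists>Y'\<in>PS. (\<forall>\<^sub>F q in nhds m. X' q = Z q \<and> Y' q = Y1 q)
        \<and> frame A b (psiL b (fst (Z m)) Y m) (\<pi> m) = D0 X' Y' m"
      by (intro bexI[OF _ Z'(1)] bexI[OF _ Y'(1)] conjI ev *[OF Z'(1) Y'(1) ev, symmetric])
    fix w assume "\<exists>X'\<in>SS. \<exists>Y'\<in>PS. (\<forall>\<^sub>F q in nhds m. X' q = Z q \<and> Y' q = Y1 q) \<and> w = D0 X' Y' m"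
    then show "w = frame A b (psiL b (fst (Z m)) Y m) (\<pi> m)" using * by blast
  qed
qed

lemma smooth_comp_section:
  assumes U: "bm.lsec U x" and F: "smooth_at Ts F (U x)"
  shows "smooth_at Bs (\<lambda>q. F (U q)) x"
proof -
  obtain b where b: "b \<in> \<BB>" "x \<in> dom b" using ex_bundle_chart by blast
  have "\<forall>\<^sub>F q in nhds x. \<pi> (U q) = q" using U by (simp add: bm_lsec_iff)
  then have e: "\<forall>\<^sub>F q in nhds x. frame A b (snd b (U q)) q = U q"
    using eventually_dom[OF b] by eventually_elim (metis frame_psi b(1))
  have "smooth_at Bs (\<lambda>q. F (frame A b (snd b (U q)) q)) x"
    by (rule smooth_frame_comp_base[OF b smooth_psi_bm[OF U b]]) (simp add: F eventually_nhds_x_imp_x[OF e])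
  then show ?thesis by (rule base.smooth_at_transform[rotated]) (use e in eventually_elim, simp)
qed

text \<open>The image of \<open>\<rho>(u)\<close> under the tangent map of the section \<open>U\<close>, as an element of the prolongation
  with first component \<open>u\<close>.\<close>

definition lift_vec :: "('m, 'e, 'a, 'f) bundle_chart \<Rightarrow> ('m \<Rightarrow> 'a) \<Rightarrow> 'm \<Rightarrow> 'a \<Rightarrow> ('e, 'a, 'f) prol" where
  "lift_vec b U x u = prol_pt b (U x) (snd b u, deriv_along Bs x (anchor A u) (\<lambda>q. snd b (U q)))"

text \<open>The last claim is the chain rule for \<open>F\<close> composed with \<open>U\<close>, in
  coordinates where \<open>U\<close> is the graph of its fibre coordinates. It turns derivatives of
  functions restricted to the section into derivatives on the total space.\<close>

lemma lift_vec:
  assumes U: "bm.lsec U x" and u: "\<pi> u = x" and b: "b \<in> \<BB>" "x \<in> dom b"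
  shows "lift_vec b U x u \<in> prol_fiber A (U x)" and "fst (lift_vec b U x u) = u"
    and "snd (snd (lift_vec b U x u) (tc b)) = deriv_along Bs x (anchor A u) (\<lambda>q. snd b (U q))"
    and "smooth_at Ts F (U x) \<Longrightarrow> deriv_along Ts (U x) (snd (lift_vec b U x u)) F = deriv_along Bs x (anchor A u) (\<lambda>q. F (U q))"
proof -
  let ?k = "\<lambda>q. snd b (U q)"
  note Ux = bm_lsec_pi[OF U]
  have v: "anchor A u \<in> tangent_space Bs x" using anchor_tangent[of u] u by simp
  have tcv: "snd (lift_vec b U x u) (tc b) = (anchor_coeff A b (snd b u) x, deriv_along Bs x (anchor A u) ?k)"
    using b Ux by (simp add: lift_vec_def prol_pt_def tot.coord_vector_chart bundle_chart)
  then show "snd (snd (lift_vec b U x u) (tc b)) = deriv_along Bs x (anchor A u) ?k" by simp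
  show p: "lift_vec b U x u \<in> prol_fiber A (U x)"
    unfolding lift_vec_def by (rule qm.pt_fib) (simp_all add: b Ux)
  show "fst (lift_vec b U x u) = u"
    using b u Ux frame_psi[OF b(1), of u] by (simp add: lift_vec_def prol_pt_def)
  assume F: "smooth_at Ts F (U x)"
  define G where "G z = F (chart_inv (tc b) z)" for z
  have Ud: "U x \<in> fst (tc b)" using Ux b by simp
  have G: "Cinf_at G (snd (tc b) (U x))"
    using F unfolding G_def tot.smooth_at_chart[OF bundle_chart(5)[OF b(1)] Ud] .
  have k: "smooth_at Bs ?k x" by (rule smooth_psi_bm[OF U b])
  have c: "smooth_at Bs (snd (fst b)) x" by (rule base.smooth_at_chart_map) (simp_all add: b bundle_chart)
  have kc: "smooth_at Bs (\<lambda>q. (snd (fst b) q, ?k q)) x" by (rule base.smooth_at_Pair[OF c k])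
  have e: "\<forall>\<^sub>F q in nhds x. G (snd (fst b) q, ?k q) = F (U q)"
  proof -
    have "\<forall>\<^sub>F q in nhds x. \<pi> (U q) = q" using U by (simp add: bm_lsec_iff)
    then show ?thesis using eventually_dom[OF b]
      by eventually_elim (metis G_def chart_inv_tc frame_psi b(1))
  qed
  have G': "(G has_derivative fderiv G (snd (fst b) x, ?k x)) (at (snd (fst b) x, ?k x))"
    using Cinf_at_has_derivative[OF G] Ux by (simp add: snd_tc)
  have "smooth_at Bs (\<lambda>q. G (snd (fst b) q, ?k q)) x"
    by (rule base.smooth_at_transform[OF e smooth_comp_section[OF U F]])
  from base.deriv_along_compose[OF v kc G' this]
  have "deriv_along Bs x (anchor A u) (\<lambda>q. F (U q)) = fderiv G (snd (fst b) x, ?k x) (anchor A u (fst b), deriv_along Bs x (anchor A u) ?k)"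
    using base.deriv_along_eventually[OF e] base.deriv_along_Pair[OF v c k] base.deriv_along_chart_map[OF v, of "fst b"] b
    by (simp add: bundle_chart)
  moreover have "anchor A u (fst b) = anchor_coeff A b (snd b u) x" using anchor_coeff_psi[OF b(1), of u] u b by simp
  ultimately show "deriv_along Ts (U x) (snd (lift_vec b U x u)) F = deriv_along Bs x (anchor A u) (\<lambda>q. F (U q))"
    using tot.deriv_along_chart[OF prol_fiberD(2)[OF p] bundle_chart(5)[OF b(1)] Ud F] tcv Ux by (simp add: snd_tc G_def[abs_def])
qed

text \<open>Compatibility on the total space is evaluated on the tangent image of \<rho>(u). The
  argument of its Cartan term is the coordinate derivative of \<open>U\<close> plus
  \<open>thH\<close> of \<open>u\<close>; the latter is the Christoffel term of \<open>U\<close> by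
  \<open>Gam_psi\<close>.\<close>

lemma psiL_compatible:
  assumes U: "bm.lsec U x" and Y: "bm.lsec Y x" and Z: "bm.lsec Z x" and m: "U x \<in> CM" and u: "\<pi> u = x"
    and b: "b \<in> \<BB>" "x \<in> dom b"
  shows "deriv_along Bs x (anchor A u) (\<lambda>q. gm b (U q) (snd b (Y q)) (snd b (Z q))) =
    gm b (U x) (psiL b u Y (U x)) (snd b (Z x)) + gm b (U x) (snd b (Y x)) (psiL b u Z (U x))
    + CC b (U x) (psiL b u U (U x)) (snd b (Y x)) (snd b (Z x))"
proof -
  note Ux = bm_lsec_pi[OF U]
  have bU: "\<pi> (U x) \<in> dom b" using b Ux by simp
  note p = lift_vec[OF U u b]
  have s: "smooth_at Ts (\<lambda>q. snd b (Y (\<pi> q))) (U x)" "smooth_at Ts (\<lambda>q. snd b (Z (\<pi> q))) (U x)"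
    using Y Z Ux by (auto intro!: smooth_lift smooth_psi_bm b)
  have dl: "deriv_along Ts (U x) (snd (lift_vec b U x u)) (\<lambda>q. snd b (W (\<pi> q))) = deriv_along Bs x (anchor A u) (\<lambda>q. snd b (W q))"
    if "bm.lsec W x" for W
    using deriv_along_lift_prol[OF p(1), of "\<lambda>q. snd b (W q)"] smooth_psi_bm[OF that b] by (simp add: Ux p(2))
  let ?F = "\<lambda>q. gm b q (snd b (Y (\<pi> q))) (snd b (Z (\<pi> q)))"
  have "\<forall>\<^sub>F q in nhds (U x). linear (gm b q (snd b (Y (\<pi> q))))"
    using eventually_CM_dom[OF b(1) m bU] by eventually_elim (intro gm_linear b; simp)
  then have F: "smooth_at Ts ?F (U x)"
    by (rule tot.deriv_along_linear_field(1)[OF prol_fiberD(2)[OF p(1)] s(2)])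
      (intro smooth_gm_field b(1) bU m s)
  have "\<forall>\<^sub>F q in nhds x. \<pi> (U q) = q" using U by (simp add: bm_lsec_iff)
  then have ev: "\<forall>\<^sub>F q in nhds x. ?F (U q) = gm b (U q) (snd b (Y q)) (snd b (Z q))" by eventually_elim simp
  have "deriv_along Bs x (anchor A u) (\<lambda>q. gm b (U q) (snd b (Y q)) (snd b (Z q))) = deriv_along Ts (U x) (snd (lift_vec b U x u)) ?F"
    using base.deriv_along_eventually[OF ev, of "anchor A u"] p(4)[OF F] by simp
  also have "\<dots> = gm b (U x) (psiL b u Y (U x)) (snd b (Z x)) + gm b (U x) (snd b (Y x)) (psiL b u Z (U x))
    + CC b (U x) (psiL b u U (U x)) (snd b (Y x)) (snd b (Z x))"
    unfolding gm_compatible[OF b(1) bU m p(1) s]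
    by (simp add: dl[OF Y] dl[OF Z] p(2,3) psiL_def Ux Gam_psi[OF b(1) bU m])
  finally show ?thesis .
qed

lemma psiL_torsion:
  assumes "bm.lsec X x" "bm.lsec Y x" and m: "m \<in> CM" "\<pi> m = x" and b: "b \<in> \<BB>" "x \<in> dom b"
  shows "psiL b (X x) Y m - psiL b (Y x) X m = snd b (local_bracket A X Y x)"
  using local_bracket_formula[OF assms(1,2) b] Gam_torsion[OF b(1) _ m(1), of "snd b (X x)" "snd b (Y x)"] m b
  by (simp add: psiL_def algebra_simps)

lemma smooth_psiL:
  assumes U: "bm.lsec U x" and X: "bm.lsec X x" and Y: "bm.lsec Y x" and m: "U x \<in> CM" and b: "b \<in> \<BB>" "x \<in> dom b"
  shows "smooth_at Bs (\<lambda>q. psiL b (X q) Y (U q)) x"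
proof -
  note Ux = bm_lsec_pi[OF U]
  have "smooth_at Ts (\<lambda>q. Gam b (snd b (X (\<pi> q))) (snd b (Y (\<pi> q))) q) (U x)"
    using X Y Ux b by (intro smooth_Gam_field m) (auto intro!: smooth_lift smooth_psi_bm)
  from smooth_comp_section[OF U this]
  have 1: "smooth_at Bs (\<lambda>q. Gam b (snd b (X (\<pi> (U q)))) (snd b (Y (\<pi> (U q)))) (U q)) x" .
  have 2: "smooth_at Bs (\<lambda>q. deriv_along Bs q (anchor A (X q)) (\<lambda>q. snd b (Y q))) x"
    by (rule base.smooth_at_deriv_along[OF smooth_field_anchor[OF X] smooth_psi_bm[OF Y b]])
  have "\<forall>\<^sub>F q in nhds x. \<pi> (U q) = q" using U by (simp add: bm_lsec_iff)
  then have "\<forall>\<^sub>F q in nhds x. psiL b (X q) Y (U q) = deriv_along Bs q (anchor A (X q)) (\<lambda>q. snd b (Y q))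
      + Gam b (snd b (X (\<pi> (U q)))) (snd b (Y (\<pi> (U q)))) (U q)"
    by eventually_elim (simp add: psiL_def)
  then show ?thesis by (rule base.smooth_at_transform[OF _ base.smooth_at_add[OF 2 1]])
qed

section \<open>The connection along a fixed section U\<close>

context
  fixes V U assumes V: "open V" and U: "U \<in> bm.sect V" and UC: "U ` V \<subseteq> CM"
begin

abbreviation "SV \<equiv> bm.sect V"

lemma UV: "x \<in> V \<Longrightarrow> U x \<in> CM" "x \<in> V \<Longrightarrow> bm.lsec U x" "x \<in> V \<Longrightarrow> \<pi> (U x) = x"
  using UC bm.sect_lsec[OF U] bm_lsec_pi by blast+

lemma SV_pi: "X \<in> SV \<Longrightarrow> x \<in> V \<Longrightarrow> \<pi> (X x) = x"
  by (rule bm_lsec_pi[OF bm.sect_lsec])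

definition Dsec :: "('m \<Rightarrow> 'a) \<Rightarrow> ('m \<Rightarrow> 'a) \<Rightarrow> 'm \<Rightarrow> 'a" where
  "Dsec = (\<lambda>X\<in>SV. \<lambda>Y\<in>SV. \<lambda>x\<in>V. let b = (SOME b. b \<in> \<BB> \<and> x \<in> dom b) in frame A b (psiL b (X x) Y (U x)) x)"

lemma Dsec_eq:
  assumes X: "X \<in> SV" and Y: "Y \<in> SV" and x: "x \<in> V" and b: "b \<in> \<BB>" "x \<in> dom b"
  shows "Dsec X Y x = frame A b (psiL b (X x) Y (U x)) x"
proof -
  define b0 where "b0 = (SOME b. b \<in> \<BB> \<and> x \<in> dom b)"
  have "b0 \<in> \<BB> \<and> x \<in> dom b0" unfolding b0_def
    using ex_bundle_chart[of x] by (intro someI_ex[of "\<lambda>b. b \<in> \<BB> \<and> x \<in> dom b"]) blast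
  then have "frame A b0 (psiL b0 (X x) Y (U x)) x = frame A b (psiL b (X x) Y (U x)) x"
    using psiL_chart[OF UV(1)[OF x], of Y "X x" b0 b] UV(3)[OF x] bm.sect_lsec[OF Y x] SV_pi[OF X x] b by simp
  then show ?thesis using X Y x by (simp add: Dsec_def flip: b0_def)
qed

lemma psi_Dsec: "X \<in> SV \<Longrightarrow> Y \<in> SV \<Longrightarrow> x \<in> V \<Longrightarrow> b \<in> \<BB> \<Longrightarrow> x \<in> dom b \<Longrightarrow> snd b (Dsec X Y x) = psiL b (X x) Y (U x)"
  by (simp add: Dsec_eq psi_frame)

lemma Dsec_sect: assumes X: "X \<in> SV" and Y: "Y \<in> SV" shows "Dsec X Y \<in> SV"
  unfolding bm.sect_def
proof (intro CollectI conjI ballI)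
  show "Dsec X Y \<in> extensional V" using X Y by (simp add: Dsec_def)
  fix x assume x: "x \<in> V"
  obtain b where b: "b \<in> \<BB>" "x \<in> dom b" using ex_bundle_chart by blast
  have "\<forall>\<^sub>F q in nhds x. Dsec X Y q = frame A b (psiL b (X q) Y (U q)) q"
    using eventually_nhds_in_open[OF V x] eventually_dom[OF b] by eventually_elim (rule Dsec_eq[OF X Y _ b(1)])
  then show "bm.lsec (Dsec X Y) x"
    by (rule bm.lsec_transform[OF _ bm.lsec_pt[OF b smooth_psiL[OF UV(2)[OF x] bm.sect_lsec[OF X x] bm.sect_lsec[OF Y x] UV(1)[OF x] b]]])
qed

lemma SV_eqI:
  assumes "X \<in> SV" "Y \<in> SV" "\<And>x b. x \<in> V \<Longrightarrow> b \<in> \<BB> \<Longrightarrow> x \<in> dom b \<Longrightarrow> snd b (X x) = snd b (Y x)"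
  shows "X = Y"
proof (rule extensionalityI[OF bm.sect_ext[OF assms(1)] bm.sect_ext[OF assms(2)]])
  fix x assume x: "x \<in> V"
  obtain b where b: "b \<in> \<BB>" "x \<in> dom b" using ex_bundle_chart by blast
  show "X x = Y x" using SV_pi[OF assms(1) x] SV_pi[OF assms(2) x] assms(3)[OF x b] b by (intro fibre_eqI[of b]) simp_all
qed

lemma psi_section_add:
  "Y \<in> SV \<Longrightarrow> Y' \<in> SV \<Longrightarrow> x \<in> V \<Longrightarrow> b \<in> \<BB> \<Longrightarrow> x \<in> dom b \<Longrightarrow>
    snd b (section_add (fadd A) V Y Y' x) = snd b (Y x) + snd b (Y' x)"
  by (simp add: section_add_def bundle_chart SV_pi)

lemma psi_section_scale:
  "Y \<in> SV \<Longrightarrow> x \<in> V \<Longrightarrow> b \<in> \<BB> \<Longrightarrow> x \<in> dom b \<Longrightarrow> snd b (section_scale (fscale A) V f Y x) = f x *\<^sub>R snd b (Y x)"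
  by (simp add: section_scale_def bundle_chart SV_pi)

lemma psiL_section:
  assumes X: "X \<in> SV" and X': "X' \<in> SV" and Y: "Y \<in> SV" and Y': "Y' \<in> SV" and f: "smooth_at Bs f x"
    and x: "x \<in> V" and b: "b \<in> \<BB>" "x \<in> dom b"
  shows psiL_add_left: "psiL b (section_add (fadd A) V X X' x) Y (U x) = psiL b (X x) Y (U x) + psiL b (X' x) Y (U x)"
    and psiL_scale_left: "psiL b (section_scale (fscale A) V f X x) Y (U x) = f x *\<^sub>R psiL b (X x) Y (U x)"
    and psiL_add_right: "psiL b (X x) (section_add (fadd A) V Y Y') (U x) = psiL b (X x) Y (U x) + psiL b (X x) Y' (U x)"
    and psiL_scale_right: "psiL b (X x) (section_scale (fscale A) V f Y) (U x) = bm.act X f x *\<^sub>R snd b (Y x) + f x *\<^sub>R psiL b (X x) Y (U x)"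
proof -
  note Ux = UV(3)[OF x]
  have bU: "\<pi> (U x) \<in> dom b" using b Ux by simp
  have an: "anchor A (Z x) \<in> tangent_space Bs x" if "Z \<in> SV" for Z using anchor_tangent[of "Z x"] SV_pi[OF that x] by simp
  have s: "smooth_at Bs (\<lambda>q. snd b (Z q)) x" if "Z \<in> SV" for Z by (rule smooth_psi_bm[OF bm.sect_lsec[OF that x] b])
  note G = bilinear_Gam[OF b(1) bU UV(1)[OF x]]
  have ev: "\<forall>\<^sub>F q in nhds x. q \<in> V \<and> q \<in> dom b"
    using eventually_nhds_in_open[OF V x] eventually_dom[OF b] by eventually_elim simp
  have pi: "\<pi> (X x) = x" "\<pi> (X' x) = x" using X X' SV_pi x by blast+
  show "psiL b (section_add (fadd A) V X X' x) Y (U x) = psiL b (X x) Y (U x) + psiL b (X' x) Y (U x)"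
    using x X X' Y by (simp add: psiL_def section_add_def pi anchor_add bundle_chart b Ux
      base.deriv_along_add_vector[OF an an s] bilinear_ladd[OF G] algebra_simps)
  show "psiL b (section_scale (fscale A) V f X x) Y (U x) = f x *\<^sub>R psiL b (X x) Y (U x)"
    using x X Y by (simp add: psiL_def section_scale_def pi anchor_scale bundle_chart b Ux
      base.deriv_along_scale_vector[OF an s] bilinear_lmul[OF G] algebra_simps)
  have "\<forall>\<^sub>F q in nhds x. snd b (section_add (fadd A) V Y Y' q) = snd b (Y q) + snd b (Y' q)"
    using ev by eventually_elim (simp add: psi_section_add Y Y' b)
  from base.deriv_along_eventually[OF this] eventually_nhds_x_imp_x[OF this]
  show "psiL b (X x) (section_add (fadd A) V Y Y') (U x) = psiL b (X x) Y (U x) + psiL b (X x) Y' (U x)"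
    by (simp add: psiL_def Ux base.deriv_along_add[OF an[OF X] s[OF Y] s[OF Y']] bilinear_radd[OF G] algebra_simps)
  have "\<forall>\<^sub>F q in nhds x. snd b (section_scale (fscale A) V f Y q) = f q *\<^sub>R snd b (Y q)"
    using ev by eventually_elim (simp add: psi_section_scale Y b)
  from base.deriv_along_eventually[OF this] eventually_nhds_x_imp_x[OF this]
  show "psiL b (X x) (section_scale (fscale A) V f Y) (U x) = bm.act X f x *\<^sub>R snd b (Y x) + f x *\<^sub>R psiL b (X x) Y (U x)"
    by (simp add: psiL_def Ux base.deriv_along_scaleR[OF an[OF X] f s[OF Y]] bilinear_rmul[OF G] bm.act_def algebra_simps)
qed

lemma smooth_bm_act: "X \<in> SV \<Longrightarrow> x \<in> V \<Longrightarrow> smooth_at Bs f x \<Longrightarrow> smooth_at Bs (bm.act X f) x"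
  unfolding bm.act_def by (intro base.smooth_at_deriv_along smooth_field_anchor bm.sect_lsec)

lemma connection_Dsec:
  "connection SV (fadd A) (fscale A) SV (fadd A) (fscale A) V {f. smooth_fun Bs V f} bm.act Dsec"
  unfolding connection_def
proof (intro conjI ballI)
  show "Dsec \<in> SV \<rightarrow>\<^sub>E SV \<rightarrow>\<^sub>E SV"
  proof (intro PiE_I)
    show "Dsec X Y \<in> SV" if "X \<in> SV" "Y \<in> SV" for X Y by (rule Dsec_sect[OF that])
  qed (simp_all add: Dsec_def)
next
  fix X X' Y assume "X \<in> SV" "X' \<in> SV" "Y \<in> SV"
  then show "Dsec (section_add (fadd A) V X X') Y = section_add (fadd A) V (Dsec X Y) (Dsec X' Y)"
    by (intro SV_eqI) (simp_all add: bm.sect_add[OF V] Dsec_sect psi_Dsec psi_section_add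
      psiL_add_left[OF _ _ _ _ base.smooth_at_const, of X X' Y Y])
next
  fix X Y Y' assume "X \<in> SV" "Y \<in> SV" "Y' \<in> SV"
  then show "Dsec X (section_add (fadd A) V Y Y') = section_add (fadd A) V (Dsec X Y) (Dsec X Y')"
    by (intro SV_eqI) (simp_all add: bm.sect_add[OF V] Dsec_sect psi_Dsec psi_section_add
      psiL_add_right[OF _ _ _ _ base.smooth_at_const, of X X Y Y'])
next
  fix X Y and f :: "'m \<Rightarrow> real" assume XY: "X \<in> SV" "Y \<in> SV" and "f \<in> {f. smooth_fun Bs V f}"
  then have f: "\<And>x. x \<in> V \<Longrightarrow> smooth_at Bs f x" using base.smooth_fun_iff[OF V] by auto
  have s: "section_scale (fscale A) V f Z \<in> SV" "section_scale (fscale A) V (bm.act X f) Z \<in> SV" if "Z \<in> SV" for Z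
    using that XY f by (auto intro!: bm.sect_scale[OF V] smooth_bm_act)
  show "Dsec (section_scale (fscale A) V f X) Y = section_scale (fscale A) V f (Dsec X Y)"
    by (rule SV_eqI) (simp_all add: s XY Dsec_sect psi_Dsec psi_section_scale psiL_scale_left[OF XY(1,1,2,2) f])
  show "Dsec X (section_scale (fscale A) V f Y) =
      section_add (fadd A) V (section_scale (fscale A) V (bm.act X f) Y) (section_scale (fscale A) V f (Dsec X Y))"
    by (rule SV_eqI) (simp_all add: s XY Dsec_sect psi_Dsec psi_section_scale psi_section_add bm.sect_add[OF V]
      psiL_scale_right[OF XY(1,1,2,2) f])
qed

lemma sectional_iff:
  "is_sectional_connection A V U D \<longleftrightarrow>
    connection SV (fadd A) (fscale A) SV (fadd A) (fscale A) V {f. smooth_fun Bs V f} bm.act D \<and>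
    (\<forall>X\<in>SV. \<forall>Y\<in>SV. \<forall>x\<in>V. fadd A (D X Y x) (fscale A (-1) (D Y X x)) = local_bracket A X Y x) \<and>
    (\<forall>X\<in>SV. \<forall>Y\<in>SV. \<forall>Z\<in>SV. \<forall>x\<in>V. bm.act X (\<lambda>p. fund_tensor A (U p) (Y p) (Z p)) x =
      fund_tensor A (U x) (D X Y x) (Z x) + fund_tensor A (U x) (Y x) (D X Z x)
      + 2 * cartan_tensor A (U x) (D X U x) (Y x) (Z x))"
  unfolding is_sectional_connection_def Let_def sections_eq[OF V] act_eq ..

lemma sectional_Dsec: "is_sectional_connection A V U Dsec"
  unfolding sectional_iff
proof (intro conjI ballI connection_Dsec)
  fix X Y x assume X: "X \<in> SV" and Y: "Y \<in> SV" and x: "x \<in> V"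
  obtain b where b: "b \<in> \<BB>" "x \<in> dom b" using ex_bundle_chart by blast
  note l = bm.sect_lsec[OF X x] bm.sect_lsec[OF Y x]
  note pi = SV_pi[OF Dsec_sect[OF X Y] x] SV_pi[OF Dsec_sect[OF Y X] x] bm_lsec_pi[OF bm.sect_lsec[OF X x]]
  have "\<pi> (local_bracket A X Y x) = x" by (rule bm_lsec_pi[OF lsec_local_bracket[OF l]])
  then show "fadd A (Dsec X Y x) (fscale A (-1) (Dsec Y X x)) = local_bracket A X Y x"
    using b pi psiL_torsion[OF l UV(1)[OF x] UV(3)[OF x] b]
    by (intro fibre_eqI[of b]) (simp_all add: bundle_chart psi_Dsec X Y x)
next
  fix X Y Z x assume X: "X \<in> SV" and Y: "Y \<in> SV" and Z: "Z \<in> SV" and x: "x \<in> V"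
  obtain b where b: "b \<in> \<BB>" "x \<in> dom b" using ex_bundle_chart by blast
  have bU: "\<pi> (U x) \<in> dom b" using b UV(3)[OF x] by simp
  note pi = SV_pi[OF Dsec_sect[OF X U] x] SV_pi[OF Dsec_sect[OF X Y] x] SV_pi[OF Dsec_sect[OF X Z] x]
    SV_pi[OF Y x] SV_pi[OF Z x] UV(3)[OF x]
  have "\<forall>\<^sub>F q in nhds x. q \<in> V \<and> q \<in> dom b"
    using eventually_nhds_in_open[OF V x] eventually_dom[OF b] by eventually_elim simp
  then have "\<forall>\<^sub>F q in nhds x. fund_tensor A (U q) (Y q) (Z q) = gm b (U q) (snd b (Y q)) (snd b (Z q))"
    by eventually_elim (simp add: fund_tensor_eq[of b] b UV SV_pi Y Z)
  from base.deriv_along_eventually[OF this]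
  show "bm.act X (\<lambda>p. fund_tensor A (U p) (Y p) (Z p)) x =
      fund_tensor A (U x) (Dsec X Y x) (Z x) + fund_tensor A (U x) (Y x) (Dsec X Z x)
      + 2 * cartan_tensor A (U x) (Dsec X U x) (Y x) (Z x)"
    using psiL_compatible[OF UV(2)[OF x] bm.sect_lsec[OF Y x] bm.sect_lsec[OF Z x] UV(1)[OF x] SV_pi[OF X x] b]
      cartan_tensor_eq[OF b(1) bU UV(1)[OF x], of "Dsec X U x" "Y x" "Z x"] pi
    by (simp add: bm.act_def fund_tensor_eq[OF b(1) bU UV(1)[OF x]] psi_Dsec X Y Z U x b CC_def)
qed

text \<open>In the compatibility condition for \<open>T = D - D'\<close> the Cartan tensor disappears as soon as one of the two
  differentiated sections is \<open>U\<close>; this gives first \<open>T(U, U) = 0\<close>, then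
  \<open>T(X, U) = 0\<close>, and then the usual argument for the Levi-Civita connection applies.\<close>

lemma sectional_unique:
  assumes D: "is_sectional_connection A V U D" "is_sectional_connection A V U D'"
  shows "D = D'"
proof -
  note c = D[unfolded sectional_iff connection_def]
  have P: "D \<in> SV \<rightarrow>\<^sub>E SV \<rightarrow>\<^sub>E SV" "D' \<in> SV \<rightarrow>\<^sub>E SV \<rightarrow>\<^sub>E SV"
    by (rule conjunct1[OF conjunct1[OF c(1)]], rule conjunct1[OF conjunct1[OF c(2)]])
  have PD: "E X Y \<in> SV" if "E \<in> SV \<rightarrow>\<^sub>E SV \<rightarrow>\<^sub>E SV" "X \<in> SV" "Y \<in> SV" for E X Y
    by (rule PiE_mem[OF PiE_mem[OF that(1,2)] that(3)])
  have "D X Y x = D' X Y x" if X: "X \<in> SV" and Y: "Y \<in> SV" and x: "x \<in> V" for X Y x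
  proof -
    obtain b where b: "b \<in> \<BB>" "x \<in> dom b" using ex_bundle_chart by blast
    have bU: "\<pi> (U x) \<in> dom b" using b UV(3)[OF x] by simp
    note m = UV(1)[OF x]
    note Ux = UV(3)[OF x]
    have pi: "\<pi> (D X Y x) = x" "\<pi> (D' X Y x) = x" if "X \<in> SV" "Y \<in> SV" for X Y
      using SV_pi[OF PD[OF P(1) that] x] SV_pi[OF PD[OF P(2) that] x] .
    define T where "T X Y = snd b (D X Y x) - snd b (D' X Y x)" for X Y
    define \<psi> where "\<psi> X = snd b (X x)" for X :: "'m \<Rightarrow> 'a"
    have tor: "snd b (E X Y x) - snd b (E Y X x) = snd b (local_bracket A X Y x)"
      if "is_sectional_connection A V U E" "X \<in> SV" "Y \<in> SV" "\<pi> (E X Y x) = x" "\<pi> (E Y X x) = x" for E X Y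
    proof -
      have "fadd A (E X Y x) (fscale A (-1) (E Y X x)) = local_bracket A X Y x"
        using that x unfolding sectional_iff by blast
      then show ?thesis using that(4,5) b by (simp add: bundle_chart flip: \<open>_ = local_bracket A X Y x\<close>)
    qed
    have sym: "T X Y = T Y X" if XY: "X \<in> SV" "Y \<in> SV" for X Y
      using tor[OF D(1) XY] tor[OF D(2) XY] pi[OF XY] pi[OF XY(2,1)] by (simp add: T_def algebra_simps)
    have cmp: "bm.act X (\<lambda>p. fund_tensor A (U p) (Y p) (Z p)) x = gm b (U x) (snd b (E X Y x)) (\<psi> Z)
        + gm b (U x) (\<psi> Y) (snd b (E X Z x)) + CC b (U x) (snd b (E X U x)) (\<psi> Y) (\<psi> Z)"
      if E: "is_sectional_connection A V U E" "E \<in> SV \<rightarrow>\<^sub>E SV \<rightarrow>\<^sub>E SV" and XYZ: "X \<in> SV" "Y \<in> SV" "Z \<in> SV" for E X Y Z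
    proof -
      note e = SV_pi[OF PD[OF E(2) XYZ(1) XYZ(2)] x] SV_pi[OF PD[OF E(2) XYZ(1) XYZ(3)] x]
        SV_pi[OF PD[OF E(2) XYZ(1) U] x] SV_pi[OF XYZ(2) x] SV_pi[OF XYZ(3) x] Ux
      have "bm.act X (\<lambda>p. fund_tensor A (U p) (Y p) (Z p)) x =
          fund_tensor A (U x) (E X Y x) (Z x) + fund_tensor A (U x) (Y x) (E X Z x)
          + 2 * cartan_tensor A (U x) (E X U x) (Y x) (Z x)"
        using E(1) XYZ x unfolding sectional_iff by blast
      then show ?thesis
        using cartan_tensor_eq[OF b(1) bU m, of "E X U x" "Y x" "Z x"] e
        by (simp add: fund_tensor_eq[OF b(1) bU m] \<psi>_def CC_def)
    qed
    \<comment> \<open>The difference of the two compatibility conditions. The connections enter the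
      Cartan tensor in its first argument only, in which it is linear.\<close>
    have main: "gm b (U x) (T X Y) (\<psi> Z) + gm b (U x) (\<psi> Y) (T X Z) + CC b (U x) (T X U) (\<psi> Y) (\<psi> Z) = 0"
      if XYZ: "X \<in> SV" "Y \<in> SV" "Z \<in> SV" for X Y Z
      using cmp[OF D(1) P(1) XYZ] cmp[OF D(2) P(2) XYZ]
      unfolding T_def linear_diff[OF gm_linear(1)[OF b(1) bU m]] linear_diff[OF gm_linear(2)[OF b(1) bU m]]
        linear_diff[OF linear_CC(1)[OF b(1) bU m]] by simp
    have C0: "CC b (U x) a (\<psi> U) d = 0" "CC b (U x) a d (\<psi> U) = 0" "CC b (U x) 0 d e = 0" for a d e
      using V_gm_psi[OF b(1) bU m, of a d] V_gm_sym(2)[OF b(1) bU m, of a d "\<psi> U"] linear_0[OF linear_CC(1)[OF b(1) bU m]]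
      by (simp_all add: CC_def \<psi>_def)
    \<comment> \<open>A value at \<open>x\<close> is extended globally and restricted to
      \<open>V\<close>, so that sections through arbitrary fibre vectors are available for
      testing.\<close>
    have sec: "\<exists>Z\<in>SV. \<psi> Z = w" for w
    proof -
      obtain Z where Z: "Z \<in> bm.sect UNIV" "Z x = frame A b w x"
        using bm.sect_value[of x "frame A b w x"] pi_frame[OF b] by auto
      have "(\<lambda>p\<in>V. Z p) \<in> SV" by (rule bm.sectI[OF V]) (use bm.sect_lsec[OF Z(1)] in simp)
      then show ?thesis using x Z(2) psi_frame[OF b] by (intro bexI[of _ "\<lambda>p\<in>V. Z p"]) (simp_all add: \<psi>_def)
    qed
    have zero: "t = 0" if "\<And>Z. Z \<in> SV \<Longrightarrow> gm b (U x) t (\<psi> Z) = 0" for t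
    proof (rule gm_nondegenerate[OF b(1) bU m])
      fix w
      show "gm b (U x) t w = gm b (U x) 0 w"
        using sec[of w] that linear_0[OF gm_linear(1)[OF b(1) bU m]] by auto
    qed
    note gs = gm_sym[OF b(1) m bU]
    \<comment> \<open>Both differentiated sections are \<open>U\<close>, so the two metric terms
      coincide and their sum vanishes.\<close>
    have XUU: "gm b (U x) (\<psi> U) (T X U) = 0" if "X \<in> SV" for X
      using main[OF that U U] C0 gs[of "T X U" "\<psi> U"] by simp
    have UU: "T U U = 0"
    proof (rule zero)
      fix Z assume Z: "Z \<in> SV"
      show "gm b (U x) (T U U) (\<psi> Z) = 0" using main[OF U U Z] C0 sym[OF U Z] XUU[OF Z] by simp
    qed
    \<comment> \<open>With \<open>T U U = 0\<close> the pairing of \<open>T X U\<close> with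
      \<open>Z\<close> is skew in \<open>X\<close> and \<open>Z\<close> by the instance U, X, Z, and
      symmetric by the instances X, U, Z and Z, U, X.\<close>
    have XU: "T X U = 0" if X: "X \<in> SV" for X
    proof (rule zero)
      fix Z assume Z: "Z \<in> SV"
      show "gm b (U x) (T X U) (\<psi> Z) = 0"
        using main[OF U X Z] main[OF X U Z] main[OF Z U X] sym[OF U X] sym[OF U Z] sym[OF X Z] C0 UU
          gs[of "\<psi> X" "T Z U"] by simp
    qed
    have "T X Y = 0"
    proof (rule zero)
      fix Z assume Z: "Z \<in> SV"
      \<comment> \<open>The Cartan term is now gone for all arguments, and skewness together with
        the symmetry of \<open>T\<close> is the Levi-Civita situation.\<close>
      have k: "gm b (U x) (T X' Y') (\<psi> Z') = - gm b (U x) (T X' Z') (\<psi> Y')" if "X' \<in> SV" "Y' \<in> SV" "Z' \<in> SV" for X' Y' Z'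
        using main[OF that] XU[OF that(1)] C0 gs[of "\<psi> Y'" "T X' Z'"] by simp
      show "gm b (U x) (T X Y) (\<psi> Z) = 0"
        using k[OF X Y Z] k[OF Y Z X] k[OF Z X Y] sym[OF X Y] sym[OF Y Z] sym[OF X Z] by simp
    qed
    then show ?thesis using pi[OF X Y] b by (intro fibre_eqI[of b]) (simp_all add: T_def)
  qed
  then have eq: "D X Y = D' X Y" if "X \<in> SV" "Y \<in> SV" for X Y
    using that by (intro extensionalityI[OF bm.sect_ext[OF PD[OF P(1) that]] bm.sect_ext[OF PD[OF P(2) that]]])
  show ?thesis
  proof (rule PiE_ext[OF P])
    fix X assume X: "X \<in> SV"
    show "D X = D' X"
      by (rule PiE_ext[OF PiE_mem[OF P(1) X] PiE_mem[OF P(2) X]]) (rule eq[OF X])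
  qed
qed

lemma sectional_connection_eq: "sectional_connection A V U = Dsec"
  unfolding sectional_connection_def
proof (rule the_equality)
  show "is_sectional_connection A V U Dsec" by (rule sectional_Dsec)
  show "D = Dsec" if "is_sectional_connection A V U D" for D by (rule sectional_unique[OF that sectional_Dsec])
qed

text \<open>Both sides are \<open>psiL\<close> at \<open>U x\<close>: on the left because a lifted
  section is differentiated by the projection of \<open>Z\<close>, which is \<open>X\<close>, on the
  right by the explicit form of the sectional connection.\<close>

lemma local_value_eq:
  assumes X: "X \<in> SV" and Y: "Y \<in> SV" and Z: "Z \<in> qm.sect (CM \<inter> \<pi> -` V)"
    and proj: "projectable_on A (CM \<inter> \<pi> -` V) Z X" and x: "x \<in> V"
  shows "local_value SS PS D0 Z (pb_lift A (CM \<inter> \<pi> -` V) Y) (U x) = sectional_connection A V U X Y x"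
proof -
  obtain b where b: "b \<in> \<BB>" "x \<in> dom b" using ex_bundle_chart by blast
  note Ux = UV(3)[OF x]
  have U': "U x \<in> CM \<inter> \<pi> -` V" using UV(1)[OF x] Ux x by simp
  have "open (CM \<inter> \<pi> -` V)" by (intro open_Int open_CM pi_continuous V)
  from eventually_nhds_in_open[OF this U']
  have ev: "\<forall>\<^sub>F q in nhds (U x). pb_lift A (CM \<inter> \<pi> -` V) Y q = Y (\<pi> q)" by eventually_elim (simp add: pb_lift_def)
  have "fst (Z (U x)) = X x" using proj U' Ux by (simp add: projectable_on_def)
  then show ?thesis
    using local_value_D0[OF UV(1)[OF x] qm.sect_lsec[OF Z U'] _ ev b(1)] bm.sect_lsec[OF Y x] b
    by (simp add: sectional_connection_eq Dsec_eq[OF X Y x b] Ux)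
qed

end

end

theorem theorem8p2p1:
  fixes A :: "('m::t2_space, 'e::real_inner, 'a::topological_space, 'f::euclidean_space)
                finsler_algebroid"
  assumes "partial_finsler_pre_lie_algebroid A"
  shows "(\<exists>!D. linear_connection A D \<and> torsion_free A D \<and> almost_compatible A D) \<and>
    (\<forall>D. linear_connection A D \<and> torsion_free A D \<and> almost_compatible A D \<longrightarrow>
      (\<forall>V U X Y Z. open V \<and> U \<in> sections A V \<and> U ` V \<subseteq> conic_dom A \<and>
         X \<in> sections A V \<and> Y \<in> sections A V \<and>
         Z \<in> prol_sections A (conic_dom A \<inter> bproj A -` V) \<and>
         projectable_on A (conic_dom A \<inter> bproj A -` V) Z X \<longrightarrow>
         (\<forall>x\<in>V. local_value (prol_sections A (conic_dom A)) (pb_sections A (conic_dom A)) D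
              Z (pb_lift A (conic_dom A \<inter> bproj A -` V) Y) (U x) =
            sectional_connection A V U X Y x)))"
proof -
  interpret partial_finsler A by (rule partial_finsler.intro[OF assms])
  show ?thesis
  proof (intro conjI allI impI ballI, goal_cases)
    case 1
    show ?case using connection_exists connection_unique by blast
  next
    case (2 D V U X Y Z x)
    \<comment> \<open>By uniqueness the arbitrary connection \<open>D\<close> is the one constructed
      above, whose values on local sections are known.\<close>
    then have V: "open V" and D: "D = D0" using connection_unique by blast+
    have "open (CM \<inter> \<pi> -` V)" by (intro open_Int open_CM pi_continuous V)
    note e = sections_eq[OF V] prol_sections_eq[OF this] prol_sections_eq[OF open_CM] pb_sections_eq[OF open_CM]
    show ?case using 2 unfolding D e by (intro local_value_eq[OF V]) blast+
  qed
qed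

end
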